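(* Let $P_0$ be the distribution of a $B_4$-mixing point process on $\mathbb{R}^d$ with intensity $\lambda_0>0$ and generalized $K$-function $K_{0,B}$, and let $N=\sum_{i\ge1}\delta_{X_i}$ have distribution $P_0$ (null hypothesis $H_0$). Let $(W_n)$ be a convex averaging sequence, $R>0$, $0<\alpha\le1/2$ with $c_n^\alpha/\varrho(W_n)\to0$. Assume: (a) $(N(W_n)-\lambda_0|W_n|)/\sqrt{|W_n|}\xrightarrow{d}\mathcal N(0,\sigma_0^2)$ as $n\to\infty$, where $\sigma_0^2=\lambda_0(1+\gamma^{(2)}_{red}(\mathbb{R}^d))$; (b) there is $a_0>0$ with $\alpha^{(2)}_{red}(A)\le a_0|A|$ for all bounded Borel $A\subset\mathbb{R}^d$; (c) either $\alpha>1/4$, or $\gamma^{(3)}_{red},\gamma^{(4)}_{red}$ have Lebesgue densities $\kappa^{(3)},\kappa^{(4)}$ with $|\kappa^{(3)}(x,y)|\le a_{01}$ for all $x,y\in\mathbb{R}^d$ and $\int_{\mathbb{R}^d}\int_{\mathbb{R}^d}\bigl(\int_{\mathbb{R}^d}|\kappa^{(4)}(x,y+z,z)|dz\bigr)^2dy\,dx\le a_{02}$ for some constants $a_{01},a_{02}$; (d) the bandwidths $b_n>0$ satisfy $b_n\to0$, $c_nb_n\to\infty$, $c_nb_n^2\to0$ and $c_nb_n/\varrho(W_n)\to0$. Let $V:[0,R]\to[0,\infty)$ be non-decreasing and right-continuous with $V(R)<\infty$, and let $v\in D[0,R]$ be a càdlàg function. Then, as $n\to\infty$, $$\frac{\int_0^R\bigl(\Delta^{(\alpha)}_{0,B,n}(r)\bigr)^2dV(r)}{(\widehat{\lambda^2})_n(\widehat{\sigma^2})_n}+\frac{|W_n|(\widehat\lambda_n-\lambda_0)^2}{(\widehat{\sigma^2})_n}\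 \xrightarrow{d}\ \Bigl(4|B|^2\int_0^Rr^{2d}\,dV(r)+1\Bigr)\mathcal N(0,1)^2$$ and $$\frac{\sup_{0\le r\le R}\bigl|\Delta^{(\alpha)}_{0,B,n}(r)v(r)\bigr|}{\widehat\lambda_n\sqrt{(\widehat{\sigma^2})_n}}+\frac{\sqrt{|W_n|}\,|\widehat\lambda_n-\lambda_0|}{\sqrt{(\widehat{\sigma^2})_n}}\ \xrightarrow{d}\ \Bigl(2|B|\sup_{0\le r\le R}|r^dv(r)|+1\Bigr)|\mathcal N(0,1)|.$$
   Context: $|\cdot|$ is Lebesgue measure on $\mathbb{R}^d$ (or absolute value), $\mathcal N(0,\tau^2)$ a centered Gaussian random variable with variance $\tau^2$, $\xrightarrow{d}$ convergence in distribution, $\sum^{\ne}$ a sum over tuples of pairwise distinct indices. Point processes. $N=\sum_{i\ge1}\delta_{X_i}$ is a simple point process on $\mathbb{R}^d$ with intensity $\lambda=\mathbf E N([0,1)^d)>0$ (here $\lambda=\lambda_0$). Its $k$-th factorial moment measure is $\alpha^{(k)}(A_1\times\dots\times A_k)=\mathbf E\sum^{\ne}_{i_1,\dots,i_k\ge1}\mathbf 1_{A_1}(X_{i_1})\cdots\mathbf 1_{A_k}(X_{i_k})$. $N$ is $k$-th order stationary if $\mathbf E N^k([0,1)^d)<\infty$ and, for $j=1,\dots,k$, $\alpha^{(j)}$ is invariant under diagonal shifts $A_1\times\dots\times A_j\mapsto(A_1+x)\times\dots\times(A_j+x)$. The $k$-th factorial cumulant measure is the (locally finite) signed measure $\gamma^{(k)}(A_1\times\dots\times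 A_k)=\sum_{j=1}^k(-1)^{j-1}(j-1)!\sum_{K_1\cup\dots\cup K_j=\{1,\dots,k\}}\prod_{i=1}^j\alpha^{(\#K_i)}(\times_{l\in K_i}A_l)$, the inner sum being over partitions into $j$ disjoint non-empty subsets. The reduced measures $\alpha^{(k)}_{red},\gamma^{(k)}_{red}$ on $\mathbb{R}^{d(k-1)}$ are defined by $\alpha^{(k)}(A_1\times\dots\times A_k)=\lambda\int_{A_k}\alpha^{(k)}_{red}((A_1-x)\times\dots\times(A_{k-1}-x))\,dx$ and likewise for $\gamma^{(k)}$; in particular $\gamma^{(2)}_{red}(\cdot)=\alpha^{(2)}_{red}(\cdot)-\lambda|\cdot|$. $\|\gamma^{(k)}_{red}\|_{var}$ is the total variation on $\mathbb{R}^{d(k-1)}$. $N$ is $B_4$-mixing if it is fourth-order stationary and $\|\gamma^{(j)}_{red}\|_{var}<\infty$ for $j=2,3,4$. Windows and $B$. A convex averaging sequence $(W_n)$ is an increasing sequence of convex compact sets $W_n\subset\mathbb{R}^d$ with $\varrho(W_n):=\sup\{r>0: x+rB_e\subseteq W_n\text{ for some }x\in W_n\}\to\infty$, where $B_e$ is the closed Euclidean unit ball. Put $c_n:=|W_n|^{1/d}$. $B\subset\mathbb{R}^d$ is a fixed compact convex set, symmetric about the origin, with the origin as an interior point. $D[0,R]$ is the Skorohod space of càdlàg functions on $[0,R]$. $K$-function and estimators. $K_{0,B}(r):=\lambda_0^{-1}\alpha^{(2)}_{red}(rB)$ under $P_0$, $$(\widehat{\lambda^2K_B})_n(r):=\sum^{\ne}_{i,j\ge1}\frac{\mathbf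 1_{W_n}(X_i)\mathbf 1_{W_n}(X_j)\mathbf 1_{rB}(X_j-X_i)}{|(W_n-X_i)\cap(W_n-X_j)|},$$ $$\Delta^{(\alpha)}_{0,B,n}(r):=|W_n|^{1/2-\alpha}\bigl((\widehat{\lambda^2K_B})_n(c_n^\alpha r)-\lambda_0^2K_{0,B}(c_n^\alpha r)\bigr),$$ $$\widehat\lambda_n:=\frac{N(W_n)}{|W_n|},\qquad(\widehat{\lambda^2})_n:=\frac{(N(W_n)-1)N(W_n)}{|W_n|^2},$$ $$(\widehat{\sigma^2})_n:=\widehat\lambda_n+\sum^{\ne}_{i,j\ge1}\frac{\mathbf 1_{W_n}(X_i)\mathbf 1_{W_n}(X_j)}{|(W_n-X_i)\cap(W_n-X_j)|}\,w\Bigl(\frac{X_j-X_i}{b_nc_n}\Bigr)-(\widehat{\lambda^2})_n(b_nc_n)^d\int_{\mathbb{R}^d}w(x)\,dx,$$ where $w:\mathbb{R}^d\to[0,\infty)$ is a fixed Borel-measurable, bounded, symmetric function with bounded support and $\lim_{x\to0}w(x)=w(0)=1$.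
   Formalization: The formal theorem additionally assumes that the asymptotic variance σ_0² is strictly positive; when σ_0² = 0 (e.g. suitable randomly perturbed lattices) the stated limits fail. *)

theory Defs
  imports "HOL-Probability.Probability"
begin

text \<open>
  A simple locally finite counting measure is identified with its support, so a simple point
  process on \<open>\<real>\<^sup>d\<close> (an arbitrary type \<open>'a\<close> of class \<open>euclidean_space\<close>, with
  \<open>d = DIM('a)\<close>) is a random locally finite set \<open>N\<close> on a probability space \<open>M\<close>.
  Measurability of the counts of bounded Borel sets is measurability with respect to the usual
  \<open>\<sigma>\<close>-algebra on the space of locally finite configurations.
\<close>

definition simple_point_process :: "'o measure \<Rightarrow> ('o \<Rightarrow> 'a::euclidean_space set) \<Rightarrow> bool" where
  "simple_point_process M N \<longleftrightarrow>
     prob_space M \<and>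
     (\<forall>\<omega>\<in>space M. \<forall>A. bounded A \<longrightarrow> finite (N \<omega> \<inter> A)) \<and>
     (\<forall>A\<in>sets borel. bounded A \<longrightarrow> (\<lambda>\<omega>. card (N \<omega> \<inter> A)) \<in> measurable M (count_space UNIV))"

definition unit_cube :: "'a::euclidean_space set" where
  "unit_cube = {x. \<forall>b\<in>Basis. 0 \<le> x \<bullet> b \<and> x \<bullet> b < 1}"

definition intensity :: "'o measure \<Rightarrow> ('o \<Rightarrow> 'a::euclidean_space set) \<Rightarrow> real" where
  "intensity M N = (\<integral>\<omega>. real (card (N \<omega> \<inter> unit_cube)) \<partial>M)"

text \<open>
  The factorial moment measure of order \<open>card K\<close> on the rectangle with sides \<open>A l\<close>,
  \<open>l \<in> K\<close>. Since the points of \<open>N \<omega>\<close> are distinct, tuples of pairwise distinct indices are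
  the injective families of points. Indexing by an arbitrary finite set \<open>K\<close> gives the factors
  over the blocks of a partition in the definition of the cumulant measures without renumbering.
\<close>

definition fact_moment ::
    "'o measure \<Rightarrow> ('o \<Rightarrow> 'a::euclidean_space set) \<Rightarrow> nat set \<Rightarrow> (nat \<Rightarrow> 'a set) \<Rightarrow> ennreal" where
  "fact_moment M N K A =
     (\<integral>\<^sup>+\<omega>. emeasure (count_space UNIV) {f \<in> (\<Pi>\<^sub>E l\<in>K. A l \<inter> N \<omega>). inj_on f K} \<partial>M)"

definition kth_order_stationary ::
    "nat \<Rightarrow> 'o measure \<Rightarrow> ('o \<Rightarrow> 'a::euclidean_space set) \<Rightarrow> bool" where
  "kth_order_stationary k M N \<longleftrightarrow>
     (\<integral>\<^sup>+\<omega>. ennreal (real (card (N \<omega> \<inter> unit_cube)) ^ k) \<partial>M) < \<infinity> \<and>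
     (\<forall>j\<in>{1..k}. \<forall>A x. (\<forall>l\<in>{1..j}. A l \<in> sets borel \<and> bounded (A l)) \<longrightarrow>
        fact_moment M N {1..j} (\<lambda>l. (\<lambda>y. y + x) ` A l) = fact_moment M N {1..j} A)"

definition fact_cumulant ::
    "'o measure \<Rightarrow> ('o \<Rightarrow> 'a::euclidean_space set) \<Rightarrow> nat \<Rightarrow> (nat \<Rightarrow> 'a set) \<Rightarrow> real" where
  "fact_cumulant M N k A =
     (\<Sum>j=1..k. (-1) ^ (j - 1) * fact (j - 1) *
        (\<Sum>P | partition_on {1..k} P \<and> card P = j. \<Prod>K\<in>P. enn2real (fact_moment M N K A)))"

text \<open>
  The space \<open>\<real>\<^bsup>d(k-1)\<^esup>\<close> carrying the reduced measures of order \<open>k\<close> is represented by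
  functions on the index set \<open>{1..<k}\<close>; \<open>rect k A\<close> is \<open>A 1 \<times> \<dots> \<times> A (k - 1)\<close>.
\<close>

abbreviation red_borel :: "nat \<Rightarrow> (nat \<Rightarrow> 'a::euclidean_space) measure" where
  "red_borel k \<equiv> PiM {1..<k} (\<lambda>_. borel)"

abbreviation red_lborel :: "nat \<Rightarrow> (nat \<Rightarrow> 'a::euclidean_space) measure" where
  "red_lborel k \<equiv> PiM {1..<k} (\<lambda>_. lborel)"

abbreviation rect :: "nat \<Rightarrow> (nat \<Rightarrow> 'a set) \<Rightarrow> (nat \<Rightarrow> 'a) set" where
  "rect k A \<equiv> Pi\<^sub>E {1..<k} A"

abbreviation rect_minus :: "nat \<Rightarrow> (nat \<Rightarrow> 'a::ab_group_add set) \<Rightarrow> 'a \<Rightarrow> (nat \<Rightarrow> 'a) set" where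
  "rect_minus k A x \<equiv> Pi\<^sub>E {1..<k} (\<lambda>l. (\<lambda>y. y - x) ` A l)"

definition is_reduced_moment ::
    "'o measure \<Rightarrow> ('o \<Rightarrow> 'a::euclidean_space set) \<Rightarrow> nat \<Rightarrow> (nat \<Rightarrow> 'a) measure \<Rightarrow> bool" where
  "is_reduced_moment M N k \<mu> \<longleftrightarrow>
     sets \<mu> = sets (red_borel k) \<and>
     (\<forall>A. (\<forall>l\<in>{1..k}. A l \<in> sets borel \<and> bounded (A l)) \<longrightarrow>
        fact_moment M N {1..k} A =
          ennreal (intensity M N) * (\<integral>\<^sup>+x\<in>A k. emeasure \<mu> (rect_minus k A x) \<partial>lborel))"

definition alpha_red ::
    "'o measure \<Rightarrow> ('o \<Rightarrow> 'a::euclidean_space set) \<Rightarrow> nat \<Rightarrow> (nat \<Rightarrow> 'a) measure" where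
  "alpha_red M N k = (SOME \<mu>. is_reduced_moment M N k \<mu>)"

definition alpha2_red :: "'o measure \<Rightarrow> ('o \<Rightarrow> 'a::euclidean_space set) \<Rightarrow> 'a set \<Rightarrow> real" where
  "alpha2_red M N A = measure (alpha_red M N 2) (rect 2 (\<lambda>_. A))"

text \<open>
  A locally finite signed measure is represented by its Jordan decomposition: a pair of mutually
  singular measures that are finite on bounded sets. The decomposition is unique, and the total
  variation is the sum of the two total masses.
\<close>

definition signed_val :: "'b measure \<times> 'b measure \<Rightarrow> 'b set \<Rightarrow> real" where
  "signed_val g S = measure (fst g) S - measure (snd g) S"

definition total_variation :: "'b measure \<times> 'b measure \<Rightarrow> ennreal" where
  "total_variation g = emeasure (fst g) (space (fst g)) + emeasure (snd g) (space (snd g))"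

definition jordan_pair ::
    "nat \<Rightarrow> (nat \<Rightarrow> 'a::euclidean_space) measure \<times> (nat \<Rightarrow> 'a) measure \<Rightarrow> bool" where
  "jordan_pair k g \<longleftrightarrow>
     sets (fst g) = sets (red_borel k) \<and> sets (snd g) = sets (red_borel k) \<and>
     (\<forall>A. (\<forall>l\<in>{1..<k}. A l \<in> sets borel \<and> bounded (A l)) \<longrightarrow>
        emeasure (fst g) (rect k A) < \<infinity> \<and> emeasure (snd g) (rect k A) < \<infinity>) \<and>
     (\<exists>S\<in>sets (red_borel k). emeasure (fst g) (space (red_borel k) - S) = 0 \<and> emeasure (snd g) S = 0)"

definition is_reduced_cumulant ::
    "'o measure \<Rightarrow> ('o \<Rightarrow> 'a::euclidean_space set) \<Rightarrow> nat \<Rightarrow>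
       (nat \<Rightarrow> 'a) measure \<times> (nat \<Rightarrow> 'a) measure \<Rightarrow> bool" where
  "is_reduced_cumulant M N k g \<longleftrightarrow>
     jordan_pair k g \<and>
     (\<forall>A. (\<forall>l\<in>{1..k}. A l \<in> sets borel \<and> bounded (A l)) \<longrightarrow>
        fact_cumulant M N k A =
          intensity M N * (LINT x:A k|lborel. signed_val g (rect_minus k A x)))"

definition gamma_red ::
    "'o measure \<Rightarrow> ('o \<Rightarrow> 'a::euclidean_space set) \<Rightarrow> nat \<Rightarrow>
       (nat \<Rightarrow> 'a) measure \<times> (nat \<Rightarrow> 'a) measure" where
  "gamma_red M N k = (SOME g. is_reduced_cumulant M N k g)"

text \<open>
  The first conjunct under the quantifier only says that \<open>gamma_red M N j\<close> is not an arbitrary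
  value of the choice operator; the reduced measures always exist (and are unique) for a
  fourth-order stationary process of positive intensity.
\<close>

definition B4_mixing :: "'o measure \<Rightarrow> ('o \<Rightarrow> 'a::euclidean_space set) \<Rightarrow> bool" where
  "B4_mixing M N \<longleftrightarrow>
     kth_order_stationary 4 M N \<and>
     (\<forall>j\<in>{2,3,4}. is_reduced_cumulant M N j (gamma_red M N j) \<and>
        total_variation (gamma_red M N j) < \<infinity>)"

text \<open>
  For signed measures of finite total variation only: the density is required to be integrable,
  and \<open>signed_val\<close> is meaningful on all Borel sets.
\<close>

definition has_lebesgue_density ::
    "nat \<Rightarrow> (nat \<Rightarrow> 'a::euclidean_space) measure \<times> (nat \<Rightarrow> 'a) measure \<Rightarrow>
       ((nat \<Rightarrow> 'a) \<Rightarrow> real) \<Rightarrow> bool" where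
  "has_lebesgue_density k g \<kappa> \<longleftrightarrow>
     integrable (red_lborel k) \<kappa> \<and>
     (\<forall>S\<in>sets (red_lborel k). signed_val g S = (LINT z:S|red_lborel k. \<kappa> z))"

definition sigma2 :: "'o measure \<Rightarrow> ('o \<Rightarrow> 'a::euclidean_space set) \<Rightarrow> real" where
  "sigma2 M N = intensity M N * (1 + signed_val (gamma_red M N 2) (rect 2 (\<lambda>_. UNIV)))"

definition inradius :: "'a::euclidean_space set \<Rightarrow> real" where
  "inradius W = Sup {r. 0 < r \<and> (\<exists>x\<in>W. cball x r \<subseteq> W)}"

definition convex_averaging :: "(nat \<Rightarrow> 'a::euclidean_space set) \<Rightarrow> bool" where
  "convex_averaging W \<longleftrightarrow>
     incseq W \<and> (\<forall>n. convex (W n) \<and> compact (W n)) \<and>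
     filterlim (\<lambda>n. inradius (W n)) at_top sequentially"

abbreviation vol :: "'a::euclidean_space set \<Rightarrow> real" where
  "vol A \<equiv> measure lborel A"

definition win_scale :: "'a::euclidean_space set \<Rightarrow> real" where
  "win_scale W = vol W powr (1 / real DIM('a))"

abbreviation scaled :: "real \<Rightarrow> 'a::euclidean_space set \<Rightarrow> 'a set" where
  "scaled r B \<equiv> (\<lambda>x. r *\<^sub>R x) ` B"

definition K_fun :: "'o measure \<Rightarrow> ('o \<Rightarrow> 'a::euclidean_space set) \<Rightarrow> 'a set \<Rightarrow> real \<Rightarrow> real" where
  "K_fun M N B r = alpha2_red M N (scaled r B) / intensity M N"

text \<open>
  In the estimators, \<open>W\<close> is the window and \<open>\<phi>\<close> the realised configuration of points.
\<close>

definition edge_corrected_sum ::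
    "'a::euclidean_space set \<Rightarrow> 'a set \<Rightarrow> ('a \<Rightarrow> real) \<Rightarrow> real" where
  "edge_corrected_sum W \<phi> h =
     (\<Sum>(x, y) \<in> {(x, y). x \<in> \<phi> \<inter> W \<and> y \<in> \<phi> \<inter> W \<and> x \<noteq> y}.
        h (y - x) / vol (((\<lambda>z. z - x) ` W) \<inter> ((\<lambda>z. z - y) ` W)))"

definition lambda2K_hat ::
    "'a::euclidean_space set \<Rightarrow> 'a set \<Rightarrow> 'a set \<Rightarrow> real \<Rightarrow> real" where
  "lambda2K_hat B W \<phi> r = edge_corrected_sum W \<phi> (indicator (scaled r B))"

definition lambda_hat :: "'a::euclidean_space set \<Rightarrow> 'a set \<Rightarrow> real" where
  "lambda_hat W \<phi> = real (card (\<phi> \<inter> W)) / vol W"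

definition lambda2_hat :: "'a::euclidean_space set \<Rightarrow> 'a set \<Rightarrow> real" where
  "lambda2_hat W \<phi> = (real (card (\<phi> \<inter> W)) - 1) * real (card (\<phi> \<inter> W)) / (vol W)\<^sup>2"

definition sigma2_hat ::
    "('a::euclidean_space \<Rightarrow> real) \<Rightarrow> real \<Rightarrow> 'a set \<Rightarrow> 'a set \<Rightarrow> real" where
  "sigma2_hat w b W \<phi> =
     lambda_hat W \<phi>
     + edge_corrected_sum W \<phi> (\<lambda>z. w (z /\<^sub>R (b * win_scale W)))
     - lambda2_hat W \<phi> * (b * win_scale W) ^ DIM('a) * (\<integral>x. w x \<partial>lborel)"

definition Delta ::
    "'o measure \<Rightarrow> ('o \<Rightarrow> 'a::euclidean_space set) \<Rightarrow> 'a set \<Rightarrow> real \<Rightarrow> 'a set \<Rightarrow> 'o \<Rightarrow> real \<Rightarrow> real" where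
  "Delta M N B \<alpha> W \<omega> r =
     vol W powr (1/2 - \<alpha>) *
     (lambda2K_hat B W (N \<omega>) (win_scale W powr \<alpha> * r)
      - (intensity M N)\<^sup>2 * K_fun M N B (win_scale W powr \<alpha> * r))"

text \<open>
  The Lebesgue--Stieltjes measure of \<open>V\<close> on \<open>[0, R]\<close>, obtained by extending \<open>V\<close> constantly
  outside \<open>[0, R]\<close>. It gives no mass to \<open>0\<close>; this is immaterial here because \<open>r ^ d\<close> and
  \<open>Delta \<dots> r\<close> vanish at \<open>r = 0\<close>.
\<close>

definition stieltjes :: "real \<Rightarrow> (real \<Rightarrow> real) \<Rightarrow> real measure" where
  "stieltjes R V = interval_measure (\<lambda>r. V (max 0 (min R r)))"

definition cadlag_on :: "real \<Rightarrow> (real \<Rightarrow> real) \<Rightarrow> bool" where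
  "cadlag_on R v \<longleftrightarrow>
     (\<forall>r\<in>{0..<R}. (v \<longlongrightarrow> v r) (at_right r)) \<and>
     (\<forall>r\<in>{0<..R}. \<exists>l. (v \<longlongrightarrow> l) (at_left r))"

definition smoothing_kernel :: "('a::euclidean_space \<Rightarrow> real) \<Rightarrow> bool" where
  "smoothing_kernel w \<longleftrightarrow>
     w \<in> borel_measurable borel \<and> (\<forall>x. 0 \<le> w x) \<and> bounded (range w) \<and>
     (\<forall>x. w (- x) = w x) \<and> bounded {x. w x \<noteq> 0} \<and>
     (w \<longlongrightarrow> 1) (at 0) \<and> w 0 = 1"

text \<open>
  Measurability is required because \<open>distr\<close> is not meaningful for non-measurable functions.
\<close>

definition converges_in_distribution ::
    "'o measure \<Rightarrow> (nat \<Rightarrow> 'o \<Rightarrow> real) \<Rightarrow> real measure \<Rightarrow> bool" where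
  "converges_in_distribution M X L \<longleftrightarrow>
     (\<forall>n. X n \<in> borel_measurable M) \<and> weak_conv_m (\<lambda>n. distr M borel (X n)) L"

end

theory Submission
 imports Defs "HOL-Probability.Probability"
begin

text \<open>
 Write \<open>T(r)\<close> for the edge corrected pair count and \<open>Y\<close> for the normalised intensity error. Expanding
 the fourth moment measure into cumulants shows that, after subtraction of its Hoeffding projection,
 the pair sum \<open>T(r) - E T(r)\<close> has variance governed by the total masses of the reduced cumulants of
 annuli, so \<open>Delta(r) - 2 lam |B| r^d Y\<close> has small dyadic increments. A chaining bound combined with
 monotonicity of \<open>T\<close> and the bound on the reduced second moment makes this difference vanish uniformly
 in \<open>r\<close>; the same variance bound gives consistency of the estimator of \<open>sigma^2\<close>. Both statistics
 are therefore asymptotically functions of \<open>Y\<close> alone.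
\<close>

text \<open>The scaling decides the shape of the proof. After projection the second moment belonging
  to a lag set A is, up to constants and a boundary term, \<open>lag_measure A\<close> / |W|, and
  \<open>lag_measure\<close> is additive in A. The annuli of one dyadic level are disjoint, so the
  second moments of all increments of that level add up to a quantity of order |W|^(alpha - 1),
  whatever the level. Bounding the largest increment by the l2 norm of the level therefore gives the
  same rate on every level. About log |W| levels suffice, because the remaining mesh is bridged by
  monotonicity, and after multiplication by |W|^(1/2 - alpha) the logarithm is absorbed by the
  remaining factor |W|^(-alpha/2). Convexity of the windows enters through the overlap of W with its
  translates: it controls how far the projection deviates from a constant near the boundary. The
  reduced measures are values of a choice operator, so the existence of a reduced second moment
  measure has to be proved before anything can be said about the K-function.\<close>

lemmas borel_cont = borel_measurable_continuous_onI continuous_intros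
lemmas bochner_integral_add = Bochner_Integration.integral_add
lemmas bochner_integrable_bound = Bochner_Integration.integrable_bound
lemmas bochner_integral_cong = Bochner_Integration.integral_cong

section \<open>Convergence in probability\<close>

text \<open>Measurability is demanded for every index, as in
  \<open>converges_in_distribution\<close>, although the estimates below hold only for large
  windows.\<close>

definition tends_in_prob :: "'o measure => (nat => 'o => real) => real => bool" where
 "tends_in_prob M X a \<longleftrightarrow>
   (\<forall>n. X n \<in> borel_measurable M) \<and>
   (\<forall>e>0. (%n. measure M {om\<in>space M. e < \<bar>X n om - a\<bar>}) \<longlonglongrightarrow> 0)"

text \<open>Tightness, asked only for large indices because the variance bounds need a window of
  positive volume.\<close>

definition bounded_in_prob :: "'o measure => (nat => 'o => real) => bool" where
 "bounded_in_prob M X \<longleftrightarrow>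
   (\<forall>n. X n \<in> borel_measurable M) \<and>
   (\<forall>e>0. \<exists>K>0. eventually (%n. measure M {om\<in>space M. K < \<bar>X n om\<bar>} < e) sequentially)"

context prob_space
begin

lemma tends_in_probD [measurable_dest]: "tends_in_prob M X a ==> X n \<in> borel_measurable M"
 by (simp add: tends_in_prob_def)

lemma bounded_in_probD [measurable_dest]: "bounded_in_prob M X ==> X n \<in> borel_measurable M"
 by (simp add: bounded_in_prob_def)

lemma tends_in_prob_sup_le:
 assumes [measurable]: "!!n. X n \<in> borel_measurable M"
  and U: "tends_in_prob M U 0"
  and le: "eventually (%n. \<forall>om\<in>space M. \<bar>X n om - a\<bar> <= U n om) sequentially"
 shows "tends_in_prob M X a"
 unfolding tends_in_prob_def
proof (intro conjI allI impI)
 fix e :: real assume e: "0 < e"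
 have [measurable]: "!!n. U n \<in> borel_measurable M" using U by (simp add: tends_in_prob_def)
 have "(%n. measure M {om\<in>space M. e < \<bar>U n om - 0\<bar>}) \<longlonglongrightarrow> 0"
  using U e by (simp add: tends_in_prob_def)
 then show "(%n. measure M {om\<in>space M. e < \<bar>X n om - a\<bar>}) \<longlonglongrightarrow> 0"
 proof (rule Lim_null_comparison[rotated])
  show "eventually (%n. norm (measure M {om\<in>space M. e < \<bar>X n om - a\<bar>})
       <= measure M {om\<in>space M. e < \<bar>U n om - 0\<bar>}) sequentially"
   using le by eventually_elim (auto intro!: finite_measure_mono)
 qed
qed simp

text \<open>Continuity at the limit point alone suffices, since the pair is close to that point with
  high probability. This is what permits inversion at nonzero limits later.\<close>

lemma tends_in_prob_continuous2:
 assumes X: "tends_in_prob M X a" and Y: "tends_in_prob M Y b"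
  and g: "continuous (at (a, b)) g" and gm: "g \<in> borel_measurable (borel \<Otimes>\<^sub>M borel)"
 shows "tends_in_prob M (%n om. g (X n om, Y n om)) (g (a, b))"
 unfolding tends_in_prob_def
proof (intro conjI allI impI)
 have [measurable]: "!!n. X n \<in> borel_measurable M" "!!n. Y n \<in> borel_measurable M"
  using X Y by (auto simp: tends_in_prob_def)
 note gm[measurable]
 show "(%om. g (X n om, Y n om)) \<in> borel_measurable M" for n by measurable
 fix e :: real assume e: "0 < e"
 obtain d where d: "0 < d" and D: "!!x y. dist (x, y) (a, b) < d ==> dist (g (x, y)) (g (a, b)) < e"
  using g e by (fastforce simp: continuous_at_eps_delta)
 \<comment> \<open>The product metric is at most the sum of the coordinate distances, so d / 3 in
   each coordinate leaves a strict margin below d.\<close>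
 have imp: "\<bar>g (x, y) - g (a, b)\<bar> < e" if "\<bar>x - a\<bar> <= d / 3" "\<bar>y - b\<bar> <= d / 3" for x y
 proof -
  have "dist (x, y) (a, b) <= dist x a + dist y b"
   unfolding dist_prod_def by (auto intro: sqrt_sum_squares_le_sum)
  with that d have "dist (x, y) (a, b) < d" by (simp add: dist_real_def)
  from D[OF this] show ?thesis by (simp add: dist_real_def)
 qed
 let ?P = "%n. measure M {om\<in>space M. d / 3 < \<bar>X n om - a\<bar>} + measure M {om\<in>space M. d / 3 < \<bar>Y n om - b\<bar>}"
 have "?P \<longlonglongrightarrow> 0 + 0"
  using X Y divide_pos_pos[OF d zero_less_numeral[of "num.Bit1 num.One"]] unfolding tends_in_prob_def
  by (intro tendsto_add) blast+
 then have "?P \<longlonglongrightarrow> 0" by simp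
 then show "(%n. measure M {om\<in>space M. e < \<bar>g (X n om, Y n om) - g (a, b)\<bar>}) \<longlonglongrightarrow> 0"
 proof (rule Lim_null_comparison[rotated], intro always_eventually allI)
  fix n
  have "measure M {om\<in>space M. e < \<bar>g (X n om, Y n om) - g (a, b)\<bar>}
    <= measure M ({om\<in>space M. d / 3 < \<bar>X n om - a\<bar>} Un {om\<in>space M. d / 3 < \<bar>Y n om - b\<bar>})"
   using imp by (intro finite_measure_mono) (force simp: not_le[symmetric])+
  also have "... <= ?P n" by (rule measure_Un_le) auto
  finally show "norm (measure M {om\<in>space M. e < \<bar>g (X n om, Y n om) - g (a, b)\<bar>}) <= ?P n"
   by simp
 qed
qed

lemma tends_in_prob_const: "tends_in_prob M (%n om. a) a"
 by (simp add: tends_in_prob_def)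

lemma tends_in_prob_of_real_seq:
 assumes "s \<longlonglongrightarrow> a" shows "tends_in_prob M (%n om. s n) a"
 unfolding tends_in_prob_def
proof (intro conjI allI impI)
 fix e :: real assume "0 < e"
 with assms have "eventually (%n. dist (s n) a < e) sequentially" by (rule tendstoD)
 then have "eventually (%n. measure M {om\<in>space M. e < \<bar>s n - a\<bar>} = 0) sequentially"
  by eventually_elim (simp add: dist_real_def)
 then show "(%n. measure M {om\<in>space M. e < \<bar>s n - a\<bar>}) \<longlonglongrightarrow> 0"
  by (rule tendsto_eventually)
qed simp

lemma tends_in_prob_add:
 assumes "tends_in_prob M X a" "tends_in_prob M Y b"
 shows "tends_in_prob M (%n om. X n om + Y n om) (a + b)"
proof -
 have "isCont (%p::real \<times> real. fst p + snd p) (a, b)" by (intro continuous_intros)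
 then show ?thesis using tends_in_prob_continuous2[OF assms, of "%p. fst p + snd p"] by simp
qed

lemma tends_in_prob_mult:
 assumes "tends_in_prob M X a" "tends_in_prob M Y b"
 shows "tends_in_prob M (%n om. X n om * Y n om) (a * b)"
proof -
 have "isCont (%p::real \<times> real. fst p * snd p) (a, b)" by (intro continuous_intros)
 then show ?thesis using tends_in_prob_continuous2[OF assms, of "%p. fst p * snd p"] by simp
qed

lemma tends_in_prob_continuous:
 assumes X: "tends_in_prob M X a" and g: "isCont g a" and [measurable]: "g \<in> borel_measurable borel"
 shows "tends_in_prob M (%n om. g (X n om)) (g a)"
proof -
 have "isCont (%p. g (fst p)) (a, a)"
  by (rule isCont_o2[where f=fst]) (simp_all add: g)
 then show ?thesis
  using tends_in_prob_continuous2[OF X X, of "%p. g (fst p)"] by simp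
qed

lemma tends_in_prob_cmult:
 assumes "tends_in_prob M X a" shows "tends_in_prob M (%n om. c * X n om) (c * a)"
 using tends_in_prob_mult[OF tends_in_prob_const assms] .

lemma tends_in_prob_abs:
 assumes "tends_in_prob M X 0" shows "tends_in_prob M (%n om. \<bar>X n om\<bar>) 0"
 using tends_in_prob_continuous[OF assms, of abs] by simp

lemma tends_in_prob_diff:
 assumes "tends_in_prob M X a" "tends_in_prob M Y b"
 shows "tends_in_prob M (%n om. X n om - Y n om) (a - b)"
 using tends_in_prob_add[OF assms(1) tends_in_prob_cmult[OF assms(2), of "-1"]] by simp

lemma tends_in_prob_moment1:
 assumes [measurable]: "!!n. X n \<in> borel_measurable M"
  and ev: "eventually (%n. integrable M (X n) & expectation (%om. \<bar>X n om\<bar>) <= e n) sequentially"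
  and e: "e \<longlonglongrightarrow> 0"
 shows "tends_in_prob M X 0"
 unfolding tends_in_prob_def
proof (intro conjI allI impI)
 fix d :: real assume d: "0 < d"
 have "(%n. e n / d) \<longlonglongrightarrow> 0 / d" by (intro tendsto_intros e) (use d in simp)
 then have lim: "(%n. e n / d) \<longlonglongrightarrow> 0" by simp
 have "eventually (%n. norm (measure M {om\<in>space M. d < \<bar>X n om - 0\<bar>}) <= e n / d) sequentially"
  using ev
 proof eventually_elim
  case (elim n)
  have "measure M {om\<in>space M. d < \<bar>X n om - 0\<bar>} <= measure M {om\<in>space M. d <= \<bar>X n om\<bar>}"
   by (intro finite_measure_mono) auto
  also have "... <= expectation (%om. \<bar>X n om\<bar>) / d"
   using elim d by (intro integral_Markov_inequality_measure[where A="{}", simplified]) auto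
  also have "... <= e n / d" using elim d by (simp add: divide_right_mono)
  finally show ?case by simp
 qed
 with lim show "(%n. measure M {om\<in>space M. d < \<bar>X n om - 0\<bar>}) \<longlonglongrightarrow> 0"
  by (rule Lim_null_comparison[rotated])
qed simp

lemma abs_expectation_le_sqrt:
 assumes [measurable]: "X \<in> borel_measurable M" and i: "integrable M (%om. (X om)\<^sup>2)"
 shows "expectation (%om. \<bar>X om\<bar>) <= sqrt (expectation (%om. (X om)\<^sup>2))"
proof -
 have i1: "integrable M X" by (rule square_integrable_imp_integrable) (auto simp: i)
 have "0 <= variance (%om. \<bar>X om\<bar>)" by (rule variance_positive)
 also have "variance (%om. \<bar>X om\<bar>) = expectation (%om. (X om)\<^sup>2) - (expectation (%om. \<bar>X om\<bar>))\<^sup>2"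
  using i i1 by (subst variance_eq) auto
 finally have "(expectation (%om. \<bar>X om\<bar>))\<^sup>2 <= expectation (%om. (X om)\<^sup>2)" by simp
 then show ?thesis by (rule real_le_rsqrt)
qed

lemma tends_in_prob_moment2:
 assumes [measurable]: "!!n. X n \<in> borel_measurable M"
  and ev: "eventually (%n. integrable M (%om. (X n om)\<^sup>2) & expectation (%om. (X n om)\<^sup>2) <= e n) sequentially"
  and e: "e \<longlonglongrightarrow> 0"
 shows "tends_in_prob M X 0"
proof (rule tends_in_prob_moment1)
 show "eventually (%n. integrable M (X n) & expectation (%om. \<bar>X n om\<bar>) <= sqrt (e n)) sequentially"
  using ev
 proof eventually_elim
  case (elim n)
  then have "integrable M (X n)" by (simp add: square_integrable_imp_integrable)
  moreover have "expectation (%om. \<bar>X n om\<bar>) <= sqrt (expectation (%om. (X n om)\<^sup>2))"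
   using elim by (intro abs_expectation_le_sqrt) auto
  moreover have "... <= sqrt (e n)" using elim by simp
  ultimately show ?case by linarith
 qed
 show "(%n. sqrt (e n)) \<longlonglongrightarrow> 0" using tendsto_real_sqrt[OF e] by simp
qed simp

lemma bounded_in_prob_moment2:
 assumes [measurable]: "!!n. X n \<in> borel_measurable M"
  and ev: "eventually (%n. integrable M (%om. (X n om)\<^sup>2) & expectation (%om. (X n om)\<^sup>2) <= C) sequentially"
 shows "bounded_in_prob M X"
 unfolding bounded_in_prob_def
proof (intro conjI allI impI)
 fix e :: real assume e: "0 < e"
 \<comment> \<open>Replacing C by a positive number keeps K positive; with this choice the Chebyshev
   bound \<open>D / K\<^sup>2\<close> equals e / 2.\<close>
 define D where "D = max C 1"
 define K where "K = sqrt (2 * D / e)"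
 have D: "0 < D" "C <= D" by (auto simp: D_def)
 have K: "0 < K" "K\<^sup>2 = 2 * D / e" using D e by (auto simp: K_def)
 have "eventually (%n. measure M {om\<in>space M. K < \<bar>X n om\<bar>} < e) sequentially"
  using ev
 proof eventually_elim
  case (elim n)
  have "measure M {om\<in>space M. K < \<bar>X n om\<bar>} <= measure M {om\<in>space M. K\<^sup>2 <= (X n om)\<^sup>2}"
   using K(1) by (intro finite_measure_mono) (auto simp: abs_le_square_iff[symmetric])
  also have "... <= expectation (%om. (X n om)\<^sup>2) / K\<^sup>2"
   using elim K(1) by (intro integral_Markov_inequality_measure[where A="{}", simplified]) auto
  also have "... <= D / K\<^sup>2" using elim D(2) by (intro divide_right_mono) auto
  also have "... < e" using D e by (simp add: K)
  finally show ?case .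
 qed
 with K show "\<exists>K>0. eventually (%n. measure M {om\<in>space M. K < \<bar>X n om\<bar>} < e) sequentially" by blast
qed simp

lemma tends_in_prob_mult_bounded:
 assumes X: "tends_in_prob M X 0" and Y: "bounded_in_prob M Y"
 shows "tends_in_prob M (%n om. X n om * Y n om) 0"
 unfolding tends_in_prob_def
proof (intro conjI allI impI)
 have [measurable]: "!!n. X n \<in> borel_measurable M" "!!n. Y n \<in> borel_measurable M"
  using X Y by (auto simp: tends_in_prob_def bounded_in_prob_def)
 show "(%om. X n om * Y n om) \<in> borel_measurable M" for n by measurable
 fix d :: real assume d: "0 < d"
 show "(%n. measure M {om\<in>space M. d < \<bar>X n om * Y n om - 0\<bar>}) \<longlonglongrightarrow> 0"
 proof (rule tendstoI)
  fix e :: real assume e: "0 < e"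
  obtain K where K: "0 < K" and ev: "eventually (%n. measure M {om\<in>space M. K < \<bar>Y n om\<bar>} < e / 2) sequentially"
   using Y e unfolding bounded_in_prob_def by (meson half_gt_zero)
  have "(%n. measure M {om\<in>space M. d / K < \<bar>X n om - 0\<bar>}) \<longlonglongrightarrow> 0"
   using X d K by (simp add: tends_in_prob_def)
  from tendstoD[OF this, of "e / 2"] e
  have "eventually (%n. measure M {om\<in>space M. d / K < \<bar>X n om\<bar>} < e / 2) sequentially" by simp
  with ev show "eventually (%n. dist (measure M {om\<in>space M. d < \<bar>X n om * Y n om - 0\<bar>}) 0 < e) sequentially"
  proof eventually_elim
   case (elim n)
   have "measure M {om\<in>space M. d < \<bar>X n om * Y n om - 0\<bar>}
     <= measure M ({om\<in>space M. d / K < \<bar>X n om\<bar>} Un {om\<in>space M. K < \<bar>Y n om\<bar>})"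
   proof (intro finite_measure_mono subsetI)
    fix om assume om: "om \<in> {om\<in>space M. d < \<bar>X n om * Y n om - 0\<bar>}"
    { assume "\<bar>X n om\<bar> <= d / K" "\<bar>Y n om\<bar> <= K"
     then have "\<bar>X n om\<bar> * \<bar>Y n om\<bar> <= d / K * K" using d K by (intro mult_mono) auto
     with om K have False by (simp add: abs_mult) }
    with om show "om \<in> {om\<in>space M. d / K < \<bar>X n om\<bar>} Un {om\<in>space M. K < \<bar>Y n om\<bar>}"
     by fastforce
   qed auto
   also have "... <= measure M {om\<in>space M. d / K < \<bar>X n om\<bar>} + measure M {om\<in>space M. K < \<bar>Y n om\<bar>}"
    by (rule measure_Un_le) auto
   also have "... < e" using elim by simp
   finally show ?case by simp
  qed
 qed
qed

lemma bounded_in_prob_square: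
 assumes "bounded_in_prob M X" shows "bounded_in_prob M (%n om. (X n om)\<^sup>2)"
 unfolding bounded_in_prob_def
proof (intro conjI allI impI)
 show "(%om. (X n om)\<^sup>2) \<in> borel_measurable M" for n
  using assms by (intro borel_measurable_power) (simp add: bounded_in_prob_def)
 fix e :: real assume "0 < e"
 with assms obtain K where K: "0 < K" "eventually (%n. measure M {om\<in>space M. K < \<bar>X n om\<bar>} < e) sequentially"
  unfolding bounded_in_prob_def by meson
 have "K\<^sup>2 < \<bar>x\<^sup>2\<bar> \<longleftrightarrow> K < \<bar>x\<bar>" for x :: real
  using K(1) abs_le_square_iff[of x K] by (simp add: not_le[symmetric])
 with K show "\<exists>K>0. eventually (%n. measure M {om\<in>space M. K < \<bar>(X n om)\<^sup>2\<bar>} < e) sequentially"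
  by (intro exI[of _ "K\<^sup>2"]) auto
qed

lemma bounded_in_prob_abs:
 "bounded_in_prob M X ==> bounded_in_prob M (%n om. \<bar>X n om\<bar>)"
 unfolding bounded_in_prob_def by (simp add: borel_measurable_abs)

text \<open>The ramps \<open>cts_step\<close> determine weak convergence and are uniformly
  continuous, so closeness of X and Z in probability becomes closeness of their
  expectations.\<close>

lemma converges_in_distribution_slutsky:
 assumes Z: "converges_in_distribution M Z L" and L: "real_distribution L"
  and X: "!!n. X n \<in> borel_measurable M"
  and d: "tends_in_prob M (%n om. X n om - Z n om) 0"
 shows "converges_in_distribution M X L"
 unfolding converges_in_distribution_def
proof (intro conjI allI)
 have [measurable]: "!!n. X n \<in> borel_measurable M" "!!n. Z n \<in> borel_measurable M"
  using X Z by (auto simp: converges_in_distribution_def)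
 show "X n \<in> borel_measurable M" for n by simp
 have rX: "real_distribution (distr M borel (X n))" and rZ: "real_distribution (distr M borel (Z n))" for n
  by (simp_all add: prob_space_axioms real_distribution_distr)
 show "weak_conv_m (%n. distr M borel (X n)) L"
 proof (rule integral_cts_step_conv_imp_weak_conv[OF rX L])
  fix x y :: real assume xy: "x < y"
  let ?c = "cts_step x y"
  have cm[measurable]: "?c \<in> borel_measurable borel" by (auto simp: cts_step_def[abs_def])
  have cb: "0 <= ?c t" "?c t <= 1" for t using xy by (auto simp: cts_step_def field_simps)
  have cont: "isCont ?c t" for t
   using cts_step_uniformly_continuous[OF xy] uniformly_continuous_imp_continuous
    continuous_on_eq_continuous_at by blast
  have "(%n. integral\<^sup>L (distr M borel (Z n)) ?c) \<longlonglongrightarrow> integral\<^sup>L L ?c"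
   using Z cb cont by (intro weak_conv_imp_integral_bdd_continuous_conv[OF rZ L, where B=1])
    (auto simp: converges_in_distribution_def)
  then have 1: "(%n. expectation (%om. ?c (Z n om))) \<longlonglongrightarrow> integral\<^sup>L L ?c"
   by (simp add: integral_distr)
  have ib: "integrable M (%om. ?c (U om))" if "U \<in> borel_measurable M" for U
   using that cb by (intro integrable_const_bound[where B=1]) auto
  have "(%n. expectation (%om. ?c (X n om)) - expectation (%om. ?c (Z n om))) \<longlonglongrightarrow> 0"
  proof (rule tendstoI)
   fix e :: real assume e: "0 < e"
   obtain dl where dl: "0 < dl" "!!s t. dist s t < dl ==> dist (?c s) (?c t) < e / 3"
    using cts_step_uniformly_continuous[OF xy] e unfolding uniformly_continuous_on_def
    by (metis UNIV_I divide_pos_pos zero_less_numeral)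
   have "(%n. measure M {om\<in>space M. dl / 2 < \<bar>X n om - Z n om - 0\<bar>}) \<longlonglongrightarrow> 0"
    using d half_gt_zero[OF dl(1)] unfolding tends_in_prob_def by blast
   from tendstoD[OF this, of "e / 3"] e
   have "eventually (%n. measure M {om\<in>space M. dl / 2 < \<bar>X n om - Z n om\<bar>} < e / 3) sequentially" by simp
   then show "eventually (%n. dist (expectation (%om. ?c (X n om)) - expectation (%om. ?c (Z n om))) 0 < e) sequentially"
   proof eventually_elim
    case (elim n)
    define E where "E = {om\<in>space M. dl / 2 < \<bar>X n om - Z n om\<bar>}"
    have [measurable]: "E \<in> sets M" unfolding E_def by measurable
    \<comment> \<open>Off the event E the ramp changes by less than e / 3; on E it changes by at
      most 1, which is paid for by the probability of E.\<close>
    have pt: "\<bar>?c (X n om) - ?c (Z n om)\<bar> <= e / 3 + indicator E om" if "om \<in> space M" for om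
    proof (cases "om \<in> E")
     case True
     then show ?thesis using cb[of "X n om"] cb[of "Z n om"] e by auto
    next
     case False
     with that dl have "dist (X n om) (Z n om) < dl" by (simp add: dist_real_def E_def)
     from dl(2)[OF this] show ?thesis using False by (simp add: dist_real_def)
    qed
    have iE: "integrable M (indicator E :: _ => real)"
     by (rule integrable_real_indicator) (simp_all add: emeasure_eq_measure)
    have "\<bar>expectation (%om. ?c (X n om)) - expectation (%om. ?c (Z n om))\<bar>
      = \<bar>expectation (%om. ?c (X n om) - ?c (Z n om))\<bar>"
     by (subst Bochner_Integration.integral_diff) (auto intro: ib)
    also have "... <= expectation (%om. \<bar>?c (X n om) - ?c (Z n om)\<bar>)" by (rule integral_abs_bound)
    also have "... <= expectation (%om. e / 3 + indicator E om)"
     using pt by (intro integral_mono Bochner_Integration.integrable_add integrable_abs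
       Bochner_Integration.integrable_diff ib) (simp_all add: iE)
    also have "... = e / 3 + measure M E" by (subst bochner_integral_add) (auto simp: prob_space iE)
    also have "... < e" using elim e unfolding E_def by linarith
    finally show ?case by (simp add: dist_real_def)
   qed
  qed
  from tendsto_add[OF this 1] show "(%n. integral\<^sup>L (distr M borel (X n)) ?c) \<longlonglongrightarrow> integral\<^sup>L L ?c"
   by (simp add: integral_distr)
 qed
qed

lemma converges_in_distribution_continuous:
 assumes Z: "converges_in_distribution M Z L" and L: "real_distribution L"
  and ph: "!!x. isCont ph x"
 shows "converges_in_distribution M (%n om. ph (Z n om)) (distr L borel ph)"
 unfolding converges_in_distribution_def
proof (intro conjI allI)
 have [measurable]: "!!n. Z n \<in> borel_measurable M"
  using Z by (auto simp: converges_in_distribution_def)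
 have [measurable]: "ph \<in> borel_measurable borel"
  using ph by (intro borel_measurable_continuous_onI continuous_at_imp_continuous_on) auto
 interpret L: real_distribution L by fact
 show "(%om. ph (Z n om)) \<in> borel_measurable M" for n by simp
 have rZ: "real_distribution (distr M borel (Z n))" for n
  by (simp add: prob_space_axioms real_distribution_distr)
 have rphi: "real_distribution (distr L borel ph)"
  using L.prob_space_axioms by (intro real_distribution.intro prob_space.prob_space_distr) (auto simp: real_distribution_axioms_def)
 show "weak_conv_m (%n. distr M borel (%om. ph (Z n om))) (distr L borel ph)"
 proof (rule integral_bdd_continuous_conv_imp_weak_conv[OF _ rphi])
  show "real_distribution (distr M borel (%om. ph (Z n om)))" for n
   by (simp add: prob_space_axioms real_distribution_distr)
  fix f :: "real => real" and B :: real
  assume f: "!!x. isCont f x" and b: "!!x. \<bar>f x\<bar> <= 1"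
  have [measurable]: "f \<in> borel_measurable borel"
   using f by (intro borel_measurable_continuous_onI continuous_at_imp_continuous_on) auto
  have "(%n. integral\<^sup>L (distr M borel (Z n)) (%x. f (ph x))) \<longlonglongrightarrow> integral\<^sup>L L (%x. f (ph x))"
   using Z b by (intro weak_conv_imp_integral_bdd_continuous_conv[OF rZ L, where B=1])
    (auto simp: converges_in_distribution_def intro!: isCont_o2[OF ph f])
  then show "(%n. integral\<^sup>L (distr M borel (%om. ph (Z n om))) f) \<longlonglongrightarrow> integral\<^sup>L (distr L borel ph) f"
   by (simp add: integral_distr)
 qed
qed

end

section \<open>Random finite sets and their mean measures\<close>

text \<open>Monotone class induction that keeps bounds: the limit case supplies a common bound C, so
  that dominated convergence applies under finite measures. Positive and negative parts reduce the
  claim to nonnegative functions, and there boundedness travels as a premise of the induction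
  formula.\<close>

lemma bounded_borel_induct [consumes 2, case_names indicator linear lim]:
 fixes P :: "('b::topological_space => real) => bool"
 assumes F: "F \<in> borel_measurable borel" "!!x. \<bar>F x\<bar> <= C"
  and ind: "!!S. S \<in> sets borel ==> P (indicator S)"
  and lin: "!!a b f g Cf Cg. f \<in> borel_measurable borel ==> g \<in> borel_measurable borel ==>
    (!!x. \<bar>f x\<bar> <= Cf) ==> (!!x. \<bar>g x\<bar> <= Cg) ==> P f ==> P g ==> P (%x. a * f x + b * g x)"
  and lim: "!!f U C. (!!i. U i \<in> borel_measurable borel) ==> f \<in> borel_measurable borel ==>
    (!!i x. \<bar>U i x\<bar> <= C) ==> (!!x. (%i. U i x) \<longlonglongrightarrow> f x) ==> (!!i. P (U i)) ==> P f"
 shows "P F"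
proof -
 have nn: "(\<exists>C. \<forall>x. u x <= C) \<longrightarrow> P u" if "u \<in> borel_measurable borel" "!!x. 0 <= u x" for u :: "'b => real"
  using that
 proof (induction u rule: borel_measurable_induct_real)
  case (set A)
  then show ?case using ind by simp
 next
  case (mult u c)
  show ?case
  proof
   assume "\<exists>C. \<forall>x. c * u x <= C"
   then obtain C where C: "!!x. c * u x <= C" by blast
   show "P (%x. c * u x)"
   \<comment> \<open>A bound on c u gives a bound on u only for c > 0; for c = 0 the function is the
     indicator of the empty set.\<close>
   proof (cases "c = 0")
    case True
    have "(indicator {} :: 'b => real) = (%x. 0)" by auto
    with ind[of "{}"] have "P (%x. 0)" by simp
    with True show ?thesis by simp
   next
    case False
    with mult(1) C have "u x <= C / c" for x by (simp add: field_simps mult.commute)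
    with mult have "P u" "!!x. \<bar>u x\<bar> <= C / c" by auto
    with lin[of u u "C / c" "C / c" c 0] mult(2) show ?thesis by simp
   qed
  qed
 next
  case (add u v)
  show ?case
  proof
   assume "\<exists>C. \<forall>x. v x + u x <= C"
   then obtain C where C: "!!x. v x + u x <= C" by blast
   have nn: "0 <= u x" "0 <= v x" for x using add by auto
   have u: "\<bar>u x\<bar> <= C" and v: "\<bar>v x\<bar> <= C" for x using C[of x] nn(1)[of x] nn(2)[of x] by linarith+
   have uC: "u x <= C" and vC: "v x <= C" for x using u[of x] v[of x] by auto
   have P: "P u" "P v" using add uC vC by blast+
   have "u \<in> borel_measurable borel" "v \<in> borel_measurable borel" using add by auto
   with lin[of v u C C 1 1] u v P show "P (%x. v x + u x)" by simp
  qed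
 next
  case (seq U)
  show ?case
  proof
   assume "\<exists>C. \<forall>x. u x <= C"
   then obtain C where C: "!!x. u x <= C" by blast
   have le: "\<bar>U i x\<bar> <= C" for i x
   proof -
    have "incseq (%i. U i x)" using \<open>incseq U\<close> by (simp add: incseq_def le_fun_def)
    then have "U i x <= u x" by (rule incseq_le) (use seq in simp)
    moreover have "0 <= U i x" using seq by simp
    ultimately show ?thesis using C[of x] by linarith
   qed
   have leC: "U i x <= C" for i x using le[of i x] by linarith
   have PU: "P (U i)" for i using seq leC by blast
   have um: "u \<in> borel_measurable borel"
    by (rule borel_measurable_LIMSEQ_real[where u=U]) (use seq in auto)
   show "P u"
    by (rule lim[where U=U and C=C]) (use seq le um PU in auto)
  qed
 qed
 have [measurable]: "F \<in> borel_measurable borel" by fact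
 have b: "\<bar>max 0 (F x)\<bar> <= C" "\<bar>max 0 (- F x)\<bar> <= C" for x using F(2)[of x] by auto
 then have "max 0 (F x) <= C" "max 0 (- F x) <= C" for x by (meson abs_ge_self order_trans)+
 then have "P (%x. max 0 (F x))" "P (%x. max 0 (- F x))"
  using nn[of "%x. max 0 (F x)"] nn[of "%x. max 0 (- F x)"] by auto
 then have "P (%x. 1 * max 0 (F x) + (-1) * max 0 (- F x))"
  using b by (intro lin[where Cf=C and Cg=C]) simp_all
 moreover have "(%x. 1 * max 0 (F x) + (-1) * max 0 (- F x)) = F" by (auto simp: max_def)
 ultimately show ?thesis by simp
qed

definition random_finite :: "'o measure => ('o => 'b::topological_space set) => bool" where
 "random_finite M K \<longleftrightarrow> (\<forall>om\<in>space M. finite (K om)) \<and>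
   (\<forall>S\<in>sets borel. (%om. real (card (K om Int S))) \<in> borel_measurable M)"

lemma random_finiteD:
 assumes "random_finite M K"
 shows "om \<in> space M ==> finite (K om)"
  and "S \<in> sets borel ==> (%om. real (card (K om Int S))) \<in> borel_measurable M"
  and "(%om. real (card (K om))) \<in> borel_measurable M"
proof -
 show "om \<in> space M ==> finite (K om)" using assms by (simp add: random_finite_def)
 show m: "S \<in> sets borel ==> (%om. real (card (K om Int S))) \<in> borel_measurable M" for S
  using assms by (simp add: random_finite_def)
 from m[of UNIV] show "(%om. real (card (K om))) \<in> borel_measurable M" by simp
qed

lemma sum_indicator_card: "finite A ==> (\<Sum>x\<in>A. indicator S x) = real (card (A Int S))"
 by (simp add: indicator_def sum.If_cases)

lemma random_finite_sum_bounded: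
 fixes F :: "'b::topological_space => real"
 assumes K: "random_finite M K" and F: "F \<in> borel_measurable borel" "!!x. \<bar>F x\<bar> <= C"
 shows "(%om. \<Sum>x\<in>K om. F x) \<in> borel_measurable M"
 using F
proof (induction F rule: bounded_borel_induct)
 case (indicator S)
 then have "(%om. real (card (K om Int S))) \<in> borel_measurable M" by (rule random_finiteD(2)[OF K])
 also have "?this \<longleftrightarrow> ?case"
  by (rule measurable_cong) (simp add: sum_indicator_card random_finiteD[OF K])
 finally show ?case .
next
 case (linear a b f g)
 have "(%om. a * (\<Sum>x\<in>K om. f x) + b * (\<Sum>x\<in>K om. g x)) \<in> borel_measurable M" using linear by simp
 then show ?case by (simp add: sum.distrib sum_distrib_left)
next
 case (lim f U C)
 show ?case
  by (rule borel_measurable_LIMSEQ_real[where u="%i om. \<Sum>x\<in>K om. U i x"])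
   (simp_all add: lim(4,5) tendsto_sum)
qed

text \<open>Truncation at level n reduces to bounded F: at every single point the truncations agree
  with F from some level on, so the sums over a finite set converge.\<close>

lemma random_finite_sum:
 fixes F :: "'b::topological_space => real"
 assumes K: "random_finite M K" and F[measurable]: "F \<in> borel_measurable borel"
 shows "(%om. \<Sum>x\<in>K om. F x) \<in> borel_measurable M"
proof (rule borel_measurable_LIMSEQ_real[where u="%n om. \<Sum>x\<in>K om. max (- real n) (min (real n) (F x))"])
 show "(%om. \<Sum>x\<in>K om. max (- real n) (min (real n) (F x))) \<in> borel_measurable M" for n
  by (rule random_finite_sum_bounded[OF K, where C="real n"]) auto
 fix om
 show "(%n. \<Sum>x\<in>K om. max (- real n) (min (real n) (F x))) \<longlonglongrightarrow> (\<Sum>x\<in>K om. F x)"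
 proof (rule tendsto_sum)
  fix x
  obtain m :: nat where "\<bar>F x\<bar> <= real m" using real_arch_simple by blast
  then have "eventually (%n. max (- real n) (min (real n) (F x)) = F x) sequentially"
   by (intro eventually_sequentiallyI[of m]) (auto simp: max_def min_def)
  then show "(%n. max (- real n) (min (real n) (F x))) \<longlonglongrightarrow> F x" by (rule tendsto_eventually)
 qed
qed

lemma card_UN_sums:
 assumes "finite A" "disjoint_family S"
 shows "(%i. real (card (A Int S i))) sums real (card (A Int (\<Union>i. S i)))"
proof -
 interpret finite_measure "count_space A" using assms(1) by (rule finite_measure_count_space)
 have m: "measure (count_space A) (A Int T) = real (card (A Int T))" for T
  using assms(1) by (simp add: measure_count_space)
 have "(%i. measure (count_space A) (A Int S i)) sums measure (count_space A) (\<Union>i. A Int S i)"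
  by (intro finite_measure_UNION) (use assms(2) in \<open>auto simp: disjoint_family_on_def\<close>)
 moreover have "(\<Union>i. A Int S i) = A Int (\<Union>i. S i)" by auto
 ultimately show ?thesis by (simp only: m)
qed

lemma sets_borel_pair:
 "sets (borel :: ('b::second_countable_topology \<times> 'c::second_countable_topology) measure)
  = sigma_sets UNIV {a \<times> b |a b. a \<in> sets borel & b \<in> sets borel}"
proof -
 have "sets (borel \<Otimes>\<^sub>M borel :: ('b \<times> 'c) measure)
   = sigma_sets UNIV {a \<times> b |a b. a \<in> sets borel & b \<in> sets borel}"
  using sets_pair_measure[of "borel :: 'b measure" "borel :: 'c measure"] by simp
 then show ?thesis by (simp only: borel_prod)
qed

text \<open>Dynkin's argument over measurable rectangles, where the count is a product of two
  measurable counts. Finiteness of the two sets turns the complement step into a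
  subtraction.\<close>

lemma random_finite_times:
 fixes K1 :: "'o => 'b::second_countable_topology set" and K2 :: "'o => 'c::second_countable_topology set"
 assumes K1: "random_finite M K1" and K2: "random_finite M K2"
 shows "random_finite M (%om. K1 om \<times> K2 om)"
 unfolding random_finite_def
proof (intro conjI ballI)
 fix om assume "om \<in> space M" then show "finite (K1 om \<times> K2 om)"
  using random_finiteD(1)[OF K1] random_finiteD(1)[OF K2] by simp
next
 note meas = random_finiteD(2,3)[OF K1] random_finiteD(2,3)[OF K2]
 fix S :: "('b \<times> 'c) set" assume "S \<in> sets borel"
 then have S: "S \<in> sigma_sets UNIV {a \<times> b |a b. a \<in> sets (borel :: 'b measure) & b \<in> sets (borel :: 'c measure)}"
  unfolding sets_borel_pair by simp
 let ?G = "{a \<times> b |a b. a \<in> sets (borel :: 'b measure) & b \<in> sets (borel :: 'c measure)}"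
 show "(%om. real (card (K1 om \<times> K2 om Int S))) \<in> borel_measurable M"
 proof (rule sigma_sets_induct_disjoint[of ?G UNIV S "%S. (%om. real (card (K1 om \<times> K2 om Int S))) \<in> borel_measurable M"])
  show "Int_stable ?G" by (rule Int_stable_pair_measure_generator)
  show "?G \<subseteq> Pow UNIV" by simp
  show "S \<in> sigma_sets UNIV ?G" by (rule S)
 next
  fix S assume "S \<in> ?G"
  then obtain a b where ab: "S = a \<times> b" "a \<in> sets borel" "b \<in> sets borel" by blast
  have eq: "real (card (K1 om \<times> K2 om Int S)) = real (card (K1 om Int a)) * real (card (K2 om Int b))" for om
   unfolding ab(1) Times_Int_Times card_cartesian_product by simp
  show "(%om. real (card (K1 om \<times> K2 om Int S))) \<in> borel_measurable M"
   unfolding eq by (intro borel_measurable_times meas ab(2,3))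
 next
  show "(%om. real (card (K1 om \<times> K2 om Int {}))) \<in> borel_measurable M" by simp
 next
  fix A assume compl: "(%om. real (card (K1 om \<times> K2 om Int A))) \<in> borel_measurable M"
  have "(%om. real (card (K1 om)) * real (card (K2 om)) - real (card (K1 om \<times> K2 om Int A))) \<in> borel_measurable M"
   by (intro borel_measurable_times borel_measurable_diff meas compl)
  also have "?this \<longleftrightarrow> ((%om. real (card (K1 om \<times> K2 om Int (UNIV - A)))) \<in> borel_measurable M)"
  proof (rule measurable_cong)
   fix om assume "om \<in> space M"
   then have fin: "finite (K1 om \<times> K2 om)" using random_finiteD(1)[OF K1] random_finiteD(1)[OF K2] by simp
   have "K1 om \<times> K2 om Int (UNIV - A) = K1 om \<times> K2 om - (K1 om \<times> K2 om Int A)" by auto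
   then show "real (card (K1 om)) * real (card (K2 om)) - real (card (K1 om \<times> K2 om Int A))
     = real (card (K1 om \<times> K2 om Int (UNIV - A)))"
    using card_mono[OF fin Int_lower1, of A] card_Diff_subset[OF finite_Int[OF disjI1[OF fin]] Int_lower1, of A]
    by (simp only: card_cartesian_product of_nat_diff of_nat_mult)
  qed
  finally show "(%om. real (card (K1 om \<times> K2 om Int (UNIV - A)))) \<in> borel_measurable M" .
 next
  fix A :: "nat => ('b \<times> 'c) set" assume union: "disjoint_family A"
   "!!i. (%om. real (card (K1 om \<times> K2 om Int A i))) \<in> borel_measurable M"
  have "(%om. \<Sum>i. real (card (K1 om \<times> K2 om Int A i))) \<in> borel_measurable M"
   using union(2) by simp
  also have "?this \<longleftrightarrow> ((%om. real (card (K1 om \<times> K2 om Int (\<Union>i. A i)))) \<in> borel_measurable M)"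
  proof (rule measurable_cong)
   fix om assume "om \<in> space M"
   then have fin: "finite (K1 om \<times> K2 om)" using random_finiteD(1)[OF K1] random_finiteD(1)[OF K2] by simp
   show "(\<Sum>i. real (card (K1 om \<times> K2 om Int A i))) = real (card (K1 om \<times> K2 om Int (\<Union>i. A i)))"
    using card_UN_sums[OF fin union(1)] by (rule sums_unique[symmetric])
  qed
  finally show "(%om. real (card (K1 om \<times> K2 om Int (\<Union>i. A i)))) \<in> borel_measurable M" .
 qed
qed

lemma random_finite_Int:
 assumes K: "random_finite M K" and D: "D \<in> sets borel"
 shows "random_finite M (%om. K om Int D)"
 using random_finiteD(1,2)[OF K] D unfolding random_finite_def by (simp add: Int_assoc sets.Int)

lemma random_finite_compose:
 assumes K: "random_finite M K" and f: "f \<in> measurable M' M"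
 shows "random_finite M' (%om. K (f om))"
 unfolding random_finite_def
 using random_finiteD(1)[OF K] measurable_space[OF f] measurable_compose[OF f random_finiteD(2)[OF K]]
 by blast

lemma random_finite_singleton:
 assumes f: "f \<in> measurable M borel"
 shows "random_finite M (%om. {f om})"
 unfolding random_finite_def
proof (intro conjI ballI)
 fix S :: "'b set" assume [measurable]: "S \<in> sets borel"
 have eq: "real (card ({f om} Int S)) = indicator S (f om)" for om by (auto simp: indicator_def Int_insert_left)
 show "(%om. real (card ({f om} Int S))) \<in> borel_measurable M" unfolding eq using f by measurable
qed simp

text \<open>The parameter is treated as a random one-point set, so joint measurability follows from
  the product of two random finite sets.\<close>

lemma random_finite_sum_param:
 fixes K :: "'o => 'b::second_countable_topology set" and F :: "'b => 'c::second_countable_topology => real"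
 assumes K: "random_finite M K" and F: "(%(x, r). F x r) \<in> borel_measurable borel"
 shows "(%(om, r). \<Sum>x\<in>K om. F x r) \<in> borel_measurable (M \<Otimes>\<^sub>M borel)"
proof -
 have "random_finite (M \<Otimes>\<^sub>M borel) (%p. K (fst p) \<times> {snd p :: 'c})"
  by (intro random_finite_times random_finite_singleton random_finite_compose[OF K]) simp_all
 from random_finite_sum[OF this F]
 have "(%p. \<Sum>x\<in>K (fst p) \<times> {snd p}. (%(x, r). F x r) x) \<in> borel_measurable (M \<Otimes>\<^sub>M borel)" .
 also have "(%p. \<Sum>x\<in>K (fst p) \<times> {snd p}. (%(x, r). F x r) x) = (%(om, r). \<Sum>x\<in>K om. F x r)"
  by (auto simp: fun_eq_iff sum.cartesian_product[symmetric])
 finally show ?thesis .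
qed

text \<open>The intensity measure of the random set K. If K consists of the k-tuples of distinct
  points in a window, this is the k-th factorial moment measure restricted to that window.\<close>

definition mean_measure :: "'o measure => ('o => 'b::topological_space set) => 'b measure" where
 "mean_measure M K = measure_of UNIV (sets borel) (%S. \<integral>\<^sup>+om. ennreal (real (card (K om Int S))) \<partial>M)"

lemma sets_mean_measure [simp, measurable_cong]:
 "sets (mean_measure M K) = sets (borel :: 'a::topological_space measure)"
 unfolding mean_measure_def using sets.sigma_sets_eq[of "borel :: 'a measure"] by simp

lemma space_mean_measure [simp]: "space (mean_measure M K) = UNIV"
 unfolding mean_measure_def by simp

lemma emeasure_mean_measure:
 assumes K: "random_finite M K" and S: "S \<in> sets borel"
 shows "emeasure (mean_measure M K) S = (\<integral>\<^sup>+om. ennreal (real (card (K om Int S))) \<partial>M)"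
proof (rule emeasure_measure_of[OF mean_measure_def])
 note meas = random_finiteD(2)[OF K]
 show "S \<in> sets (mean_measure M K)" using S by simp
 show "positive (sets (mean_measure M K)) (%S. \<integral>\<^sup>+om. ennreal (real (card (K om Int S))) \<partial>M)"
  by (auto simp: positive_def)
 show "countably_additive (sets (mean_measure M K)) (%S. \<integral>\<^sup>+om. ennreal (real (card (K om Int S))) \<partial>M)"
 proof (rule countably_additiveI)
  fix A :: "nat => 'b set" assume A: "range A \<subseteq> sets (mean_measure M K)" "disjoint_family A"
  then have [measurable]: "!!i. A i \<in> sets borel" by auto
  have "(\<Sum>i. \<integral>\<^sup>+om. ennreal (real (card (K om Int A i))) \<partial>M)
    = (\<integral>\<^sup>+om. (\<Sum>i. ennreal (real (card (K om Int A i)))) \<partial>M)"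
   by (rule nn_integral_suminf[symmetric]) (simp add: meas)
  also have "... = (\<integral>\<^sup>+om. ennreal (real (card (K om Int (\<Union>i. A i)))) \<partial>M)"
  proof (rule nn_integral_cong)
   fix om assume "om \<in> space M"
   then have "finite (K om)" using K by (rule random_finiteD(1)[rotated])
   from card_UN_sums[OF this A(2)]
   show "(\<Sum>i. ennreal (real (card (K om Int A i)))) = ennreal (real (card (K om Int (\<Union>i. A i))))"
    by (intro suminf_ennreal_eq) auto
  qed
  finally show "(\<Sum>i. \<integral>\<^sup>+om. ennreal (real (card (K om Int A i))) \<partial>M)
    = (\<integral>\<^sup>+om. ennreal (real (card (K om Int (\<Union>i. A i)))) \<partial>M)" .
 qed
qed simp

text \<open>Campbell's formula. Measurability of the sum is proved in the same induction, because
  the additive and monotone steps for the integrals rely on it.\<close>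

lemma nn_integral_mean_measure:
 fixes F :: "'b::topological_space => ennreal"
 assumes K: "random_finite M K" and F: "F \<in> borel_measurable borel"
 shows "(%om. \<Sum>x\<in>K om. F x) \<in> borel_measurable M \<and>
  (\<integral>\<^sup>+x. F x \<partial>mean_measure M K) = (\<integral>\<^sup>+om. (\<Sum>x\<in>K om. F x) \<partial>M)"
 using F
proof (induction F rule: borel_measurable_induct)
 case (cong f g) then show ?case by (simp add: fun_eq_iff cong: sum.cong)
next
 case (set S)
 have eq: "(\<Sum>x\<in>K om. indicator S x) = ennreal (real (card (K om Int S)))" if "om \<in> space M" for om
 proof -
  have "finite (K om)" using that K by (rule random_finiteD(1)[rotated])
  from sum_indicator_card[OF this, of S]
  have "ennreal (\<Sum>x\<in>K om. indicator S x) = ennreal (real (card (K om Int S)))" by simp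
  then show ?thesis by (simp add: sum_ennreal[symmetric] ennreal_indicator)
 qed
 have "(%om. ennreal (real (card (K om Int S)))) \<in> borel_measurable M"
  using random_finiteD(2)[OF K set] by simp
 also have "?this \<longleftrightarrow> (%om. \<Sum>x\<in>K om. indicator S x :: ennreal) \<in> borel_measurable M"
  by (rule measurable_cong) (simp add: eq)
 finally show ?case using set by (simp add: emeasure_mean_measure[OF K] eq cong: nn_integral_cong)
next
 case (mult u c)
 then have "(%om. c * (\<Sum>x\<in>K om. u x)) \<in> borel_measurable M" by (intro borel_measurable_times_ennreal) auto
 with mult show ?case by (simp add: nn_integral_cmult sum_distrib_left[symmetric])
next
 case (add u v)
 then have "(%om. (\<Sum>x\<in>K om. v x) + (\<Sum>x\<in>K om. u x)) \<in> borel_measurable M"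
  by (intro borel_measurable_add) auto
 with add show ?case by (simp add: nn_integral_add sum.distrib)
next
 case (seq U)
 have SUP: "(\<Sum>x\<in>K om. (SUP i. U i) x) = (SUP i. \<Sum>x\<in>K om. U i x)" for om
  using seq(3) by (simp add: SUP_apply incseq_def le_fun_def incseq_SucI ennreal_SUP_sum image_comp)
 have inc: "incseq (%i om. \<Sum>x\<in>K om. U i x)"
  using seq(3) by (auto simp: incseq_def le_fun_def intro!: sum_mono)
 have "(\<integral>\<^sup>+x. (SUP i. U i) x \<partial>mean_measure M K) = (SUP i. \<integral>\<^sup>+x. U i x \<partial>mean_measure M K)"
  using seq by (simp add: SUP_apply image_comp nn_integral_monotone_convergence_SUP)
 also have "... = (SUP i. \<integral>\<^sup>+om. (\<Sum>x\<in>K om. U i x) \<partial>M)" using seq by simp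
 also have "... = (\<integral>\<^sup>+om. (SUP i. \<Sum>x\<in>K om. U i x) \<partial>M)"
  using seq inc by (simp add: nn_integral_monotone_convergence_SUP)
 finally have "(\<integral>\<^sup>+x. (SUP i. U i) x \<partial>mean_measure M K) = (\<integral>\<^sup>+om. (\<Sum>x\<in>K om. (SUP i. U i) x) \<partial>M)"
  unfolding SUP .
 moreover have "(%om. SUP i. \<Sum>x\<in>K om. U i x) \<in> borel_measurable M"
  using seq by (intro borel_measurable_SUP) auto
 ultimately show ?case unfolding SUP seq(4) by blast
qed

lemma finite_measure_mean_measure:
 assumes K: "random_finite M K" and i: "integrable M (%om. real (card (K om)))"
 shows "finite_measure (mean_measure M K)"
proof
 show "emeasure (mean_measure M K) (space (mean_measure M K)) ~= \<infinity>"
  using emeasure_mean_measure[OF K, of UNIV] i by (auto simp: integrable_iff_bounded)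
qed

lemma integrable_sum_random_finite:
 fixes F :: "'b::topological_space => real"
 assumes K: "random_finite M K" and i: "integrable M (%om. real (card (K om)))"
  and F: "F \<in> borel_measurable borel" "!!x. \<bar>F x\<bar> <= C"
 shows "integrable M (%om. \<Sum>x\<in>K om. F x)"
proof (rule bochner_integrable_bound)
 show "integrable M (%om. C * real (card (K om)))" using i by simp
 show "(%om. \<Sum>x\<in>K om. F x) \<in> borel_measurable M" using K F(1) by (rule random_finite_sum)
 have "\<bar>\<Sum>x\<in>K om. F x\<bar> <= \<bar>C * real (card (K om))\<bar>" for om
 proof -
  have "\<bar>\<Sum>x\<in>K om. F x\<bar> <= (\<Sum>x\<in>K om. C)" using F(2) by (intro order_trans[OF sum_abs] sum_mono)
  then show ?thesis by (simp add: mult.commute)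
 qed
 then show "AE om in M. norm (\<Sum>x\<in>K om. F x) <= norm (C * real (card (K om)))" by simp
qed

text \<open>Campbell's formula for bounded signed functions; in the limit step the sums are
  dominated by C times the total count, which is integrable by assumption.\<close>

lemma integral_mean_measure:
 fixes F :: "'b::topological_space => real"
 assumes K: "random_finite M K" and i: "integrable M (%om. real (card (K om)))"
  and F: "F \<in> borel_measurable borel" "!!x. \<bar>F x\<bar> <= C"
 shows "(LINT x|mean_measure M K. F x) = (\<integral>om. (\<Sum>x\<in>K om. F x) \<partial>M)"
 using F
proof (induction F rule: bounded_borel_induct)
 interpret fm: finite_measure "mean_measure M K" using K i by (rule finite_measure_mean_measure)
 case (indicator S)
 have "(LINT x|mean_measure M K. indicator S x) = enn2real (\<integral>\<^sup>+om. ennreal (real (card (K om Int S))) \<partial>M)"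
  using indicator by (simp add: measure_def emeasure_mean_measure[OF K])
 also have "... = (\<integral>om. real (card (K om Int S)) \<partial>M)"
  using random_finiteD(2)[OF K indicator] by (intro integral_eq_nn_integral[symmetric]) auto
 also have "... = (\<integral>om. (\<Sum>x\<in>K om. indicator S x) \<partial>M)"
  by (rule bochner_integral_cong) (auto simp: sum_indicator_card random_finiteD[OF K])
 finally show ?case .
next
 interpret fm: finite_measure "mean_measure M K" using K i by (rule finite_measure_mean_measure)
 case (linear a b f g Cf Cg)
 have if': "integrable (mean_measure M K) f" "integrable (mean_measure M K) g"
  using linear by (auto intro: fm.integrable_const_bound[where B=Cf] fm.integrable_const_bound[where B=Cg])
 have is': "integrable M (%om. \<Sum>x\<in>K om. f x)" "integrable M (%om. \<Sum>x\<in>K om. g x)"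
  using linear by (auto intro: integrable_sum_random_finite[OF K i])
 show ?case using if' is' linear by (simp add: sum.distrib sum_distrib_left[symmetric])
next
 interpret fm: finite_measure "mean_measure M K" using K i by (rule finite_measure_mean_measure)
 case (lim f U C)
 have 1: "(%n. \<integral>x. U n x \<partial>mean_measure M K) \<longlonglongrightarrow> (LINT x|mean_measure M K. f x)"
  using lim by (intro integral_dominated_convergence[where w="%_. C"]) auto
 have 2: "(%n. \<integral>om. (\<Sum>x\<in>K om. U n x) \<partial>M) \<longlonglongrightarrow> (\<integral>om. (\<Sum>x\<in>K om. f x) \<partial>M)"
 proof (rule integral_dominated_convergence[where w="%om. C * real (card (K om))"])
  show "AE om in M. norm (\<Sum>x\<in>K om. U n x) <= C * real (card (K om))" for n
  proof (intro AE_I2)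
   fix om
   have "\<bar>\<Sum>x\<in>K om. U n x\<bar> <= (\<Sum>x\<in>K om. C)" using lim(3) by (intro order_trans[OF sum_abs] sum_mono)
   then show "norm (\<Sum>x\<in>K om. U n x) <= C * real (card (K om))" by (simp add: mult.commute)
  qed
 qed (use lim i in \<open>auto intro!: tendsto_sum random_finite_sum[OF K]\<close>)
 have "(%n. \<integral>x. U n x \<partial>mean_measure M K) \<longlonglongrightarrow> (\<integral>om. (\<Sum>x\<in>K om. f x) \<partial>M)"
  using 2 lim(5) by simp
 with 1 show ?case by (rule LIMSEQ_unique)
qed

section \<open>Sums over set partitions\<close>

lemma partition_on_card_le:
 assumes "partition_on A P" "finite A"
 shows "card P <= card A"
proof -
 have fin: "finite P" using finite_elements[OF assms(2,1)] .
 have finB: "finite B" if "B \<in> P" for B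
  using that assms partition_onD1[OF assms(1)] by (meson Union_upper finite_subset)
 have ne: "B ~= {}" if "B \<in> P" for B using that partition_onD3[OF assms(1)] by blast
 have "card P = (\<Sum>B\<in>P. 1)" by simp
 also have "... <= (\<Sum>B\<in>P. card B)"
  by (rule sum_mono) (use finB ne in \<open>simp add: Suc_le_eq card_gt_0_iff\<close>)
 also have "... = card (\<Union>P)"
  by (rule card_Union_disjoint[symmetric])
   (use partition_onD2[OF assms(1)] finB in \<open>auto simp: disjoint_def pairwise_def disjnt_def\<close>)
 also have "\<Union>P = A" using partition_onD1[OF assms(1)] by simp
 finally show ?thesis .
qed

text \<open>Grouping by the number of blocks merges the two nested sums into one sum over all
  partitions, which can then be evaluated by inserting one element at a time.\<close>

lemma fact_cumulant_eq_sum_partitions: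
 assumes "0 < k"
 shows "fact_cumulant M N k A =
   (\<Sum>P | partition_on {1..k} P. (-1) ^ (card P - 1) * fact (card P - 1) *
    (\<Prod>K\<in>P. enn2real (fact_moment M N K A)))"
proof -
 define h where "h P = (-1) ^ (card P - 1) * fact (card P - 1) *
    (\<Prod>K\<in>P. enn2real (fact_moment M N K A))" for P :: "nat set set"
 have fin: "finite {P. partition_on {1..k} P}" by (rule finitely_many_partition_on) simp
 have img: "card ` {P. partition_on {1..k} P} \<subseteq> {1..k}"
 proof clarify
  fix P assume P: "partition_on {1..k} P"
  have "finite P" by (rule finite_elements[OF _ P]) simp
  moreover have "P ~= {}" using partition_onD1[OF P] assms by auto
  moreover have "card P <= k" using partition_on_card_le[OF P] by simp
  ultimately show "card P \<in> {1..k}" by (simp add: Suc_le_eq card_gt_0_iff)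
 qed
 have "fact_cumulant M N k A = (\<Sum>j\<in>{1..k}. \<Sum>P\<in>{P\<in>{P. partition_on {1..k} P}. card P = j}. h P)"
  unfolding fact_cumulant_def h_def sum_distrib_left by (intro sum.cong refl) auto
 also have "... = (\<Sum>P | partition_on {1..k} P. h P)"
  by (rule sum.group[OF fin _ img]) simp
 finally show ?thesis by (simp add: h_def)
qed

lemma partition_on_insert_singleton:
 assumes "partition_on A Q" "a \<notin> A" shows "partition_on (insert a A) (insert {a} Q)"
proof (rule partition_onI)
 show "\<Union>(insert {a} Q) = insert a A" using partition_onD1[OF assms(1)] by auto
 show "disjnt p p'" if "p \<in> insert {a} Q" "p' \<in> insert {a} Q" "p ~= p'" for p p'
  using that assms(2) partition_onD1[OF assms(1)] partition_onD2[OF assms(1)]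
  by (auto simp: disjoint_def disjnt_def)
 show "{} \<notin> insert {a} Q" using partition_onD3[OF assms(1)] by auto
qed

lemma partition_on_insert_block:
 assumes "partition_on A Q" "a \<notin> A" "K \<in> Q"
 shows "partition_on (insert a A) (insert (insert a K) (Q - {K}))"
proof (rule partition_onI)
 show "\<Union>(insert (insert a K) (Q - {K})) = insert a A" using partition_onD1[OF assms(1)] assms(3) by auto
 have dis: "X Int Y = {}" if "X \<in> Q" "Y \<in> Q" "X ~= Y" for X Y
  using that partition_onD2[OF assms(1)] by (auto simp: disjoint_def)
 have aX: "a \<notin> X" if "X \<in> Q" for X using that assms(2) partition_onD1[OF assms(1)] by auto
 show "disjnt p p'" if p: "p \<in> insert (insert a K) (Q - {K})" "p' \<in> insert (insert a K) (Q - {K})" "p ~= p'" for p p'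
 proof (cases "p = insert a K")
  case True
  with p have p': "p' \<in> Q" "p' ~= K" by auto
  show ?thesis using True dis[OF assms(3) p'(1)] p'(2) aX[OF p'(1)] by (auto simp: disjnt_def)
 next
  case False
  with p have pq: "p \<in> Q" "p ~= K" by auto
  show ?thesis
  proof (cases "p' = insert a K")
   case True
   show ?thesis using True dis[OF pq(1) assms(3) pq(2)] aX[OF pq(1)] by (auto simp: disjnt_def)
  next
   case False
   with p have "p' \<in> Q" by auto
   from dis[OF pq(1) this p(3)] show ?thesis by (simp add: disjnt_def)
  qed
 qed
 show "{} \<notin> insert (insert a K) (Q - {K})" using partition_onD3[OF assms(1)] by auto
qed

text \<open>Deleting a from the block X that contains it either removes X altogether or leaves a
  nonempty block K of a partition of A.\<close>

lemma partition_on_insert_cases: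
 assumes P: "partition_on (insert a A) P" and a: "a \<notin> A"
 shows "(\<exists>Q. partition_on A Q & P = insert {a} Q) \<or>
  (\<exists>Q K. partition_on A Q & K \<in> Q & P = insert (insert a K) (Q - {K}))"
proof -
 have dis: "X Int Y = {}" if "X \<in> P" "Y \<in> P" "X ~= Y" for X Y
  using that partition_onD2[OF P] by (auto simp: disjoint_def)
 have U: "\<Union>P = insert a A" using partition_onD1[OF P] by simp
 then obtain X where X: "X \<in> P" "a \<in> X" by (metis UnionE insertI1)
 have other: "a \<notin> Y" if "Y \<in> P - {X}" for Y using dis[OF _ X(1), of Y] that X(2) by auto
 show ?thesis
 proof (cases "X = {a}")
  case True
  have "partition_on A (P - {X})"
  proof (rule partition_onI)
   show "\<Union>(P - {X}) = A"
   proof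
    show "\<Union>(P - {X}) \<subseteq> A"
    proof
     fix x assume "x \<in> \<Union>(P - {X})"
     then obtain Y where Y: "Y \<in> P - {X}" "x \<in> Y" by (rule UnionE)
     then have "x \<in> \<Union>P" by (intro UnionI[of Y]) simp_all
     moreover have "x ~= a" using other[OF Y(1)] Y(2) by auto
     ultimately show "x \<in> A" using U by simp
    qed
    show "A \<subseteq> \<Union>(P - {X})"
    proof
     fix x assume x: "x \<in> A"
     then obtain Y where "Y \<in> P" "x \<in> Y" using U by (metis UnionE insertI2)
     moreover have "Y ~= X" using True x a \<open>x \<in> Y\<close> by auto
     ultimately show "x \<in> \<Union>(P - {X})" by auto
    qed
   qed
   show "disjnt p p'" if "p \<in> P - {X}" "p' \<in> P - {X}" "p ~= p'" for p p'
    using dis that by (simp add: disjnt_def)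
   show "{} \<notin> P - {X}" using partition_onD3[OF P] by auto
  qed
  moreover have "P = insert {a} (P - {X})" using X True by auto
  ultimately show ?thesis by blast
 next
  case False
  define K where "K = X - {a}"
  have K: "insert a K = X" "a \<notin> K" "K ~= {}" using X False by (auto simp: K_def)
  \<comment> \<open>K is a nonempty proper part of X, hence not itself a block. Without this,
    removing K again from the smaller partition could delete an original block.\<close>
  have KP: "K \<notin> P"
  proof
   assume "K \<in> P"
   moreover have "K ~= X" using K X by auto
   ultimately have "K Int X = {}" using dis X by simp
   with K show False by (auto simp: K_def)
  qed
  have "partition_on A (insert K (P - {X}))"
  proof (rule partition_onI)
   show "\<Union>(insert K (P - {X})) = A"
   proof
    show "\<Union>(insert K (P - {X})) \<subseteq> A"
    proof
     fix x assume "x \<in> \<Union>(insert K (P - {X}))"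
     then obtain Y where Y: "Y \<in> insert K (P - {X})" "x \<in> Y" by (rule UnionE)
     have "x \<in> \<Union>P & x ~= a"
     proof (cases "Y = K")
      case True
      then show ?thesis using Y(2) X(1) by (intro conjI UnionI[of X]) (auto simp: K_def)
     next
      case False
      then have Y': "Y \<in> P - {X}" using Y(1) by simp
      then show ?thesis using Y(2) other[OF Y'] by (intro conjI UnionI[of Y]) auto
     qed
     then show "x \<in> A" using U by auto
    qed
    show "A \<subseteq> \<Union>(insert K (P - {X}))"
    proof
     fix x assume x: "x \<in> A"
     then obtain Y where Y: "Y \<in> P" "x \<in> Y" using U by (metis UnionE insertI2)
     show "x \<in> \<Union>(insert K (P - {X}))"
     proof (cases "Y = X")
      case True with Y x a show ?thesis by (auto simp: K_def)
     next
      case False with Y show ?thesis by auto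
     qed
    qed
   qed
   show "disjnt p p'" if p: "p \<in> insert K (P - {X})" "p' \<in> insert K (P - {X})" "p ~= p'" for p p'
   proof (cases "p = K")
    case True
    with p have "p' \<in> P" "p' ~= X" by auto
    from dis[OF X(1) this(1)] this(2) show ?thesis using True by (auto simp: disjnt_def K_def)
   next
    case False
    with p have pq: "p \<in> P" "p ~= X" by auto
    show ?thesis
    proof (cases "p' = K")
     case True
     from dis[OF X(1) pq(1)] pq(2) show ?thesis using True by (auto simp: disjnt_def K_def)
    next
     case False
     with p have "p' \<in> P" by auto
     from dis[OF pq(1) this p(3)] show ?thesis by (simp add: disjnt_def)
    qed
   qed
   show "{} \<notin> insert K (P - {X})" using partition_onD3[OF P] K by auto
  qed
  moreover have "P = insert (insert a K) (insert K (P - {X}) - {K})" using X K KP by auto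
  ultimately show ?thesis by blast
 qed
qed

text \<open>The recursion for set partitions: a forms a block of its own or joins one of the old
  blocks. Both constructions are injective and their images are disjoint, since a occurs in exactly
  one block, which is {a} only in the first case.\<close>

lemma sum_partitions_insert:
 fixes ph :: "'b set set => real"
 assumes A: "finite A" and a: "a \<notin> A"
 shows "(\<Sum>P | partition_on (insert a A) P. ph P) =
  (\<Sum>Q | partition_on A Q. ph (insert {a} Q) + (\<Sum>K\<in>Q. ph (insert (insert a K) (Q - {K}))))"
proof -
 define PA where "PA = {Q. partition_on A Q}"
 have finPA: "finite PA" unfolding PA_def by (rule finitely_many_partition_on[OF A])
 have finQ: "finite Q" if "Q \<in> PA" for Q using that finite_elements[OF A] by (auto simp: PA_def)
 have aK: "a \<notin> K" if "Q \<in> PA" "K \<in> Q" for Q K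
  using that a by (auto simp: PA_def dest!: partition_onD1)
 have ne: "K ~= {}" if "Q \<in> PA" "K \<in> Q" for Q K
  using that by (auto simp: PA_def dest: partition_onD3)
 define f1 where "f1 Q = insert {a} Q" for Q
 define f2 where "f2 p = insert (insert a (snd p)) (fst p - {snd p})" for p :: "'b set set \<times> 'b set"
 have eq: "{P. partition_on (insert a A) P} = f1 ` PA Un f2 ` (SIGMA Q:PA. Q)"
 proof (intro equalityI subsetI)
  fix P assume "P \<in> {P. partition_on (insert a A) P}"
  then have "partition_on (insert a A) P" by simp
  from partition_on_insert_cases[OF this a] show "P \<in> f1 ` PA Un f2 ` (SIGMA Q:PA. Q)"
  proof (elim disjE exE conjE)
   fix Q assume "partition_on A Q" "P = insert {a} Q"
   then show ?thesis by (intro UnI1 image_eqI[of _ _ Q]) (simp_all add: PA_def f1_def)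
  next
   fix Q K assume "partition_on A Q" "K \<in> Q" "P = insert (insert a K) (Q - {K})"
   then show ?thesis by (intro UnI2 image_eqI[of _ _ "(Q, K)"]) (simp_all add: PA_def f2_def)
  qed
 next
  fix P assume "P \<in> f1 ` PA Un f2 ` (SIGMA Q:PA. Q)"
  then show "P \<in> {P. partition_on (insert a A) P}"
  proof (elim UnE imageE)
   fix Q assume "P = f1 Q" "Q \<in> PA"
   then show ?thesis using partition_on_insert_singleton[OF _ a] by (simp add: PA_def f1_def)
  next
   fix p assume "P = f2 p" "p \<in> (SIGMA Q:PA. Q)"
   then show ?thesis using partition_on_insert_block[OF _ a] by (cases p) (simp add: PA_def f2_def)
  qed
 qed
 have inj1: "inj_on f1 PA"
 proof (rule inj_onI)
  fix Q Q' assume q: "Q \<in> PA" "Q' \<in> PA" "f1 Q = f1 Q'"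
  have "{a} \<notin> Q" "{a} \<notin> Q'" using aK[OF q(1), of "{a}"] aK[OF q(2), of "{a}"] by auto
  from insert_ident[OF this] q(3) show "Q = Q'" unfolding f1_def by simp
 qed
 have inj2: "inj_on f2 (SIGMA Q:PA. Q)"
 proof (rule inj_onI)
  fix p p' assume p: "p \<in> (SIGMA Q:PA. Q)" "p' \<in> (SIGMA Q:PA. Q)" "f2 p = f2 p'"
  obtain Q K Q' K' where pp: "p = (Q, K)" "p' = (Q', K')" by (cases p, cases p') auto
  have q: "Q \<in> PA" "K \<in> Q" "Q' \<in> PA" "K' \<in> Q'" using p(1,2) unfolding pp by simp_all
  have e: "insert (insert a K) (Q - {K}) = insert (insert a K') (Q' - {K'})"
   using p(3) by (simp add: f2_def pp)
  have n: "insert a K \<notin> Q'" "insert a K' \<notin> Q" "insert a K \<notin> Q" "insert a K' \<notin> Q'"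
   using aK[OF q(1), of "insert a K"] aK[OF q(1), of "insert a K'"]
    aK[OF q(3), of "insert a K"] aK[OF q(3), of "insert a K'"] by auto
  have "insert a K \<in> insert (insert a K') (Q' - {K'})" using insertI1[of "insert a K" "Q - {K}"] unfolding e .
  with n have ia: "insert a K = insert a K'" by simp
  have KK: "K = K'" using ia insert_ident[OF aK[OF q(1,2)] aK[OF q(3,4)]] by simp
  have "insert a K \<notin> Q - {K}" "insert a K \<notin> Q' - {K}" using n by simp_all
  from insert_ident[OF this] e KK have QK: "Q - {K} = Q' - {K}" by simp
  have "Q = insert K (Q - {K})" "Q' = insert K (Q' - {K})" using q KK by auto
  with QK have "Q = Q'" by simp
  with KK show "p = p'" unfolding pp by simp
 qed
 have disj: "f1 ` PA Int f2 ` (SIGMA Q:PA. Q) = {}"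
 proof -
  have False if q: "Q \<in> PA" "Q' \<in> PA" "K \<in> Q'" "insert {a} Q = insert (insert a K) (Q' - {K})" for Q Q' K
  proof -
   have "{a} \<in> insert (insert a K) (Q' - {K})" using q(4) by blast
   moreover have "{a} ~= insert a K" using ne[OF q(2,3)] aK[OF q(2,3)] by blast
   ultimately have "{a} \<in> Q'" by blast
   with aK[OF q(2)] show False by blast
  qed
  then show ?thesis by (auto simp: f1_def f2_def)
 qed
 have "(\<Sum>P | partition_on (insert a A) P. ph P) = sum ph (f1 ` PA) + sum ph (f2 ` (SIGMA Q:PA. Q))"
  unfolding eq by (rule sum.union_disjoint) (use finPA finQ disj in auto)
 also have "... = (\<Sum>Q\<in>PA. ph (insert {a} Q)) + (\<Sum>p\<in>(SIGMA Q:PA. Q). ph (f2 p))"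
  unfolding sum.reindex[OF inj1] sum.reindex[OF inj2] by (simp add: f1_def)
 also have "(\<Sum>p\<in>(SIGMA Q:PA. Q). ph (f2 p)) = (\<Sum>Q\<in>PA. \<Sum>K\<in>Q. ph (f2 (Q, K)))"
  using finPA finQ by (subst sum.Sigma) (auto simp: case_prod_unfold)
 finally show ?thesis by (simp add: sum.distrib PA_def f2_def)
qed

lemma sum_partitions_1: "(\<Sum>P | partition_on {a} P. ph P) = (ph {{a}} :: real)"
proof -
 have "{P. partition_on {} P} = {{} :: 'a set set}" by (auto simp: partition_on_empty)
 then show ?thesis using sum_partitions_insert[of "{}" a ph] by simp
qed

lemma sum_partitions_2:
 assumes "a ~= b"
 shows "(\<Sum>P | partition_on {a, b} P. ph P) = (ph {{a}, {b}} + ph {{a, b}} :: real)"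
 using assms by (subst sum_partitions_insert) (simp_all add: sum_partitions_1)

lemma sum_partitions_3:
 assumes "a ~= b" "a ~= c" "b ~= c"
 shows "(\<Sum>P | partition_on {a, b, c} P. ph P) =
  (ph {{a}, {b}, {c}} + ph {{a, b}, {c}} + ph {{a, c}, {b}} + ph {{a}, {b, c}} + ph {{a, b, c}} :: real)"
proof -
 have "{{b}, {c}} - {{b}} = {{c}}" "{{b}, {c}} - {{c}} = {{b}}" using assms by auto
 then show ?thesis using assms by (subst sum_partitions_insert) (simp_all add: sum_partitions_2)
qed

text \<open>The fifteen partitions of a four-element set, obtained from the five partitions of three
  elements; distinctness of the blocks must be known before the inner sums over blocks can be
  unfolded.\<close>

lemma sum_partitions_4:
 assumes "a ~= b" "a ~= c" "a ~= d" "b ~= c" "b ~= d" "c ~= d"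
 shows "(\<Sum>P | partition_on {a, b, c, d} P. ph P) =
  (ph {{a}, {b}, {c}, {d}} + ph {{a, b}, {c}, {d}} + ph {{a, c}, {b}, {d}} + ph {{a, d}, {b}, {c}}
  + ph {{a}, {b, c}, {d}} + ph {{a, b, c}, {d}} + ph {{a, d}, {b, c}}
  + ph {{a}, {b, d}, {c}} + ph {{a, b, d}, {c}} + ph {{a, c}, {b, d}}
  + ph {{a}, {b}, {c, d}} + ph {{a, b}, {c, d}} + ph {{a, c, d}, {b}}
  + ph {{a}, {b, c, d}} + ph {{a, b, c, d}} :: real)"
proof -
 have ne: "{b} ~= {c}" "{b} ~= {d}" "{c} ~= {d}" "{b, c} ~= {d}" "{b, d} ~= {c}" "{b} ~= {c, d}" using assms by auto
 have s3: "(\<Sum>K\<in>{{b}, {c}, {d}}. g K) = g {b} + (g {c} + g {d} :: real)" for g using ne by simp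
 have s2: "(\<Sum>K\<in>{{b, c}, {d}}. g K) = g {b, c} + (g {d} :: real)"
  "(\<Sum>K\<in>{{b, d}, {c}}. g K) = g {b, d} + (g {c} :: real)"
  "(\<Sum>K\<in>{{b}, {c, d}}. g K) = g {b} + (g {c, d} :: real)" for g using ne by simp_all
 have s1: "(\<Sum>K\<in>{{b, c, d}}. g K) = (g {b, c, d} :: real)" for g by simp
 have d: "{{b}, {c}, {d}} - {{b}} = {{c}, {d}}" "{{b}, {c}, {d}} - {{c}} = {{b}, {d}}" "{{b}, {c}, {d}} - {{d}} = {{b}, {c}}"
  "{{b, c}, {d}} - {{b, c}} = {{d}}" "{{b, c}, {d}} - {{d}} = {{b, c}}"
  "{{b, d}, {c}} - {{b, d}} = {{c}}" "{{b, d}, {c}} - {{c}} = {{b, d}}"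
  "{{b}, {c, d}} - {{b}} = {{c, d}}" "{{b}, {c, d}} - {{c, d}} = {{b}}"
  "{{b, c, d}} - {{b, c, d}} = {}"
  using ne by blast+
 have i: "{{a, c}, {b}, {d}} = {{a, c}, {b}, {d}}" by simp
 have "(\<Sum>P | partition_on {a, b, c, d} P. ph P) =
  (\<Sum>Q | partition_on {b, c, d} Q. ph (insert {a} Q) + (\<Sum>K\<in>Q. ph (insert (insert a K) (Q - {K}))))"
  by (rule sum_partitions_insert) (use assms in auto)
 also have "... = (ph {{a}, {b}, {c}, {d}} + ph {{a, b}, {c}, {d}} + ph {{a, c}, {b}, {d}} + ph {{a, d}, {b}, {c}}
  + ph {{a}, {b, c}, {d}} + ph {{a, b, c}, {d}} + ph {{a, d}, {b, c}}
  + ph {{a}, {b, d}, {c}} + ph {{a, b, d}, {c}} + ph {{a, c}, {b, d}}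
  + ph {{a}, {b}, {c, d}} + ph {{a, b}, {c, d}} + ph {{a, c, d}, {b}}
  + ph {{a}, {b, c, d}} + ph {{a, b, c, d}})"
  unfolding sum_partitions_3[OF assms(4-6)] s3 s2 s1 d by simp
 finally show ?thesis .
qed

lemma fact_cumulant_2:
 "fact_cumulant M N 2 A = (let m = %K. enn2real (fact_moment M N K A) in m {1, 2} - m {1} * m {2})"
proof -
 have s: "{1..2::nat} = {1, 2}" by auto
 have p: "(1::nat) ~= 2" by simp
 show ?thesis
  by (subst fact_cumulant_eq_sum_partitions, simp, unfold s sum_partitions_2[OF p]) (simp add: Let_def)
qed

lemma fact_cumulant_3:
 "fact_cumulant M N 3 A = (let m = %K. enn2real (fact_moment M N K A) in
   m {1, 2, 3} - m {1, 2} * m {3} - m {1, 3} * m {2} - m {2, 3} * m {1} + 2 * (m {1} * m {2} * m {3}))"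
proof -
 have s: "{1..3::nat} = {1, 2, 3}" by auto
 have ne: "{1, 2} ~= {3::nat}" "{1, 3} ~= {2::nat}" "{1} ~= {2, 3::nat}" by auto
 have p: "(1::nat) ~= 2" "(1::nat) ~= 3" "(2::nat) ~= 3" by simp_all
 show ?thesis
  by (subst fact_cumulant_eq_sum_partitions, simp, unfold s sum_partitions_3[OF p])
   (use ne in \<open>simp add: Let_def numeral_2_eq_2[symmetric] fact_2\<close>)
qed

text \<open>The coefficients 1, -1, 2, -6 are (-1)^(j-1) (j-1)! for partitions into j = 1, 2, 3, 4
  blocks.\<close>

lemma fact_cumulant_4:
 "fact_cumulant M N 4 A = (let m = %K. enn2real (fact_moment M N K A) in
   m {1, 2, 3, 4}
   - m {1, 2, 3} * m {4} - m {1, 2, 4} * m {3} - m {1, 3, 4} * m {2} - m {2, 3, 4} * m {1}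
   - m {1, 2} * m {3, 4} - m {1, 3} * m {2, 4} - m {1, 4} * m {2, 3}
   + 2 * (m {1, 2} * (m {3} * m {4})) + 2 * (m {1, 3} * (m {2} * m {4})) + 2 * (m {1, 4} * (m {2} * m {3}))
   + 2 * (m {2, 3} * (m {1} * m {4})) + 2 * (m {2, 4} * (m {1} * m {3})) + 2 * (m {3, 4} * (m {1} * m {2}))
   - 6 * (m {1} * (m {2} * (m {3} * m {4}))))"
proof -
 have s: "{1..4::nat} = {1, 2, 3, 4}" by auto
 have ne: "{1, 2} ~= {3::nat}" "{1, 2} ~= {4::nat}" "{1, 3} ~= {2::nat}" "{1, 3} ~= {4::nat}" "{1, 4} ~= {2::nat}" "{1, 4} ~= {3::nat}"
  "{1} ~= {2, 3::nat}" "{2, 3} ~= {4::nat}" "{1} ~= {2, 4::nat}" "{2, 4} ~= {3::nat}" "{1} ~= {3, 4::nat}" "{2} ~= {3, 4::nat}"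
  "{1, 2, 3} ~= {4::nat}" "{1, 2, 4} ~= {3::nat}" "{1, 3, 4} ~= {2::nat}" "{1} ~= {2, 3, 4::nat}"
  "{1, 4} ~= {2, 3::nat}" "{1, 3} ~= {2, 4::nat}" "{1, 2} ~= {3, 4::nat}"
  by auto
 have f3: "fact 3 = (6::real)" by (simp add: fact_numeral)
 have p: "(1::nat) ~= 2" "(1::nat) ~= 3" "(1::nat) ~= 4" "(2::nat) ~= 3" "(2::nat) ~= 4" "(3::nat) ~= 4"
  by simp_all
 show ?thesis
  by (subst fact_cumulant_eq_sum_partitions, simp, unfold s sum_partitions_4[OF p])
   (use ne in \<open>simp add: Let_def numeral_2_eq_2[symmetric] numeral_3_eq_3[symmetric] fact_2 f3\<close>)
qed

section \<open>Factorial moment measures\<close>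

definition tuples2 :: "'a set => ('a \<times> 'a) set" where
 "tuples2 S = {(x, y). x \<in> S & y \<in> S & x ~= y}"

definition tuples3 :: "'a set => ('a \<times> 'a \<times> 'a) set" where
 "tuples3 S = {(x, y, z). x \<in> S & y \<in> S & z \<in> S & x ~= y & x ~= z & y ~= z}"

definition tuples4 :: "'a set => ('a \<times> 'a \<times> 'a \<times> 'a) set" where
 "tuples4 S = {(x, y, z, u). x \<in> S & y \<in> S & z \<in> S & u \<in> S \<and>
   x ~= y & x ~= z & y ~= z & x ~= u & y ~= u & z ~= u}"

lemma tuples2_le: "finite S ==> finite (tuples2 S) & card (tuples2 S) <= card S ^ 2"
proof -
 assume f: "finite S"
 have sub: "tuples2 S \<subseteq> S \<times> S" by (auto simp: tuples2_def)
 have fin: "finite (S \<times> S)" using f by simp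
 from finite_subset[OF sub fin] card_mono[OF fin sub] show ?thesis
  by (simp add: card_cartesian_product power2_eq_square)
qed

lemma tuples3_le: "finite S ==> finite (tuples3 S) & card (tuples3 S) <= card S ^ 3"
proof -
 assume f: "finite S"
 have sub: "tuples3 S \<subseteq> S \<times> S \<times> S" by (auto simp: tuples3_def)
 have fin: "finite (S \<times> S \<times> S)" using f by simp
 from finite_subset[OF sub fin] card_mono[OF fin sub] show ?thesis
  by (simp add: card_cartesian_product power3_eq_cube)
qed

lemma tuples4_le: "finite S ==> finite (tuples4 S) & card (tuples4 S) <= card S ^ 4"
proof -
 assume f: "finite S"
 have sub: "tuples4 S \<subseteq> S \<times> S \<times> S \<times> S" by (auto simp: tuples4_def)
 have fin: "finite (S \<times> S \<times> S \<times> S)" using f by simp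
 from finite_subset[OF sub fin] card_mono[OF fin sub] show ?thesis
  by (simp add: card_cartesian_product power4_eq_xxxx)
qed

lemma card_tuples4:
 assumes f: "finite S"
 shows "card (tuples4 S) = card S * ((card S - 1) * ((card S - 2) * (card S - 3)))"
proof -
 have eq: "tuples4 S = (SIGMA x:S. SIGMA y:S - {x}. SIGMA z:S - {x, y}. S - {x, y, z})"
  by (auto simp: tuples4_def)
 have c3: "card (S - {x, y, z}) = card S - 3" if "x \<in> S" "y \<in> S - {x}" "z \<in> S - {x, y}" for x y z
  using that f by (subst card_Diff_subset) auto
 have c2: "card (S - {x, y}) = card S - 2" if "x \<in> S" "y \<in> S - {x}" for x y
  using that f by (subst card_Diff_subset) auto
 have c1: "card (S - {x}) = card S - 1" if "x \<in> S" for x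
  using that f by (subst card_Diff_subset) auto
 have a: "card (SIGMA z:S - {x, y}. S - {x, y, z}) = (card S - 2) * (card S - 3)" if "x \<in> S" "y \<in> S - {x}" for x y
 proof -
  have "card (SIGMA z:S - {x, y}. S - {x, y, z}) = (\<Sum>z\<in>S - {x, y}. card (S - {x, y, z}))"
   using f by (intro card_SigmaI) auto
  also have "... = (\<Sum>z\<in>S - {x, y}. card S - 3)" by (intro sum.cong refl c3 that)
  finally show ?thesis using c2[OF that] by simp
 qed
 have b: "card (SIGMA y:S - {x}. SIGMA z:S - {x, y}. S - {x, y, z}) = (card S - 1) * ((card S - 2) * (card S - 3))"
  if "x \<in> S" for x
 proof -
  have "card (SIGMA y:S - {x}. SIGMA z:S - {x, y}. S - {x, y, z})
    = (\<Sum>y\<in>S - {x}. card (SIGMA z:S - {x, y}. S - {x, y, z}))"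
   using f by (intro card_SigmaI) auto
  also have "... = (\<Sum>y\<in>S - {x}. (card S - 2) * (card S - 3))" by (intro sum.cong refl a that)
  finally show ?thesis using c1[OF that] by simp
 qed
 have "card (tuples4 S) = (\<Sum>x\<in>S. card (SIGMA y:S - {x}. SIGMA z:S - {x, y}. S - {x, y, z}))"
  unfolding eq using f by (intro card_SigmaI) auto
 also have "... = (\<Sum>x\<in>S. (card S - 1) * ((card S - 2) * (card S - 3)))" by (intro sum.cong refl b)
 finally show ?thesis by simp
qed

text \<open>Up to three points the power is at most 3^4 = 81. For n >= 4 the factors n-1, n-2, n-3
  are at least 3n/4, n/2, n/4, so the falling factorial is at least 3 n^4 / 32, and 32/3 < 11. This
  transfers bounds from factorial moments to ordinary ones.\<close>

lemma card_pow4_le: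
 assumes "finite S"
 shows "real (card S) ^ 4 <= 81 + 11 * real (card (tuples4 S))"
proof (cases "card S <= 3")
 case True
 then have "real (card S) ^ 4 <= 3 ^ 4" by (intro power_mono) auto
 then show ?thesis by simp
next
 case False
 define n where "n = real (card S)"
 have n: "4 <= n" using False by (simp add: n_def)
 have t: "real (card (tuples4 S)) = n * ((n - 1) * ((n - 2) * (n - 3)))"
  unfolding card_tuples4[OF assms] n_def using False by (simp add: of_nat_diff)
 have "(n / 4) * 1 <= (n - 3) * 1" using n by simp
 have "(3 * n / 4) * ((n / 2) * (n / 4)) <= (n - 1) * ((n - 2) * (n - 3))"
  using n by (intro mult_mono) auto
 then have "n * ((3 * n / 4) * ((n / 2) * (n / 4))) <= n * ((n - 1) * ((n - 2) * (n - 3)))"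
  using n by (intro mult_left_mono) auto
 then have "3 / 32 * n ^ 4 <= n * ((n - 1) * ((n - 2) * (n - 3)))"
  by (simp add: power4_eq_xxxx)
 moreover have "0 <= n ^ 4" by simp
 ultimately have "n ^ 4 <= 11 * (n * ((n - 1) * ((n - 2) * (n - 3))))" by linarith
 then show ?thesis by (simp add: t n_def[symmetric])
qed

text \<open>For each order from one to four, injective families indexed by K correspond to tuples of
  distinct points. The window W around all sides makes these sets finite, so the counting measure
  becomes a cardinality.\<close>

lemma emeasure_inj_PiE_1:
 assumes "A a \<subseteq> W" "finite (S Int W)"
 shows "emeasure (count_space UNIV) {f \<in> (\<Pi>\<^sub>E l\<in>{a}. A l Int S). inj_on f {a}}
  = ennreal (real (card ((S Int W) Int A a)))"
proof -
 have bij: "bij_betw (%f. f a) {f \<in> (\<Pi>\<^sub>E l\<in>{a}. A l Int S). inj_on f {a}} ((S Int W) Int A a)"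
  by (rule bij_betw_byWitness[where f'="%x. \<lambda>l\<in>{a}. x"])
   (use assms in \<open>auto simp: PiE_def extensional_def restrict_def fun_eq_iff\<close>)
 have "finite ((S Int W) Int A a)" using assms by blast
 then have "finite {f \<in> (\<Pi>\<^sub>E l\<in>{a}. A l Int S). inj_on f {a}}" using bij_betw_finite[OF bij] by simp
 then show ?thesis using bij_betw_same_card[OF bij] by (simp add: ennreal_of_nat_eq_real_of_nat)
qed

lemma emeasure_inj_PiE_2:
 assumes ab: "a ~= b" and W: "A a \<subseteq> W" "A b \<subseteq> W" "finite (S Int W)"
 shows "emeasure (count_space UNIV) {f \<in> (\<Pi>\<^sub>E l\<in>{a, b}. A l Int S). inj_on f {a, b}}
  = ennreal (real (card (tuples2 (S Int W) Int A a \<times> A b)))"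
proof -
 have bij: "bij_betw (%f. (f a, f b)) {f \<in> (\<Pi>\<^sub>E l\<in>{a, b}. A l Int S). inj_on f {a, b}} (tuples2 (S Int W) Int A a \<times> A b)"
  by (rule bij_betw_byWitness[where f'="%(x, y). \<lambda>l\<in>{a, b}. if l = a then x else y"])
   (use ab W(1,2) in \<open>auto simp: PiE_def extensional_def restrict_def fun_eq_iff tuples2_def\<close>)
 have "finite (tuples2 (S Int W) Int A a \<times> A b)" using tuples2_le[OF W(3)] by blast
 then have "finite {f \<in> (\<Pi>\<^sub>E l\<in>{a, b}. A l Int S). inj_on f {a, b}}" using bij_betw_finite[OF bij] by simp
 then show ?thesis using bij_betw_same_card[OF bij] by (simp add: ennreal_of_nat_eq_real_of_nat)
qed

lemma emeasure_inj_PiE_3: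
 assumes ab: "a ~= b" "a ~= c" "b ~= c" and W: "A a \<subseteq> W" "A b \<subseteq> W" "A c \<subseteq> W" "finite (S Int W)"
 shows "emeasure (count_space UNIV) {f \<in> (\<Pi>\<^sub>E l\<in>{a, b, c}. A l Int S). inj_on f {a, b, c}}
  = ennreal (real (card (tuples3 (S Int W) Int A a \<times> A b \<times> A c)))"
proof -
 have bij: "bij_betw (%f. (f a, f b, f c)) {f \<in> (\<Pi>\<^sub>E l\<in>{a, b, c}. A l Int S). inj_on f {a, b, c}}
   (tuples3 (S Int W) Int A a \<times> A b \<times> A c)"
  by (rule bij_betw_byWitness[where f'="%(x, y, z). \<lambda>l\<in>{a, b, c}. if l = a then x else if l = b then y else z"])
   (use ab W(1-3) in \<open>auto simp: PiE_def extensional_def restrict_def fun_eq_iff tuples3_def\<close>)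
 have "finite (tuples3 (S Int W) Int A a \<times> A b \<times> A c)" using tuples3_le[OF W(4)] by blast
 then have "finite {f \<in> (\<Pi>\<^sub>E l\<in>{a, b, c}. A l Int S). inj_on f {a, b, c}}" using bij_betw_finite[OF bij] by simp
 then show ?thesis using bij_betw_same_card[OF bij] by (simp add: ennreal_of_nat_eq_real_of_nat)
qed

lemma emeasure_inj_PiE_4:
 assumes ab: "a ~= b" "a ~= c" "b ~= c" "a ~= d" "b ~= d" "c ~= d"
  and W: "A a \<subseteq> W" "A b \<subseteq> W" "A c \<subseteq> W" "A d \<subseteq> W" "finite (S Int W)"
 shows "emeasure (count_space UNIV) {f \<in> (\<Pi>\<^sub>E l\<in>{a, b, c, d}. A l Int S). inj_on f {a, b, c, d}}
  = ennreal (real (card (tuples4 (S Int W) Int A a \<times> A b \<times> A c \<times> A d)))"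
proof -
 have bij: "bij_betw (%f. (f a, f b, f c, f d)) {f \<in> (\<Pi>\<^sub>E l\<in>{a, b, c, d}. A l Int S). inj_on f {a, b, c, d}}
   (tuples4 (S Int W) Int A a \<times> A b \<times> A c \<times> A d)"
  by (rule bij_betw_byWitness[where f'="%(x, y, z, u). \<lambda>l\<in>{a, b, c, d}. if l = a then x else if l = b then y else if l = c then z else u"])
   (use ab W(1-4) in \<open>auto simp: PiE_def extensional_def restrict_def fun_eq_iff tuples4_def\<close>)
 have "finite (tuples4 (S Int W) Int A a \<times> A b \<times> A c \<times> A d)" using tuples4_le[OF W(5)] by blast
 then have "finite {f \<in> (\<Pi>\<^sub>E l\<in>{a, b, c, d}. A l Int S). inj_on f {a, b, c, d}}" using bij_betw_finite[OF bij] by simp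
 then show ?thesis using bij_betw_same_card[OF bij] by (simp add: ennreal_of_nat_eq_real_of_nat)
qed

section \<open>The unit cube and translations of Lebesgue measure\<close>

lemma unit_cube_box: "box 0 One \<subseteq> unit_cube" "unit_cube \<subseteq> cbox 0 (One :: 'a::euclidean_space)"
 by (auto simp: unit_cube_def box_def cbox_def intro: less_imp_le)

lemma unit_cube_borel [measurable]: "unit_cube \<in> sets (borel :: 'a::euclidean_space measure)"
proof -
 have "unit_cube = (\<Inter>b\<in>Basis. {x::'a. 0 <= x \<bullet> b} Int {x. x \<bullet> b < 1})"
  by (auto simp: unit_cube_def)
 also have "... \<in> sets borel" by (intro sets.finite_INT sets.Int) auto
 finally show ?thesis .
qed

lemma bounded_unit_cube: "bounded (unit_cube :: 'a::euclidean_space set)"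
 using bounded_subset[OF bounded_cbox unit_cube_box(2)] .

lemma emeasure_unit_cube: "emeasure lborel (unit_cube :: 'a::euclidean_space set) = 1"
proof (rule antisym)
 have "emeasure lborel (unit_cube :: 'a set) <= emeasure lborel (cbox 0 One :: 'a set)"
  by (intro emeasure_mono unit_cube_box) simp
 also have "... = 1" by (subst emeasure_lborel_cbox) simp_all
 finally show "emeasure lborel (unit_cube :: 'a set) <= 1" .
 have "1 = emeasure lborel (box 0 One :: 'a set)" by (subst emeasure_lborel_box) simp_all
 also have "... <= emeasure lborel (unit_cube :: 'a set)" by (intro emeasure_mono unit_cube_box) simp
 finally show "1 <= emeasure lborel (unit_cube :: 'a set)" .
qed

lemma bounded_translate: "bounded (A :: 'a::real_normed_vector set) ==> bounded ((%y. y + x) ` A)"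
 using bounded_translation[of A x] by (simp add: add.commute)

lemma image_add_eq_vimage: "(%y. y + x) ` A = (%y. y - x) -` (A :: 'a::ab_group_add set)"
 by (auto simp: image_iff) (metis diff_add_cancel)

lemma borel_translate: "A \<in> sets borel ==> (%y. y + x) ` A \<in> sets (borel :: 'a::euclidean_space measure)"
 unfolding image_add_eq_vimage by (rule measurable_sets_borel[of _ borel]) simp_all

lemma nn_integral_lborel_plus:
 fixes f :: "'a::euclidean_space => ennreal"
 assumes [measurable]: "f \<in> borel_measurable borel"
 shows "(\<integral>\<^sup>+y. f (x + y) \<partial>lborel) = (\<integral>\<^sup>+y. f y \<partial>lborel)"
proof -
 have "(\<integral>\<^sup>+y. f y \<partial>lborel) = (\<integral>\<^sup>+y. f y \<partial>distr lborel borel ((+) x))"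
  by (simp only: lborel_distr_plus)
 also have "... = (\<integral>\<^sup>+y. f (x + y) \<partial>lborel)" by (rule nn_integral_distr) simp_all
 finally show ?thesis by simp
qed

lemma lborel_distr_minus: "distr lborel borel (%y. x - y) = (lborel :: 'a::euclidean_space measure)"
 using lborel_affine[of "-1" x] by (simp add: density_1)

lemma nn_integral_lborel_minus:
 fixes f :: "'a::euclidean_space => ennreal"
 assumes [measurable]: "f \<in> borel_measurable borel"
 shows "(\<integral>\<^sup>+y. f (x - y) \<partial>lborel) = (\<integral>\<^sup>+y. f y \<partial>lborel)"
proof -
 have "(\<integral>\<^sup>+y. f y \<partial>lborel) = (\<integral>\<^sup>+y. f y \<partial>distr lborel borel (%y. x - y))"
  by (simp only: lborel_distr_minus)
 also have "... = (\<integral>\<^sup>+y. f (x - y) \<partial>lborel)" by (rule nn_integral_distr) simp_all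
 finally show ?thesis by simp
qed

text \<open>Each of these maps puts the coordinates of a product over the blocks of a partition back
  into their original order, so that all terms of a cumulant become measures on one and the same
  space. For instance \<open>arrange3\<close> belongs to the blocks {1, 3} and {2, 4}.\<close>

abbreviation "arrange1 \<equiv> %p. (fst (fst p), fst (snd (fst p)), snd (snd (fst p)), snd p)"
abbreviation "arrange2 \<equiv> %p. (fst (fst p), fst (snd (fst p)), snd p, snd (snd (fst p)))"
abbreviation "arrange3 \<equiv> %p. (fst (fst p), fst (snd p), snd (fst p), snd (snd p))"
abbreviation "arrange4 \<equiv> %p. (fst (fst p), fst (snd p), snd (snd p), snd (fst p))"
abbreviation "arrange5 \<equiv> %p. (fst (fst p), snd (fst p), fst (snd p), snd (snd p))"
abbreviation "arrange6 \<equiv> %p. (fst (fst p), snd (fst p), snd p)"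
abbreviation "arrange7 \<equiv> %p. (fst (fst p), snd p, fst (snd (fst p)), snd (snd (fst p)))"
abbreviation "arrange8 \<equiv> %p. (fst (fst p), snd p, snd (fst p))"
abbreviation "arrange9 \<equiv> %p. (fst (snd p), fst (fst p), snd (fst p), snd (snd p))"
abbreviation "arrange10 \<equiv> %p. (fst (snd p), fst (fst p), snd (snd p), snd (fst p))"
abbreviation "arrange11 \<equiv> %p. (fst (snd p), snd (snd p), fst (fst p), snd (fst p))"
abbreviation "arrange12 \<equiv> %p. (fst p, fst (snd p), fst (snd (snd p)), snd (snd (snd p)))"
abbreviation "arrange13 \<equiv> %p. (fst p, fst (snd p), snd (snd p))"
abbreviation "arrange14 \<equiv> %p. (snd p, fst (fst p), fst (snd (fst p)), snd (snd (fst p)))"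
abbreviation "arrange15 \<equiv> %p. (snd p, fst (fst p), snd (fst p))"

section \<open>Moments of counts and moment measures on a window\<close>

locale B4_process = prob_space M
 for M :: "'o measure" and N :: "'o => 'a::euclidean_space set" +
 assumes spp: "simple_point_process M N" and B4: "B4_mixing M N" and intensity_pos: "0 < intensity M N"
begin

abbreviation "lam \<equiv> intensity M N"

lemma finite_pts: "om \<in> space M ==> bounded A ==> finite (N om Int A)"
 using spp by (simp add: simple_point_process_def)

lemma random_finite_pts:
 assumes A: "A \<in> sets borel" "bounded A"
 shows "random_finite M (%om. N om Int A)"
 unfolding random_finite_def
proof (intro conjI ballI)
 fix om assume "om \<in> space M" then show "finite (N om Int A)" using A by (simp add: finite_pts)
next
 fix S :: "'a set" assume S: "S \<in> sets borel"
 have "A Int S \<in> sets borel" "bounded (A Int S)" using A S by (auto intro: bounded_subset)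
 then have "(%om. card (N om Int (A Int S))) \<in> measurable M (count_space UNIV)"
  using spp unfolding simple_point_process_def by blast
 then have "(%om. real (card (N om Int (A Int S)))) \<in> borel_measurable M" by simp
 then show "(%om. real (card (N om Int A Int S))) \<in> borel_measurable M" by (simp add: Int_assoc)
qed

lemma random_finite_tuples2:
 assumes A: "A \<in> sets borel" "bounded A"
 shows "random_finite M (%om. tuples2 (N om Int A))"
proof -
 note K = random_finite_pts[OF A]
 have "open {p :: 'a \<times> 'a. fst p ~= snd p}" by (intro open_Collect_neq continuous_intros)
 then have "random_finite M (%om. (N om Int A) \<times> (N om Int A) Int {p. fst p ~= snd p})"
  by (intro random_finite_Int random_finite_times K) simp
 moreover have "(N om Int A) \<times> (N om Int A) Int {p. fst p ~= snd p} = tuples2 (N om Int A)" for om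
  by (auto simp: tuples2_def)
 ultimately show ?thesis by simp
qed

lemma random_finite_tuples3:
 assumes A: "A \<in> sets borel" "bounded A"
 shows "random_finite M (%om. tuples3 (N om Int A))"
proof -
 note K = random_finite_pts[OF A]
 let ?D = "{p :: 'a \<times> 'a \<times> 'a. fst p ~= fst (snd p) & fst p ~= snd (snd p) & fst (snd p) ~= snd (snd p)}"
 have "open ?D" by (intro open_Collect_conj open_Collect_neq continuous_intros)
 then have "random_finite M (%om. (N om Int A) \<times> (N om Int A) \<times> (N om Int A) Int ?D)"
  by (intro random_finite_Int random_finite_times K) simp
 moreover have "(N om Int A) \<times> (N om Int A) \<times> (N om Int A) Int ?D = tuples3 (N om Int A)" for om
  by (auto simp: tuples3_def)
 ultimately show ?thesis by simp
qed

lemma random_finite_tuples4: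
 assumes A: "A \<in> sets borel" "bounded A"
 shows "random_finite M (%om. tuples4 (N om Int A))"
proof -
 note K = random_finite_pts[OF A]
 let ?D = "{p :: 'a \<times> 'a \<times> 'a \<times> 'a. fst p ~= fst (snd p) & fst p ~= fst (snd (snd p)) & fst (snd p) ~= fst (snd (snd p))
   & fst p ~= snd (snd (snd p)) & fst (snd p) ~= snd (snd (snd p)) & fst (snd (snd p)) ~= snd (snd (snd p))}"
 have "open ?D" by (intro open_Collect_conj open_Collect_neq continuous_intros)
 then have "random_finite M (%om. (N om Int A) \<times> (N om Int A) \<times> (N om Int A) \<times> (N om Int A) Int ?D)"
  by (intro random_finite_Int random_finite_times K) simp
 moreover have "(N om Int A) \<times> (N om Int A) \<times> (N om Int A) \<times> (N om Int A) Int ?D = tuples4 (N om Int A)" for om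
  by (auto simp: tuples4_def)
 ultimately show ?thesis by simp
qed

lemma stationary_fact_moment:
 assumes "j \<in> {1..4}" "!!l. l \<in> {1..j} ==> A l \<in> sets borel & bounded (A l)"
 shows "fact_moment M N {1..j} (%l. (%y. y + x) ` A l) = fact_moment M N {1..j} A"
 using B4 assms unfolding B4_mixing_def kth_order_stationary_def by blast

lemma fact_moment_1:
 assumes W: "W \<in> sets borel" "bounded W" and A: "A a \<in> sets borel" "A a \<subseteq> W"
 shows "fact_moment M N {a} A = emeasure (mean_measure M (%om. N om Int W)) (A a)"
 unfolding fact_moment_def emeasure_mean_measure[OF random_finite_pts[OF W] A(1)]
 by (intro nn_integral_cong emeasure_inj_PiE_1 A finite_pts W)

lemma fact_moment_2:
 assumes W: "W \<in> sets borel" "bounded W" and ab: "a ~= b"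
  and A: "A a \<in> sets borel" "A b \<in> sets borel" "A a \<subseteq> W" "A b \<subseteq> W"
 shows "fact_moment M N {a, b} A = emeasure (mean_measure M (%om. tuples2 (N om Int W))) (A a \<times> A b)"
proof -
 have "A a \<times> A b \<in> sets borel" using A by (intro borel_Times)
 note e = emeasure_mean_measure[OF random_finite_tuples2[OF W] this]
 show ?thesis unfolding fact_moment_def e
  by (intro nn_integral_cong emeasure_inj_PiE_2 A finite_pts W ab)
qed

lemma fact_moment_3:
 assumes W: "W \<in> sets borel" "bounded W" and ab: "a ~= b" "a ~= c" "b ~= c"
  and A: "A a \<in> sets borel" "A b \<in> sets borel" "A c \<in> sets borel" "A a \<subseteq> W" "A b \<subseteq> W" "A c \<subseteq> W"
 shows "fact_moment M N {a, b, c} A = emeasure (mean_measure M (%om. tuples3 (N om Int W))) (A a \<times> A b \<times> A c)"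
proof -
 have "A a \<times> A b \<times> A c \<in> sets borel" using A by (intro borel_Times)
 note e = emeasure_mean_measure[OF random_finite_tuples3[OF W] this]
 show ?thesis unfolding fact_moment_def e
  by (intro nn_integral_cong emeasure_inj_PiE_3 A finite_pts W ab)
qed

lemma fact_moment_4:
 assumes W: "W \<in> sets borel" "bounded W"
  and ab: "a ~= b" "a ~= c" "b ~= c" "a ~= d" "b ~= d" "c ~= d"
  and A: "A a \<in> sets borel" "A b \<in> sets borel" "A c \<in> sets borel" "A d \<in> sets borel"
   "A a \<subseteq> W" "A b \<subseteq> W" "A c \<subseteq> W" "A d \<subseteq> W"
 shows "fact_moment M N {a, b, c, d} A
  = emeasure (mean_measure M (%om. tuples4 (N om Int W))) (A a \<times> A b \<times> A c \<times> A d)"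
proof -
 have "A a \<times> A b \<times> A c \<times> A d \<in> sets borel" using A by (intro borel_Times)
 note e = emeasure_mean_measure[OF random_finite_tuples4[OF W] this]
 show ?thesis unfolding fact_moment_def e
  by (intro nn_integral_cong emeasure_inj_PiE_4 A finite_pts W ab)
qed

text \<open>Stationarity is formulated for factorial moment measures, so the fourth moment over a
  translated cube is bounded by the fourth factorial moment. That one is translation invariant and
  is finite over the original cube.\<close>

lemma nn_moment4_translate:
 "(\<integral>\<^sup>+om. ennreal (real (card (N om Int (%y. y + x) ` unit_cube)) ^ 4) \<partial>M) < \<infinity>"
proof -
 let ?C = "unit_cube :: 'a set" and ?D = "(%y. y + x) ` unit_cube :: 'a set"
 note C = unit_cube_borel bounded_unit_cube
 have D: "?D \<in> sets borel" "bounded ?D" by (intro borel_translate bounded_translate C)+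
 have s: "{1..4} = {1, 2, 3, 4::nat}" by auto
 have fmD: "fact_moment M N {1, 2, 3, 4::nat} (%_. ?D) = (\<integral>\<^sup>+om. ennreal (real (card (tuples4 (N om Int ?D)))) \<partial>M)"
  unfolding fact_moment_def
 proof (rule nn_integral_cong)
  fix om assume "om \<in> space M"
  then have "finite (N om Int ?D)" using D by (intro finite_pts)
  note fin = this
  have "tuples4 (N om Int ?D) Int ?D \<times> ?D \<times> ?D \<times> ?D = tuples4 (N om Int ?D)" by (auto simp: tuples4_def)
  moreover have "emeasure (count_space UNIV) {f \<in> \<Pi>\<^sub>E l\<in>{1, 2, 3, 4::nat}. ?D Int N om. inj_on f {1, 2, 3, 4}}
   = ennreal (real (card (tuples4 (N om Int ?D) Int ?D \<times> ?D \<times> ?D \<times> ?D)))"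
   by (rule emeasure_inj_PiE_4[of "1::nat" 2 3 4 "%_. ?D" ?D]) (simp_all add: fin)
  ultimately show "emeasure (count_space UNIV) {f \<in> \<Pi>\<^sub>E l\<in>{1, 2, 3, 4::nat}. ?D Int N om. inj_on f {1, 2, 3, 4}}
   = ennreal (real (card (tuples4 (N om Int ?D))))" by simp
 qed
 have fmC: "fact_moment M N {1, 2, 3, 4::nat} (%_. ?C) <= (\<integral>\<^sup>+om. ennreal (real (card (N om Int ?C)) ^ 4) \<partial>M)"
  unfolding fact_moment_def
 proof (rule nn_integral_mono)
  fix om assume "om \<in> space M"
  then have fin: "finite (N om Int ?C)" using C by (intro finite_pts)
  have "real (card (tuples4 (N om Int ?C) Int ?C \<times> ?C \<times> ?C \<times> ?C)) <= real (card (tuples4 (N om Int ?C)))"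
   using tuples4_le[OF fin] by (simp add: card_mono)
  also have "... <= real (card (N om Int ?C) ^ 4)" using tuples4_le[OF fin] by linarith
  finally have le: "real (card (tuples4 (N om Int ?C) Int ?C \<times> ?C \<times> ?C \<times> ?C)) <= real (card (N om Int ?C)) ^ 4" by simp
  have "emeasure (count_space UNIV) {f \<in> \<Pi>\<^sub>E l\<in>{1, 2, 3, 4::nat}. ?C Int N om. inj_on f {1, 2, 3, 4}}
   = ennreal (real (card (tuples4 (N om Int ?C) Int ?C \<times> ?C \<times> ?C \<times> ?C)))"
   by (rule emeasure_inj_PiE_4[of "1::nat" 2 3 4 "%_. ?C" ?C]) (simp_all add: fin)
  with ennreal_leI[OF le]
  show "emeasure (count_space UNIV) {f \<in> \<Pi>\<^sub>E l\<in>{1, 2, 3, 4::nat}. ?C Int N om. inj_on f {1, 2, 3, 4}}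
   <= ennreal (real (card (N om Int ?C)) ^ 4)" by (simp only:)
 qed
 have "(\<integral>\<^sup>+om. ennreal (real (card (N om Int ?D)) ^ 4) \<partial>M)
   <= (\<integral>\<^sup>+om. 81 + 11 * ennreal (real (card (tuples4 (N om Int ?D)))) \<partial>M)"
 proof (rule nn_integral_mono)
  fix om assume "om \<in> space M"
  then have fin: "finite (N om Int ?D)" using D by (intro finite_pts)
  from card_pow4_le[OF this]
  have "ennreal (real (card (N om Int ?D)) ^ 4) <= ennreal (81 + 11 * real (card (tuples4 (N om Int ?D))))"
   by (rule ennreal_leI)
  also have "... = 81 + 11 * ennreal (real (card (tuples4 (N om Int ?D))))"
   by (simp add: ennreal_mult')
  finally show "ennreal (real (card (N om Int ?D)) ^ 4) <= 81 + 11 * ennreal (real (card (tuples4 (N om Int ?D))))" .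
 qed
 also have "... = 81 + 11 * (\<integral>\<^sup>+om. ennreal (real (card (tuples4 (N om Int ?D)))) \<partial>M)"
  using random_finiteD(3)[OF random_finite_tuples4[OF D]]
  by (simp add: nn_integral_add nn_integral_cmult emeasure_space_1)
 also have "(\<integral>\<^sup>+om. ennreal (real (card (tuples4 (N om Int ?D)))) \<partial>M) = fact_moment M N {1, 2, 3, 4::nat} (%_. ?C)"
  using stationary_fact_moment[of 4 "%_. ?C" x] C unfolding s fmD by simp
 finally have le: "(\<integral>\<^sup>+om. ennreal (real (card (N om Int ?D)) ^ 4) \<partial>M)
   <= 81 + 11 * fact_moment M N {1, 2, 3, 4::nat} (%_. ?C)" .
 have "(\<integral>\<^sup>+om. ennreal (real (card (N om Int ?C)) ^ 4) \<partial>M) < \<infinity>"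
  using B4 unfolding B4_mixing_def kth_order_stationary_def by blast
 with fmC have "fact_moment M N {1, 2, 3, 4::nat} (%_. ?C) < \<infinity>" by (rule le_less_trans)
 then have "81 + 11 * fact_moment M N {1, 2, 3, 4::nat} (%_. ?C) < \<infinity>"
  by (simp add: ennreal_mult_less_top)
 with le show ?thesis by (rule le_less_trans)
qed

text \<open>A compact closure is covered by finitely many translates of the open box inside the unit
  cube, and each translated cube has a finite fourth moment.\<close>

lemma integrable_card_pow4:
 assumes A: "A \<in> sets borel" "bounded A"
 shows "integrable M (%om. real (card (N om Int A)) ^ 4)"
proof -
 define D where "D x = (%y. y + x) ` (unit_cube :: 'a set)" for x
 note C = unit_cube_borel bounded_unit_cube
 have D: "D x \<in> sets borel" "bounded (D x)" for x unfolding D_def by (intro borel_translate bounded_translate C)+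
 have iD: "integrable M (%om. real (card (N om Int D x)) ^ 4)" for x
  using nn_moment4_translate[of x] random_finiteD(3)[OF random_finite_pts[OF D, of x]]
  by (intro integrableI_bounded) (auto simp: D_def)
 define U where "U x = (%y. y + x) ` box 0 (One :: 'a)" for x
 have "closure A \<subseteq> (\<Union>x\<in>UNIV. U x)"
 proof
  fix p assume "p \<in> closure A"
  have "p - (1/2) *\<^sub>R One + (1/2) *\<^sub>R One = p" by simp
  moreover have "(1/2) *\<^sub>R One \<in> box 0 (One :: 'a)" by (auto simp: box_def inner_sum_left_Basis)
  ultimately have "p \<in> U (p - (1/2) *\<^sub>R One)" unfolding U_def
   by (intro image_eqI[of _ _ "(1/2) *\<^sub>R One"]) auto
  then show "p \<in> (\<Union>x\<in>UNIV. U x)" by blast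
 qed
 moreover have "open (U x)" for x
  unfolding U_def using open_translation[OF open_box, of x 0 One] by (simp add: add.commute)
 moreover have "compact (closure A)" using A(2) by (simp add: compact_closure)
 ultimately obtain I where I: "finite I" "closure A \<subseteq> (\<Union>x\<in>I. U x)"
  by (meson compactE_image subset_UNIV)
 have sub: "A \<subseteq> (\<Union>x\<in>I. D x)"
 proof
  fix p assume "p \<in> A"
  then have "p \<in> closure A" using closure_subset by blast
  then obtain x where x: "x \<in> I" "p \<in> U x" using I(2) by blast
  have "U x \<subseteq> D x" unfolding U_def D_def by (rule image_mono[OF unit_cube_box(1)])
  with x show "p \<in> (\<Union>x\<in>I. D x)" by blast
 qed
 show ?thesis
 proof (rule bochner_integrable_bound)
  show "integrable M (%om. real (card I) ^ 4 * (\<Sum>x\<in>I. real (card (N om Int D x)) ^ 4))"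
   using iD by simp
  show "(%om. real (card (N om Int A)) ^ 4) \<in> borel_measurable M"
   using random_finiteD(3)[OF random_finite_pts[OF A]] by simp
  show "AE om in M. norm (real (card (N om Int A)) ^ 4)
    <= norm (real (card I) ^ 4 * (\<Sum>x\<in>I. real (card (N om Int D x)) ^ 4))"
  proof (rule AE_I2)
   fix om assume om: "om \<in> space M"
   have fin: "finite (N om Int D x)" for x using finite_pts[OF om D(2)] .
   define s where "s = (\<Sum>x\<in>I. real (card (N om Int D x)) ^ 4)"
   have "N om Int A \<subseteq> (\<Union>x\<in>I. N om Int D x)" using sub by (auto dest: subsetD)
   moreover have "finite (\<Union>x\<in>I. N om Int D x)" by (intro finite_UN_I I fin)
   ultimately have "card (N om Int A) <= card (\<Union>x\<in>I. N om Int D x)" by (intro card_mono)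
   also have "... <= (\<Sum>x\<in>I. card (N om Int D x))" by (rule card_UN_le[OF I(1)])
   finally have "real (card (N om Int A)) <= (\<Sum>x\<in>I. real (card (N om Int D x)))" by (simp flip: of_nat_sum)
   \<comment> \<open>Each single count is at most the fourth root of the sum s of all fourth powers;
     this avoids a power mean inequality at the price of the factor |I|^4.\<close>
   also have "... <= (\<Sum>x\<in>I. root 4 s)"
   proof (rule sum_mono)
    fix x assume x: "x \<in> I"
    have "real (card (N om Int D x)) ^ 4 <= s" unfolding s_def
     by (rule member_le_sum[OF x]) (use I in auto)
    then have "root 4 (real (card (N om Int D x)) ^ 4) <= root 4 s" by simp
    then show "real (card (N om Int D x)) <= root 4 s" by (simp add: real_root_power_cancel)
   qed
   also have "... = real (card I) * root 4 s" by simp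
   finally have "real (card (N om Int A)) ^ 4 <= (real (card I) * root 4 s) ^ 4" by (intro power_mono) auto
   also have "... = real (card I) ^ 4 * s"
    by (simp add: power_mult_distrib s_def sum_nonneg)
   finally show "norm (real (card (N om Int A)) ^ 4)
    <= norm (real (card I) ^ 4 * (\<Sum>x\<in>I. real (card (N om Int D x)) ^ 4))" by (simp add: s_def)
  qed
 qed
qed

lemma integrable_pow4_bound:
 assumes A: "A \<in> sets borel" "bounded A" and f: "f \<in> borel_measurable M"
  and le: "!!om. om \<in> space M ==> \<bar>f om\<bar> <= C * real (card (N om Int A)) ^ j" and j: "j <= 4"
 shows "integrable M f"
proof (rule bochner_integrable_bound)
 show "integrable M (%om. \<bar>C\<bar> * (1 + real (card (N om Int A)) ^ 4))"
  using integrable_card_pow4[OF A] by simp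
 show "AE om in M. norm (f om) <= norm (\<bar>C\<bar> * (1 + real (card (N om Int A)) ^ 4))"
 proof (rule AE_I2)
  fix om assume om: "om \<in> space M"
  define n where "n = real (card (N om Int A))"
  \<comment> \<open>A count is either 0 or at least 1, so lower powers are dominated by the fourth;
    the summand 1 covers the exponent j = 0.\<close>
  have nj: "n ^ j <= 1 + n ^ 4"
  proof (cases "1 <= n")
   case True then have "n ^ j <= n ^ 4" using j by (intro power_increasing)
   then show ?thesis by simp
  next
   case False
   then have "n = 0" unfolding n_def by simp
   then show ?thesis by (cases j) auto
  qed
  have "\<bar>f om\<bar> <= C * n ^ j" using le[OF om] by (simp add: n_def)
  also have "... <= \<bar>C\<bar> * n ^ j" by (intro mult_right_mono) (auto simp: n_def)
  also have "... <= \<bar>C\<bar> * (1 + n ^ 4)" by (intro mult_left_mono nj) auto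
  finally show "norm (f om) <= norm (\<bar>C\<bar> * (1 + real (card (N om Int A)) ^ 4))"
   by (simp add: n_def abs_mult)
 qed
qed fact

lemma integrable_card:
 assumes A: "A \<in> sets borel" "bounded A"
 shows "integrable M (%om. real (card (N om Int A)))"
  and "integrable M (%om. real (card (tuples2 (N om Int A))))"
  and "integrable M (%om. real (card (tuples3 (N om Int A))))"
  and "integrable M (%om. real (card (tuples4 (N om Int A))))"
proof -
 have le: "real m <= 1 * real n ^ k" if "m <= n ^ k" for m n k :: nat
  using that by (simp flip: of_nat_power)
 have fin: "finite (N om Int A)" if "om \<in> space M" for om using finite_pts[OF that A(2)] .
 show "integrable M (%om. real (card (N om Int A)))"
  by (rule integrable_pow4_bound[OF A, where j=1 and C=1])
   (use random_finiteD(3)[OF random_finite_pts[OF A]] in auto)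
 show "integrable M (%om. real (card (tuples2 (N om Int A))))"
  by (rule integrable_pow4_bound[OF A, where j=2 and C=1])
   (use random_finiteD(3)[OF random_finite_tuples2[OF A]] tuples2_le[OF fin] in \<open>auto intro!: le simp del: mult_1\<close>)
 show "integrable M (%om. real (card (tuples3 (N om Int A))))"
  by (rule integrable_pow4_bound[OF A, where j=3 and C=1])
   (use random_finiteD(3)[OF random_finite_tuples3[OF A]] tuples3_le[OF fin] in \<open>auto intro!: le simp del: mult_1\<close>)
 show "integrable M (%om. real (card (tuples4 (N om Int A))))"
  by (rule integrable_pow4_bound[OF A, where j=4 and C=1])
   (use random_finiteD(3)[OF random_finite_tuples4[OF A]] tuples4_le[OF fin] in \<open>auto intro!: le simp del: mult_1\<close>)
qed

text \<open>Restriction to a window replaces the locally finite factorial moment measures by finite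
  measures, against which every bounded Borel function is integrable.\<close>

definition "mom1 W = mean_measure M (%om. N om Int W)"
definition "mom2 W = mean_measure M (%om. tuples2 (N om Int W))"
definition "mom3 W = mean_measure M (%om. tuples3 (N om Int W))"
definition "mom4 W = mean_measure M (%om. tuples4 (N om Int W))"

abbreviation "m11 W \<equiv> mom1 W \<Otimes>\<^sub>M mom1 W"
abbreviation "m111 W \<equiv> mom1 W \<Otimes>\<^sub>M m11 W"
abbreviation "m21 W \<equiv> mom2 W \<Otimes>\<^sub>M mom1 W"
abbreviation "m22 W \<equiv> mom2 W \<Otimes>\<^sub>M mom2 W"
abbreviation "m31 W \<equiv> mom3 W \<Otimes>\<^sub>M mom1 W"
abbreviation "m211 W \<equiv> mom2 W \<Otimes>\<^sub>M m11 W"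

lemma sets_mom [simp, measurable_cong]:
 "sets (mom1 W) = sets borel" "sets (mom2 W) = sets borel" "sets (mom3 W) = sets borel" "sets (mom4 W) = sets borel"
 by (simp_all add: mom1_def mom2_def mom3_def mom4_def)

lemma space_mom [simp]:
 "space (mom1 W) = UNIV" "space (mom2 W) = UNIV" "space (mom3 W) = UNIV" "space (mom4 W) = UNIV"
 by (simp_all add: mom1_def mom2_def mom3_def mom4_def)

lemma finite_measure_mom:
 assumes W: "W \<in> sets borel" "bounded W"
 shows "finite_measure (mom1 W)" "finite_measure (mom2 W)" "finite_measure (mom3 W)" "finite_measure (mom4 W)"
 unfolding mom1_def mom2_def mom3_def mom4_def
 by (intro finite_measure_mean_measure random_finite_pts random_finite_tuples2
   random_finite_tuples3 random_finite_tuples4 integrable_card W)+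

lemma integral_mom:
 fixes f1 :: "'a => real" and f2 :: "'a \<times> 'a => real" and f3 :: "'a \<times> 'a \<times> 'a => real"
  and f4 :: "'a \<times> 'a \<times> 'a \<times> 'a => real"
 assumes W: "W \<in> sets borel" "bounded W"
 shows "f1 \<in> borel_measurable borel ==> (!!x. \<bar>f1 x\<bar> <= C) ==>
   integral\<^sup>L (mom1 W) f1 = expectation (%om. \<Sum>p\<in>N om Int W. f1 p)"
  and "f2 \<in> borel_measurable borel ==> (!!x. \<bar>f2 x\<bar> <= C) ==>
   integral\<^sup>L (mom2 W) f2 = expectation (%om. \<Sum>p\<in>tuples2 (N om Int W). f2 p)"
  and "f3 \<in> borel_measurable borel ==> (!!x. \<bar>f3 x\<bar> <= C) ==>
   integral\<^sup>L (mom3 W) f3 = expectation (%om. \<Sum>p\<in>tuples3 (N om Int W). f3 p)"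
  and "f4 \<in> borel_measurable borel ==> (!!x. \<bar>f4 x\<bar> <= C) ==>
   integral\<^sup>L (mom4 W) f4 = expectation (%om. \<Sum>p\<in>tuples4 (N om Int W). f4 p)"
 using integral_mean_measure[OF random_finite_pts[OF W] integrable_card(1)[OF W], of f1 C]
  integral_mean_measure[OF random_finite_tuples2[OF W] integrable_card(2)[OF W], of f2 C]
  integral_mean_measure[OF random_finite_tuples3[OF W] integrable_card(3)[OF W], of f3 C]
  integral_mean_measure[OF random_finite_tuples4[OF W] integrable_card(4)[OF W], of f4 C]
 unfolding mom1_def mom2_def mom3_def mom4_def by blast+

text \<open>The first moment measure is lam times Lebesgue measure. The mean number of points x in
  A, weighted by the volume of all y with x + y in the unit cube, is computed in two ways: that
  volume is 1 for every x, and stationarity moves the shift y from the cube to A before Fubini is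
  applied a second time.\<close>

lemma emeasure_mom1:
 assumes W: "W \<in> sets borel" "bounded W" and S: "S \<in> sets borel"
 shows "emeasure (mom1 W) S = ennreal lam * emeasure lborel (W Int S)"
proof -
 let ?C = "unit_cube :: 'a set"
 note C = unit_cube_borel bounded_unit_cube
 have main: "emeasure (mom1 A) UNIV = ennreal lam * emeasure lborel A"
  if A: "A \<in> sets borel" "bounded A" for A
 proof -
  note [measurable] = A(1)
  interpret fA: finite_measure "mom1 A" by (rule finite_measure_mom[OF A])
  interpret fC: finite_measure "mom1 ?C" by (rule finite_measure_mom[OF C])
  interpret pA: pair_sigma_finite lborel "mom1 A" ..
  interpret pC: pair_sigma_finite lborel "mom1 ?C" ..
  have fm: "fact_moment M N {1..1::nat} (%_. B) = emeasure (mom1 V) B"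
   if "V \<in> sets borel" "bounded V" "B \<in> sets borel" "B \<subseteq> V" for B V
   using fact_moment_1[OF that(1,2), of "%_. B" 1] that by (simp add: mom1_def)
  have restr: "emeasure (mom1 V) B = emeasure (mom1 V) (V Int B)" if "V \<in> sets borel" "bounded V" "B \<in> sets borel" for B V
   unfolding mom1_def using that
   by (simp add: emeasure_mean_measure[OF random_finite_pts] sets.Int Int_assoc[symmetric])
  \<comment> \<open>Translation by y carries the part of A that y moves into the cube onto the part
    of the cube that comes from A.\<close>
  have inv: "emeasure (mom1 A) {x. x + y \<in> ?C} = emeasure (mom1 ?C) {x. x - y \<in> A}" for y
  proof -
   have [measurable]: "{x. x + y \<in> ?C} \<in> sets borel" "{x. x - y \<in> A} \<in> sets borel" by measurable
   let ?B = "A Int {x. x + y \<in> ?C}"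
   have B: "?B \<in> sets borel" "bounded ?B" using A by (auto intro: bounded_subset)
   have e: "(%z. z + y) ` ?B = ?C Int {x. x - y \<in> A}" unfolding image_add_eq_vimage by auto
   have "emeasure (mom1 A) {x. x + y \<in> ?C} = fact_moment M N {1..1::nat} (%_. ?B)"
    unfolding restr[OF A \<open>{x. x + y \<in> ?C} \<in> sets borel\<close>] by (rule fm[symmetric]) (use A B in auto)
   also have "... = fact_moment M N {1..1::nat} (%_. (%z. z + y) ` ?B)"
    by (rule stationary_fact_moment[symmetric]) (use B in auto)
   also have "... = emeasure (mom1 ?C) (?C Int {x. x - y \<in> A})"
    unfolding e by (rule fm) (use C in auto)
   finally show ?thesis using restr[OF C \<open>{x. x - y \<in> A} \<in> sets borel\<close>] by simp
  qed
  have "emeasure (mom1 A) UNIV = (\<integral>\<^sup>+x. 1 \<partial>mom1 A)" by simp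
  also have "... = (\<integral>\<^sup>+x. (\<integral>\<^sup>+y. indicator ?C (x + y) \<partial>lborel) \<partial>mom1 A)"
  proof (rule nn_integral_cong)
   fix x
   have "(\<integral>\<^sup>+y. indicator ?C (x + y) \<partial>lborel) = (\<integral>\<^sup>+y. indicator ?C y \<partial>lborel)"
    by (subst (2) lborel_distr_plus[of x, symmetric], subst nn_integral_distr) auto
   also have "... = 1" by (simp add: emeasure_unit_cube)
   finally show "1 = (\<integral>\<^sup>+y. indicator ?C (x + y) \<partial>lborel)" by simp
  qed
  also have "... = (\<integral>\<^sup>+y. (\<integral>\<^sup>+x. indicator ?C (x + y) \<partial>mom1 A) \<partial>lborel)"
   by (rule pA.Fubini') measurable
  also have "... = (\<integral>\<^sup>+y. (\<integral>\<^sup>+x. indicator A (x - y) \<partial>mom1 ?C) \<partial>lborel)"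
  proof (rule nn_integral_cong)
   fix y
   have "(\<integral>\<^sup>+x. indicator ?C (x + y) \<partial>mom1 A) = (\<integral>\<^sup>+x. indicator {x. x + y \<in> ?C} x \<partial>mom1 A)"
    by (rule nn_integral_cong) (simp add: indicator_def)
   also have "... = emeasure (mom1 A) {x. x + y \<in> ?C}" by (rule nn_integral_indicator) measurable
   also have "... = (\<integral>\<^sup>+x. indicator {x. x - y \<in> A} x \<partial>mom1 ?C)"
    unfolding inv by (rule nn_integral_indicator[symmetric]) measurable
   also have "... = (\<integral>\<^sup>+x. indicator A (x - y) \<partial>mom1 ?C)"
    by (rule nn_integral_cong) (simp add: indicator_def)
   finally show "(\<integral>\<^sup>+x. indicator ?C (x + y) \<partial>mom1 A) = (\<integral>\<^sup>+x. indicator A (x - y) \<partial>mom1 ?C)" .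
  qed
  also have "... = (\<integral>\<^sup>+x. (\<integral>\<^sup>+y. indicator A (x - y) \<partial>lborel) \<partial>mom1 ?C)"
   by (rule pC.Fubini'[symmetric]) measurable
  also have "... = (\<integral>\<^sup>+x. emeasure lborel A \<partial>mom1 ?C)"
  proof (rule nn_integral_cong)
   fix x
   have "(\<integral>\<^sup>+y. indicator A (x - y) \<partial>lborel) = (\<integral>\<^sup>+y. indicator A y \<partial>lborel)"
    by (rule nn_integral_lborel_minus) measurable
   then show "(\<integral>\<^sup>+y. indicator A (x - y) \<partial>lborel) = emeasure lborel A" by simp
  qed
  also have "... = emeasure lborel A * emeasure (mom1 ?C) UNIV" by simp
  also have "emeasure (mom1 ?C) UNIV = ennreal lam"
   unfolding mom1_def intensity_def
   using emeasure_mean_measure[OF random_finite_pts[OF C], of UNIV]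
    nn_integral_eq_integral[OF integrable_card(1)[OF C]] by simp
  finally show ?thesis by (simp add: mult.commute)
 qed
 have "emeasure (mom1 W) S = emeasure (mom1 (W Int S)) UNIV"
  unfolding mom1_def using W S
  by (simp add: emeasure_mean_measure[OF random_finite_pts] bounded_subset Int_assoc bounded_Int)
 also have "... = ennreal lam * emeasure lborel (W Int S)"
  using W S by (intro main) (auto simp: bounded_Int)
 finally show ?thesis .
qed

end

section \<open>Factorial cumulants as signed measures\<close>

text \<open>A formal signed combination of positive measures, kept as a list of coefficients and
  measures. The argument \<open>ph\<close> is the functional to be evaluated, such as the measure of
  a fixed set or the integral of a fixed function.\<close>

fun lin_comb :: "(real \<times> 'b) list => ('b => real) => real" where
 "lin_comb [] ph = 0"
| "lin_comb (p # L) ph = fst p * ph (snd p) + lin_comb L ph"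

lemma lin_comb_cong: "(!!p. p \<in> set L ==> ph (snd p) = \<psi> (snd p)) ==> lin_comb L ph = lin_comb L \<psi>"
 by (induction L) auto

lemma lin_comb_linear: "lin_comb L (%mu. a * ph mu + b * \<psi> mu) = a * lin_comb L ph + b * lin_comb L \<psi>"
 by (induction L) (auto simp: algebra_simps)

lemma lin_comb_tendsto:
 "(!!p. p \<in> set L ==> (%i. ph i (snd p)) \<longlonglongrightarrow> \<psi> (snd p)) ==> (%i. lin_comb L (ph i)) \<longlonglongrightarrow> lin_comb L \<psi>"
 by (induction L) (auto intro!: tendsto_intros)

lemma lin_comb_sums:
 "(!!p. p \<in> set L ==> (%i. ph i (snd p)) sums \<psi> (snd p)) ==> (%i. lin_comb L (ph i)) sums lin_comb L \<psi>"
 by (induction L) (auto intro!: sums_add sums_mult)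

text \<open>A signed combination of finite measures that vanishes on an intersection-stable
  generator vanishes on all Borel sets and then, by linearity and dominated convergence, on bounded
  functions. Everything is cut down to D because the cumulant identities are used only for
  rectangles inside the window.\<close>

lemma lin_comb_vanishes:
 fixes L :: "(real \<times> 'b::topological_space measure) list"
 assumes G: "Int_stable G" "sets (borel :: 'b measure) = sigma_sets UNIV G" "UNIV \<in> G"
  and L: "!!p. p \<in> set L ==> finite_measure (snd p) & sets (snd p) = sets borel"
  and D: "D \<in> sets borel"
  and zero: "!!S. S \<in> G ==> lin_comb L (%mu. measure mu (D Int S)) = 0"
  and F: "F \<in> borel_measurable borel" "!!x. \<bar>F x\<bar> <= C" "!!x. x \<notin> D ==> F x = (0::real)"
 shows "lin_comb L (%mu. integral\<^sup>L mu F) = 0"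
proof -
 have fm: "finite_measure (snd p)" and sb: "sets (snd p) = sets borel" if "p \<in> set L" for p
  using L[OF that] by simp_all
 have ms: "S \<in> sets (snd p)" if "p \<in> set L" "S \<in> sets borel" for p S using sb[OF that(1)] that(2) by simp
 have sets0: "lin_comb L (%mu. measure mu (D Int S)) = 0" if "S \<in> sets borel" for S
 proof (rule sigma_sets_induct_disjoint[of G UNIV S "%S. lin_comb L (%mu. measure mu (D Int S)) = 0"])
  show "S \<in> sigma_sets UNIV G" using that G(2) by simp
  show "lin_comb L (%mu. measure mu (D Int {})) = 0" using lin_comb_linear[of L 0 "%_. 0" 0 "%_. 0"] by simp
  fix A assume A: "A \<in> sigma_sets UNIV G" and z: "lin_comb L (%mu. measure mu (D Int A)) = 0"
  have Ab: "A \<in> sets borel" using A G(2) by simp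
  have "lin_comb L (%mu. measure mu (D Int (UNIV - A)))
    = lin_comb L (%mu. 1 * measure mu (D Int UNIV) + (-1) * measure mu (D Int A))"
  proof (rule lin_comb_cong)
   fix p assume p: "p \<in> set L"
   interpret finite_measure "snd p" using fm[OF p] .
   have "measure (snd p) (D - D Int A) = measure (snd p) D - measure (snd p) (D Int A)"
    using finite_measure_Diff[OF ms[OF p D] ms[OF p sets.Int[OF D Ab]] Int_lower1] .
   moreover have "D - D Int A = D Int (UNIV - A)" by auto
   ultimately show "measure (snd p) (D Int (UNIV - A)) = 1 * measure (snd p) (D Int UNIV) + (-1) * measure (snd p) (D Int A)"
    by simp
  qed
  also have "... = 0" unfolding lin_comb_linear using z zero[OF G(3)] by simp
  finally show "lin_comb L (%mu. measure mu (D Int (UNIV - A))) = 0" .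
 next
  fix A :: "nat => 'b set"
  assume A: "disjoint_family A" "range A \<subseteq> sigma_sets UNIV G" "!!i. lin_comb L (%mu. measure mu (D Int A i)) = 0"
  have Ab: "A i \<in> sets borel" for i using A(2) G(2) by auto
  have "(%i. lin_comb L (%mu. measure mu (D Int A i))) sums lin_comb L (%mu. measure mu (D Int (\<Union>i. A i)))"
  proof (rule lin_comb_sums)
   fix p assume p: "p \<in> set L"
   interpret finite_measure "snd p" using fm[OF p] .
   have "(%i. measure (snd p) (D Int A i)) sums measure (snd p) (\<Union>i. D Int A i)"
   proof (rule finite_measure_UNION)
    show "range (%i. D Int A i) \<subseteq> sets (snd p)" using ms[OF p sets.Int[OF D Ab]] by blast
    show "disjoint_family (%i. D Int A i)" using A(1) by (auto simp: disjoint_family_on_def)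
   qed
   moreover have "(\<Union>i. D Int A i) = D Int (\<Union>i. A i)" by auto
   ultimately show "(%i. measure (snd p) (D Int A i)) sums measure (snd p) (D Int (\<Union>i. A i))" by simp
  qed
  then show "lin_comb L (%mu. measure mu (D Int (\<Union>i. A i))) = 0"
   unfolding A(3) using sums_unique2[OF _ sums_zero] by blast
 qed (use G zero in auto)
 have "lin_comb L (%mu. \<integral>x. indicator D x * F x \<partial>mu) = 0"
  using F(1,2)
 proof (induction F rule: bounded_borel_induct)
  case (indicator S)
  have "lin_comb L (%mu. \<integral>x. indicat_real D x * indicat_real S x \<partial>mu) = lin_comb L (%mu. measure mu (D Int S))"
  proof (rule lin_comb_cong)
   fix p assume p: "p \<in> set L"
   interpret finite_measure "snd p" using fm[OF p] .
   have "(LINT x|snd p. indicat_real D x * indicat_real S x) = (LINT x|snd p. indicat_real (D Int S) x)"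
    by (rule bochner_integral_cong) (simp_all add: indicator_inter_arith)
   also have "... = measure (snd p) (D Int S)"
    using sets.sets_into_space[OF ms[OF p sets.Int[OF D indicator]]] ms[OF p sets.Int[OF D indicator]]
    by (simp add: Int_absorb2)
   finally show "(LINT x|snd p. indicat_real D x * indicat_real S x) = measure (snd p) (D Int S)" .
  qed
  then show ?case using sets0[OF indicator] by simp
 next
  case (linear a b f g Cf Cg)
  have "lin_comb L (%mu. \<integral>x. indicator D x * (a * f x + b * g x) \<partial>mu)
    = lin_comb L (%mu. a * (LINT x|mu. indicator D x * f x) + b * (LINT x|mu. indicator D x * g x))"
  proof (rule lin_comb_cong)
   fix p assume p: "p \<in> set L"
   interpret finite_measure "snd p" using fm[OF p] .
   note [measurable_cong] = sb[OF p]
   note [measurable] = linear(1,2) D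
   have "integrable (snd p) (%x. indicator D x * f x)"
    by (rule integrable_const_bound[where B=Cf]) (use linear(3) order_trans[OF abs_ge_zero linear(3)] in \<open>auto simp: indicator_def\<close>)
   moreover have "integrable (snd p) (%x. indicator D x * g x)"
    by (rule integrable_const_bound[where B=Cg]) (use linear(4) order_trans[OF abs_ge_zero linear(4)] in \<open>auto simp: indicator_def\<close>)
   ultimately show "(LINT x|snd p. indicator D x * (a * f x + b * g x))
    = a * (LINT x|snd p. indicator D x * f x) + b * (LINT x|snd p. indicator D x * g x)"
    by (simp add: distrib_left mult.left_commute)
  qed
  then show ?case using linear unfolding lin_comb_linear by simp
 next
  case (lim f U C)
  have "(%i. lin_comb L (%mu. \<integral>x. indicator D x * U i x \<partial>mu)) \<longlonglongrightarrow> lin_comb L (%mu. \<integral>x. indicator D x * f x \<partial>mu)"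
  proof (rule lin_comb_tendsto)
   fix p assume p: "p \<in> set L"
   interpret finite_measure "snd p" using fm[OF p] .
   note [measurable_cong] = sb[OF p]
   note [measurable] = lim(1,2) D
   show "(%i. \<integral>x. indicator D x * U i x \<partial>snd p) \<longlonglongrightarrow> (LINT x|snd p. indicator D x * f x)"
   proof (rule integral_dominated_convergence[where w="%_. C"])
    show "AE x in snd p. (%i. indicator D x * U i x) \<longlonglongrightarrow> indicator D x * f x"
     using lim(4) by (intro AE_I2 tendsto_mult_left) simp
    have "0 <= C" using order_trans[OF abs_ge_zero lim(3)] .
    then show "AE x in snd p. norm (indicator D x * U i x) <= C" for i
     using lim(3)[of i] by (intro AE_I2) (simp add: indicator_def)
   qed simp_all
  qed
  then show ?case unfolding lim(5) by (simp add: LIMSEQ_const_iff)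
 qed
 moreover have "(%x. indicator D x * F x) = F"
 proof (rule ext)
  fix x show "indicator D x * F x = F x" using F(3)[of x] by (cases "x \<in> D") simp_all
 qed
 ultimately show ?thesis by simp
qed

lemma sets_borel_pair_generated:
 assumes E: "sets (borel :: 'c::second_countable_topology measure) = sigma_sets UNIV E" "UNIV \<in> E"
 shows "sets (borel :: ('b::second_countable_topology \<times> 'c) measure)
  = sigma_sets UNIV {a \<times> e |a e. a \<in> sets borel & e \<in> E}"
proof -
 have "sets (borel \<Otimes>\<^sub>M borel :: ('b \<times> 'c) measure)
  = sets (sigma (space (borel :: 'b measure) \<times> space (borel :: 'c measure)) {a \<times> e |a e. a \<in> sets borel & e \<in> E})"
 proof (rule sets_pair_eq[where Ca="{UNIV}" and Cb="{UNIV}"])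
  show "sets (borel :: 'b measure) = sigma_sets (space borel) (sets borel)" by (simp only: sets.sigma_sets_eq)
 qed (use E in auto)
 then show ?thesis by (simp only: borel_prod) simp
qed

lemma Int_stable_Times:
 assumes "Int_stable E"
 shows "Int_stable {a \<times> e |a e. a \<in> sets (borel :: 'b::topological_space measure) & e \<in> E}"
proof (rule Int_stableI)
 fix X Y assume "X \<in> {a \<times> e |a e. a \<in> sets (borel :: 'b measure) & e \<in> E}" "Y \<in> {a \<times> e |a e. a \<in> sets (borel :: 'b measure) & e \<in> E}"
 then obtain a e a' e' where "X = a \<times> e" "Y = a' \<times> e'" "a \<in> sets borel" "a' \<in> sets borel" "e \<in> E" "e' \<in> E" by blast
 moreover have "e Int e' \<in> E" using assms \<open>e \<in> E\<close> \<open>e' \<in> E\<close> by (auto simp: Int_stable_def)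
 moreover have "a \<times> e Int a' \<times> e' = (a Int a') \<times> (e Int e')" by auto
 ultimately show "X Int Y \<in> {a \<times> e |a e. a \<in> sets (borel :: 'b measure) & e \<in> E}"
  by (intro CollectI exI[of _ "a Int a'"] exI[of _ "e Int e'"]) auto
qed

text \<open>Rectangles nested to the right like the tuple types; each family is the generator that
  \<open>lin_comb_vanishes\<close> asks for in its dimension.\<close>

definition rects2 :: "('b::second_countable_topology \<times> 'b) set set" where
 "rects2 = {a \<times> e |a e. a \<in> sets borel & e \<in> sets borel}"
definition rects3 :: "('b::second_countable_topology \<times> 'b \<times> 'b) set set" where
 "rects3 = {a \<times> e |a e. a \<in> sets borel & e \<in> rects2}"
definition rects4 :: "('b::second_countable_topology \<times> 'b \<times> 'b \<times> 'b) set set" where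
 "rects4 = {a \<times> e |a e. a \<in> sets borel & e \<in> rects3}"

lemma rects2: "Int_stable (rects2 :: ('b::second_countable_topology \<times> 'b) set set)"
 "sets (borel :: ('b \<times> 'b) measure) = sigma_sets UNIV rects2" "UNIV \<in> (rects2 :: ('b \<times> 'b) set set)"
proof -
 show "UNIV \<in> (rects2 :: ('b \<times> 'b) set set)" unfolding rects2_def
  by (intro CollectI exI[of _ UNIV]) simp
 show "Int_stable (rects2 :: ('b \<times> 'b) set set)" unfolding rects2_def
  by (intro Int_stable_Times) (auto simp: Int_stable_def)
 show "sets (borel :: ('b \<times> 'b) measure) = sigma_sets UNIV rects2" unfolding rects2_def by (rule sets_borel_pair)
qed

lemma rects3: "Int_stable (rects3 :: ('b::second_countable_topology \<times> 'b \<times> 'b) set set)"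
 "sets (borel :: ('b \<times> 'b \<times> 'b) measure) = sigma_sets UNIV rects3" "UNIV \<in> (rects3 :: ('b \<times> 'b \<times> 'b) set set)"
proof -
 show "UNIV \<in> (rects3 :: ('b \<times> 'b \<times> 'b) set set)" unfolding rects3_def
  by (intro CollectI exI[of _ UNIV]) (simp add: rects2)
 show "Int_stable (rects3 :: ('b \<times> 'b \<times> 'b) set set)" unfolding rects3_def by (intro Int_stable_Times rects2)
 show "sets (borel :: ('b \<times> 'b \<times> 'b) measure) = sigma_sets UNIV rects3" unfolding rects3_def
  by (intro sets_borel_pair_generated rects2)
qed

lemma rects4: "Int_stable (rects4 :: ('b::second_countable_topology \<times> 'b \<times> 'b \<times> 'b) set set)"
 "sets (borel :: ('b \<times> 'b \<times> 'b \<times> 'b) measure) = sigma_sets UNIV rects4" "UNIV \<in> (rects4 :: ('b \<times> 'b \<times> 'b \<times> 'b) set set)"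
proof -
 show "UNIV \<in> (rects4 :: ('b \<times> 'b \<times> 'b \<times> 'b) set set)" unfolding rects4_def
  by (intro CollectI exI[of _ UNIV]) (simp add: rects3)
 show "Int_stable (rects4 :: ('b \<times> 'b \<times> 'b \<times> 'b) set set)" unfolding rects4_def by (intro Int_stable_Times rects3)
 show "sets (borel :: ('b \<times> 'b \<times> 'b \<times> 'b) measure) = sigma_sets UNIV rects4" unfolding rects4_def
  by (intro sets_borel_pair_generated rects3)
qed

section \<open>Finite Borel measures: products, images and Fubini\<close>

lemma sets_pair_borel:
 assumes "sets mu = sets (borel :: 'b::second_countable_topology measure)"
  and "sets \<nu> = sets (borel :: 'c::second_countable_topology measure)"
 shows "sets (mu \<Otimes>\<^sub>M \<nu>) = sets (borel :: ('b \<times> 'c) measure)"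
 using sets_pair_measure_cong[OF assms] by (simp only: borel_prod)

lemma finite_pair_borel:
 assumes "finite_measure mu" "finite_measure \<nu>" shows "finite_measure (mu \<Otimes>\<^sub>M \<nu>)"
proof -
 interpret a: finite_measure mu by fact
 interpret b: finite_measure \<nu> by fact
 show ?thesis by (rule finite_measure_pair_measure) unfold_locales
qed

lemma finite_measure_distr_pair:
 assumes "finite_measure mu" "finite_measure \<nu>" "ta \<in> measurable (mu \<Otimes>\<^sub>M \<nu>) borel"
 shows "finite_measure (distr (mu \<Otimes>\<^sub>M \<nu>) borel ta)"
 using finite_measure.finite_measure_distr[OF finite_pair_borel[OF assms(1,2)] assms(3)] .

lemma measurable_pair_borel:
 assumes "sets mu = sets (borel :: 'b::second_countable_topology measure)"
  and "sets \<nu> = sets (borel :: 'c::second_countable_topology measure)"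
  and "ta \<in> borel_measurable borel"
 shows "ta \<in> measurable (mu \<Otimes>\<^sub>M \<nu>) borel"
 using assms(3) by (simp add: measurable_cong_sets[OF sets_pair_borel[OF assms(1,2)] refl])

lemma measure_pair_Times:
 assumes "finite_measure mu" "finite_measure \<nu>" "A \<in> sets mu" "B \<in> sets \<nu>"
 shows "measure (mu \<Otimes>\<^sub>M \<nu>) (A \<times> B) = measure mu A * measure \<nu> B"
proof -
 interpret a: finite_measure mu by fact
 interpret b: finite_measure \<nu> by fact
 show ?thesis unfolding measure_def
  by (subst b.emeasure_pair_measure_Times) (use assms(3,4) in \<open>simp_all add: enn2real_mult\<close>)
qed

lemma measure_distr_pair:
 fixes mu :: "'b::second_countable_topology measure" and \<nu> :: "'c::second_countable_topology measure"
  and ta :: "'b \<times> 'c => 'd::topological_space"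
 assumes fin: "finite_measure mu" "finite_measure \<nu>"
  and s: "sets mu = sets borel" "sets \<nu> = sets borel"
  and ta: "ta \<in> borel_measurable borel" and R: "R \<in> sets borel" "ta -` R = A \<times> B"
  and A: "A \<in> sets borel" "B \<in> sets borel"
 shows "measure (distr (mu \<Otimes>\<^sub>M \<nu>) borel ta) R = measure mu A * measure \<nu> B"
proof -
 have "space (mu \<Otimes>\<^sub>M \<nu>) = UNIV"
  using sets_eq_imp_space_eq[OF s(1)] sets_eq_imp_space_eq[OF s(2)] by (simp add: space_pair_measure)
 then have "measure (distr (mu \<Otimes>\<^sub>M \<nu>) borel ta) R = measure (mu \<Otimes>\<^sub>M \<nu>) (A \<times> B)"
  using measure_distr[OF measurable_pair_borel[OF s ta] R(1)] R(2) by simp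
 also have "... = measure mu A * measure \<nu> B" using A s by (intro measure_pair_Times fin) auto
 finally show ?thesis .
qed

lemma integrable_bounded_finite:
 assumes "finite_measure mu" "sets mu = sets borel" "F \<in> borel_measurable borel" "!!x. \<bar>F x\<bar> <= (C::real)"
 shows "integrable mu F"
 using finite_measure.integrable_const_bound[OF assms(1), of F C] assms(3,4)
 by (simp add: measurable_cong_sets[OF assms(2) refl])

lemma integral_pair_borel:
 fixes mu :: "'b::second_countable_topology measure" and \<nu> :: "'c::second_countable_topology measure"
  and F :: "'b \<times> 'c => real"
 assumes fin: "finite_measure mu" "finite_measure \<nu>"
  and s: "sets mu = sets borel" "sets \<nu> = sets borel"
  and F: "F \<in> borel_measurable borel" "!!x. \<bar>F x\<bar> <= C"
 shows "integral\<^sup>L (mu \<Otimes>\<^sub>M \<nu>) F = (LINT x|mu. (LINT y|\<nu>. F (x, y)))"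
  and "integral\<^sup>L (mu \<Otimes>\<^sub>M \<nu>) F = (LINT y|\<nu>. (LINT x|mu. F (x, y)))"
proof -
 interpret a: finite_measure mu by fact
 interpret b: finite_measure \<nu> by fact
 interpret p: pair_sigma_finite mu \<nu> ..
 have i: "integrable (mu \<Otimes>\<^sub>M \<nu>) F"
  by (rule integrable_bounded_finite[OF finite_pair_borel[OF fin] sets_pair_borel[OF s] F])
 show "integral\<^sup>L (mu \<Otimes>\<^sub>M \<nu>) F = (LINT x|mu. (LINT y|\<nu>. F (x, y)))"
  using p.integral_fst'[OF i] by simp
 have "(LINT y|\<nu>. (LINT x|mu. F (x, y))) = integral\<^sup>L (mu \<Otimes>\<^sub>M \<nu>) (case_prod (%x y. F (x, y)))"
  by (rule p.integral_snd) (use i in simp)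
 then show "integral\<^sup>L (mu \<Otimes>\<^sub>M \<nu>) F = (LINT y|\<nu>. (LINT x|mu. F (x, y)))" by simp
qed

lemma integral_distr_pair:
 fixes mu :: "'b::second_countable_topology measure" and \<nu> :: "'c::second_countable_topology measure"
  and ta :: "'b \<times> 'c => 'd::topological_space" and F :: "'d => real"
 assumes fin: "finite_measure mu" "finite_measure \<nu>"
  and s: "sets mu = sets borel" "sets \<nu> = sets borel"
  and ta: "ta \<in> borel_measurable borel" and F: "F \<in> borel_measurable borel" "!!x. \<bar>F x\<bar> <= C"
 shows "integral\<^sup>L (distr (mu \<Otimes>\<^sub>M \<nu>) borel ta) F = (LINT x|mu. (LINT y|\<nu>. F (ta (x, y))))"
  and "integral\<^sup>L (distr (mu \<Otimes>\<^sub>M \<nu>) borel ta) F = (LINT y|\<nu>. (LINT x|mu. F (ta (x, y))))"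
proof -
 have "integral\<^sup>L (distr (mu \<Otimes>\<^sub>M \<nu>) borel ta) F = (LINT p|(mu \<Otimes>\<^sub>M \<nu>). F (ta p))"
  by (rule integral_distr[OF measurable_pair_borel[OF s ta] F(1)])
 moreover have "(%p. F (ta p)) \<in> borel_measurable borel" using measurable_compose[OF ta F(1)] .
 note p = integral_pair_borel[OF fin s this, of C]
 ultimately show "integral\<^sup>L (distr (mu \<Otimes>\<^sub>M \<nu>) borel ta) F = (LINT x|mu. (LINT y|\<nu>. F (ta (x, y))))"
  "integral\<^sup>L (distr (mu \<Otimes>\<^sub>M \<nu>) borel ta) F = (LINT y|\<nu>. (LINT x|mu. F (ta (x, y))))"
  using F(2) by simp_all
qed

text \<open>Lebesgue measure on W, realised as a density so that it lives on the whole space and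
  shares its Borel sets with the other measures.\<close>

definition leb_on :: "'a::euclidean_space set => 'a measure" where
 "leb_on W = density lborel (indicator W)"

lemma sets_leb_on [simp, measurable_cong]: "sets (leb_on W) = sets borel"
 and space_leb_on [simp]: "space (leb_on W) = UNIV"
 by (simp_all add: leb_on_def)

lemma emeasure_leb_on:
 "W \<in> sets borel ==> S \<in> sets borel ==> emeasure (leb_on W) S = emeasure lborel (W Int S)"
 unfolding leb_on_def by (subst emeasure_density) (simp_all add: indicator_inter_arith[symmetric] flip: nn_integral_indicator)

lemma finite_measure_leb_on:
 assumes "W \<in> sets borel" "bounded W" shows "finite_measure (leb_on (W :: 'a::euclidean_space set))"
proof
 show "emeasure (leb_on W) (space (leb_on W)) ~= \<infinity>"
  using emeasure_leb_on[OF assms(1), of UNIV] emeasure_bounded_finite[OF assms(2)] by auto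
qed

lemma integral_leb_on:
 fixes f :: "'a::euclidean_space => real"
 assumes "W \<in> sets borel" "f \<in> borel_measurable borel"
 shows "integral\<^sup>L (leb_on W) f = (LINT x|lborel. indicator W x * f x)"
proof -
 have "leb_on W = density lborel (%x. ennreal (indicator W x))" by (simp add: leb_on_def ennreal_indicator)
 moreover have "integral\<^sup>L (density lborel (%x. ennreal (indicator W x))) f = (LINT x|lborel. indicator W x * f x)"
  using assms by (subst integral_density) auto
 ultimately show ?thesis by simp
qed

lemma nn_integral_leb_on:
 assumes "W \<in> sets borel" "f \<in> borel_measurable borel"
 shows "integral\<^sup>N (leb_on W) f = (\<integral>\<^sup>+x\<in>W. f x \<partial>lborel)"
 using assms unfolding leb_on_def by (subst nn_integral_density) (auto simp: mult.commute)

text \<open>Inverse of the passage to a reduced measure: a base point is drawn from Lebesgue measure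
  on W, and \<open>ta\<close> turns the lags and the base point into a tuple of points. The
  intensity factor stays outside.\<close>

definition unreduce ::
 "'a::euclidean_space set => ((nat => 'a) \<times> 'a => 'b) => (nat => 'a) measure => 'b::topological_space measure" where
 "unreduce W ta rh = distr (rh \<Otimes>\<^sub>M leb_on W) borel ta"

lemma sets_unreduce [simp, measurable_cong]: "sets (unreduce W ta rh) = sets borel"
 and space_unreduce [simp]: "space (unreduce W ta rh) = UNIV"
 by (simp_all add: unreduce_def)

lemma
 fixes W :: "'a::euclidean_space set" and ta :: "(nat => 'a) \<times> 'a => 'b::topological_space"
  and F :: "'b => real"
 assumes rh: "finite_measure rh" and W: "W \<in> sets borel" "bounded W"
  and ta: "ta \<in> borel_measurable (rh \<Otimes>\<^sub>M borel)"
 shows finite_measure_unreduce: "finite_measure (unreduce W ta rh)"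
  and integral_unreduce: "F \<in> borel_measurable borel ==> (!!x. \<bar>F x\<bar> <= C) ==>
   integral\<^sup>L (unreduce W ta rh) F = (LINT x|lborel. indicator W x * (LINT f|rh. F (ta (f, x))))"
proof -
 interpret a: finite_measure rh by fact
 interpret b: finite_measure "leb_on W" by (rule finite_measure_leb_on[OF W])
 interpret p: pair_sigma_finite rh "leb_on W" ..
 interpret ab: finite_measure "rh \<Otimes>\<^sub>M leb_on W" by (rule finite_pair_borel) unfold_locales
 have tam: "ta \<in> borel_measurable (rh \<Otimes>\<^sub>M leb_on W)"
  using ta measurable_cong_sets[OF sets_pair_measure_cong[OF refl sets_leb_on] refl] by blast
 show "finite_measure (unreduce W ta rh)"
  unfolding unreduce_def by (rule ab.finite_measure_distr[OF tam])
 assume F: "F \<in> borel_measurable borel" "!!x. \<bar>F x\<bar> <= C"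
 have Fm: "(%q. F (ta q)) \<in> borel_measurable (rh \<Otimes>\<^sub>M leb_on W)" using measurable_compose[OF tam F(1)] .
 have i: "integrable (rh \<Otimes>\<^sub>M leb_on W) (%q. F (ta q))"
  by (rule ab.integrable_const_bound[where B=C]) (use F Fm in auto)
 have "integral\<^sup>L (unreduce W ta rh) F = (LINT q|(rh \<Otimes>\<^sub>M leb_on W). F (ta q))"
  unfolding unreduce_def by (rule integral_distr[OF tam F(1)])
 also have "... = (LINT x|leb_on W. (LINT f|rh. F (ta (f, x))))"
 proof -
  have "(LINT x|leb_on W. (LINT f|rh. F (ta (f, x)))) = integral\<^sup>L (rh \<Otimes>\<^sub>M leb_on W) (case_prod (%f x. F (ta (f, x))))"
   by (rule p.integral_snd) (use i in \<open>simp add: case_prod_unfold\<close>)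
  then show ?thesis by (simp add: case_prod_unfold)
 qed
 also have "... = (LINT x|lborel. indicator W x * (LINT f|rh. F (ta (f, x))))"
 proof (rule integral_leb_on[OF W(1)])
  have "(%q. F (ta q)) \<in> borel_measurable (rh \<Otimes>\<^sub>M borel)" using measurable_compose[OF ta F(1)] .
  then have "(%(x, f). F (ta (f, x))) \<in> borel_measurable (borel \<Otimes>\<^sub>M rh)"
   by (subst (asm) measurable_pair_swap_iff) (simp add: case_prod_unfold)
  then show "(%x. \<integral>f. F (ta (f, x)) \<partial>rh) \<in> borel_measurable borel"
   using a.borel_measurable_lebesgue_integral by simp
 qed
 finally show "integral\<^sup>L (unreduce W ta rh) F = (LINT x|lborel. indicator W x * (LINT f|rh. F (ta (f, x))))" .
qed

text \<open>For a rectangle R the section of its preimage at base point x is the shifted rectangle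
  of lags if x lies in the last side, and empty otherwise. These formulas recover exactly the
  integrals in the definitions of reduced moment and cumulant measures.\<close>

lemma
 fixes W :: "'a::euclidean_space set" and ta :: "(nat => 'a) \<times> 'a => 'b::topological_space"
 assumes rh: "finite_measure rh" and W: "W \<in> sets borel" "bounded W"
  and ta: "ta \<in> borel_measurable (rh \<Otimes>\<^sub>M borel)"
  and A: "A k \<in> sets borel" "A k \<subseteq> W" and R: "R \<in> sets borel"
  and iff: "!!f x. f \<in> space rh ==> ta (f, x) \<in> R \<longleftrightarrow> x \<in> A k & f \<in> rect_minus k A x"
  and sub: "!!x. rect_minus k A x \<subseteq> space rh"
 shows unreduce_rect: "measure (unreduce W ta rh) R = (LINT x:A k|lborel. measure rh (rect_minus k A x))"
  and integrable_unreduce_rect: "set_integrable lborel (A k) (%x. measure rh (rect_minus k A x))"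
  and nn_unreduce_rect: "emeasure (unreduce W ta rh) R = (\<integral>\<^sup>+x\<in>A k. emeasure rh (rect_minus k A x) \<partial>lborel)"
proof -
 interpret a: finite_measure rh by fact
 interpret b: finite_measure "leb_on W" by (rule finite_measure_leb_on[OF W])
 interpret p: pair_sigma_finite rh "leb_on W" ..
 note [measurable] = A(1) W(1)
 have tam: "ta \<in> borel_measurable (rh \<Otimes>\<^sub>M leb_on W)"
  using ta measurable_cong_sets[OF sets_pair_measure_cong[OF refl sets_leb_on] refl] by blast
 define Q where "Q = ta -` R Int space (rh \<Otimes>\<^sub>M leb_on W)"
 have Q: "Q \<in> sets (rh \<Otimes>\<^sub>M leb_on W)" unfolding Q_def by (rule measurable_sets[OF tam R])
 \<comment> \<open>The base point is the last coordinate, so it must lie in A k; the remaining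
   coordinates are conditions on lags alone.\<close>
 have sec: "(%f. (f, x)) -` Q = (if x \<in> A k then rect_minus k A x else {})" for x
 proof (rule set_eqI)
  fix f
  have "f \<in> (%f. (f, x)) -` Q \<longleftrightarrow> f \<in> space rh & ta (f, x) \<in> R"
   by (simp add: Q_def space_pair_measure conj_commute)
  also have "... \<longleftrightarrow> f \<in> space rh & x \<in> A k & f \<in> rect_minus k A x" using iff by blast
  also have "... \<longleftrightarrow> f \<in> (if x \<in> A k then rect_minus k A x else {})" using sub[of x] by (simp only: if_splits subset_iff) blast
  finally show "f \<in> (%f. (f, x)) -` Q \<longleftrightarrow> f \<in> (if x \<in> A k then rect_minus k A x else {})" .
 qed
 have m: "(%x. emeasure rh ((%f. (f, x)) -` Q)) \<in> borel_measurable borel"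
  using p.measurable_emeasure_Pair2[OF Q] by simp
 have "emeasure (unreduce W ta rh) R = emeasure (rh \<Otimes>\<^sub>M leb_on W) Q"
  unfolding unreduce_def Q_def by (rule emeasure_distr[OF tam R])
 also have "... = (\<integral>\<^sup>+x. emeasure rh ((%f. (f, x)) -` Q) \<partial>leb_on W)"
  by (rule p.emeasure_pair_measure_alt2[OF Q])
 also have "... = (\<integral>\<^sup>+x\<in>W. emeasure rh ((%f. (f, x)) -` Q) \<partial>lborel)"
  by (rule nn_integral_leb_on[OF W(1) m])
 also have "... = (\<integral>\<^sup>+x\<in>A k. emeasure rh (rect_minus k A x) \<partial>lborel)"
  using A(2) by (intro nn_integral_cong) (auto simp: sec indicator_def)
 finally show e: "emeasure (unreduce W ta rh) R = (\<integral>\<^sup>+x\<in>A k. emeasure rh (rect_minus k A x) \<partial>lborel)" .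
 have eq: "indicator (A k) x *\<^sub>R measure rh (rect_minus k A x) = enn2real (emeasure rh ((%f. (f, x)) -` Q))" for x
  unfolding sec by (simp add: measure_def indicator_def)
 have eqn: "ennreal (indicator (A k) x *\<^sub>R measure rh (rect_minus k A x)) = emeasure rh (rect_minus k A x) * indicator (A k) x" for x
  by (simp add: indicator_def a.emeasure_eq_measure)
 have mr: "(%x. indicator (A k) x *\<^sub>R measure rh (rect_minus k A x)) \<in> borel_measurable lborel"
  unfolding eq using m by simp
 interpret u: finite_measure "unreduce W ta rh" by (rule finite_measure_unreduce[OF rh W ta])
 show "set_integrable lborel (A k) (%x. measure rh (rect_minus k A x))"
  unfolding set_integrable_def
 proof (rule integrableI_bounded[OF mr])
  have "(\<integral>\<^sup>+x. ennreal (norm (indicator (A k) x *\<^sub>R measure rh (rect_minus k A x))) \<partial>lborel)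
    = emeasure (unreduce W ta rh) R"
   unfolding e
  proof (rule nn_integral_cong)
   fix x
   have "norm (indicator (A k) x *\<^sub>R measure rh (rect_minus k A x)) = indicator (A k) x *\<^sub>R measure rh (rect_minus k A x)"
    by (simp add: abs_mult)
   then show "ennreal (norm (indicator (A k) x *\<^sub>R measure rh (rect_minus k A x))) = emeasure rh (rect_minus k A x) * indicator (A k) x"
    by (simp only: eqn)
  qed
  also have "... < \<infinity>" by (simp add: u.emeasure_eq_measure)
  finally show "(\<integral>\<^sup>+x. ennreal (norm (indicator (A k) x *\<^sub>R measure rh (rect_minus k A x))) \<partial>lborel) < \<infinity>" .
 qed
 have "(LINT x:A k|lborel. measure rh (rect_minus k A x))
   = enn2real (\<integral>\<^sup>+x. ennreal (indicator (A k) x *\<^sub>R measure rh (rect_minus k A x)) \<partial>lborel)"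
  unfolding set_lebesgue_integral_def by (rule integral_eq_nn_integral[OF mr]) simp
 also have "... = measure (unreduce W ta rh) R" unfolding eqn e[symmetric] by (simp add: measure_def)
 finally show "measure (unreduce W ta rh) R = (LINT x:A k|lborel. measure rh (rect_minus k A x))" by simp
qed

text \<open>From lags to points: the last point is the base point, as in the definition of the
  reduced measures, and the other points are reached by adding it to the lags.\<close>

definition tau2 :: "(nat => 'a::ab_group_add) \<times> 'a => 'a \<times> 'a" where
 "tau2 p = (fst p 1 + snd p, snd p)"
definition tau3 :: "(nat => 'a::ab_group_add) \<times> 'a => 'a \<times> 'a \<times> 'a" where
 "tau3 p = (fst p 1 + snd p, fst p 2 + snd p, snd p)"
definition tau4 :: "(nat => 'a::ab_group_add) \<times> 'a => 'a \<times> 'a \<times> 'a \<times> 'a" where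
 "tau4 p = (fst p 1 + snd p, fst p 2 + snd p, fst p 3 + snd p, snd p)"

lemma red_component_measurable:
 assumes "sets rh = sets (red_borel k :: (nat => 'a::euclidean_space) measure)" "i \<in> {1..<k}"
 shows "(%p. fst p i + snd p) \<in> borel_measurable (rh \<Otimes>\<^sub>M borel)"
proof -
 have "(%f. f i) \<in> measurable rh borel"
  using measurable_component_singleton[OF assms(2), of "%_. borel"] measurable_cong_sets[OF assms(1) refl] by blast
 then have "(%p. fst p i) \<in> borel_measurable (rh \<Otimes>\<^sub>M borel)" by (rule measurable_compose[OF measurable_fst])
 then show ?thesis by (intro borel_measurable_add) auto
qed

lemma tau_measurable:
 "sets rh = sets (red_borel 2 :: (nat => 'a::euclidean_space) measure) ==> tau2 \<in> borel_measurable (rh \<Otimes>\<^sub>M borel)"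
 "sets rh = sets (red_borel 3 :: (nat => 'a::euclidean_space) measure) ==> tau3 \<in> borel_measurable (rh \<Otimes>\<^sub>M borel)"
 "sets rh = sets (red_borel 4 :: (nat => 'a::euclidean_space) measure) ==> tau4 \<in> borel_measurable (rh \<Otimes>\<^sub>M borel)"
proof -
 have i: "1 \<in> {1..<2::nat}" "1 \<in> {1..<3::nat}" "2 \<in> {1..<3::nat}" "1 \<in> {1..<4::nat}" "2 \<in> {1..<4::nat}" "3 \<in> {1..<4::nat}"
  by simp_all
 note r = red_component_measurable
 { assume s: "sets rh = sets (red_borel 2 :: (nat => 'a::euclidean_space) measure)"
  show "tau2 \<in> borel_measurable (rh \<Otimes>\<^sub>M borel)"
   unfolding tau2_def[abs_def] by (intro borel_measurable_Pair r[OF s i(1)] measurable_snd) }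
 { assume s: "sets rh = sets (red_borel 3 :: (nat => 'a::euclidean_space) measure)"
  show "tau3 \<in> borel_measurable (rh \<Otimes>\<^sub>M borel)"
   unfolding tau3_def[abs_def] by (intro borel_measurable_Pair r[OF s i(2)] r[OF s i(3)] measurable_snd) }
 { assume s: "sets rh = sets (red_borel 4 :: (nat => 'a::euclidean_space) measure)"
  show "tau4 \<in> borel_measurable (rh \<Otimes>\<^sub>M borel)"
   unfolding tau4_def[abs_def] by (intro borel_measurable_Pair r[OF s i(4)] r[OF s i(5)] r[OF s i(6)] measurable_snd) }
qed

lemma space_red:
 "sets rh = sets (red_borel k :: (nat => 'a::euclidean_space) measure) ==> space rh = (\<Pi>\<^sub>E i\<in>{1..<k}. UNIV)"
 using sets_eq_imp_space_eq[of rh "red_borel k"] by (simp add: space_PiM)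

lemma mem_rect_minus:
 assumes "f \<in> (\<Pi>\<^sub>E i\<in>{1..<k}. UNIV)"
 shows "f \<in> rect_minus k A x \<longleftrightarrow> (\<forall>l\<in>{1..<k}. f l + x \<in> (A l :: 'a::ab_group_add set))"
proof -
 have "f l \<in> (%y. y - x) ` A l \<longleftrightarrow> f l + x \<in> A l" for l
  by (auto simp: image_iff) (metis add_diff_cancel_right')
 then show ?thesis using assms by (auto simp: PiE_iff)
qed

lemma ball_red: "(\<forall>l\<in>{1..<2::nat}. P l) \<longleftrightarrow> P 1" "(\<forall>l\<in>{1..<3::nat}. P l) \<longleftrightarrow> P 1 & P 2"
 "(\<forall>l\<in>{1..<4::nat}. P l) \<longleftrightarrow> P 1 & P 2 & P 3"
proof -
 have "{1..<2::nat} = {1}" "{1..<3::nat} = {1, 2}" "{1..<4::nat} = {1, 2, 3}" by auto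
 then show "(\<forall>l\<in>{1..<2::nat}. P l) \<longleftrightarrow> P 1" "(\<forall>l\<in>{1..<3::nat}. P l) \<longleftrightarrow> P 1 & P 2"
  "(\<forall>l\<in>{1..<4::nat}. P l) \<longleftrightarrow> P 1 & P 2 & P 3" by simp_all
qed

section \<open>Moment-cumulant identities of orders two, three and four on a window\<close>

context B4_process
begin

definition "gp k = fst (gamma_red M N k)"
definition "gm k = snd (gamma_red M N k)"

lemma reduced_cumulant: "k \<in> {2, 3, 4} ==> is_reduced_cumulant M N k (gamma_red M N k)"
 and total_variation_finite: "k \<in> {2, 3, 4} ==> total_variation (gamma_red M N k) < \<infinity>"
 using B4 unfolding B4_mixing_def by blast+

lemma sets_gp: "k \<in> {2, 3, 4} ==> sets (gp k) = sets (red_borel k)"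
 and sets_gm: "k \<in> {2, 3, 4} ==> sets (gm k) = sets (red_borel k)"
 using reduced_cumulant unfolding is_reduced_cumulant_def jordan_pair_def gp_def gm_def by blast+

lemma finite_gp: "k \<in> {2, 3, 4} ==> finite_measure (gp k)"
 and finite_gm: "k \<in> {2, 3, 4} ==> finite_measure (gm k)"
 using total_variation_finite[of k] unfolding total_variation_def gp_def gm_def
 by (auto intro!: finite_measureI)

text \<open>Finite total variation makes both Jordan parts finite measures, so the integral of their
  difference over the last side splits into two integrals, each of them a section formula for
  \<open>unreduce\<close>.\<close>

lemma fact_cumulant_unreduce:
 fixes ta :: "(nat => 'a) \<times> 'a => 'b::topological_space"
 assumes k: "k \<in> {2, 3, 4}" and W: "W \<in> sets borel" "bounded W"
  and A: "!!l. A l \<in> sets borel" "!!l. A l \<subseteq> W"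
  and ta: "!!rh. sets rh = sets (red_borel k) ==> ta \<in> borel_measurable (rh \<Otimes>\<^sub>M borel)" and R: "R \<in> sets borel"
  and iff: "!!f x. f \<in> (\<Pi>\<^sub>E i\<in>{1..<k}. UNIV) ==> ta (f, x) \<in> R \<longleftrightarrow> x \<in> A k & f \<in> rect_minus k A x"
 shows "fact_cumulant M N k A = lam * (measure (unreduce W ta (gp k)) R - measure (unreduce W ta (gm k)) R)"
proof -
 have bA: "bounded (A l)" for l using bounded_subset[OF W(2) A(2)] .
 have "fact_cumulant M N k A = lam * (LINT x:A k|lborel. signed_val (gamma_red M N k) (rect_minus k A x))"
  using reduced_cumulant[OF k] A(1) bA unfolding is_reduced_cumulant_def by blast
 also have "(LINT x:A k|lborel. signed_val (gamma_red M N k) (rect_minus k A x))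
   = (LINT x:A k|lborel. measure (gp k) (rect_minus k A x) - measure (gm k) (rect_minus k A x))"
  by (simp add: signed_val_def gp_def gm_def)
 also have "... = measure (unreduce W ta (gp k)) R - measure (unreduce W ta (gm k)) R"
 proof -
  have sub: "rect_minus k A x \<subseteq> (\<Pi>\<^sub>E i\<in>{1..<k}. UNIV)" for x by (intro PiE_mono) auto
  note up = finite_gp[OF k] W ta[OF sets_gp[OF k]] A(1) A(2) R
  note um = finite_gm[OF k] W ta[OF sets_gm[OF k]] A(1) A(2) R
  have p: "measure (unreduce W ta (gp k)) R = (LINT x:A k|lborel. measure (gp k) (rect_minus k A x))"
   "set_integrable lborel (A k) (%x. measure (gp k) (rect_minus k A x))"
   using unreduce_rect[OF up, unfolded space_red[OF sets_gp[OF k]], OF iff sub]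
    integrable_unreduce_rect[OF up, unfolded space_red[OF sets_gp[OF k]], OF iff sub] by simp_all
  have m: "measure (unreduce W ta (gm k)) R = (LINT x:A k|lborel. measure (gm k) (rect_minus k A x))"
   "set_integrable lborel (A k) (%x. measure (gm k) (rect_minus k A x))"
   using unreduce_rect[OF um, unfolded space_red[OF sets_gm[OF k]], OF iff sub]
    integrable_unreduce_rect[OF um, unfolded space_red[OF sets_gm[OF k]], OF iff sub] by simp_all
  show ?thesis unfolding p(1) m(1) by (rule set_integral_diff(2)[OF p(2) m(2)])
 qed
 finally show ?thesis .
qed

lemma fact_cumulant_unreduce2:
 assumes W: "W \<in> sets borel" "bounded W" and A: "!!l. A l \<in> sets borel" "!!l. A l \<subseteq> W"
 shows "fact_cumulant M N 2 A
  = lam * (measure (unreduce W tau2 (gp 2)) (A 1 \<times> A 2) - measure (unreduce W tau2 (gm 2)) (A 1 \<times> A 2))"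
proof (rule fact_cumulant_unreduce[OF _ W A])
 show "tau2 (f, x) \<in> A 1 \<times> A 2 \<longleftrightarrow> x \<in> A 2 & f \<in> rect_minus 2 A x"
  if "f \<in> (\<Pi>\<^sub>E i\<in>{1..<2}. UNIV)" for f x
  unfolding mem_rect_minus[OF that] ball_red tau2_def by auto
 show "A 1 \<times> A 2 \<in> sets borel" by (intro borel_Times A)
qed (simp_all add: tau_measurable)

lemma fact_cumulant_unreduce3:
 assumes W: "W \<in> sets borel" "bounded W" and A: "!!l. A l \<in> sets borel" "!!l. A l \<subseteq> W"
 shows "fact_cumulant M N 3 A
  = lam * (measure (unreduce W tau3 (gp 3)) (A 1 \<times> A 2 \<times> A 3) - measure (unreduce W tau3 (gm 3)) (A 1 \<times> A 2 \<times> A 3))"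
proof (rule fact_cumulant_unreduce[OF _ W A])
 show "tau3 (f, x) \<in> A 1 \<times> A 2 \<times> A 3 \<longleftrightarrow> x \<in> A 3 & f \<in> rect_minus 3 A x"
  if "f \<in> (\<Pi>\<^sub>E i\<in>{1..<3}. UNIV)" for f x
  unfolding mem_rect_minus[OF that] ball_red tau3_def by auto
 show "A 1 \<times> A 2 \<times> A 3 \<in> sets borel" by (intro borel_Times A)
qed (simp_all add: tau_measurable)

lemma fact_cumulant_unreduce4:
 assumes W: "W \<in> sets borel" "bounded W" and A: "!!l. A l \<in> sets borel" "!!l. A l \<subseteq> W"
 shows "fact_cumulant M N 4 A
  = lam * (measure (unreduce W tau4 (gp 4)) (A 1 \<times> A 2 \<times> A 3 \<times> A 4) - measure (unreduce W tau4 (gm 4)) (A 1 \<times> A 2 \<times> A 3 \<times> A 4))"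
proof (rule fact_cumulant_unreduce[OF _ W A])
 show "tau4 (f, x) \<in> A 1 \<times> A 2 \<times> A 3 \<times> A 4 \<longleftrightarrow> x \<in> A 4 & f \<in> rect_minus 4 A x"
  if "f \<in> (\<Pi>\<^sub>E i\<in>{1..<4}. UNIV)" for f x
  unfolding mem_rect_minus[OF that] ball_red tau4_def by auto
 show "A 1 \<times> A 2 \<times> A 3 \<times> A 4 \<in> sets borel" by (intro borel_Times A)
qed (simp_all add: tau_measurable)

text \<open>The second moment measure minus the products of first moments minus the cumulant
  measure, the latter entering through its Jordan parts with coefficients -lam and lam. As a signed
  measure on W x W this combination is zero.\<close>

definition cumulant_terms2 :: "'a set => (real \<times> ('a \<times> 'a) measure) list" where
 "cumulant_terms2 W = [(1, mom2 W),
  (-1, distr (m11 W) borel (%p. (fst p, snd p))),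
  (- lam, unreduce W tau2 (gp 2)), (lam, unreduce W tau2 (gm 2))]"

lemmas pair_rules = finite_measure_distr_pair finite_pair_borel measurable_pair_borel sets_pair_borel

lemma cumulant_terms2_finite:
 assumes W: "W \<in> sets borel" "bounded W" and p: "p \<in> set (cumulant_terms2 W)"
 shows "finite_measure (snd p) & sets (snd p) = sets borel"
proof -
 note f = finite_measure_mom[OF W]
 have e0: "finite_measure (distr (m11 W) borel (%p. (fst p, snd p)))"
  by (intro pair_rules f sets_mom
    borel_cont)
 have u: "finite_measure (unreduce W tau2 (gp 2))" "finite_measure (unreduce W tau2 (gm 2))"
  by (intro finite_measure_unreduce W finite_gp finite_gm tau_measurable sets_gp sets_gm; simp)+
 show ?thesis using p e0 u f(2) unfolding cumulant_terms2_def by auto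
qed

lemma cumulant_terms2_rect:
 fixes A :: "nat => 'a set"
 assumes W: "W \<in> sets borel" "bounded W" and A: "!!l. A l \<in> sets borel" "!!l. A l \<subseteq> W"
 shows "lin_comb (cumulant_terms2 W) (%mu. measure mu (A 1 \<times> A 2)) = 0"
proof -
 note f = finite_measure_mom[OF W]
 note fp = f finite_pair_borel[OF f(1) f(1)] finite_pair_borel[OF f(1) finite_pair_borel[OF f(1) f(1)]]
 note sp = sets_mom[of W] sets_pair_borel[OF sets_mom(1)[of W] sets_mom(1)[of W]] sets_pair_borel[OF sets_mom(1)[of W] sets_pair_borel[OF sets_mom(1)[of W] sets_mom(1)[of W]]]
 note Ab = A(1) borel_Times
 have m1: "enn2real (fact_moment M N {a} A) = measure (mom1 W) (A a)" for a :: nat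
  using fact_moment_1[OF W A(1) A(2)] by (simp add: mom1_def measure_def)
 have m2: "enn2real (fact_moment M N {a, b} A) = measure (mom2 W) (A a \<times> A b)" if "a ~= b" for a b :: nat
  using fact_moment_2[OF W that A(1) A(1) A(2) A(2)] by (simp add: mom2_def measure_def)
 have p11: "measure (m11 W) (A a \<times> A b) = measure (mom1 W) (A a) * measure (mom1 W) (A b)" for a b
  by (rule measure_pair_Times) (simp_all add: f A)
 have e0: "measure (distr (m11 W) borel (%p. (fst p, snd p))) (A 1 \<times> A 2)
  = measure (mom1 W) (A 1) * measure (mom1 W) (A 2)"
  by (subst measure_distr_pair[where A="(A 1)" and B="(A 2)"])
   (rule sp fp | (auto simp: A Ab intro!: borel_cont)[1])+
 have c: "fact_cumulant M N 2 A = lam * (measure (unreduce W tau2 (gp 2)) (A 1 \<times> A 2) - measure (unreduce W tau2 (gm 2)) (A 1 \<times> A 2))"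
  by (rule fact_cumulant_unreduce2[OF W A])
 show ?thesis
  using c[unfolded fact_cumulant_2 Let_def]
  unfolding cumulant_terms2_def lin_comb.simps prod.sel e0
  by (simp add: m1 m2 algebra_simps)
qed

text \<open>Cumulants are defined on rectangles only; this transfers the defining identity to
  bounded functions carried by the window. The same is done for orders three and four.\<close>

lemma cumulant_terms2_integral:
 assumes W: "W \<in> sets borel" "bounded W"
  and F: "F \<in> borel_measurable borel" "!!p. \<bar>F p\<bar> <= C" "!!p. p \<notin> W \<times> W ==> F p = (0::real)"
 shows "lin_comb (cumulant_terms2 W) (%mu. integral\<^sup>L mu F) = 0"
proof (rule lin_comb_vanishes[OF rects2 cumulant_terms2_finite[OF W] _ _ F])
 show "W \<times> W \<in> sets borel" by (intro borel_Times W)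
 fix S :: "('a \<times> 'a) set" assume "S \<in> rects2"
 then obtain a b where S: "S = a \<times> b" and b: "a \<in> sets borel" "b \<in> sets borel"
  unfolding rects2_def by blast
 define A where "A l = W Int (if l = 1 then a else b)" for l :: nat
 have "(W \<times> W) Int S = A 1 \<times> A 2" unfolding S A_def by auto
 moreover have "lin_comb (cumulant_terms2 W) (%mu. measure mu (A 1 \<times> A 2)) = 0"
  by (rule cumulant_terms2_rect[OF W]) (use b W in \<open>auto simp: A_def\<close>)
 ultimately show "lin_comb (cumulant_terms2 W) (%mu. measure mu ((W \<times> W) Int S)) = 0" by simp
qed
definition cumulant_terms3 :: "'a set => (real \<times> ('a \<times> 'a \<times> 'a) measure) list" where
 "cumulant_terms3 W = [(1, mom3 W),
  (-1, distr (m21 W) borel arrange6),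
  (-1, distr (m21 W) borel arrange8),
  (-1, distr (m21 W) borel arrange15),
  (2, distr (m111 W) borel arrange13),
  (- lam, unreduce W tau3 (gp 3)), (lam, unreduce W tau3 (gm 3))]"

lemma cumulant_terms3_finite:
 assumes W: "W \<in> sets borel" "bounded W" and p: "p \<in> set (cumulant_terms3 W)"
 shows "finite_measure (snd p) & sets (snd p) = sets borel"
proof -
 note f = finite_measure_mom[OF W]
 have e0: "finite_measure (distr (m21 W) borel arrange6)"
  by (intro pair_rules f sets_mom
    borel_cont)
 have e1: "finite_measure (distr (m21 W) borel arrange8)"
  by (intro pair_rules f sets_mom
    borel_cont)
 have e2: "finite_measure (distr (m21 W) borel arrange15)"
  by (intro pair_rules f sets_mom
    borel_cont)
 have e3: "finite_measure (distr (m111 W) borel arrange13)"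
  by (intro pair_rules f sets_mom
    borel_cont)
 have u: "finite_measure (unreduce W tau3 (gp 3))" "finite_measure (unreduce W tau3 (gm 3))"
  by (intro finite_measure_unreduce W finite_gp finite_gm tau_measurable sets_gp sets_gm; simp)+
 show ?thesis using p e0 e1 e2 e3 u f(3) unfolding cumulant_terms3_def by auto
qed

lemma cumulant_terms3_rect:
 fixes A :: "nat => 'a set"
 assumes W: "W \<in> sets borel" "bounded W" and A: "!!l. A l \<in> sets borel" "!!l. A l \<subseteq> W"
 shows "lin_comb (cumulant_terms3 W) (%mu. measure mu (A 1 \<times> A 2 \<times> A 3)) = 0"
proof -
 note f = finite_measure_mom[OF W]
 note fp = f finite_pair_borel[OF f(1) f(1)] finite_pair_borel[OF f(1) finite_pair_borel[OF f(1) f(1)]]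
 note sp = sets_mom[of W] sets_pair_borel[OF sets_mom(1)[of W] sets_mom(1)[of W]] sets_pair_borel[OF sets_mom(1)[of W] sets_pair_borel[OF sets_mom(1)[of W] sets_mom(1)[of W]]]
 note Ab = A(1) borel_Times
 have m1: "enn2real (fact_moment M N {a} A) = measure (mom1 W) (A a)" for a :: nat
  using fact_moment_1[OF W A(1) A(2)] by (simp add: mom1_def measure_def)
 have m2: "enn2real (fact_moment M N {a, b} A) = measure (mom2 W) (A a \<times> A b)" if "a ~= b" for a b :: nat
  using fact_moment_2[OF W that A(1) A(1) A(2) A(2)] by (simp add: mom2_def measure_def)
 have m3: "enn2real (fact_moment M N {a, b, c} A) = measure (mom3 W) (A a \<times> A b \<times> A c)"
  if "a ~= b" "a ~= c" "b ~= c" for a b c :: nat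
  using fact_moment_3[OF W that A(1) A(1) A(1) A(2) A(2) A(2)] by (simp add: mom3_def measure_def)
 have p11: "measure (m11 W) (A a \<times> A b) = measure (mom1 W) (A a) * measure (mom1 W) (A b)" for a b
  by (rule measure_pair_Times) (simp_all add: f A)
 have e0: "measure (distr (m21 W) borel arrange6) (A 1 \<times> A 2 \<times> A 3)
  = measure (mom2 W) (A 1 \<times> A 2) * measure (mom1 W) (A 3)"
  by (subst measure_distr_pair[where A="(A 1 \<times> A 2)" and B="(A 3)"])
   (rule sp fp | (auto simp: A Ab intro!: borel_cont)[1])+
 have e1: "measure (distr (m21 W) borel arrange8) (A 1 \<times> A 2 \<times> A 3)
  = measure (mom2 W) (A 1 \<times> A 3) * measure (mom1 W) (A 2)"
  by (subst measure_distr_pair[where A="(A 1 \<times> A 3)" and B="(A 2)"])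
   (rule sp fp | (auto simp: A Ab intro!: borel_cont)[1])+
 have e2: "measure (distr (m21 W) borel arrange15) (A 1 \<times> A 2 \<times> A 3)
  = measure (mom2 W) (A 2 \<times> A 3) * measure (mom1 W) (A 1)"
  by (subst measure_distr_pair[where A="(A 2 \<times> A 3)" and B="(A 1)"])
   (rule sp fp | (auto simp: A Ab intro!: borel_cont)[1])+
 have e3: "measure (distr (m111 W) borel arrange13) (A 1 \<times> A 2 \<times> A 3)
  = measure (mom1 W) (A 1) * (measure (mom1 W) (A 2) * measure (mom1 W) (A 3))"
  by (subst measure_distr_pair[where A="(A 1)" and B="(A 2 \<times> A 3)"])
   (rule sp fp | (auto simp: A Ab p11 intro!: borel_cont)[1])+
 have c: "fact_cumulant M N 3 A = lam * (measure (unreduce W tau3 (gp 3)) (A 1 \<times> A 2 \<times> A 3) - measure (unreduce W tau3 (gm 3)) (A 1 \<times> A 2 \<times> A 3))"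
  by (rule fact_cumulant_unreduce3[OF W A])
 show ?thesis
  using c[unfolded fact_cumulant_3 Let_def]
  unfolding cumulant_terms3_def lin_comb.simps prod.sel e0 e1 e2 e3
  by (simp add: m1 m2 m3 algebra_simps)
qed

lemma cumulant_terms3_integral:
 assumes W: "W \<in> sets borel" "bounded W"
  and F: "F \<in> borel_measurable borel" "!!p. \<bar>F p\<bar> <= C" "!!p. p \<notin> W \<times> W \<times> W ==> F p = (0::real)"
 shows "lin_comb (cumulant_terms3 W) (%mu. integral\<^sup>L mu F) = 0"
proof (rule lin_comb_vanishes[OF rects3 cumulant_terms3_finite[OF W] _ _ F])
 show "W \<times> W \<times> W \<in> sets borel" by (intro borel_Times W)
 fix S :: "('a \<times> 'a \<times> 'a) set" assume "S \<in> rects3"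
 then obtain a b c where S: "S = a \<times> b \<times> c" and b: "a \<in> sets borel" "b \<in> sets borel" "c \<in> sets borel"
  unfolding rects2_def rects3_def by blast
 define A where "A l = W Int (if l = 1 then a else if l = 2 then b else c)" for l :: nat
 have "(W \<times> W \<times> W) Int S = A 1 \<times> A 2 \<times> A 3" unfolding S A_def by auto
 moreover have "lin_comb (cumulant_terms3 W) (%mu. measure mu (A 1 \<times> A 2 \<times> A 3)) = 0"
  by (rule cumulant_terms3_rect[OF W]) (use b W in \<open>auto simp: A_def\<close>)
 ultimately show "lin_comb (cumulant_terms3 W) (%mu. measure mu ((W \<times> W \<times> W) Int S)) = 0" by simp
qed
text \<open>Besides the full block there are four partitions of type 3+1 and three of type 2+2 with
  coefficient -1, six of type 2+1+1 with coefficient 2, and one into singletons with coefficient -6;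
  the two last entries are the Jordan parts of the cumulant.\<close>

definition cumulant_terms4 :: "'a set => (real \<times> ('a \<times> 'a \<times> 'a \<times> 'a) measure) list" where
 "cumulant_terms4 W = [(1, mom4 W),
  (-1, distr (m31 W) borel arrange1),
  (-1, distr (m31 W) borel arrange2),
  (-1, distr (m31 W) borel arrange7),
  (-1, distr (m31 W) borel arrange14),
  (-1, distr (m22 W) borel arrange5),
  (-1, distr (m22 W) borel arrange3),
  (-1, distr (m22 W) borel arrange4),
  (2, distr (m211 W) borel arrange5),
  (2, distr (m211 W) borel arrange3),
  (2, distr (m211 W) borel arrange4),
  (2, distr (m211 W) borel arrange9),
  (2, distr (m211 W) borel arrange10),
  (2, distr (m211 W) borel arrange11),
  (-6, distr (mom1 W \<Otimes>\<^sub>M (m111 W)) borel arrange12),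
  (- lam, unreduce W tau4 (gp 4)), (lam, unreduce W tau4 (gm 4))]"

lemma cumulant_terms4_finite:
 assumes W: "W \<in> sets borel" "bounded W" and p: "p \<in> set (cumulant_terms4 W)"
 shows "finite_measure (snd p) & sets (snd p) = sets borel"
proof -
 note f = finite_measure_mom[OF W]
 have e0: "finite_measure (distr (m31 W) borel arrange1)"
  by (intro pair_rules f sets_mom
    borel_cont)
 have e1: "finite_measure (distr (m31 W) borel arrange2)"
  by (intro pair_rules f sets_mom
    borel_cont)
 have e2: "finite_measure (distr (m31 W) borel arrange7)"
  by (intro pair_rules f sets_mom
    borel_cont)
 have e3: "finite_measure (distr (m31 W) borel arrange14)"
  by (intro pair_rules f sets_mom
    borel_cont)
 have e4: "finite_measure (distr (m22 W) borel arrange5)"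
  by (intro pair_rules f sets_mom
    borel_cont)
 have e5: "finite_measure (distr (m22 W) borel arrange3)"
  by (intro pair_rules f sets_mom
    borel_cont)
 have e6: "finite_measure (distr (m22 W) borel arrange4)"
  by (intro pair_rules f sets_mom
    borel_cont)
 have e7: "finite_measure (distr (m211 W) borel arrange5)"
  by (intro pair_rules f sets_mom
    borel_cont)
 have e8: "finite_measure (distr (m211 W) borel arrange3)"
  by (intro pair_rules f sets_mom
    borel_cont)
 have e9: "finite_measure (distr (m211 W) borel arrange4)"
  by (intro pair_rules f sets_mom
    borel_cont)
 have e10: "finite_measure (distr (m211 W) borel arrange9)"
  by (intro pair_rules f sets_mom
    borel_cont)
 have e11: "finite_measure (distr (m211 W) borel arrange10)"
  by (intro pair_rules f sets_mom
    borel_cont)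
 have e12: "finite_measure (distr (m211 W) borel arrange11)"
  by (intro pair_rules f sets_mom
    borel_cont)
 have e13: "finite_measure (distr (mom1 W \<Otimes>\<^sub>M (m111 W)) borel arrange12)"
  by (intro pair_rules f sets_mom
    borel_cont)
 have u: "finite_measure (unreduce W tau4 (gp 4))" "finite_measure (unreduce W tau4 (gm 4))"
  by (intro finite_measure_unreduce W finite_gp finite_gm tau_measurable sets_gp sets_gm; simp)+
 show ?thesis using p e0 e1 e2 e3 e4 e5 e6 e7 e8 e9 e10 e11 e12 e13 u f(4) unfolding cumulant_terms4_def by auto
qed

lemma cumulant_terms4_rect:
 fixes A :: "nat => 'a set"
 assumes W: "W \<in> sets borel" "bounded W" and A: "!!l. A l \<in> sets borel" "!!l. A l \<subseteq> W"
 shows "lin_comb (cumulant_terms4 W) (%mu. measure mu (A 1 \<times> A 2 \<times> A 3 \<times> A 4)) = 0"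
proof -
 note f = finite_measure_mom[OF W]
 note fp = f finite_pair_borel[OF f(1) f(1)] finite_pair_borel[OF f(1) finite_pair_borel[OF f(1) f(1)]]
 note sp = sets_mom[of W] sets_pair_borel[OF sets_mom(1)[of W] sets_mom(1)[of W]] sets_pair_borel[OF sets_mom(1)[of W] sets_pair_borel[OF sets_mom(1)[of W] sets_mom(1)[of W]]]
 note Ab = A(1) borel_Times
 have m1: "enn2real (fact_moment M N {a} A) = measure (mom1 W) (A a)" for a :: nat
  using fact_moment_1[OF W A(1) A(2)] by (simp add: mom1_def measure_def)
 have m2: "enn2real (fact_moment M N {a, b} A) = measure (mom2 W) (A a \<times> A b)" if "a ~= b" for a b :: nat
  using fact_moment_2[OF W that A(1) A(1) A(2) A(2)] by (simp add: mom2_def measure_def)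
 have m3: "enn2real (fact_moment M N {a, b, c} A) = measure (mom3 W) (A a \<times> A b \<times> A c)"
  if "a ~= b" "a ~= c" "b ~= c" for a b c :: nat
  using fact_moment_3[OF W that A(1) A(1) A(1) A(2) A(2) A(2)] by (simp add: mom3_def measure_def)
 have m4: "enn2real (fact_moment M N {a, b, c, d} A) = measure (mom4 W) (A a \<times> A b \<times> A c \<times> A d)"
  if "a ~= b" "a ~= c" "b ~= c" "a ~= d" "b ~= d" "c ~= d" for a b c d :: nat
  using fact_moment_4[OF W that A(1) A(1) A(1) A(1) A(2) A(2) A(2) A(2)] by (simp add: mom4_def measure_def)
 have p11: "measure (m11 W) (A a \<times> A b) = measure (mom1 W) (A a) * measure (mom1 W) (A b)" for a b
  by (rule measure_pair_Times) (simp_all add: f A)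
 have p111: "measure (m111 W) (A a \<times> A b \<times> A c)
  = measure (mom1 W) (A a) * (measure (mom1 W) (A b) * measure (mom1 W) (A c))" for a b c
  by (subst measure_pair_Times) (simp_all add: fp sp(5) A Ab p11)
 have e0: "measure (distr (m31 W) borel arrange1) (A 1 \<times> A 2 \<times> A 3 \<times> A 4)
  = measure (mom3 W) (A 1 \<times> A 2 \<times> A 3) * measure (mom1 W) (A 4)"
  by (subst measure_distr_pair[where A="(A 1 \<times> A 2 \<times> A 3)" and B="(A 4)"])
   (rule sp fp | (auto simp: A Ab intro!: borel_cont)[1])+
 have e1: "measure (distr (m31 W) borel arrange2) (A 1 \<times> A 2 \<times> A 3 \<times> A 4)
  = measure (mom3 W) (A 1 \<times> A 2 \<times> A 4) * measure (mom1 W) (A 3)"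
  by (subst measure_distr_pair[where A="(A 1 \<times> A 2 \<times> A 4)" and B="(A 3)"])
   (rule sp fp | (auto simp: A Ab intro!: borel_cont)[1])+
 have e2: "measure (distr (m31 W) borel arrange7) (A 1 \<times> A 2 \<times> A 3 \<times> A 4)
  = measure (mom3 W) (A 1 \<times> A 3 \<times> A 4) * measure (mom1 W) (A 2)"
  by (subst measure_distr_pair[where A="(A 1 \<times> A 3 \<times> A 4)" and B="(A 2)"])
   (rule sp fp | (auto simp: A Ab intro!: borel_cont)[1])+
 have e3: "measure (distr (m31 W) borel arrange14) (A 1 \<times> A 2 \<times> A 3 \<times> A 4)
  = measure (mom3 W) (A 2 \<times> A 3 \<times> A 4) * measure (mom1 W) (A 1)"
  by (subst measure_distr_pair[where A="(A 2 \<times> A 3 \<times> A 4)" and B="(A 1)"])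
   (rule sp fp | (auto simp: A Ab intro!: borel_cont)[1])+
 have e4: "measure (distr (m22 W) borel arrange5) (A 1 \<times> A 2 \<times> A 3 \<times> A 4)
  = measure (mom2 W) (A 1 \<times> A 2) * measure (mom2 W) (A 3 \<times> A 4)"
  by (subst measure_distr_pair[where A="(A 1 \<times> A 2)" and B="(A 3 \<times> A 4)"])
   (rule sp fp | (auto simp: A Ab intro!: borel_cont)[1])+
 have e5: "measure (distr (m22 W) borel arrange3) (A 1 \<times> A 2 \<times> A 3 \<times> A 4)
  = measure (mom2 W) (A 1 \<times> A 3) * measure (mom2 W) (A 2 \<times> A 4)"
  by (subst measure_distr_pair[where A="(A 1 \<times> A 3)" and B="(A 2 \<times> A 4)"])
   (rule sp fp | (auto simp: A Ab intro!: borel_cont)[1])+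
 have e6: "measure (distr (m22 W) borel arrange4) (A 1 \<times> A 2 \<times> A 3 \<times> A 4)
  = measure (mom2 W) (A 1 \<times> A 4) * measure (mom2 W) (A 2 \<times> A 3)"
  by (subst measure_distr_pair[where A="(A 1 \<times> A 4)" and B="(A 2 \<times> A 3)"])
   (rule sp fp | (auto simp: A Ab intro!: borel_cont)[1])+
 have e7: "measure (distr (m211 W) borel arrange5) (A 1 \<times> A 2 \<times> A 3 \<times> A 4)
  = measure (mom2 W) (A 1 \<times> A 2) * (measure (mom1 W) (A 3) * measure (mom1 W) (A 4))"
  by (subst measure_distr_pair[where A="(A 1 \<times> A 2)" and B="(A 3 \<times> A 4)"])
   (rule sp fp | (auto simp: A Ab p11 intro!: borel_cont)[1])+
 have e8: "measure (distr (m211 W) borel arrange3) (A 1 \<times> A 2 \<times> A 3 \<times> A 4)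
  = measure (mom2 W) (A 1 \<times> A 3) * (measure (mom1 W) (A 2) * measure (mom1 W) (A 4))"
  by (subst measure_distr_pair[where A="(A 1 \<times> A 3)" and B="(A 2 \<times> A 4)"])
   (rule sp fp | (auto simp: A Ab p11 intro!: borel_cont)[1])+
 have e9: "measure (distr (m211 W) borel arrange4) (A 1 \<times> A 2 \<times> A 3 \<times> A 4)
  = measure (mom2 W) (A 1 \<times> A 4) * (measure (mom1 W) (A 2) * measure (mom1 W) (A 3))"
  by (subst measure_distr_pair[where A="(A 1 \<times> A 4)" and B="(A 2 \<times> A 3)"])
   (rule sp fp | (auto simp: A Ab p11 intro!: borel_cont)[1])+
 have e10: "measure (distr (m211 W) borel arrange9) (A 1 \<times> A 2 \<times> A 3 \<times> A 4)
  = measure (mom2 W) (A 2 \<times> A 3) * (measure (mom1 W) (A 1) * measure (mom1 W) (A 4))"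
  by (subst measure_distr_pair[where A="(A 2 \<times> A 3)" and B="(A 1 \<times> A 4)"])
   (rule sp fp | (auto simp: A Ab p11 intro!: borel_cont)[1])+
 have e11: "measure (distr (m211 W) borel arrange10) (A 1 \<times> A 2 \<times> A 3 \<times> A 4)
  = measure (mom2 W) (A 2 \<times> A 4) * (measure (mom1 W) (A 1) * measure (mom1 W) (A 3))"
  by (subst measure_distr_pair[where A="(A 2 \<times> A 4)" and B="(A 1 \<times> A 3)"])
   (rule sp fp | (auto simp: A Ab p11 intro!: borel_cont)[1])+
 have e12: "measure (distr (m211 W) borel arrange11) (A 1 \<times> A 2 \<times> A 3 \<times> A 4)
  = measure (mom2 W) (A 3 \<times> A 4) * (measure (mom1 W) (A 1) * measure (mom1 W) (A 2))"
  by (subst measure_distr_pair[where A="(A 3 \<times> A 4)" and B="(A 1 \<times> A 2)"])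
   (rule sp fp | (auto simp: A Ab p11 intro!: borel_cont)[1])+
 have e13: "measure (distr (mom1 W \<Otimes>\<^sub>M (m111 W)) borel arrange12) (A 1 \<times> A 2 \<times> A 3 \<times> A 4)
  = measure (mom1 W) (A 1) * (measure (mom1 W) (A 2) * (measure (mom1 W) (A 3) * measure (mom1 W) (A 4)))"
  by (subst measure_distr_pair[where A="(A 1)" and B="(A 2 \<times> A 3 \<times> A 4)"])
   (rule sp fp | (auto simp: A Ab p111 intro!: borel_cont)[1])+
 have c: "fact_cumulant M N 4 A = lam * (measure (unreduce W tau4 (gp 4)) (A 1 \<times> A 2 \<times> A 3 \<times> A 4) - measure (unreduce W tau4 (gm 4)) (A 1 \<times> A 2 \<times> A 3 \<times> A 4))"
  by (rule fact_cumulant_unreduce4[OF W A])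
 show ?thesis
  using c[unfolded fact_cumulant_4 Let_def]
  unfolding cumulant_terms4_def lin_comb.simps prod.sel e0 e1 e2 e3 e4 e5 e6 e7 e8 e9 e10 e11 e12 e13
  by (simp add: m1 m2 m3 m4 algebra_simps)
qed

lemma cumulant_terms4_integral:
 assumes W: "W \<in> sets borel" "bounded W"
  and F: "F \<in> borel_measurable borel" "!!p. \<bar>F p\<bar> <= C" "!!p. p \<notin> W \<times> W \<times> W \<times> W ==> F p = (0::real)"
 shows "lin_comb (cumulant_terms4 W) (%mu. integral\<^sup>L mu F) = 0"
proof (rule lin_comb_vanishes[OF rects4 cumulant_terms4_finite[OF W] _ _ F])
 show "W \<times> W \<times> W \<times> W \<in> sets borel" by (intro borel_Times W)
 fix S :: "('a \<times> 'a \<times> 'a \<times> 'a) set" assume "S \<in> rects4"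
 then obtain a b c d where S: "S = a \<times> b \<times> c \<times> d" and b: "a \<in> sets borel" "b \<in> sets borel" "c \<in> sets borel" "d \<in> sets borel"
  unfolding rects2_def rects3_def rects4_def by blast
 define A where "A l = W Int (if l = 1 then a else if l = 2 then b else if l = 3 then c else d)" for l :: nat
 have "(W \<times> W \<times> W \<times> W) Int S = A 1 \<times> A 2 \<times> A 3 \<times> A 4" unfolding S A_def by auto
 moreover have "lin_comb (cumulant_terms4 W) (%mu. measure mu (A 1 \<times> A 2 \<times> A 3 \<times> A 4)) = 0"
  by (rule cumulant_terms4_rect[OF W]) (use b W in \<open>auto simp: A_def\<close>)
 ultimately show "lin_comb (cumulant_terms4 W) (%mu. measure mu ((W \<times> W \<times> W \<times> W) Int S)) = 0" by simp
qed

end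

section \<open>Products of sums over points and over pairs\<close>

lemma sum_tuples2:
 assumes "finite S"
 shows "(\<Sum>p\<in>tuples2 S. h p) = (\<Sum>x\<in>S. \<Sum>y\<in>S - {x}. h (x, y) :: real)"
proof -
 have "tuples2 S = (SIGMA x:S. S - {x})" by (auto simp: tuples2_def)
 then show ?thesis using assms by (simp add: sum.Sigma split_def)
qed

lemma sum_tuples3:
 assumes "finite S"
 shows "(\<Sum>p\<in>tuples3 S. h p) = (\<Sum>x\<in>S. \<Sum>y\<in>S - {x}. \<Sum>z\<in>S - {x, y}. h (x, y, z) :: real)"
proof -
 have "tuples3 S = (SIGMA x:S. SIGMA y:S - {x}. S - {x, y})" by (auto simp: tuples3_def)
 then show ?thesis using assms by (simp add: sum.Sigma split_def)
qed

lemma sum_tuples4: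
 assumes "finite S"
 shows "(\<Sum>p\<in>tuples4 S. h p)
  = (\<Sum>x\<in>S. \<Sum>y\<in>S - {x}. \<Sum>z\<in>S - {x, y}. \<Sum>u\<in>S - {x, y, z}. h (x, y, z, u) :: real)"
proof -
 have "tuples4 S = (SIGMA x:S. SIGMA y:S - {x}. SIGMA z:S - {x, y}. S - {x, y, z})" by (auto simp: tuples4_def)
 then show ?thesis using assms by (simp add: sum.Sigma split_def)
qed

lemma sum_tuples3_swap:
 "(\<Sum>p\<in>tuples3 S. h p) = (\<Sum>(x, y, z)\<in>tuples3 S. h (y, x, z))"
 by (rule sum.reindex_bij_witness[where i="%(x, y, z). (y, x, z)" and j="%(x, y, z). (y, x, z)"])
  (auto simp: tuples3_def)

lemma sum_tuples3_rotate:
 "(\<Sum>p\<in>tuples3 S. h p) = (\<Sum>(x, y, z)\<in>tuples3 S. h (y, z, x))"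
 by (rule sum.reindex_bij_witness[where j="%(y, z, x). (x, y, z)" and i="%(x, y, z). (y, z, x)"])
  (auto simp: tuples3_def)

lemma sum_split1: "finite S ==> x \<in> S ==> (\<Sum>z\<in>S. h z) = h x + (\<Sum>z\<in>S - {x}. h z :: real)"
 by (rule sum.remove)

lemma sum_split2:
 assumes "finite S" "x \<in> S" "y \<in> S" "x ~= y"
 shows "(\<Sum>z\<in>S. h z) = h x + h y + (\<Sum>z\<in>S - {x, y}. h z :: real)"
proof -
 have "S - {x} - {y} = S - {x, y}" by auto
 then show ?thesis using sum_split1[of S x h] sum_split1[of "S - {x}" y h] assms by simp
qed

lemma square_sum_points:
 fixes g :: "'a => real"
 assumes S: "finite S"
 shows "(\<Sum>x\<in>S. g x) ^ 2 = (\<Sum>p\<in>tuples2 S. g (fst p) * g (snd p)) + (\<Sum>x\<in>S. (g x)\<^sup>2)"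
proof -
 have "(\<Sum>x\<in>S. g x) ^ 2 = (\<Sum>x\<in>S. g x * (\<Sum>y\<in>S. g y))"
  by (simp add: power2_eq_square sum_distrib_right)
 also have "... = (\<Sum>x\<in>S. g x * (g x + (\<Sum>y\<in>S - {x}. g y)))"
  by (intro sum.cong refl arg_cong2[where f="(*)"] sum_split1 S)
 also have "... = (\<Sum>p\<in>tuples2 S. g (fst p) * g (snd p)) + (\<Sum>x\<in>S. (g x)\<^sup>2)"
  by (simp add: sum_tuples2[OF S] distrib_left sum.distrib power2_eq_square sum_distrib_left)
 finally show ?thesis .
qed

text \<open>The extra point is either new or one of the two points of the pair; by symmetry of f the
  two coincidences contribute equally.\<close>

lemma pair_times_points:
 fixes g :: "'a => real"
 assumes S: "finite S" and sym: "!!x y. f x y = f y x"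
 shows "(\<Sum>p\<in>tuples2 S. f (fst p) (snd p)) * (\<Sum>x\<in>S. g x)
  = (\<Sum>p\<in>tuples3 S. f (fst p) (fst (snd p)) * g (snd (snd p))) + 2 * (\<Sum>p\<in>tuples2 S. f (fst p) (snd p) * g (fst p))"
proof -
 have sw: "(\<Sum>p\<in>tuples2 S. f (fst p) (snd p) * g (snd p)) = (\<Sum>p\<in>tuples2 S. f (fst p) (snd p) * g (fst p))"
  by (rule sum.reindex_bij_witness[where i=prod.swap and j=prod.swap]) (auto simp: tuples2_def sym)
 have "(\<Sum>p\<in>tuples2 S. f (fst p) (snd p)) * (\<Sum>x\<in>S. g x)
   = (\<Sum>x\<in>S. \<Sum>y\<in>S - {x}. f x y * (\<Sum>z\<in>S. g z))"
  by (simp add: sum_tuples2[OF S] sum_distrib_right)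
 also have "... = (\<Sum>x\<in>S. \<Sum>y\<in>S - {x}. f x y * (g x + g y + (\<Sum>z\<in>S - {x, y}. g z)))"
  by (intro sum.cong refl arg_cong2[where f="(*)"] sum_split2 S) auto
 also have "... = (\<Sum>p\<in>tuples3 S. f (fst p) (fst (snd p)) * g (snd (snd p)))
   + (\<Sum>p\<in>tuples2 S. f (fst p) (snd p) * g (fst p)) + (\<Sum>p\<in>tuples2 S. f (fst p) (snd p) * g (snd p))"
  by (simp add: sum_tuples2[OF S] sum_tuples3[OF S] distrib_left sum.distrib sum_distrib_left)
 finally show ?thesis unfolding sw by simp
qed

text \<open>Two ordered pairs share no point, one point, or both. A single common point can be
  chosen in four ways, and an identical unordered pair arises in two orders, whence the factors 4
  and 2.\<close>

lemma square_sum_pairs: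
 fixes f :: "'a => 'a => real"
 assumes S: "finite S" and sym: "!!x y. f x y = f y x"
 shows "(\<Sum>p\<in>tuples2 S. f (fst p) (snd p)) ^ 2
  = (\<Sum>p\<in>tuples4 S. f (fst p) (fst (snd p)) * f (fst (snd (snd p))) (snd (snd (snd p))))
  + 4 * (\<Sum>p\<in>tuples3 S. f (fst p) (fst (snd p)) * f (fst p) (snd (snd p)))
  + 2 * (\<Sum>p\<in>tuples2 S. (f (fst p) (snd p))\<^sup>2)"
proof -
 \<comment> \<open>For a fixed first pair (x, y), the second pair sum is sorted by how many of its
   entries lie in {x, y}.\<close>
 have inner: "(\<Sum>p\<in>tuples2 S. f (fst p) (snd p)) = 2 * f x y + 2 * (\<Sum>u\<in>S - {x, y}. f x u) + 2 * (\<Sum>u\<in>S - {x, y}. f y u)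
   + (\<Sum>z\<in>S - {x, y}. \<Sum>u\<in>S - {x, y, z}. f z u)" if "x \<in> S" "y \<in> S" "x ~= y" for x y
 proof -
  let ?S = "S - {x, y}"
  have 1: "(\<Sum>u\<in>S - {x}. f x u) = f x y + (\<Sum>u\<in>?S. f x u)"
  proof -
   have "S - {x} - {y} = ?S" by auto
   then show ?thesis using sum_split1[of "S - {x}" y "f x"] that S by simp
  qed
  have 2: "(\<Sum>u\<in>S - {y}. f y u) = f x y + (\<Sum>u\<in>?S. f y u)"
  proof -
   have "S - {y} - {x} = ?S" by auto
   then show ?thesis using sum_split1[of "S - {y}" x "f y"] that S sym[of x y] by simp
  qed
  have 3: "(\<Sum>u\<in>S - {z}. f z u) = f x z + f y z + (\<Sum>u\<in>S - {x, y, z}. f z u)" if z: "z \<in> ?S" for z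
  proof -
   have "S - {z} - {x, y} = S - {x, y, z}" by auto
   then show ?thesis using sum_split2[of "S - {z}" x y "f z"] that z \<open>x \<in> S\<close> \<open>y \<in> S\<close> \<open>x ~= y\<close> S sym[of z x] sym[of z y] by auto
  qed
  have "(\<Sum>p\<in>tuples2 S. f (fst p) (snd p)) = (\<Sum>z\<in>S. \<Sum>u\<in>S - {z}. f z u)" by (simp add: sum_tuples2[OF S])
  also have "... = (\<Sum>u\<in>S - {x}. f x u) + (\<Sum>u\<in>S - {y}. f y u) + (\<Sum>z\<in>?S. \<Sum>u\<in>S - {z}. f z u)"
   by (rule sum_split2[OF S that])
  also have "(\<Sum>z\<in>?S. \<Sum>u\<in>S - {z}. f z u) = (\<Sum>z\<in>?S. f x z + f y z + (\<Sum>u\<in>S - {x, y, z}. f z u))"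
   by (intro sum.cong refl 3)
  finally show ?thesis unfolding 1 2 by (simp add: sum.distrib)
 qed
 have sw: "(\<Sum>p\<in>tuples3 S. f (fst p) (fst (snd p)) * f (fst (snd p)) (snd (snd p)))
   = (\<Sum>p\<in>tuples3 S. f (fst p) (fst (snd p)) * f (fst p) (snd (snd p)))"
  by (subst sum_tuples3_swap) (simp add: split_def sym[of "fst (snd _)" "fst _"])
 have "(\<Sum>p\<in>tuples2 S. f (fst p) (snd p)) ^ 2
   = (\<Sum>p\<in>tuples2 S. f (fst p) (snd p)) * (\<Sum>p\<in>tuples2 S. f (fst p) (snd p))"
  by (rule power2_eq_square)
 also have "... = (\<Sum>x\<in>S. \<Sum>y\<in>S - {x}. f x y) * (\<Sum>p\<in>tuples2 S. f (fst p) (snd p))"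
  using sum_tuples2[OF S, of "%p. f (fst p) (snd p)"] by simp
 also have "... = (\<Sum>x\<in>S. \<Sum>y\<in>S - {x}. f x y * (\<Sum>p\<in>tuples2 S. f (fst p) (snd p)))"
  by (simp add: sum_distrib_right)
 also have "... = (\<Sum>x\<in>S. \<Sum>y\<in>S - {x}. f x y * (2 * f x y + 2 * (\<Sum>u\<in>S - {x, y}. f x u) + 2 * (\<Sum>u\<in>S - {x, y}. f y u)
   + (\<Sum>z\<in>S - {x, y}. \<Sum>u\<in>S - {x, y, z}. f z u)))"
  by (intro sum.cong refl arg_cong2[where f="(*)"] inner) auto
 also have "... = (\<Sum>p\<in>tuples4 S. f (fst p) (fst (snd p)) * f (fst (snd (snd p))) (snd (snd (snd p))))
  + 2 * (\<Sum>p\<in>tuples3 S. f (fst p) (fst (snd p)) * f (fst p) (snd (snd p)))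
  + 2 * (\<Sum>p\<in>tuples3 S. f (fst p) (fst (snd p)) * f (fst (snd p)) (snd (snd p)))
  + 2 * (\<Sum>p\<in>tuples2 S. (f (fst p) (snd p))\<^sup>2)"
  by (simp add: sum_tuples2[OF S] sum_tuples3[OF S] sum_tuples4[OF S] distrib_left sum.distrib sum_distrib_left
    power2_eq_square mult.left_commute)
 finally show ?thesis unfolding sw by simp
qed

lemma fst_snd_borel [measurable]:
 "fst \<in> borel_measurable (borel :: ('b::second_countable_topology \<times> 'c::second_countable_topology) measure)"
 "snd \<in> borel_measurable (borel :: ('b \<times> 'c) measure)"
 by (intro borel_cont)+

text \<open>A majorant that factors into a function of the base point and a function of the lags
  yields a product of two integrals, one of which will be a mass of the reduced measure.\<close>

lemma abs_integral_unreduce_le: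
 fixes ta :: "(nat => 'a::euclidean_space) \<times> 'a => 'b::topological_space" and F :: "'b => real"
 assumes rh: "finite_measure rh" and W: "W \<in> sets borel" "bounded W"
  and ta: "ta \<in> borel_measurable (rh \<Otimes>\<^sub>M borel)"
  and F: "F \<in> borel_measurable borel" "!!x. \<bar>F x\<bar> <= C"
  and le: "!!f x. f \<in> space rh ==> x \<in> W ==> \<bar>F (ta (f, x))\<bar> <= \<beta> x * \<kappa> f"
  and \<beta>: "integrable lborel (%x. indicator W x * \<beta> x)" "!!x. 0 <= \<beta> x" and \<kappa>: "integrable rh \<kappa>" "!!f. 0 <= \<kappa> f"
 shows "\<bar>integral\<^sup>L (unreduce W ta rh) F\<bar> <= (LINT x|lborel. indicator W x * \<beta> x) * (LINT f|rh. \<kappa> f)"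
proof -
 have inner: "\<bar>indicator W x * (LINT f|rh. F (ta (f, x)))\<bar> <= indicator W x * \<beta> x * (LINT f|rh. \<kappa> f)" for x
 proof (cases "x \<in> W")
  case True
  have "\<bar>\<integral>f. F (ta (f, x)) \<partial>rh\<bar> <= (LINT f|rh. \<beta> x * \<kappa> f)"
  proof (cases "integrable rh (%f. F (ta (f, x)))")
   case i: True
   have "\<bar>\<integral>f. F (ta (f, x)) \<partial>rh\<bar> <= (LINT f|rh. \<bar>F (ta (f, x))\<bar>)" by (rule integral_abs_bound)
   also have "... <= (LINT f|rh. \<beta> x * \<kappa> f)"
    using i \<kappa>(1) le[OF _ True] by (intro integral_mono) auto
   finally show ?thesis .
  next
   \<comment> \<open>A section integral that does not exist has value 0 by convention, and the bound
     is nonnegative.\<close>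
   case False
   then show ?thesis using \<beta>(2) \<kappa>(2) by (simp add: not_integrable_integral_eq)
  qed
  then show ?thesis using True by simp
 qed simp
 have "\<bar>integral\<^sup>L (unreduce W ta rh) F\<bar> = \<bar>\<integral>x. indicator W x * (LINT f|rh. F (ta (f, x))) \<partial>lborel\<bar>"
  using integral_unreduce[OF rh W ta F] by simp
 also have "... <= (LINT x|lborel. \<bar>indicator W x * (LINT f|rh. F (ta (f, x)))\<bar>)" by (rule integral_abs_bound)
 also have "... <= (LINT x|lborel. indicator W x * \<beta> x * (LINT f|rh. \<kappa> f))"
  using \<beta> \<kappa> by (intro integral_mono' inner integrable_mult_left) (auto intro!: mult_nonneg_nonneg)
 also have "... = (LINT x|lborel. indicator W x * \<beta> x) * (LINT f|rh. \<kappa> f)" by simp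
 finally show ?thesis .
qed

section \<open>Second cumulants and the variance of sums over points\<close>

context B4_process
begin

lemma integral_mom1:
 assumes W: "W \<in> sets borel" "bounded W" and h: "h \<in> borel_measurable borel"
 shows "integral\<^sup>L (mom1 W) h = lam * (\<integral>x. indicator W x * h x \<partial>lborel :: real)"
proof -
 have "mom1 W = density (leb_on W) (%_. ennreal lam)"
 proof (rule measure_eqI)
  fix S assume "S \<in> sets (mom1 W)"
  then have S: "S \<in> sets borel" by simp
  then show "emeasure (mom1 W) S = emeasure (density (leb_on W) (%_. ennreal lam)) S"
   using emeasure_mom1[OF W S] emeasure_leb_on[OF W(1) S] by (simp add: emeasure_density_const)
 qed simp
 then show ?thesis using h intensity_pos integral_leb_on[OF W(1) h]
  by (simp add: integral_density)
qed

lemma measure_mom1: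
 assumes W: "W \<in> sets borel" "bounded W"
 shows "measure (mom1 W) UNIV = lam * vol W"
 using emeasure_mom1[OF W, of UNIV] intensity_pos by (simp add: measure_def enn2real_mult)

definition "gamma_total = measure (gp 2) (space (gp 2)) + measure (gm 2) (space (gm 2))"

lemma gamma_total_nonneg: "0 <= gamma_total" by (simp add: gamma_total_def)

text \<open>The integral of h against the second factorial cumulant measure restricted to the
  window.\<close>

definition "cum2 W h = lam * (integral\<^sup>L (unreduce W tau2 (gp 2)) h - integral\<^sup>L (unreduce W tau2 (gm 2)) h)"

lemma integral_mom2:
 assumes W: "W \<in> sets borel" "bounded W"
  and F: "F \<in> borel_measurable borel" "!!p. \<bar>F p\<bar> <= C" "!!p. p \<notin> W \<times> W ==> F p = 0"
 shows "integral\<^sup>L (mom2 W) F = (LINT x|mom1 W. (LINT y|mom1 W. F (x, y))) + cum2 W F"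
proof -
 have ta: "(%p. (fst p, snd p)) \<in> borel_measurable (borel :: ('a \<times> 'a) measure)" by measurable
 note d = integral_distr_pair(1)[OF finite_measure_mom(1)[OF W] finite_measure_mom(1)[OF W] sets_mom(1) sets_mom(1) ta F(1,2)]
 show ?thesis
  using cumulant_terms2_integral[OF W F] unfolding cumulant_terms2_def lin_comb.simps prod.sel d
  by (simp add: cum2_def algebra_simps)
qed

text \<open>The majorant depends on the base point y only, so integrating out the lag costs the
  total variation of the reduced cumulant and nothing else.\<close>

lemma abs_cum2_le:
 assumes W: "W \<in> sets borel" "bounded W" and F: "F \<in> borel_measurable borel" "!!p. \<bar>F p\<bar> <= C"
  and le: "!!x y. y \<in> W ==> \<bar>F (x, y)\<bar> <= \<beta> y"
  and \<beta>: "integrable lborel (%x. indicator W x * \<beta> x)" "!!x. 0 <= \<beta> x"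
 shows "\<bar>cum2 W F\<bar> <= lam * gamma_total * (LINT x|lborel. indicator W x * \<beta> x)"
proof -
 let ?I = "\<integral>x. indicator W x * \<beta> x \<partial>lborel"
 have b: "\<bar>integral\<^sup>L (unreduce W tau2 rh) F\<bar> <= ?I * measure rh (space rh)"
  if r: "finite_measure rh" "sets rh = sets (red_borel 2)" for rh
 proof -
  interpret finite_measure rh by fact
  have "\<bar>integral\<^sup>L (unreduce W tau2 rh) F\<bar> <= ?I * (LINT f|rh. 1)"
   using le by (intro abs_integral_unreduce_le[OF r(1) W tau_measurable(1)[OF r(2)] F _ \<beta>]) (auto simp: tau2_def)
  then show ?thesis by simp
 qed
 have "\<bar>cum2 W F\<bar> = lam * \<bar>integral\<^sup>L (unreduce W tau2 (gp 2)) F - integral\<^sup>L (unreduce W tau2 (gm 2)) F\<bar>"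
  using intensity_pos by (simp add: cum2_def abs_mult)
 also have "... <= lam * (?I * measure (gp 2) (space (gp 2)) + ?I * measure (gm 2) (space (gm 2)))"
  using b[OF finite_gp[of 2] sets_gp[of 2]] b[OF finite_gm[of 2] sets_gm[of 2]] intensity_pos
  by (intro mult_left_mono order_trans[OF abs_triangle_ineq4] add_mono) auto
 finally show ?thesis by (simp add: gamma_total_def algebra_simps)
qed

lemma integrable_indicator_bounded:
 assumes W: "W \<in> sets borel" "bounded W" and \<beta>: "\<beta> \<in> borel_measurable borel" "!!x. \<bar>\<beta> x\<bar> <= C"
 shows "integrable lborel (%x :: 'a. indicator W x * \<beta> x :: real)"
proof (rule bochner_integrable_bound)
 show "integrable lborel (%x. indicator W x * C)"
  using W emeasure_bounded_finite[OF W(2)] by (intro integrable_mult_left integrable_real_indicator) auto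
 show "(%x. indicator W x * \<beta> x) \<in> borel_measurable lborel" using W \<beta> by measurable
 show "AE x in lborel. norm (indicator W x * \<beta> x) <= norm (indicator W x * C)"
  using \<beta>(2) by (intro AE_I2) (auto simp: indicator_def intro: order_trans[OF _ abs_ge_self])
qed

text \<open>The product of expectations cancels, leaving the second cumulant and the diagonal. In
  both, one factor h is bounded by H and the other is integrated, so a small L1 norm of h is enough
  for a small variance; the 1 in the constant is the diagonal.\<close>

lemma variance_points_le:
 assumes W: "W \<in> sets borel" "bounded W" and h: "h \<in> borel_measurable borel" "!!x. \<bar>h x\<bar> <= H" "!!x. x \<notin> W ==> h x = 0"
 shows "integrable M (%om. (\<Sum>x\<in>N om Int W. h x)\<^sup>2)"
  and "variance (%om. \<Sum>x\<in>N om Int W. h x) <= lam * (1 + gamma_total) * H * (LINT x|lborel. indicator W x * \<bar>h x\<bar>)"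
proof -
 note [measurable] = h(1)
 have H: "0 <= H" using h(2)[of 0] by linarith
 have fin: "finite (N om Int W)" if "om \<in> space M" for om using finite_pts[OF that W(2)] .
 have hh: "(%p. h (fst p) * h (snd p)) \<in> borel_measurable borel" by measurable
 have hhb: "\<bar>h (fst p) * h (snd p)\<bar> <= H * H" for p
  unfolding abs_mult by (intro mult_mono h abs_ge_zero H)
 have h2b: "\<bar>(h x)\<^sup>2\<bar> <= H * H" for x
  using mult_mono[OF h(2)[of x] h(2)[of x]] H by (simp add: power2_eq_square abs_mult)
 have h2m: "(%x. (h x)\<^sup>2) \<in> borel_measurable borel" by measurable
 have i1: "integrable M (%om. \<Sum>x\<in>N om Int W. h x)"
  by (rule integrable_sum_random_finite[OF random_finite_pts[OF W] integrable_card(1)[OF W] h(1,2)])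
 have i2: "integrable M (%om. \<Sum>x\<in>N om Int W. (h x)\<^sup>2)"
  by (rule integrable_sum_random_finite[OF random_finite_pts[OF W] integrable_card(1)[OF W] h2m h2b])
 have i3: "integrable M (%om. \<Sum>p\<in>tuples2 (N om Int W). h (fst p) * h (snd p))"
  by (rule integrable_sum_random_finite[OF random_finite_tuples2[OF W] integrable_card(2)[OF W] hh hhb])
 have sq: "(\<Sum>x\<in>N om Int W. h x)\<^sup>2 = (\<Sum>p\<in>tuples2 (N om Int W). h (fst p) * h (snd p)) + (\<Sum>x\<in>N om Int W. (h x)\<^sup>2)"
  if "om \<in> space M" for om by (rule square_sum_points[OF fin[OF that]])
 have "integrable M (%om. (\<Sum>x\<in>N om Int W. h x)\<^sup>2) \<longleftrightarrow>
   integrable M (%om. (\<Sum>p\<in>tuples2 (N om Int W). h (fst p) * h (snd p)) + (\<Sum>x\<in>N om Int W. (h x)\<^sup>2))"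
  by (rule Bochner_Integration.integrable_cong) (simp_all add: sq)
 with i2 i3 show isq: "integrable M (%om. (\<Sum>x\<in>N om Int W. h x)\<^sup>2)" by simp
 have Esq: "expectation (%om. (\<Sum>x\<in>N om Int W. h x)\<^sup>2)
   = integral\<^sup>L (mom2 W) (%p. h (fst p) * h (snd p)) + integral\<^sup>L (mom1 W) (%x. (h x)\<^sup>2)"
  unfolding integral_mom(2)[OF W hh hhb] integral_mom(1)[OF W h2m h2b]
 proof -
  have "expectation (%om. (\<Sum>x\<in>N om Int W. h x)\<^sup>2) =
   expectation (%om. (\<Sum>p\<in>tuples2 (N om Int W). h (fst p) * h (snd p)) + (\<Sum>x\<in>N om Int W. (h x)\<^sup>2))"
   by (rule bochner_integral_cong) (simp_all add: sq)
  also have "... = expectation (%om. \<Sum>p\<in>tuples2 (N om Int W). h (fst p) * h (snd p)) + expectation (%om. \<Sum>x\<in>N om Int W. (h x)\<^sup>2)"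
   by (rule bochner_integral_add[OF i3 i2])
  finally show "expectation (%om. (\<Sum>x\<in>N om Int W. h x)\<^sup>2) = ..." .
 qed
 have m2: "integral\<^sup>L (mom2 W) (%p. h (fst p) * h (snd p))
   = (integral\<^sup>L (mom1 W) h)\<^sup>2 + cum2 W (%p. h (fst p) * h (snd p))"
 proof -
  have z: "h (fst p) * h (snd p) = 0" if "p \<notin> W \<times> W" for p
   using that h(3)[of "fst p"] h(3)[of "snd p"] by (cases p) auto
  show ?thesis using integral_mom2[OF W hh hhb z] by (simp add: power2_eq_square)
 qed
 let ?I = "\<integral>x. indicator W x * \<bar>h x\<bar> \<partial>lborel"
 have c: "\<bar>cum2 W (%p. h (fst p) * h (snd p))\<bar> <= lam * gamma_total * (LINT x|lborel. indicator W x * (H * \<bar>h x\<bar>))"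
 proof (rule abs_cum2_le[OF W hh hhb])
  show "integrable lborel (%x. indicator W x * (H * \<bar>h x\<bar>))"
   by (rule integrable_indicator_bounded[OF W, where C="H * H"]) (use h H in \<open>auto simp: abs_mult intro!: mult_left_mono\<close>)
  show "\<bar>h (fst (x, y)) * h (snd (x, y))\<bar> <= H * \<bar>h y\<bar>" for x y
   using h(2)[of x] by (simp add: abs_mult mult_right_mono)
 qed (use H in auto)
 have e: "(LINT x|lborel. indicator W x * (H * \<bar>h x\<bar>)) = H * ?I"
  by (simp add: mult.left_commute[of _ H])
 have s: "integral\<^sup>L (mom1 W) (%x. (h x)\<^sup>2) <= lam * (H * ?I)"
 proof -
  have "(LINT x|lborel. indicator W x * (h x)\<^sup>2) <= (LINT x|lborel. indicator W x * (H * \<bar>h x\<bar>))"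
  proof (rule integral_mono)
   show "integrable lborel (%x. indicator W x * (h x)\<^sup>2)" by (rule integrable_indicator_bounded[OF W h2m h2b])
   show "integrable lborel (%x. indicator W x * (H * \<bar>h x\<bar>))"
    by (rule integrable_indicator_bounded[OF W, where C="H * H"]) (use h H in \<open>auto simp: abs_mult intro!: mult_left_mono\<close>)
   fix x
   have "(h x)\<^sup>2 = \<bar>h x\<bar> * \<bar>h x\<bar>" by (simp add: power2_eq_square)
   also have "... <= H * \<bar>h x\<bar>" by (intro mult_right_mono h) simp
   finally show "indicator W x * (h x)\<^sup>2 <= indicator W x * (H * \<bar>h x\<bar>)" by (intro mult_left_mono) auto
  qed
  then show ?thesis unfolding integral_mom1[OF W h2m] e using intensity_pos by simp
 qed
 have "variance (%om. \<Sum>x\<in>N om Int W. h x) = expectation (%om. (\<Sum>x\<in>N om Int W. h x)\<^sup>2) - (integral\<^sup>L (mom1 W) h)\<^sup>2"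
  using variance_eq[OF i1 isq] integral_mom(1)[OF W h(1,2)] by simp
 also have "... = cum2 W (%p. h (fst p) * h (snd p)) + integral\<^sup>L (mom1 W) (%x. (h x)\<^sup>2)" unfolding Esq m2 by simp
 also have "... <= lam * gamma_total * (H * ?I) + lam * (H * ?I)" using c s unfolding e by linarith
 finally show "variance (%om. \<Sum>x\<in>N om Int W. h x) <= lam * (1 + gamma_total) * H * ?I" by (simp add: algebra_simps)
qed

end

section \<open>Variance of pair sums\<close>

text \<open>A symmetric kernel bounded by D and carried by pairs of window points with lag in A. The
  variance bound is to depend on A through the mass that the cumulant measures give to it, not only
  through its volume.\<close>

locale pair_kernel = B4_process M N
 for M :: "'o measure" and N :: "'o => 'a::euclidean_space set" +
 fixes W A :: "'a set" and f :: "'a => 'a => real" and D :: real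
 assumes W: "W \<in> sets borel" "bounded W" and A: "A \<in> sets borel" "bounded A"
  and f_borel: "(%p. f (fst p) (snd p)) \<in> borel_measurable borel"
  and f_sym: "f x y = f y x"
  and f_le: "\<bar>f x y\<bar> <= D * indicator A (y - x)"
  and f_out: "x \<notin> W ==> f x y = 0"
  and D: "0 <= D"
begin

lemma f_out2: "y \<notin> W ==> f x y = 0" using f_out[of y x] f_sym by simp

lemma f_le_D: "\<bar>f x y\<bar> <= D"
 using f_le[of x y] D by (cases "y - x \<in> A") auto

lemma f_measurable [measurable (raw)]:
 assumes "a \<in> borel_measurable K" "b \<in> borel_measurable K"
 shows "(%p. f (a p) (b p)) \<in> borel_measurable K"
 using measurable_compose[OF borel_measurable_Pair[OF assms] f_borel] by simp

text \<open>Integrating one argument against the first moment measure gives the kernel of the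
  Hoeffding projection; since f is symmetric, the linear part of the pair sum is
  \<open>2 * lin_sum\<close>.\<close>

definition "g x = (LINT y|mom1 W. f x y)"

definition "pair_sum om = (\<Sum>p\<in>tuples2 (N om Int W). f (fst p) (snd p))"
definition "lin_sum om = (\<Sum>x\<in>N om Int W. g x)"

lemmas fm1 = finite_measure_mom(1)[OF W]
lemmas fm2 = finite_measure_mom(2)[OF W]
lemmas fm3 = finite_measure_mom(3)[OF W]

definition "Cg = D * measure (mom1 W) UNIV"

lemma Cg_nonneg: "0 <= Cg" using D by (simp add: Cg_def)

lemma g_borel [measurable]: "g \<in> borel_measurable borel"
proof -
 interpret finite_measure "mom1 W" by (rule fm1)
 have "(%(x, y). f x y) \<in> borel_measurable (borel \<Otimes>\<^sub>M mom1 W)" by measurable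
 then show ?thesis unfolding g_def[abs_def] by (rule borel_measurable_lebesgue_integral)
qed

lemma abs_integral_mom1_le:
 assumes "!!y. \<bar>h y\<bar> <= C" shows "\<bar>\<integral>y. h y \<partial>mom1 W\<bar> <= C * measure (mom1 W) UNIV"
proof -
 interpret finite_measure "mom1 W" by (rule fm1)
 show ?thesis
 proof (cases "integrable (mom1 W) h")
  case True
  have "\<bar>\<integral>y. h y \<partial>mom1 W\<bar> <= (LINT y|mom1 W. \<bar>h y\<bar>)" by (rule integral_abs_bound)
  also have "... <= (LINT y|mom1 W. C)" using True assms by (intro integral_mono) auto
  finally show ?thesis by (simp add: mult.commute)
 next
  case False
  have "0 <= C" using order_trans[OF abs_ge_zero assms] .
  then show ?thesis using False by (simp add: not_integrable_integral_eq)
 qed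
qed

lemma g_le: "\<bar>g x\<bar> <= Cg" unfolding g_def Cg_def by (intro abs_integral_mom1_le f_le_D)

lemma g_out: "x \<notin> W ==> g x = 0" by (simp add: g_def f_out)

lemma integral_abs_f_le: "(LINT y|lborel. indicator W y * \<bar>f x y\<bar>) <= D * vol A"
 and integrable_abs_f: "integrable lborel (%y. indicator W y * \<bar>f x y\<bar>)"
proof -
 show i: "integrable lborel (%y. indicator W y * \<bar>f x y\<bar>)"
  by (rule integrable_indicator_bounded[OF W, where C=D]) (auto simp: f_le_D)
 have tr: "(%y. y + x) ` A \<in> sets borel" by (rule borel_translate[OF A(1)])
 have eq: "indicator A (y - x) = (indicator ((%y. y + x) ` A) y :: real)" for y
  unfolding image_add_eq_vimage by (simp add: indicator_def)
 have bnd: "bounded ((%y. y + x) ` A)" by (rule bounded_translate[OF A(2)])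
 have "(LINT y|lborel. indicator W y * \<bar>f x y\<bar>) <= (LINT y|lborel. D * indicator A (y - x))"
 proof (rule integral_mono[OF i])
  show "integrable lborel (%y. D * indicator A (y - x) :: real)"
   unfolding eq using tr emeasure_bounded_finite[OF bnd] by (intro integrable_mult_right integrable_real_indicator) auto
  show "indicator W y * \<bar>f x y\<bar> <= D * indicator A (y - x)" for y
   using f_le[of x y] D by (cases "y \<in> W") auto
 qed
 also have "... = D * measure lborel ((%y. y + x) ` A)" unfolding eq using tr by simp
 also have "measure lborel ((%y. y + x) ` A) = vol A"
 proof -
  have "emeasure lborel ((%y. y + x) ` A) = (\<integral>\<^sup>+y. indicator ((%y. y + x) ` A) y \<partial>lborel)"
   using tr by simp
  also have "... = (\<integral>\<^sup>+y. indicator A (- x + y) \<partial>lborel)"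
   unfolding image_add_eq_vimage by (intro nn_integral_cong) (simp add: indicator_def)
  also have "... = (\<integral>\<^sup>+y. indicator A y \<partial>lborel)" using A(1) by (intro nn_integral_lborel_plus) auto
  also have "... = emeasure lborel A" using A(1) by simp
  finally show ?thesis by (simp add: measure_def)
 qed
 finally show "(LINT y|lborel. indicator W y * \<bar>f x y\<bar>) <= D * vol A" .
qed

definition "F4 p = f (fst p) (fst (snd p)) * f (fst (snd (snd p))) (snd (snd (snd p)))"
definition "F3 p = f (fst p) (fst (snd p)) * f (fst p) (snd (snd p))"

lemma F4_borel: "F4 \<in> borel_measurable borel" unfolding F4_def[abs_def] by measurable
lemma F3_borel: "F3 \<in> borel_measurable borel" unfolding F3_def[abs_def] by measurable

lemma mult_le_DD: "\<bar>f x y * f z u\<bar> <= D * D"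
 unfolding abs_mult by (intro mult_mono f_le_D abs_ge_zero D)

lemma F4_le: "\<bar>F4 p\<bar> <= D * D" unfolding F4_def by (rule mult_le_DD)
lemma F3_le: "\<bar>F3 p\<bar> <= D * D" unfolding F3_def by (rule mult_le_DD)
lemma F4_out: "p \<notin> W \<times> W \<times> W \<times> W ==> F4 p = 0"
 by (cases p) (auto simp: F4_def f_out f_out2)
lemma F3_out: "p \<notin> W \<times> W \<times> W ==> F3 p = 0"
 by (cases p) (auto simp: F3_def f_out f_out2)

text \<open>Names for the integrals in the fourth moment expansion. \<open>PP\<close> comes from the
  partitions {1,3},{2,4} and {1,4},{2,3}, \<open>QQ\<close> from {1},{2,3}; \<open>c4\<close> and
  \<open>c3\<close> are the contributions of the cumulants of order four and three. The others are
  products in which some kernel has been integrated to g or m.\<close>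

definition "e = integral\<^sup>L (mom2 W) (%p. f (fst p) (snd p))"
definition "m = integral\<^sup>L (mom1 W) g"
definition "h2 = integral\<^sup>L (mom2 W) (%p. g (fst p) * g (snd p))"
definition "k2 = integral\<^sup>L (mom2 W) (%p. f (fst p) (snd p) * g (fst p))"
definition "a2 = integral\<^sup>L (mom2 W) (%p. (f (fst p) (snd p))\<^sup>2)"
definition "b3 = integral\<^sup>L (mom3 W) (%p. f (fst p) (fst (snd p)) * g (snd (snd p)))"
definition "n2 = integral\<^sup>L (mom1 W) (%x. (g x)\<^sup>2)"
definition "PP = (LINT p|mom2 W. (LINT q|mom2 W. f (fst p) (fst q) * f (snd p) (snd q)))"
definition "QQ = (LINT u|mom1 W. (LINT p|mom2 W. f u (fst p) * f u (snd p)))"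
definition "c4 = lam * (integral\<^sup>L (unreduce W tau4 (gp 4)) F4 - integral\<^sup>L (unreduce W tau4 (gm 4)) F4)"
definition "c3 = lam * (integral\<^sup>L (unreduce W tau3 (gp 3)) F3 - integral\<^sup>L (unreduce W tau3 (gm 3)) F3)"

lemma fg_le: "\<bar>f x y * g z\<bar> <= D * Cg"
 unfolding abs_mult by (intro mult_mono f_le_D g_le abs_ge_zero D)

lemma gg_le: "\<bar>g y * g z\<bar> <= Cg * Cg"
 unfolding abs_mult by (intro mult_mono g_le abs_ge_zero Cg_nonneg)

lemma b3_rotate: "integral\<^sup>L (mom3 W) (%p. f (fst (snd p)) (snd (snd p)) * g (fst p)) = b3"
proof -
 have m1: "(%p :: 'a \<times> 'a \<times> 'a. f (fst (snd p)) (snd (snd p)) * g (fst p)) \<in> borel_measurable borel" by measurable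
 have m2: "(%p :: 'a \<times> 'a \<times> 'a. f (fst p) (fst (snd p)) * g (snd (snd p))) \<in> borel_measurable borel" by measurable
 have eq: "(\<Sum>p\<in>tuples3 S. f (fst p) (fst (snd p)) * g (snd (snd p))) = (\<Sum>p\<in>tuples3 S. f (fst (snd p)) (snd (snd p)) * g (fst p))" for S
  by (subst sum_tuples3_rotate) (simp add: split_def)
 show ?thesis unfolding b3_def integral_mom(3)[OF W m1 fg_le] integral_mom(3)[OF W m2 fg_le] eq ..
qed

text \<open>By symmetry of f all 3+1 partitions give b3. Of the 2+2 partitions, {1,2},{3,4} gives
  e^2 and the other two give PP; of the 2+1+1 partitions two give e m and four give h2; the
  singletons give m^2.\<close>

lemma cumulant4_identity: "integral\<^sup>L (mom4 W) F4 = 4 * b3 + e^2 + 2 * PP - 4 * e * m - 8 * h2 + 6 * m^2 + c4"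
proof -
 note p11 = finite_pair_borel[OF fm1 fm1] sets_pair_borel[OF sets_mom(1)[of W] sets_mom(1)[of W]]
 note p111 = finite_pair_borel[OF fm1 p11(1)] sets_pair_borel[OF sets_mom(1)[of W] p11(2)]
 note d31 = integral_distr_pair(1)[OF fm3 fm1 sets_mom(3) sets_mom(1) _ F4_borel F4_le]
 note d22 = integral_distr_pair(1)[OF fm2 fm2 sets_mom(2) sets_mom(2) _ F4_borel F4_le]
 note d211 = integral_distr_pair(1)[OF fm2 p11(1) sets_mom(2) p11(2) _ F4_borel F4_le]
 note d1111 = integral_distr_pair(1)[OF fm1 p111(1) sets_mom(1) p111(2) _ F4_borel F4_le]
 \<comment> \<open>Symmetry of f is used to put the variable of the inner integral into the second
   argument, as in the definitions of g and PP.\<close>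
 have E2: "F4 (fst x, fst (snd x), y, snd (snd x)) = f (fst x) (fst (snd x)) * f (snd (snd x)) y" for x :: "'a \<times> 'a \<times> 'a" and y
  unfolding F4_def prod.sel f_sym[of y "snd (snd x)"] ..
 have E4: "F4 (y, x) = f (fst x) y * f (fst (snd x)) (snd (snd x))" for x :: "'a \<times> 'a \<times> 'a" and y
  unfolding F4_def prod.sel f_sym[of y "fst x"] ..
 have E7: "F4 (fst x, fst y, snd y, snd x) = f (fst x) (fst y) * f (snd x) (snd y)" for x y :: "'a \<times> 'a"
  unfolding F4_def prod.sel f_sym[of "snd y" "snd x"] ..
 have E11: "F4 (fst y, fst x, snd x, snd y) = f (fst x) (fst y) * f (snd x) (snd y)" for x y :: "'a \<times> 'a"
  unfolding F4_def prod.sel f_sym[of "fst y" "fst x"] ..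
 have E12: "F4 (fst y, fst x, snd y, snd x) = f (fst x) (fst y) * f (snd x) (snd y)" for x y :: "'a \<times> 'a"
  unfolding F4_def prod.sel f_sym[of "fst y" "fst x"] f_sym[of "snd y" "snd x"] ..
 have t1: "integral\<^sup>L (distr (m31 W) borel arrange1) F4 = b3"
  by (subst d31; (simp add: F4_def b3_def g_def; fail | intro borel_cont))
 have t2: "integral\<^sup>L (distr (m31 W) borel arrange2) F4 = b3"
  by (subst d31; (simp add: E2 b3_def g_def; fail | intro borel_cont))
 have t3: "integral\<^sup>L (distr (m31 W) borel arrange7) F4 = b3"
  by (subst d31; (simp add: F4_def b3_rotate[symmetric] g_def mult.commute; fail | intro borel_cont))
 have t4: "integral\<^sup>L (distr (m31 W) borel arrange14) F4 = b3"
  by (subst d31; (simp add: E4 b3_rotate[symmetric] g_def mult.commute; fail | intro borel_cont))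
 have t5: "integral\<^sup>L (distr (m22 W) borel arrange5) F4 = e * e"
  by (subst d22; (simp add: F4_def e_def; fail | intro borel_cont))
 have t6: "integral\<^sup>L (distr (m22 W) borel arrange3) F4 = PP"
  by (subst d22; (simp add: F4_def PP_def; fail | intro borel_cont))
 have t7: "integral\<^sup>L (distr (m22 W) borel arrange4) F4 = PP"
  by (subst d22; (simp add: E7 PP_def; fail | intro borel_cont))
 have two: "integral\<^sup>L (m11 W) (%q. f x (fst q) * f y (snd q)) = g x * g y" for x y
 proof -
  have mm: "(%q. f x (fst q) * f y (snd q)) \<in> borel_measurable borel" by measurable
  show ?thesis by (subst integral_pair_borel(1)[OF fm1 fm1 sets_mom(1) sets_mom(1) mm mult_le_DD]) (simp add: g_def)
 qed
 have one: "integral\<^sup>L (m11 W) (%q. f (fst q) (snd q)) = m"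
 proof -
  have mm: "(%q. f (fst q) (snd q)) \<in> borel_measurable borel" by measurable
  show ?thesis by (subst integral_pair_borel(1)[OF fm1 fm1 sets_mom(1) sets_mom(1) mm f_le_D]) (simp add: g_def[abs_def] m_def)
 qed
 have t8: "integral\<^sup>L (distr (m211 W) borel arrange5) F4 = e * m"
  by (subst d211; (simp add: F4_def e_def one; fail | intro borel_cont))
 have t9: "integral\<^sup>L (distr (m211 W) borel arrange3) F4 = h2"
  by (subst d211; (simp add: F4_def h2_def two; fail | intro borel_cont))
 have t10: "integral\<^sup>L (distr (m211 W) borel arrange4) F4 = h2"
  by (subst d211; (simp add: E7 h2_def two; fail | intro borel_cont))
 have t11: "integral\<^sup>L (distr (m211 W) borel arrange9) F4 = h2"
  by (subst d211; (simp add: E11 h2_def two; fail | intro borel_cont))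
 have t12: "integral\<^sup>L (distr (m211 W) borel arrange10) F4 = h2"
  by (subst d211; (simp add: E12 h2_def two; fail | intro borel_cont))
 have t13: "integral\<^sup>L (distr (m211 W) borel arrange11) F4 = e * m"
  by (subst d211; (simp add: F4_def e_def one; fail | intro borel_cont))
 have t14: "integral\<^sup>L (distr (mom1 W \<Otimes>\<^sub>M (m111 W)) borel arrange12) F4 = m * m"
 proof (subst d1111)
  have "integral\<^sup>L (m111 W) (%y. f x (fst y) * f (fst (snd y)) (snd (snd y))) = g x * m" for x
  proof -
   have mm: "(%y. f x (fst y) * f (fst (snd y)) (snd (snd y))) \<in> borel_measurable borel" by measurable
   show ?thesis by (subst integral_pair_borel(1)[OF fm1 p11(1) sets_mom(1) p11(2) mm mult_le_DD]) (simp add: g_def one)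
  qed
  then show "(\<integral>x. \<integral>y. F4 (fst (x, y), fst (snd (x, y)), fst (snd (snd (x, y))), snd (snd (snd (x, y))))
    \<partial>(m111 W) \<partial>mom1 W) = m * m"
   by (simp add: F4_def m_def)
 qed (intro borel_cont)
 show ?thesis
  using cumulant_terms4_integral[OF W F4_borel F4_le F4_out]
  unfolding cumulant_terms4_def lin_comb.simps prod.sel t1 t2 t3 t4 t5 t6 t7 t8 t9 t10 t11 t12 t13 t14
  by (simp add: c4_def power2_eq_square algebra_simps)
qed

lemma cumulant3_identity: "integral\<^sup>L (mom3 W) F3 = 2 * k2 + QQ - 2 * n2 + c3"
proof -
 note p11 = finite_pair_borel[OF fm1 fm1] sets_pair_borel[OF sets_mom(1)[of W] sets_mom(1)[of W]]
 note d21 = integral_distr_pair(1)[OF fm2 fm1 sets_mom(2) sets_mom(1) _ F3_borel F3_le]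
 note d21' = integral_distr_pair(2)[OF fm2 fm1 sets_mom(2) sets_mom(1) _ F3_borel F3_le]
 note d111 = integral_distr_pair(1)[OF fm1 p11(1) sets_mom(1) p11(2) _ F3_borel F3_le]
 have t1: "integral\<^sup>L (distr (m21 W) borel arrange6) F3 = k2"
  by (subst d21; (simp add: F3_def k2_def g_def; fail | intro borel_cont))
 have t2: "integral\<^sup>L (distr (m21 W) borel arrange8) F3 = k2"
  by (subst d21; (simp add: F3_def k2_def g_def mult.commute; fail | intro borel_cont))
 \<comment> \<open>The single point belongs to both kernels here and is integrated last, which takes
   the other order in Fubini's theorem.\<close>
 have t3: "integral\<^sup>L (distr (m21 W) borel arrange15) F3 = QQ"
  by (subst d21'; (simp add: F3_def QQ_def; fail | intro borel_cont))
 have t4: "integral\<^sup>L (distr (m111 W) borel arrange13) F3 = n2"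
 proof (subst d111)
  have "integral\<^sup>L (m11 W) (%q. f x (fst q) * f x (snd q)) = (g x)\<^sup>2" for x
  proof -
   have mm: "(%q. f x (fst q) * f x (snd q)) \<in> borel_measurable borel" by measurable
   show ?thesis by (subst integral_pair_borel(1)[OF fm1 fm1 sets_mom(1) sets_mom(1) mm mult_le_DD]) (simp add: g_def power2_eq_square)
  qed
  then show "(\<integral>x. \<integral>y. F3 (fst (x, y), fst (snd (x, y)), snd (snd (x, y))) \<partial>(m11 W) \<partial>mom1 W) = n2"
   by (simp add: F3_def n2_def)
 qed (intro borel_cont)
 show ?thesis
  using cumulant_terms3_integral[OF W F3_borel F3_le F3_out]
  unfolding cumulant_terms3_def lin_comb.simps prod.sel t1 t2 t3 t4
  by (simp add: c3_def algebra_simps)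
qed

text \<open>With the factor 2 in front of the projection all terms b3, k2, e^2 and e m cancel. What
  is left besides a2 and the two proper cumulants are the combinations PP - 2 h2 + m^2 and QQ - n2,
  each of which turns out to be an integral against second cumulants.\<close>

lemma variance_identity:
 "integrable M (%om. (pair_sum om - 2 * lin_sum om)\<^sup>2)"
 "variance (%om. pair_sum om - 2 * lin_sum om)
   = c4 + 2 * (PP - 2 * h2 + m\<^sup>2) + 4 * c3 + 4 * (QQ - n2) + 2 * a2"
 "expectation pair_sum = e" "expectation lin_sum = m" "integrable M pair_sum" "integrable M lin_sum"
proof -
 note K1 = random_finite_pts[OF W] integrable_card(1)[OF W]
 note K2 = random_finite_tuples2[OF W] integrable_card(2)[OF W]
 note K3 = random_finite_tuples3[OF W] integrable_card(3)[OF W]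
 note K4 = random_finite_tuples4[OF W] integrable_card(4)[OF W]
 have fin: "finite (N om Int W)" if "om \<in> space M" for om using finite_pts[OF that W(2)] .
 have b1: "(%p. f (fst p) (snd p)) \<in> borel_measurable borel" by (rule f_borel)
 have b2: "(%p. (f (fst p) (snd p))\<^sup>2) \<in> borel_measurable borel" by measurable
 have l2: "\<bar>(f x y)\<^sup>2\<bar> <= D * D" for x y using mult_le_DD[of x y x y] by (simp add: power2_eq_square)
 have b3': "(%p :: 'a \<times> 'a \<times> 'a. f (fst p) (fst (snd p)) * g (snd (snd p))) \<in> borel_measurable borel" by measurable
 have b4: "(%p. f (fst p) (snd p) * g (fst p)) \<in> borel_measurable borel" by measurable
 have b5: "(%p. g (fst p) * g (snd p)) \<in> borel_measurable borel" by measurable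
 have b6: "(%x. (g x)\<^sup>2) \<in> borel_measurable borel" by measurable
 have l6: "\<bar>(g x)\<^sup>2\<bar> <= Cg * Cg" for x using gg_le[of x x] by (simp add: power2_eq_square)
 define S4 where "S4 om = (\<Sum>p\<in>tuples4 (N om Int W). F4 p)" for om
 define S3 where "S3 om = (\<Sum>p\<in>tuples3 (N om Int W). F3 p)" for om
 define S2 where "S2 om = (\<Sum>p\<in>tuples2 (N om Int W). (f (fst p) (snd p))\<^sup>2)" for om
 define R3 where "R3 om = (\<Sum>p\<in>tuples3 (N om Int W). f (fst p) (fst (snd p)) * g (snd (snd p)))" for om
 define R2 where "R2 om = (\<Sum>p\<in>tuples2 (N om Int W). f (fst p) (snd p) * g (fst p))" for om
 define H2 where "H2 om = (\<Sum>p\<in>tuples2 (N om Int W). g (fst p) * g (snd p))" for om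
 define G2 where "G2 om = (\<Sum>x\<in>N om Int W. (g x)\<^sup>2)" for om
 have i4: "integrable M S4" "expectation S4 = integral\<^sup>L (mom4 W) F4"
  unfolding S4_def[abs_def] using integrable_sum_random_finite[OF K4 F4_borel F4_le] integral_mom(4)[OF W F4_borel F4_le] by auto
 have i3: "integrable M S3" "expectation S3 = integral\<^sup>L (mom3 W) F3"
  unfolding S3_def[abs_def] using integrable_sum_random_finite[OF K3 F3_borel F3_le] integral_mom(3)[OF W F3_borel F3_le] by auto
 have i2: "integrable M S2" "expectation S2 = a2"
  unfolding S2_def[abs_def] a2_def using integrable_sum_random_finite[OF K2 b2 l2] integral_mom(2)[OF W b2 l2] by auto
 have j3: "integrable M R3" "expectation R3 = b3"
  unfolding R3_def[abs_def] b3_def using integrable_sum_random_finite[OF K3 b3' fg_le] integral_mom(3)[OF W b3' fg_le] by auto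
 have j2: "integrable M R2" "expectation R2 = k2"
  unfolding R2_def[abs_def] k2_def using integrable_sum_random_finite[OF K2 b4 fg_le] integral_mom(2)[OF W b4 fg_le] by auto
 have ih: "integrable M H2" "expectation H2 = h2"
  unfolding H2_def[abs_def] h2_def using integrable_sum_random_finite[OF K2 b5 gg_le] integral_mom(2)[OF W b5 gg_le] by auto
 have ig: "integrable M G2" "expectation G2 = n2"
  unfolding G2_def[abs_def] n2_def using integrable_sum_random_finite[OF K1 b6 l6] integral_mom(1)[OF W b6 l6] by auto
 show ip: "integrable M pair_sum" "expectation pair_sum = e"
  unfolding pair_sum_def[abs_def] e_def using integrable_sum_random_finite[OF K2 b1 f_le_D] integral_mom(2)[OF W b1 f_le_D] by auto
 show il: "integrable M lin_sum" "expectation lin_sum = m"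
  unfolding lin_sum_def[abs_def] m_def using integrable_sum_random_finite[OF K1 g_borel g_le] integral_mom(1)[OF W g_borel g_le] by auto
 define Z where "Z om = S4 om + 4 * S3 om + 2 * S2 om - 4 * (R3 om + 2 * R2 om) + 4 * (H2 om + G2 om)" for om
 have sq: "(pair_sum om - 2 * lin_sum om)\<^sup>2 = Z om" if "om \<in> space M" for om
 proof -
  have "(pair_sum om - 2 * lin_sum om)\<^sup>2 = (pair_sum om)\<^sup>2 - 4 * (pair_sum om * lin_sum om) + 4 * (lin_sum om)\<^sup>2"
   by (simp add: power2_eq_square algebra_simps)
  moreover have "(pair_sum om)\<^sup>2 = S4 om + 4 * S3 om + 2 * S2 om"
   unfolding pair_sum_def S4_def S3_def S2_def F4_def F3_def by (rule square_sum_pairs[OF fin[OF that] f_sym])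
  moreover have "pair_sum om * lin_sum om = R3 om + 2 * R2 om"
   unfolding pair_sum_def lin_sum_def R3_def R2_def by (rule pair_times_points[OF fin[OF that] f_sym])
  moreover have "(lin_sum om)\<^sup>2 = H2 om + G2 om"
   unfolding lin_sum_def H2_def G2_def by (rule square_sum_points[OF fin[OF that]])
  ultimately show ?thesis by (simp add: Z_def)
 qed
 have iZ: "integrable M Z" unfolding Z_def[abs_def] using i4 i3 i2 j3 j2 ih ig by simp
 have "integrable M (%om. (pair_sum om - 2 * lin_sum om)\<^sup>2) \<longleftrightarrow> integrable M Z"
  by (rule Bochner_Integration.integrable_cong) (simp_all add: sq)
 with iZ show isq: "integrable M (%om. (pair_sum om - 2 * lin_sum om)\<^sup>2)" by simp
 have id: "integrable M (%om. pair_sum om - 2 * lin_sum om)" using ip il by simp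
 have "expectation (%om. (pair_sum om - 2 * lin_sum om)\<^sup>2) = expectation Z"
  by (rule bochner_integral_cong) (simp_all add: sq)
 also have "... = integral\<^sup>L (mom4 W) F4 + 4 * integral\<^sup>L (mom3 W) F3 + 2 * a2 - 4 * (b3 + 2 * k2) + 4 * (h2 + n2)"
  unfolding Z_def[abs_def] using i4 i3 i2 j3 j2 ih ig by simp
 finally have E: "expectation (%om. (pair_sum om - 2 * lin_sum om)\<^sup>2)
   = integral\<^sup>L (mom4 W) F4 + 4 * integral\<^sup>L (mom3 W) F3 + 2 * a2 - 4 * (b3 + 2 * k2) + 4 * (h2 + n2)" .
 have "variance (%om. pair_sum om - 2 * lin_sum om)
   = expectation (%om. (pair_sum om - 2 * lin_sum om)\<^sup>2) - (e - 2 * m)\<^sup>2"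
  using variance_eq[OF id isq] ip il by simp
 then show "variance (%om. pair_sum om - 2 * lin_sum om)
   = c4 + 2 * (PP - 2 * h2 + m\<^sup>2) + 4 * c3 + 4 * (QQ - n2) + 2 * a2"
  unfolding E cumulant4_identity cumulant3_identity by (simp add: power2_eq_square algebra_simps)
qed

end

section \<open>Masses that the cumulant measures give to a set of lags\<close>

context B4_process
begin

text \<open>The sign comes from orientation: \<open>tau2\<close> to \<open>tau4\<close> produce the
  pair (h i + x, x), whereas the kernel bound looks at second point minus first point.\<close>

definition lag_set :: "(nat => 'a) measure => nat => 'a set => (nat => 'a) set" where
 "lag_set rh i B = {h \<in> space rh. - h i \<in> B}"

definition "lag_mass k i B = measure (gp k) (lag_set (gp k) i B) + measure (gm k) (lag_set (gm k) i B)"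

lemma lag_set_sets:
 assumes "sets rh = sets (red_borel k :: (nat => 'a) measure)" "i \<in> {1..<k}" "B \<in> sets borel"
 shows "lag_set rh i B \<in> sets rh"
proof -
 have "(%f. f i) \<in> measurable rh borel"
  using measurable_component_singleton[OF assms(2), of "%_. borel"] measurable_cong_sets[OF assms(1) refl] by blast
 then have "(%f. - f i) \<in> measurable rh borel" by simp
 from measurable_sets[OF this assms(3)] show ?thesis
  by (simp add: lag_set_def vimage_def Int_def conj_commute)
qed

text \<open>Collects everything the variance of a pair sum sees of its lag set. The weights 4 and 2
  are those of c3 and a2 in \<open>variance_identity\<close>; the volume term unites 2 gamma^2 from
  PP, 4 gamma from QQ and 2 from a2. Its additivity in B is what the chaining rests on.\<close>

definition "lag_measure B = lam * (lag_mass 4 3 B + 4 * lag_mass 3 1 B + 2 * lag_mass 2 1 B)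
 + 2 * lam^2 * (1 + gamma_total)^2 * vol B"

lemma abs_signed_integral_le:
 fixes ta :: "(nat => 'a) \<times> 'a => 'b::topological_space"
 assumes k: "k \<in> {2, 3, 4}" and i: "i \<in> {1..<k}" and W: "W \<in> sets borel" "bounded W" and B: "B \<in> sets borel"
  and ta: "!!rh. sets rh = sets (red_borel k) ==> ta \<in> borel_measurable (rh \<Otimes>\<^sub>M borel)"
  and F: "F \<in> borel_measurable borel" "!!x. \<bar>F x\<bar> <= C"
  and le: "!!h x. \<bar>F (ta (h, x))\<bar> <= D * indicator B (- h i)" and D: "0 <= D"
 shows "\<bar>lam * (integral\<^sup>L (unreduce W ta (gp k)) F - integral\<^sup>L (unreduce W ta (gm k)) F)\<bar>
  <= lam * D * vol W * lag_mass k i B"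
proof -
 have iW: "(LINT x|lborel. indicator W x * D) = vol W * D" using W by simp
 have b: "\<bar>integral\<^sup>L (unreduce W ta rh) F\<bar> <= vol W * D * measure rh (lag_set rh i B)"
  if r: "finite_measure rh" "sets rh = sets (red_borel k)" for rh
 proof -
  interpret finite_measure rh by fact
  note s = lag_set_sets[OF r(2) i B]
  have "\<bar>integral\<^sup>L (unreduce W ta rh) F\<bar> <= (LINT x|lborel. indicator W x * D) * (LINT h|rh. indicator (lag_set rh i B) h)"
  proof (rule abs_integral_unreduce_le[OF r(1) W ta[OF r(2)] F])
   show "\<bar>F (ta (h, x))\<bar> <= D * indicator (lag_set rh i B) h" if "h \<in> space rh" for h x
    using le[of h x] that by (simp add: lag_set_def indicator_def)
   show "integrable lborel (%x. indicator W x * D)"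
    using D by (intro integrable_indicator_bounded[OF W, where C=D]) auto
   show "integrable rh (indicator (lag_set rh i B) :: _ => real)"
    using s by (intro integrable_real_indicator) (simp_all add: emeasure_eq_measure)
  qed (use D in auto)
  also have "(LINT h|rh. indicator (lag_set rh i B) h) = measure rh (lag_set rh i B)"
   using s sets.sets_into_space[OF s] by (simp add: Int_absorb2)
  finally show ?thesis unfolding iW .
 qed
 have "\<bar>lam * (integral\<^sup>L (unreduce W ta (gp k)) F - integral\<^sup>L (unreduce W ta (gm k)) F)\<bar>
   = lam * \<bar>integral\<^sup>L (unreduce W ta (gp k)) F - integral\<^sup>L (unreduce W ta (gm k)) F\<bar>"
  using intensity_pos by (simp add: abs_mult)
 also have "... <= lam * (vol W * D * measure (gp k) (lag_set (gp k) i B) + vol W * D * measure (gm k) (lag_set (gm k) i B))"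
  using b[OF finite_gp[OF k] sets_gp[OF k]] b[OF finite_gm[OF k] sets_gm[OF k]] intensity_pos
  by (intro mult_left_mono order_trans[OF abs_triangle_ineq4] add_mono) auto
 finally show ?thesis by (simp add: lag_mass_def algebra_simps)
qed

end

section \<open>Bounds for the terms of the variance\<close>

context pair_kernel
begin

text \<open>Only the kernel that joins the third point to the base point is used to localise the
  lag; the other one is bounded by D. The cumulant of order four thus enters through one marginal of
  its variation.\<close>

lemma c4_le: "\<bar>c4\<bar> <= lam * (D * D) * vol W * lag_mass 4 3 A"
 unfolding c4_def
proof (rule abs_signed_integral_le[OF _ _ W A(1) tau_measurable(3) F4_borel F4_le])
 fix h :: "nat => 'a" and x
 have "\<bar>F4 (tau4 (h, x))\<bar> = \<bar>f (h 1 + x) (h 2 + x)\<bar> * \<bar>f (h 3 + x) x\<bar>" by (simp add: F4_def tau4_def abs_mult)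
 also have "... <= D * (D * indicator A (- h 3))"
  using f_le[of "h 3 + x" x] D by (intro mult_mono f_le_D) auto
 finally show "\<bar>F4 (tau4 (h, x))\<bar> <= D * D * indicator A (- h 3)" by simp
qed (use D in auto)

lemma c3_le: "\<bar>c3\<bar> <= lam * (D * D) * vol W * lag_mass 3 1 A"
 unfolding c3_def
proof (rule abs_signed_integral_le[OF _ _ W A(1) tau_measurable(2) F3_borel F3_le])
 fix h :: "nat => 'a" and x
 have "\<bar>F3 (tau3 (h, x))\<bar> = \<bar>f (h 1 + x) (h 2 + x)\<bar> * \<bar>f (h 1 + x) x\<bar>" by (simp add: F3_def tau3_def abs_mult)
 also have "... <= D * (D * indicator A (- h 1))"
  using f_le[of "h 1 + x" x] D by (intro mult_mono f_le_D) auto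
 finally show "\<bar>F3 (tau3 (h, x))\<bar> <= D * D * indicator A (- h 1)" by simp
qed (use D in auto)

lemma mom1_abs_f_le: "(LINT y|mom1 W. \<bar>f x y\<bar>) <= lam * (D * vol A)"
 using integral_abs_f_le[of x] intensity_pos by (subst integral_mom1[OF W]) (auto intro!: mult_left_mono)

lemma integrable_mom1_bounded:
 "h \<in> borel_measurable borel ==> (!!x. \<bar>h x\<bar> <= C) ==> integrable (mom1 W) (h :: 'a => real)"
 using integrable_bounded_finite[OF fm1 sets_mom(1)] by blast

lemma integrable_mom2_bounded:
 "h \<in> borel_measurable borel ==> (!!x. \<bar>h x\<bar> <= C) ==> integrable (mom2 W) (h :: 'a \<times> 'a => real)"
 using integrable_bounded_finite[OF fm2 sets_mom(2)] by blast

lemma a2_le: "a2 <= lam * (D * D) * vol W * lag_mass 2 1 A + lam^2 * (D * D) * vol W * vol A"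
proof -
 have bm: "(%p. (f (fst p) (snd p))\<^sup>2) \<in> borel_measurable borel" by measurable
 have l2: "\<bar>(f x y)\<^sup>2\<bar> <= D * D" for x y using mult_le_DD[of x y x y] by (simp add: power2_eq_square)
 have o2: "(f (fst p) (snd p))\<^sup>2 = 0" if "p \<notin> W \<times> W" for p
  using that by (cases p) (auto simp: f_out f_out2)
 have eq: "a2 = (LINT x|mom1 W. (LINT y|mom1 W. (f x y)\<^sup>2)) + cum2 W (%p. (f (fst p) (snd p))\<^sup>2)"
  unfolding a2_def using integral_mom2[OF W bm l2 o2] by simp
 have inner: "(LINT y|mom1 W. (f x y)\<^sup>2) <= lam * (D * D) * vol A" for x
 proof -
  have "(LINT y|mom1 W. (f x y)\<^sup>2) <= (LINT y|mom1 W. D * \<bar>f x y\<bar>)"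
  proof (rule integral_mono)
   show "integrable (mom1 W) (%y. (f x y)\<^sup>2)" by (rule integrable_mom1_bounded[OF _ l2]) measurable
   show "integrable (mom1 W) (%y. D * \<bar>f x y\<bar>)"
    by (rule integrable_mom1_bounded[where C="D * D"]) (use D f_le_D in \<open>auto simp: abs_mult intro!: mult_left_mono\<close>)
   show "(f x y)\<^sup>2 <= D * \<bar>f x y\<bar>" for y
    using mult_right_mono[OF f_le_D[of x y], of "\<bar>f x y\<bar>"] by (simp add: power2_eq_square)
  qed
  also have "... = D * (LINT y|mom1 W. \<bar>f x y\<bar>)" by simp
  also have "... <= D * (lam * (D * vol A))" by (intro mult_left_mono mom1_abs_f_le D)
  finally show ?thesis by (simp add: mult_ac)
 qed
 have "\<bar>\<integral>x. (LINT y|mom1 W. (f x y)\<^sup>2) \<partial>mom1 W\<bar> <= lam * (D * D) * vol A * measure (mom1 W) UNIV"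
  using inner by (intro abs_integral_mom1_le) (simp add: Bochner_Integration.integral_nonneg)
 also have "... = lam\<^sup>2 * (D * D) * vol W * vol A" unfolding measure_mom1[OF W] by (simp add: power2_eq_square)
 finally have 1: "(LINT x|mom1 W. (LINT y|mom1 W. (f x y)\<^sup>2)) <= lam\<^sup>2 * (D * D) * vol W * vol A" by linarith
 have 2: "\<bar>cum2 W (%p. (f (fst p) (snd p))\<^sup>2)\<bar> <= lam * (D * D) * vol W * lag_mass 2 1 A"
  unfolding cum2_def
 proof (rule abs_signed_integral_le[OF _ _ W A(1) tau_measurable(1) bm l2])
  fix h :: "nat => 'a" and x
  have "\<bar>(f (h 1 + x) x)\<^sup>2\<bar> = \<bar>f (h 1 + x) x\<bar> * \<bar>f (h 1 + x) x\<bar>" by (simp add: power2_eq_square)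
  also have "... <= D * (D * indicator A (- h 1))"
   using f_le[of "h 1 + x" x] D by (intro mult_mono f_le_D) auto
  finally show "\<bar>(f (fst (tau2 (h, x))) (snd (tau2 (h, x))))\<^sup>2\<bar> <= D * D * indicator A (- h 1)"
   by (simp add: tau2_def)
 qed (use D in auto)
 show ?thesis unfolding eq using 1 2 by linarith
qed

text \<open>What correlation adds to the mean of f(x, .) f(y, .) over pairs of points; see
  \<open>ff_integral\<close>.\<close>

definition "psi p = cum2 W (%q. f (fst p) (fst q) * f (snd p) (snd q))"

lemma ff_integral: "(LINT q|mom2 W. f x (fst q) * f y (snd q)) = g x * g y + psi (x, y)"
proof -
 have bm: "(%q. f x (fst q) * f y (snd q)) \<in> borel_measurable borel" by measurable
 have o: "f x (fst q) * f y (snd q) = 0" if "q \<notin> W \<times> W" for q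
  using that by (cases q) (auto simp: f_out f_out2)
 show ?thesis using integral_mom2[OF W bm mult_le_DD o] by (simp add: psi_def g_def)
qed

lemma abs_cum2_ff_le: "\<bar>cum2 W (%q. f x (fst q) * f y (snd q))\<bar> <= lam * gamma_total * (D * (D * vol A))"
proof -
 have bm: "(%q. f x (fst q) * f y (snd q)) \<in> borel_measurable borel" by measurable
 have "\<bar>cum2 W (%q. f x (fst q) * f y (snd q))\<bar> <= lam * gamma_total * (LINT v|lborel. indicator W v * (D * \<bar>f y v\<bar>))"
 proof (rule abs_cum2_le[OF W bm mult_le_DD])
  show "\<bar>f x (fst (u, v)) * f y (snd (u, v))\<bar> <= D * \<bar>f y v\<bar>" for u v
   by (simp add: abs_mult mult_right_mono f_le_D)
  show "integrable lborel (%v. indicator W v * (D * \<bar>f y v\<bar>))"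
   by (rule integrable_indicator_bounded[OF W, where C="D * D"])
    (use D f_le_D in \<open>auto simp: abs_mult intro!: mult_left_mono\<close>)
 qed (use D in auto)
 also have "(LINT v|lborel. indicator W v * (D * \<bar>f y v\<bar>)) = D * (LINT v|lborel. indicator W v * \<bar>f y v\<bar>)"
  by (simp add: mult.left_commute[of _ D])
 also have "lam * gamma_total * (D * (LINT v|lborel. indicator W v * \<bar>f y v\<bar>)) <= lam * gamma_total * (D * (D * vol A))"
  using integral_abs_f_le[of y] D intensity_pos gamma_total_nonneg by (intro mult_left_mono) auto
 finally show ?thesis .
qed

lemma psi_le: "\<bar>psi p\<bar> <= lam * gamma_total * (D * (D * vol A))"
 unfolding psi_def by (rule abs_cum2_ff_le)

lemma psi_out: "p \<notin> W \<times> W ==> psi p = 0"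
proof -
 assume "p \<notin> W \<times> W"
 then have "(%q. f (fst p) (fst q) * f (snd p) (snd q)) = (%q. 0)" by (cases p) (auto simp: f_out f_out2)
 then show ?thesis unfolding psi_def cum2_def by simp
qed

lemma ff_integral_borel: "(%p. \<integral>q. f (fst p) (fst q) * f (snd p) (snd q) \<partial>mom2 W) \<in> borel_measurable borel"
proof -
 interpret finite_measure "mom2 W" by (rule fm2)
 have "(%(p, q). f (fst p) (fst q) * f (snd p) (snd q)) \<in> borel_measurable (borel \<Otimes>\<^sub>M mom2 W)"
  by measurable
 then show ?thesis by (rule borel_measurable_lebesgue_integral)
qed

lemma psi_borel: "psi \<in> borel_measurable borel"
proof -
 have "psi = (%p. (LINT q|mom2 W. f (fst p) (fst q) * f (snd p) (snd q)) - g (fst p) * g (snd p))"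
  using ff_integral by (auto simp: fun_eq_iff)
 then show ?thesis using ff_integral_borel by simp
qed

text \<open>Each of the two pair integrations in PP splits into a product part and a cumulant part.
  The product part of the outer integral of psi is h2 - m^2, by exchanging the order of integration,
  so that only the twofold cumulant integral survives.\<close>

lemma PP_identity: "PP - 2 * h2 + m\<^sup>2 = cum2 W psi"
proof -
 have gm': "(%p. g (fst p) * g (snd p)) \<in> borel_measurable borel" by measurable
 note ig = integrable_mom2_bounded[OF gm' gg_le]
 note ip = integrable_mom2_bounded[OF psi_borel psi_le]
 have PP: "PP = h2 + integral\<^sup>L (mom2 W) psi"
  unfolding PP_def ff_integral h2_def using bochner_integral_add[OF ig ip] by simp
 have ip2: "integral\<^sup>L (mom2 W) psi = (LINT x|mom1 W. (LINT y|mom1 W. psi (x, y))) + cum2 W psi"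
  by (rule integral_mom2[OF W psi_borel psi_le psi_out])
 note p11 = finite_pair_borel[OF fm1 fm1] sets_pair_borel[OF sets_mom(1)[of W] sets_mom(1)[of W]]
 have psi2: "(LINT x|mom1 W. (LINT y|mom1 W. psi (x, y))) = integral\<^sup>L (m11 W) psi"
  by (rule integral_pair_borel(1)[OF fm1 fm1 sets_mom(1) sets_mom(1) psi_borel psi_le, symmetric])
 have gg2: "integral\<^sup>L (m11 W) (%p. g (fst p) * g (snd p)) = m\<^sup>2"
  by (subst integral_pair_borel(1)[OF fm1 fm1 sets_mom(1) sets_mom(1) gm' gg_le]) (simp add: m_def power2_eq_square)
 have fb: "(%z. f (fst (fst z)) (fst (snd z)) * f (snd (fst z)) (snd (snd z))) \<in> borel_measurable borel" by measurable
 note sw = integral_pair_borel[OF p11(1) fm2 p11(2) sets_mom(2) fb mult_le_DD]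
 have i1: "integrable (m11 W) psi"
  by (rule integrable_bounded_finite[OF p11 psi_borel psi_le])
 have i2: "integrable (m11 W) (%p. g (fst p) * g (snd p))"
  by (rule integrable_bounded_finite[OF p11 gm' gg_le])
 have "integral\<^sup>L (m11 W) (%p. g (fst p) * g (snd p)) + integral\<^sup>L (m11 W) psi
   = (LINT p|(m11 W). (LINT q|mom2 W. f (fst p) (fst q) * f (snd p) (snd q)))"
  unfolding ff_integral using bochner_integral_add[OF i2 i1] by simp
 also have "... = (LINT q|mom2 W. (LINT p|(m11 W). f (fst p) (fst q) * f (snd p) (snd q)))"
  using sw by simp
 also have "... = h2"
 proof -
  have "(LINT p|(m11 W). f (fst p) x * f (snd p) y) = g x * g y" for x y
  proof -
   have mm: "(%p. f (fst p) x * f (snd p) y) \<in> borel_measurable borel" by measurable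
   have "(LINT p|(m11 W). f (fst p) x * f (snd p) y) = (\<integral>u. \<integral>v. f u x * f v y \<partial>mom1 W \<partial>mom1 W)"
    by (subst integral_pair_borel(1)[OF fm1 fm1 sets_mom(1) sets_mom(1) mm mult_le_DD]) simp
   also have "... = g x * g y" unfolding f_sym[of _ x] f_sym[of _ y] by (simp add: g_def)
   finally show ?thesis .
  qed
  then show ?thesis by (simp add: h2_def)
 qed
 finally have "(LINT x|mom1 W. (LINT y|mom1 W. psi (x, y))) = h2 - m\<^sup>2" unfolding gg2 psi2 by simp
 with PP ip2 show ?thesis by simp
qed

lemma cum2_psi_le: "\<bar>cum2 W psi\<bar> <= lam\<^sup>2 * gamma_total^2 * (D * D) * vol W * vol A"
proof -
 let ?c = "lam * gamma_total * (D * (D * vol A))"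
 have c: "0 <= ?c" using intensity_pos gamma_total_nonneg D by simp
 have "\<bar>cum2 W psi\<bar> <= lam * gamma_total * (LINT y|lborel. indicator W y * ?c)"
 proof (rule abs_cum2_le[OF W psi_borel psi_le])
  show "\<bar>psi (x, y)\<bar> <= ?c" for x y by (rule psi_le)
  show "integrable lborel (%y. indicator W y * ?c)"
   using c by (intro integrable_indicator_bounded[OF W, where C="?c"]) auto
 qed (rule c)
 also have "(LINT y|lborel. indicator W y * ?c) = vol W * ?c" using W by simp
 finally show ?thesis by (simp add: power2_eq_square mult_ac)
qed

lemma QQ_le: "\<bar>QQ - n2\<bar> <= lam\<^sup>2 * gamma_total * (D * D) * vol W * vol A"
proof -
 have q: "(LINT p|mom2 W. f u (fst p) * f u (snd p)) = (g u)\<^sup>2 + psi (u, u)" for u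
  using ff_integral[of u u] by (simp add: power2_eq_square)
 have b1: "(%u. psi (u, u)) \<in> borel_measurable borel"
  by (rule measurable_compose[OF _ psi_borel]) (intro borel_measurable_Pair measurable_ident_sets; simp)
 have b2: "(%u. (g u)\<^sup>2) \<in> borel_measurable borel" by measurable
 have l2: "\<bar>(g x)\<^sup>2\<bar> <= Cg * Cg" for x using gg_le[of x x] by (simp add: power2_eq_square)
 have "QQ = n2 + (LINT u|mom1 W. psi (u, u))"
  unfolding QQ_def q n2_def
  using bochner_integral_add[OF integrable_mom1_bounded[OF b2 l2] integrable_mom1_bounded[OF b1 psi_le]] by simp
 then have "\<bar>QQ - n2\<bar> <= lam * gamma_total * (D * (D * vol A)) * measure (mom1 W) UNIV"
  using abs_integral_mom1_le[of "%u. psi (u, u)", OF psi_le] by simp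
 then show ?thesis unfolding measure_mom1[OF W] by (simp add: power2_eq_square mult_ac)
qed

text \<open>In the application D is of order 1 / |W|, so this variance is of order
  \<open>lag_measure A\<close> / |W|.\<close>

theorem variance_le: "variance (%om. pair_sum om - 2 * lin_sum om) <= D\<^sup>2 * vol W * lag_measure A"
proof -
 let ?v = "(D * D) * vol W * vol A"
 have "variance (%om. pair_sum om - 2 * lin_sum om)
   = c4 + 2 * cum2 W psi + 4 * c3 + 4 * (QQ - n2) + 2 * a2"
  unfolding variance_identity(2) PP_identity ..
 also have "... <= lam * (D * D) * vol W * lag_mass 4 3 A + 2 * (lam\<^sup>2 * gamma_total^2 * (D * D) * vol W * vol A)
   + 4 * (lam * (D * D) * vol W * lag_mass 3 1 A) + 4 * (lam\<^sup>2 * gamma_total * (D * D) * vol W * vol A)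
   + 2 * (lam * (D * D) * vol W * lag_mass 2 1 A + lam^2 * (D * D) * vol W * vol A)"
  by (intro add_mono mult_left_mono abs_le_D1[OF c4_le] abs_le_D1[OF cum2_psi_le] abs_le_D1[OF c3_le]
    abs_le_D1[OF QQ_le] a2_le) simp_all
 also have "... = D\<^sup>2 * vol W * lag_measure A"
  by (simp add: lag_measure_def power2_eq_square algebra_simps)
 finally show ?thesis .
qed

end

section \<open>The reduced second moment measure\<close>

context B4_process
begin

text \<open>Shells of unit width cut the pairs whose second point lies in the unit cube into classes
  of finite mean, so that the possibly infinite measure \<open>campbell\<close> is a countable sum
  of finite ones.\<close>

definition ring :: "nat => 'a set" where
 "ring n = {y. real n <= norm y & norm y < real n + 1}"

lemma ring_borel: "ring n \<in> sets borel" and ring_bounded: "bounded (ring n)"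
proof -
 have "ring n = {y. real n <= norm y} Int {y. norm y < real n + 1}" by (auto simp: ring_def)
 moreover have "closed {y :: 'a. real n <= norm y}" by (intro closed_Collect_le continuous_intros)
 moreover have "open {y :: 'a. norm y < real n + 1}" by (intro open_Collect_less continuous_intros)
 ultimately show "ring n \<in> sets borel" by auto
 show "bounded (ring n)" by (rule boundedI[of _ "real n + 1"]) (auto simp: ring_def)
qed

lemma ring_disjoint: "disjoint_family ring"
proof -
 have "m = n" if "y \<in> ring m" "y \<in> ring n" for m n y
 proof -
  have "real m < real n + 1" "real n < real m + 1" using that by (auto simp: ring_def)
  then show ?thesis by linarith
 qed
 then show ?thesis by (auto simp: disjoint_family_on_def)
qed

lemma ring_UN: "(\<Union>n. ring n) = UNIV"
proof -
 have "y \<in> ring (nat \<lfloor>norm y\<rfloor>)" for y :: 'a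
  unfolding ring_def by (auto simp: of_nat_nat)
 then show ?thesis by blast
qed

definition lag_pairs :: "nat => 'o => ('a \<times> 'a) set" where
 "lag_pairs n om = (N om Int ring n) \<times> (N om Int unit_cube) Int {p. fst p ~= snd p}"

lemma random_finite_lag_pairs: "random_finite M (lag_pairs n)"
proof -
 have "open {p :: 'a \<times> 'a. fst p ~= snd p}" by (intro open_Collect_neq continuous_intros)
 then show ?thesis unfolding lag_pairs_def[abs_def]
  by (intro random_finite_Int random_finite_times random_finite_pts ring_borel ring_bounded
    unit_cube_borel bounded_unit_cube) simp
qed

definition "pair_mean n = mean_measure M (lag_pairs n)"

definition lag :: "'a \<times> 'a => nat => 'a" where "lag p = (\<lambda>i\<in>{1..<2}. fst p - snd p)"

lemma lag_measurable: "lag \<in> measurable borel (red_borel 2)"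
 unfolding lag_def[abs_def] by (intro measurable_restrict) measurable

lemma lag_measurable': "lag \<in> measurable (pair_mean n) (red_borel 2)"
 using lag_measurable by (simp add: pair_mean_def measurable_cong_sets[OF sets_mean_measure refl])

abbreviation "lag_distr n \<equiv> distr (pair_mean n) (red_borel 2) lag"

text \<open>Multiplied by lam, this is the mean number of ordered pairs of distinct points whose
  second point lies in the unit cube and whose lag lies in S.\<close>

definition campbell :: "(nat => 'a) measure" where
 "campbell = measure_of (space (red_borel 2)) (sets (red_borel 2))
   (%S. ennreal (1 / lam) * (\<Sum>n. emeasure (lag_distr n) S))"

lemma sets_campbell: "sets campbell = sets (red_borel 2)"
 unfolding campbell_def using sets.sigma_sets_eq[of "red_borel 2 :: (nat => 'a) measure"]
  sets.space_closed[of "red_borel 2 :: (nat => 'a) measure"] by (simp only: sets_measure_of)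

lemma emeasure_campbell:
 assumes "S \<in> sets (red_borel 2)"
 shows "emeasure campbell S = ennreal (1 / lam) * (\<Sum>n. emeasure (lag_distr n) S)"
proof (rule emeasure_measure_of[OF campbell_def])
 show "sets (red_borel 2) \<subseteq> Pow (space (red_borel 2 :: (nat => 'a) measure))" by (rule sets.space_closed)
 show "S \<in> sets campbell" using assms by (simp add: sets_campbell)
 show "positive (sets campbell) (%S. ennreal (1 / lam) * (\<Sum>n. emeasure (lag_distr n) S))"
  by (simp add: positive_def)
 show "countably_additive (sets campbell) (%S. ennreal (1 / lam) * (\<Sum>n. emeasure (lag_distr n) S))"
 proof (rule countably_additiveI)
  fix A :: "nat => (nat => 'a) set" assume A: "range A \<subseteq> sets campbell" "disjoint_family A"
  have "(\<Sum>i. ennreal (1 / lam) * (\<Sum>n. emeasure (lag_distr n) (A i)))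
    = ennreal (1 / lam) * (\<Sum>i. \<integral>\<^sup>+n. emeasure (lag_distr n) (A i) \<partial>count_space UNIV)"
   by (simp add: nn_integral_count_space_nat)
  also have "(\<Sum>i. \<integral>\<^sup>+n. emeasure (lag_distr n) (A i) \<partial>count_space UNIV)
    = (\<integral>\<^sup>+n. (\<Sum>i. emeasure (lag_distr n) (A i)) \<partial>count_space UNIV)"
   by (rule nn_integral_suminf[symmetric]) simp
  also have "... = (\<integral>\<^sup>+n. emeasure (lag_distr n) (\<Union>i. A i) \<partial>count_space UNIV)"
   using A by (intro nn_integral_cong suminf_emeasure) (auto simp: sets_campbell)
  finally show "(\<Sum>i. ennreal (1 / lam) * (\<Sum>n. emeasure (lag_distr n) (A i)))
    = ennreal (1 / lam) * (\<Sum>n. emeasure (lag_distr n) (\<Union>i. A i))"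
   by (simp add: nn_integral_count_space_nat)
 qed
qed

lemma rect_minus_sets:
 assumes "!!l. l \<in> {1..<k} ==> A l \<in> sets (borel :: 'a measure)"
 shows "rect_minus k A x \<in> sets (red_borel k)"
proof (intro sets_PiM_I_finite)
 fix l assume "l \<in> {1..<k}"
 then show "(%y. y - x) ` A l \<in> sets borel" using borel_translate[OF assms, of l "- x"] by simp
qed simp

lemma lag_in_rect_minus: "lag p \<in> rect_minus 2 A x \<longleftrightarrow> fst p - snd p + x \<in> A 1"
proof -
 have "lag p \<in> (\<Pi>\<^sub>E i\<in>{1..<2}. UNIV)" by (auto simp: lag_def)
 show ?thesis unfolding mem_rect_minus[OF \<open>lag p \<in> _\<close>] ball_red by (simp add: lag_def)
qed

lemma emeasure_campbell_rect:
 assumes A: "A 1 \<in> sets borel"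
 shows "emeasure campbell (rect_minus 2 A x)
  = ennreal (1 / lam) * (\<Sum>n. emeasure (pair_mean n) {p. fst p - snd p + x \<in> A 1})"
proof -
 have s: "rect_minus 2 A x \<in> sets (red_borel 2)"
 proof (rule rect_minus_sets)
  fix l assume "l \<in> {1..<2::nat}"
  then have "l = 1" by auto
  with A show "A l \<in> sets borel" by simp
 qed
 have "emeasure (lag_distr n) (rect_minus 2 A x) = emeasure (pair_mean n) {p. fst p - snd p + x \<in> A 1}" for n
  unfolding emeasure_distr[OF lag_measurable' s]
  by (rule arg_cong[where f="emeasure (pair_mean n)"]) (simp only: lag_in_rect_minus vimage_def pair_mean_def space_mean_measure Int_UNIV_right)
 then show ?thesis unfolding emeasure_campbell[OF s] by simp
qed

lemma sum_pair_mean: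
 assumes P: "P1 \<in> sets borel" "bounded P1" "P2 \<in> sets borel" "bounded P2"
  and V: "V \<in> sets borel" "bounded V" "P1 \<subseteq> V" "P2 \<subseteq> V" and sub: "P2 \<subseteq> unit_cube"
 shows "(\<Sum>n. emeasure (pair_mean n) {p. fst p \<in> P1 & snd p \<in> P2}) = emeasure (mom2 V) (P1 \<times> P2)"
  and "{p :: 'a \<times> 'a. fst p \<in> P1 & snd p \<in> P2} \<in> sets borel"
proof -
 have PT: "{p :: 'a \<times> 'a. fst p \<in> P1 & snd p \<in> P2} = P1 \<times> P2" by auto
 show bT: "{p :: 'a \<times> 'a. fst p \<in> P1 & snd p \<in> P2} \<in> sets borel" unfolding PT by (intro borel_Times P)
 have R: "(P1 Int ring n) \<times> P2 \<in> sets borel" for n using P ring_borel by (intro borel_Times sets.Int)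
 have "emeasure (pair_mean n) {p. fst p \<in> P1 & snd p \<in> P2} = emeasure (mom2 V) ((P1 Int ring n) \<times> P2)" for n
  unfolding pair_mean_def mom2_def emeasure_mean_measure[OF random_finite_lag_pairs bT]
   emeasure_mean_measure[OF random_finite_tuples2[OF V(1,2)] R]
 proof (rule nn_integral_cong)
  fix om
  have "lag_pairs n om Int {p. fst p \<in> P1 & snd p \<in> P2} = tuples2 (N om Int V) Int (P1 Int ring n) \<times> P2"
   using V(3,4) sub by (auto simp: lag_pairs_def tuples2_def)
  then show "ennreal (real (card (lag_pairs n om Int {p. fst p \<in> P1 & snd p \<in> P2})))
   = ennreal (real (card (tuples2 (N om Int V) Int (P1 Int ring n) \<times> P2)))" by simp
 qed
 then have "(\<Sum>n. emeasure (pair_mean n) {p. fst p \<in> P1 & snd p \<in> P2}) = (\<Sum>n. emeasure (mom2 V) ((P1 Int ring n) \<times> P2))" by simp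
 also have "... = emeasure (mom2 V) (\<Union>n. (P1 Int ring n) \<times> P2)"
 proof (rule suminf_emeasure)
  show "range (%n. (P1 Int ring n) \<times> P2) \<subseteq> sets (mom2 V)" using R by auto
  show "disjoint_family (%n. (P1 Int ring n) \<times> P2)"
   using ring_disjoint by (auto simp: disjoint_family_on_def)
 qed
 also have "(\<Union>n. (P1 Int ring n) \<times> P2) = P1 \<times> P2" using ring_UN by auto
 finally show "(\<Sum>n. emeasure (pair_mean n) {p. fst p \<in> P1 & snd p \<in> P2}) = emeasure (mom2 V) (P1 \<times> P2)" .
qed

lemma finite_measure_pair_mean: "finite_measure (pair_mean n)"
proof -
 let ?V = "ring n Un (unit_cube :: 'a set)"
 have V: "?V \<in> sets borel" "bounded ?V" using ring_borel ring_bounded unit_cube_borel bounded_unit_cube by auto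
 have "integrable M (%om. real (card (lag_pairs n om)))"
 proof (rule bochner_integrable_bound[OF integrable_card(2)[OF V]])
  show "(%om. real (card (lag_pairs n om))) \<in> borel_measurable M"
   using random_finiteD(3)[OF random_finite_lag_pairs] .
  show "AE om in M. norm (real (card (lag_pairs n om))) <= norm (real (card (tuples2 (N om Int ?V))))"
  proof (rule AE_I2)
   fix om assume "om \<in> space M"
   then have "finite (tuples2 (N om Int ?V))" using tuples2_le[OF finite_pts[OF _ V(2)]] by blast
   moreover have "lag_pairs n om \<subseteq> tuples2 (N om Int ?V)" by (auto simp: lag_pairs_def tuples2_def)
   ultimately show "norm (real (card (lag_pairs n om))) <= norm (real (card (tuples2 (N om Int ?V))))"
    by (simp add: card_mono)
  qed
 qed
 then show ?thesis unfolding pair_mean_def by (rule finite_measure_mean_measure[OF random_finite_lag_pairs])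
qed

text \<open>Substituting x = \<open>snd p\<close> + t in the integral over the last side turns the
  condition on the lag into two conditions on the translated pair. Stationarity then moves the
  translation to the unit cube, and integrating over t removes the cube because its volume is
  1.\<close>

lemma campbell_is_reduced_moment: "is_reduced_moment M N 2 campbell"
 unfolding is_reduced_moment_def
proof (intro conjI allI impI)
 show "sets campbell = sets (red_borel 2)" by (rule sets_campbell)
 fix A :: "nat => 'a set" assume A': "\<forall>l\<in>{1..2}. A l \<in> sets borel & bounded (A l)"
 then have A: "A 1 \<in> sets borel" "bounded (A 1)" "A 2 \<in> sets borel" "bounded (A 2)" by auto
 note [measurable] = A(1,3) unit_cube_borel
 let ?S = "%t. {p :: 'a \<times> 'a. fst p + t \<in> A 1 & snd p + t \<in> A 2 & snd p \<in> unit_cube}" and ?D = "%x. {p :: 'a \<times> 'a. fst p - snd p + x \<in> A 1}"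
  and ?E = "%t. {p :: 'a \<times> 'a. fst p \<in> A 1 & snd p \<in> A 2 & snd p - t \<in> unit_cube}" and ?e = "%n. emeasure (pair_mean n)"
 define W where "W = A 1 Un A 2"
 have W: "W \<in> sets borel" "bounded W" using A by (auto simp: W_def)
 interpret m2: finite_measure "mom2 W" by (rule finite_measure_mom(2)[OF W])
 interpret pm2: pair_sigma_finite lborel "mom2 W" ..
 have s12: "{1..2} = {1, 2::nat}" by auto
 \<comment> \<open>Summing over the shells restores the full second moment measure, which is
   invariant under the common shift of both points by t.\<close>
 have shift: "(\<Sum>n. ?e n (?S t))
   = emeasure (mom2 W) (?E t)" for t
 proof -
  define P where "P l = (if l = 1 then {y. y + t \<in> A 1} else {y. y + t \<in> A 2} Int unit_cube)" for l :: nat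
  have tr: "{y. y + t \<in> B} = (%y. y + (- t)) ` B" for B unfolding image_add_eq_vimage by auto
  have P: "P 1 \<in> sets borel" "bounded (P 1)" "P 2 \<in> sets borel" "bounded (P 2)"
   unfolding P_def tr using borel_translate[OF A(1), of "- t"] borel_translate[OF A(3), of "- t"]
    bounded_translate[OF A(2), of "- t"] bounded_translate[OF A(4), of "- t"] unit_cube_borel
   by (auto simp: bounded_Int)
  let ?V = "P 1 Un P 2"
  have V: "?V \<in> sets borel" "bounded ?V" using P by auto
  have "(\<Sum>n. ?e n (?S t))
    = (\<Sum>n. ?e n {p. fst p \<in> P 1 & snd p \<in> P 2})"
   by (simp add: P_def conj_assoc)
  also have "... = emeasure (mom2 ?V) (P 1 \<times> P 2)"
   by (rule sum_pair_mean(1)[OF P V]) (auto simp: P_def)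
  also have "... = fact_moment M N {1, 2} P"
   unfolding mom2_def by (rule fact_moment_2[symmetric]) (use P V in auto)
  also have "... = fact_moment M N {1..2} (%l. (%y. y + t) ` P l)"
   unfolding s12[symmetric]
  proof (rule stationary_fact_moment[symmetric])
   fix l assume "l \<in> {1..2::nat}"
   then have "l = 1 \<or> l = 2" by auto
   with P show "P l \<in> sets borel & bounded (P l)" by blast
  qed simp
  also have "... = emeasure (mom2 W) ((%y. y + t) ` P 1 \<times> (%y. y + t) ` P 2)"
  proof -
   have "(%y. y + t) ` P 1 \<subseteq> W" "(%y. y + t) ` P 2 \<subseteq> W" by (auto simp: P_def W_def)
   then show ?thesis unfolding s12 mom2_def
    by (intro fact_moment_2[of W 1 2 "%l. (%y. y + t) ` P l"] W borel_translate P) simp_all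
  qed
  also have "(%y. y + t) ` P 1 \<times> (%y. y + t) ` P 2 = (?E t)"
   unfolding image_add_eq_vimage by (auto simp: P_def)
  finally show ?thesis .
 qed
 \<comment> \<open>Fubini is applied twice with the substitution in between; the cube condition may
   be written out since \<open>pair_mean\<close> is carried by pairs with second point in the
   cube.\<close>
 have fub: "(\<integral>\<^sup>+x. indicator (A 2) x * ?e n (?D x) \<partial>lborel)
   = (\<integral>\<^sup>+t. ?e n (?S t) \<partial>lborel)" for n
 proof -
  interpret pn: finite_measure "pair_mean n" by (rule finite_measure_pair_mean)
  interpret pp: pair_sigma_finite lborel "pair_mean n" ..
  have sp[measurable_cong]: "sets (pair_mean n) = sets borel" by (simp add: pair_mean_def)
  have restr: "?e n S = ?e n (S Int {p. snd p \<in> unit_cube})"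
   if S: "S \<in> sets borel" for S
  proof -
   have "{p :: 'a \<times> 'a. snd p \<in> unit_cube} \<in> sets borel" by measurable
   then have S2: "S Int {p. snd p \<in> unit_cube} \<in> sets borel" using S by auto
   have "lag_pairs n om Int S = lag_pairs n om Int (S Int {p. snd p \<in> unit_cube})" for om
    by (auto simp: lag_pairs_def)
   then show ?thesis
    unfolding pair_mean_def emeasure_mean_measure[OF random_finite_lag_pairs S]
     emeasure_mean_measure[OF random_finite_lag_pairs S2] by simp
  qed
  have "(\<integral>\<^sup>+x. indicator (A 2) x * ?e n (?D x) \<partial>lborel)
    = (\<integral>\<^sup>+x. (\<integral>\<^sup>+p. indicator (A 2) x * indicator (?D x) p \<partial>pair_mean n) \<partial>lborel)"
  proof (rule nn_integral_cong)
   fix x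
   have "(?D x) \<in> sets (pair_mean n)" unfolding sp by measurable
   then show "indicator (A 2) x * ?e n (?D x)
    = (\<integral>\<^sup>+p. indicator (A 2) x * indicator (?D x) p \<partial>pair_mean n)"
    by (subst nn_integral_cmult) auto
  qed
  also have "... = (\<integral>\<^sup>+x. (\<integral>\<^sup>+p. indicator (A 2) x * indicator (A 1) (fst p - snd p + x) \<partial>pair_mean n) \<partial>lborel)"
   by (intro nn_integral_cong) (simp add: indicator_def)
  also have "... = (\<integral>\<^sup>+p. (\<integral>\<^sup>+x. indicator (A 2) x * indicator (A 1) (fst p - snd p + x) \<partial>lborel) \<partial>pair_mean n)"
   by (rule pp.Fubini'[symmetric]) measurable
  also have "... = (\<integral>\<^sup>+p. (\<integral>\<^sup>+t. indicator (A 2) (snd p + t) * indicator (A 1) (fst p + t) \<partial>lborel) \<partial>pair_mean n)"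
  proof (rule nn_integral_cong)
   fix p :: "'a \<times> 'a"
   have "(\<integral>\<^sup>+t. indicator (A 2) (snd p + t) * indicator (A 1) (fst p - snd p + (snd p + t)) \<partial>lborel)
     = (\<integral>\<^sup>+x. indicator (A 2) x * indicator (A 1) (fst p - snd p + x) \<partial>lborel)"
    by (rule nn_integral_lborel_plus[where f="%x. indicator (A 2) x * indicator (A 1) (fst p - snd p + x)"]) measurable
   then show "(\<integral>\<^sup>+x. indicator (A 2) x * indicator (A 1) (fst p - snd p + x) \<partial>lborel)
     = (\<integral>\<^sup>+t. indicator (A 2) (snd p + t) * indicator (A 1) (fst p + t) \<partial>lborel)"
    by (simp add: algebra_simps)
  qed
  also have "... = (\<integral>\<^sup>+t. (\<integral>\<^sup>+p. indicator (A 2) (snd p + t) * indicator (A 1) (fst p + t) \<partial>pair_mean n) \<partial>lborel)"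
   by (rule pp.Fubini') measurable
  also have "... = (\<integral>\<^sup>+t. ?e n (?S t) \<partial>lborel)"
  proof (rule nn_integral_cong)
   fix t
   have S: "{p :: 'a \<times> 'a. fst p + t \<in> A 1 & snd p + t \<in> A 2} \<in> sets borel" by measurable
   have "(\<integral>\<^sup>+p. indicator (A 2) (snd p + t) * indicator (A 1) (fst p + t) \<partial>pair_mean n)
     = (\<integral>\<^sup>+p. indicator {p. fst p + t \<in> A 1 & snd p + t \<in> A 2} p \<partial>pair_mean n)"
    by (intro nn_integral_cong) (auto simp: indicator_def)
   also have "... = ?e n {p. fst p + t \<in> A 1 & snd p + t \<in> A 2}"
    using S by (intro nn_integral_indicator) (simp add: sp)
   also have "... = ?e n ({p. fst p + t \<in> A 1 & snd p + t \<in> A 2} Int {p. snd p \<in> unit_cube})"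
    by (rule restr[OF S])
   also have "{p. fst p + t \<in> A 1 & snd p + t \<in> A 2} Int {p. snd p \<in> unit_cube}
     = (?S t)" by auto
   finally show "(\<integral>\<^sup>+p. indicator (A 2) (snd p + t) * indicator (A 1) (fst p + t) \<partial>pair_mean n)
    = ?e n (?S t)" .
  qed
  finally show ?thesis .
 qed
 have m1: "(%x. ?e n (?D x)) \<in> borel_measurable borel" for n
 proof -
  interpret pn: finite_measure "pair_mean n" by (rule finite_measure_pair_mean)
  have sp[measurable_cong]: "sets (pair_mean n) = sets borel" by (simp add: pair_mean_def)
  have "(%x. \<integral>\<^sup>+p. indicator (A 1) (fst p - snd p + x) \<partial>pair_mean n) \<in> borel_measurable borel"
   by measurable
  also have "(%x. \<integral>\<^sup>+p. indicator (A 1) (fst p - snd p + x) \<partial>pair_mean n) = (%x. ?e n (?D x))"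
  proof (rule ext)
   fix x
   have "(?D x) \<in> sets (pair_mean n)" unfolding sp by measurable
   from nn_integral_indicator[OF this]
   show "(\<integral>\<^sup>+p. indicator (A 1) (fst p - snd p + x) \<partial>pair_mean n) = ?e n (?D x)"
    by (simp add: indicator_def)
  qed
  finally show ?thesis .
 qed
 have m2: "(%t. ?e n (?S t)) \<in> borel_measurable borel" for n
 proof -
  interpret pn: finite_measure "pair_mean n" by (rule finite_measure_pair_mean)
  have sp[measurable_cong]: "sets (pair_mean n) = sets borel" by (simp add: pair_mean_def)
  have "(%t. \<integral>\<^sup>+p. indicator (A 1) (fst p + t) * indicator (A 2) (snd p + t) * indicator unit_cube (snd p) \<partial>pair_mean n) \<in> borel_measurable borel"
   by measurable
  also have "(%t. \<integral>\<^sup>+p. indicator (A 1) (fst p + t) * indicator (A 2) (snd p + t) * indicator unit_cube (snd p) \<partial>pair_mean n)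
    = (%t. ?e n (?S t))"
  proof (rule ext)
   fix t
   have "(?S t) \<in> sets (pair_mean n)" unfolding sp by measurable
   then have "?e n (?S t)
    = (\<integral>\<^sup>+p. indicator (?S t) p \<partial>pair_mean n)" by simp
   also have "... = (\<integral>\<^sup>+p. indicator (A 1) (fst p + t) * indicator (A 2) (snd p + t) * indicator unit_cube (snd p) \<partial>pair_mean n)"
    by (intro nn_integral_cong) (simp add: indicator_def)
   finally show "(\<integral>\<^sup>+p. indicator (A 1) (fst p + t) * indicator (A 2) (snd p + t) * indicator unit_cube (snd p) \<partial>pair_mean n)
    = ?e n (?S t)" by simp
  qed
  finally show ?thesis .
 qed
 have inv: "ennreal lam * ennreal (1 / lam) = 1"
  using intensity_pos by (subst ennreal_mult[symmetric]) auto
 have "ennreal lam * (\<integral>\<^sup>+x\<in>A 2. emeasure campbell (rect_minus 2 A x) \<partial>lborel)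
   = ennreal lam * (\<integral>\<^sup>+x. ennreal (1 / lam) * (\<Sum>n. indicator (A 2) x * ?e n (?D x)) \<partial>lborel)"
  unfolding emeasure_campbell_rect[of A, OF A(1)] by (simp add: mult_ac)
 also have "... = ennreal lam * (ennreal (1 / lam) * (\<integral>\<^sup>+x. (\<Sum>n. indicator (A 2) x * ?e n (?D x)) \<partial>lborel))"
  using m1 by (subst nn_integral_cmult) auto
 also have "... = (\<integral>\<^sup>+x. (\<Sum>n. indicator (A 2) x * ?e n (?D x)) \<partial>lborel)"
  using inv by (simp add: mult.assoc[symmetric])
 also have "... = (\<Sum>n. \<integral>\<^sup>+x. indicator (A 2) x * ?e n (?D x) \<partial>lborel)"
  using m1 by (intro nn_integral_suminf) simp
 also have "... = (\<integral>\<^sup>+t. (\<Sum>n. ?e n (?S t)) \<partial>lborel)"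
  unfolding fub using m2 by (intro nn_integral_suminf[symmetric]) simp
 also have "... = (\<integral>\<^sup>+t. emeasure (mom2 W) (?E t) \<partial>lborel)"
  unfolding shift ..
 also have "... = (\<integral>\<^sup>+t. (\<integral>\<^sup>+p. indicator (A 1 \<times> A 2) p * indicator unit_cube (snd p - t) \<partial>mom2 W) \<partial>lborel)"
 proof (rule nn_integral_cong)
  fix t
  have "(?E t) \<in> sets borel" by measurable
  then have "emeasure (mom2 W) (?E t)
   = (\<integral>\<^sup>+p. indicator (?E t) p \<partial>mom2 W)" by simp
  also have "... = (\<integral>\<^sup>+p. indicator (A 1 \<times> A 2) p * indicator unit_cube (snd p - t) \<partial>mom2 W)"
   by (intro nn_integral_cong) (simp add: indicator_def mem_Times_iff)
  finally show "emeasure (mom2 W) (?E t) = ..." .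
 qed
 also have "... = (\<integral>\<^sup>+p. (\<integral>\<^sup>+t. indicator (A 1 \<times> A 2) p * indicator unit_cube (snd p - t) \<partial>lborel) \<partial>mom2 W)"
 proof (rule pm2.Fubini'[symmetric])
  have [measurable]: "A 1 \<times> A 2 \<in> sets (borel :: ('a \<times> 'a) measure)" by (intro borel_Times A)
  show "(%(t, p). indicator (A 1 \<times> A 2) p * indicator unit_cube (snd p - t) :: ennreal) \<in> borel_measurable (lborel \<Otimes>\<^sub>M mom2 W)"
   by measurable
 qed
 also have "... = (\<integral>\<^sup>+p. indicator (A 1 \<times> A 2) p \<partial>mom2 W)"
 proof (rule nn_integral_cong)
  fix p :: "'a \<times> 'a"
  have "(\<integral>\<^sup>+t. indicator unit_cube (snd p - t) \<partial>lborel) = (\<integral>\<^sup>+t. indicator unit_cube t \<partial>(lborel :: 'a measure))"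
   by (rule nn_integral_lborel_minus) measurable
  also have "... = 1" by (simp add: emeasure_unit_cube)
  finally have "(\<integral>\<^sup>+t. indicator unit_cube (snd p - t) \<partial>lborel) = 1" .
  then show "(\<integral>\<^sup>+t. indicator (A 1 \<times> A 2) p * indicator unit_cube (snd p - t) \<partial>lborel) = indicator (A 1 \<times> A 2) p"
   by (subst nn_integral_cmult) simp_all
 qed
 also have "... = emeasure (mom2 W) (A 1 \<times> A 2)" using borel_Times[OF A(1,3)] by simp
 also have "... = fact_moment M N {1..2} A"
  unfolding s12 mom2_def by (rule fact_moment_2[symmetric]) (use A W in \<open>auto simp: W_def\<close>)
 finally show "fact_moment M N {1..2} A = ennreal lam * (\<integral>\<^sup>+x\<in>A 2. emeasure campbell (rect_minus 2 A x) \<partial>lborel)"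
  by simp
qed

text \<open>Existence of one witness turns the defining property into a fact about the chosen
  measure; all later use of \<open>alpha_red\<close> goes through this property.\<close>

lemma alpha_red_is_reduced_moment: "is_reduced_moment M N 2 (alpha_red M N 2)"
 unfolding alpha_red_def by (rule someI[where P="is_reduced_moment M N 2", OF campbell_is_reduced_moment])

end

section \<open>Edge corrected sums\<close>

text \<open>The set covariance function of W. The edge correction depends on a pair of points only
  through this function of the lag, by \<open>overlap_edge\<close>.\<close>

definition overlap :: "'a::euclidean_space set => 'a => real" where
 "overlap W z = vol (W Int {u. u + z \<in> W})"

lemma emeasure_lborel_translate:
 assumes A: "A \<in> sets borel"
 shows "emeasure lborel ((%y. y + x) ` A) = emeasure lborel (A :: 'a::euclidean_space set)"
proof -
 have tr: "(%y. y + x) ` A \<in> sets borel" by (rule borel_translate[OF A])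
 have "emeasure lborel ((%y. y + x) ` A) = (\<integral>\<^sup>+y. indicator ((%y. y + x) ` A) y \<partial>lborel)"
  using tr by simp
 also have "... = (\<integral>\<^sup>+y. indicator A (- x + y) \<partial>lborel)"
  unfolding image_add_eq_vimage by (intro nn_integral_cong) (simp add: indicator_def)
 also have "... = (\<integral>\<^sup>+y. indicator A y \<partial>lborel)" using A by (intro nn_integral_lborel_plus) auto
 also have "... = emeasure lborel A" using A by simp
 finally show ?thesis .
qed

lemma integral_lborel_plus:
 fixes h :: "'a::euclidean_space => real"
 shows "(LINT y|lborel. h (x + y)) = (LINT y|lborel. h y)"
proof (cases "h \<in> borel_measurable borel")
 case True
 have "(LINT y|lborel. h y) = (\<integral>y. h y \<partial>distr lborel borel ((+) x))"
  by (simp only: lborel_distr_plus)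
 also have "... = (LINT y|lborel. h (x + y))" by (rule integral_distr) (use True in simp_all)
 finally show ?thesis by simp
next
 case False
 have "(%y. h (x + y)) \<notin> borel_measurable borel"
 proof
  assume "(%y. h (x + y)) \<in> borel_measurable borel"
  then have "(%y. h (x + (- x + y))) \<in> borel_measurable borel" by (rule measurable_compose[rotated]) simp
  with False show False by simp
 qed
 then have "\<not> integrable lborel (%y. h (x + y))" "\<not> integrable lborel h"
  using False borel_measurable_integrable[of lborel "%y. h (x + y)"] borel_measurable_integrable[of lborel h] by auto
 then show ?thesis by (simp add: not_integrable_integral_eq)
qed

lemma overlap_set_borel: "W \<in> sets borel ==> W Int {u. u + z \<in> W} \<in> sets (borel :: 'a::euclidean_space measure)"
proof -
 assume W: "W \<in> sets borel"
 have "{u. u + z \<in> W} = (%y. y + (- z)) ` W" unfolding image_add_eq_vimage by auto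
 then show ?thesis using borel_translate[OF W, of "- z"] W by auto
qed

lemma overlap_edge:
 assumes W: "W \<in> sets borel"
 shows "vol (((%z. z - x) ` W) Int ((%z. z - y) ` W)) = overlap W (y - x :: 'a::euclidean_space)"
proof -
 have "((%z. z - x) ` W) Int ((%z. z - y) ` W) = (%v. v + (- x)) ` (W Int {u. u + (y - x) \<in> W})"
  using image_add_eq_vimage[of "- x" W] image_add_eq_vimage[of "- y" W] image_add_eq_vimage[of "- x" "W Int {u. u + (y - x) \<in> W}"]
  by (auto simp: algebra_simps)
 then show ?thesis
  using emeasure_lborel_translate[OF overlap_set_borel[OF W], of "- x" "y - x"] by (simp add: overlap_def measure_def)
qed

lemma overlap_minus:
 assumes W: "W \<in> sets borel" shows "overlap W (- z) = overlap W (z :: 'a::euclidean_space)"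
proof -
 have "W Int {u. u + (- z) \<in> W} = (%v. v + z) ` (W Int {u. u + z \<in> W})"
  unfolding image_add_eq_vimage by auto
 then show ?thesis
  using emeasure_lborel_translate[OF overlap_set_borel[OF W], of z z] by (simp add: overlap_def measure_def)
qed

lemma overlap_le:
 assumes W: "W \<in> sets borel" "bounded W" shows "overlap W (z :: 'a::euclidean_space) <= vol W"
 unfolding overlap_def
proof (rule measure_mono_fmeasurable)
 show "W \<in> fmeasurable lborel" using W emeasure_bounded_finite[OF W(2)] by (simp add: fmeasurable_def less_top)
qed (use overlap_set_borel[OF W(1)] in auto)

lemma overlap_integral:
 assumes W: "W \<in> sets borel" "bounded W"
 shows "overlap W z = (LINT x|leb_on W. indicator W (x + z :: 'a::euclidean_space))"
proof -
 have m: "(%x. indicator W (x + z) :: real) \<in> borel_measurable borel" using W(1) by measurable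
 have "(LINT x|leb_on W. indicator W (x + z)) = (\<integral>x. indicator W x * indicator W (x + z) \<partial>lborel :: real)"
  by (rule integral_leb_on[OF W(1) m])
 also have "... = (LINT x|lborel. indicator (W Int {u. u + z \<in> W}) x)"
  by (rule bochner_integral_cong) (auto simp: indicator_def)
 also have "... = overlap W z" using overlap_set_borel[OF W(1), of z] by (simp add: overlap_def)
 finally show ?thesis by simp
qed

lemma overlap_borel [measurable]:
 assumes W: "W \<in> sets borel" "bounded W" shows "overlap W \<in> borel_measurable (borel :: 'a::euclidean_space measure)"
proof -
 interpret finite_measure "leb_on W" by (rule finite_measure_leb_on[OF W])
 note [measurable] = W(1)
 have "(%(z, x). indicator W (x + z) :: real) \<in> borel_measurable (borel \<Otimes>\<^sub>M leb_on W)" by measurable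
 then have "(%z. \<integral>x. indicator W (x + z) \<partial>leb_on W :: real) \<in> borel_measurable borel" by (rule borel_measurable_lebesgue_integral)
 then show ?thesis by (simp add: overlap_integral[OF W, symmetric])
qed

lemma edge_corrected_sum_eq:
 assumes W: "W \<in> sets borel"
 shows "edge_corrected_sum W ph k = (\<Sum>p\<in>tuples2 (ph Int W). k (snd p - fst p) / overlap W (snd p - fst p :: 'a::euclidean_space))"
 unfolding edge_corrected_sum_def overlap_edge[OF W] tuples2_def by (simp add: split_def)

text \<open>The number dl bounds the relative loss of overlap over all lags in A. Being at most 1/2
  it keeps the denominators above |W| / 2, and its smallness measures the boundary effect.\<close>

locale window_kernel = B4_process M N
 for M :: "'o measure" and N :: "'o => 'a::euclidean_space set" +
 fixes W A :: "'a set" and k :: "'a => real" and Ck dl :: real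
 assumes W: "W \<in> sets borel" "bounded W" and A: "A \<in> sets borel" "bounded A" and volW: "0 < vol W"
  and k_borel [measurable]: "k \<in> borel_measurable borel" and k_nonneg: "0 <= k z" and k_le: "k z <= Ck"
  and k_sym: "k (- z) = k z" and k_out: "z \<notin> A ==> k z = 0"
  and dl: "0 <= dl" "dl <= 1 / 2" and overlap_ge: "z \<in> A ==> (1 - dl) * vol W <= overlap W z"
begin

definition "u z = k z / overlap W z"
definition "f x y = indicator W x * indicator W y * u (y - x)"

lemmas W_measurable [measurable] = W(1) A(1)
lemmas overlap_m [measurable] = overlap_borel[OF W]

lemma overlap_half: "z \<in> A ==> vol W / 2 <= overlap W z"
proof -
 assume "z \<in> A"
 have "1 / 2 * vol W <= (1 - dl) * vol W" using dl volW by (intro mult_right_mono) auto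
 with overlap_ge[OF \<open>z \<in> A\<close>] show ?thesis by simp
qed

lemma overlap_pos: "z \<in> A ==> 0 < overlap W z"
 using overlap_half[of z] volW by linarith

lemma Ck_nonneg: "0 <= Ck" using k_nonneg[of 0] k_le[of 0] by linarith

lemma u_borel [measurable]: "u \<in> borel_measurable borel" unfolding u_def[abs_def] by measurable

lemma u_nonneg: "0 <= u z" using k_nonneg by (simp add: u_def overlap_def)

lemma u_out: "z \<notin> A ==> u z = 0" by (simp add: u_def k_out)

lemma u_le_k: "u z <= 2 * (k z / vol W)"
proof (cases "z \<in> A")
 case True
 have "u z <= k z / (vol W / 2)"
  unfolding u_def using k_nonneg overlap_half[OF True] volW by (intro divide_left_mono) (auto simp: overlap_pos[OF True])
 then show ?thesis by (simp add: mult.commute)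
next
 case False then show ?thesis by (simp add: u_out k_out)
qed

lemma u_le: "u z <= 2 * Ck / vol W"
proof -
 have "k z / vol W <= Ck / vol W" using k_le volW by (intro divide_right_mono) auto
 with u_le_k[of z] show ?thesis by simp
qed

lemma overlap_u: "overlap W z * u z = k z"
 using overlap_pos[of z] k_out[of z] by (cases "z \<in> A") (auto simp: u_def)

sublocale pair_kernel M N W A f "2 * Ck / vol W"
proof
 show "(%p. f (fst p) (snd p)) \<in> borel_measurable borel" unfolding f_def by measurable
 show "f x y = f y x" for x y
  using k_sym[of "y - x"] overlap_minus[OF W(1), of "y - x"] by (simp add: f_def u_def)
 show "\<bar>f x y\<bar> <= 2 * Ck / vol W * indicator A (y - x)" for x y
  using u_le[of "y - x"] u_nonneg[of "y - x"] u_out[of "y - x"]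
  by (cases "x \<in> W"; cases "y \<in> W"; cases "y - x \<in> A") (simp_all add: f_def)
 show "x \<notin> W ==> f x y = 0" for x y by (simp add: f_def)
 show "0 <= 2 * Ck / vol W" using Ck_nonneg by simp
qed (use W A in auto)

lemma edge_sum_eq: "edge_corrected_sum W (N om) k = pair_sum om"
 unfolding edge_corrected_sum_eq[OF W(1)] pair_sum_def
 by (intro sum.cong refl) (auto simp: f_def tuples2_def u_def)

lemma fmW: "finite_measure (leb_on W)" and fmA: "finite_measure (leb_on A)"
 by (rule finite_measure_leb_on[OF W] finite_measure_leb_on[OF A])+

lemma measure_leb_W: "measure (leb_on W) UNIV = vol W"
 using emeasure_leb_on[OF W(1), of UNIV] by (simp add: measure_def)

definition "kappa = (LINT z|lborel. k z)"

lemma ind_k: "indicator A z * k z = k z" using k_out by (cases "z \<in> A") auto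

lemma kappa_leb: "(LINT z|leb_on A. k z) = kappa"
 unfolding integral_leb_on[OF A(1) k_borel] ind_k kappa_def ..

lemma kappa_nonneg: "0 <= kappa" unfolding kappa_def by (rule Bochner_Integration.integral_nonneg) (simp add: k_nonneg)

lemma integrable_leb_A: "h \<in> borel_measurable borel ==> (!!x. \<bar>h x\<bar> <= C) ==> integrable (leb_on A) (h :: 'a => real)"
 using integrable_bounded_finite[OF fmA sets_leb_on] by blast

lemma integrable_leb_W: "h \<in> borel_measurable borel ==> (!!x. \<bar>h x\<bar> <= C) ==> integrable (leb_on W) (h :: 'a => real)"
 using integrable_bounded_finite[OF fmW sets_leb_on] by blast

lemma integrable_k: "integrable (leb_on A) k"
 by (rule integrable_leb_A[where C=Ck]) (auto simp: k_nonneg k_le abs_of_nonneg)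

lemma g_eq: "g x = lam * indicator W x * (LINT z|leb_on A. indicator W (x + z) * u z)"
proof -
 have "g x = lam * (LINT y|lborel. indicator W y * f x y)"
  unfolding g_def by (rule integral_mom1[OF W]) measurable
 also have "(LINT y|lborel. indicator W y * f x y)
   = (LINT y|lborel. indicator W x * (indicator W y * u (y - x)))"
  by (rule bochner_integral_cong) (simp_all add: f_def indicator_def)
 also have "... = indicator W x * (LINT y|lborel. indicator W y * u (y - x))"
  by (rule integral_mult_right_zero)
 also have "(LINT y|lborel. indicator W y * u (y - x))
   = (LINT z|lborel. indicator W (x + z) * u (x + z - x))"
  by (rule integral_lborel_plus[symmetric])
 also have "... = (LINT z|lborel. indicator A z * (indicator W (x + z) * u z))"
  by (rule bochner_integral_cong) (auto simp: indicator_def u_out)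
 also have "... = (LINT z|leb_on A. indicator W (x + z) * u z)"
  by (rule integral_leb_on[symmetric, OF A(1)]) measurable
 finally show ?thesis by simp
qed

text \<open>If the edge effects are ignored, g equals lam kappa / |W| on the window;
  \<open>hh\<close> is the deviation caused by the boundary.\<close>

definition "hh x = g x - lam * kappa / vol W * indicator W x"

lemma hh_borel [measurable]: "hh \<in> borel_measurable borel" unfolding hh_def[abs_def] by measurable

lemma w_bound: "\<bar>indicator W x * u z - k z / vol W\<bar> <= 3 * k z / vol W"
proof -
 have "0 <= k z / vol W" using k_nonneg volW by simp
 moreover have "3 * k z / vol W = 3 * (k z / vol W)" by simp
 ultimately show ?thesis using u_le_k[of z] u_nonneg[of z] by (cases "x \<in> W") (simp_all add: abs_le_iff)
qed

lemma w_bound': "\<bar>indicator A z * (indicator W x * u z - k z / vol W)\<bar> <= 3 * k z / vol W"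
 using w_bound[of x z] k_nonneg[of z] volW by (cases "z \<in> A") auto

lemma leb_on_A_cong: "(!!z. z \<in> A ==> h z = h' z) ==> h \<in> borel_measurable borel ==> h' \<in> borel_measurable borel ==>
  (LINT z|leb_on A. h z) = (LINT z|leb_on A. (h' z :: real))"
 unfolding integral_leb_on[OF A(1)] by (rule bochner_integral_cong) (auto simp: indicator_def)

lemma hh_eq: "hh x = lam * indicator W x * (LINT z|leb_on A. indicator A z * (indicator W (x + z) * u z - k z / vol W))"
proof -
 have i1: "integrable (leb_on A) (%z. indicator W (x + z) * u z)"
 proof (rule integrable_leb_A[where C="2 * Ck / vol W"])
  fix z
  have "\<bar>indicator W (x + z) * u z\<bar> <= u z" using u_nonneg[of z] by (simp add: indicator_def)
  also have "... <= 2 * Ck / vol W" by (rule u_le)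
  finally show "\<bar>indicator W (x + z) * u z\<bar> <= 2 * Ck / vol W" .
 qed measurable
 have i2: "integrable (leb_on A) (%z. k z / vol W)" using integrable_k by simp
 have "(LINT z|leb_on A. indicator A z * (indicator W (x + z) * u z - k z / vol W))
  = (LINT z|leb_on A. indicator W (x + z) * u z - k z / vol W)"
  by (rule leb_on_A_cong) (simp, measurable)
 also have "... = (LINT z|leb_on A. indicator W (x + z) * u z) - kappa / vol W"
  using i1 i2 by (simp add: kappa_leb)
 finally have e: "(LINT z|leb_on A. indicator A z * (indicator W (x + z) * u z - k z / vol W))
  = (LINT z|leb_on A. indicator W (x + z) * u z) - kappa / vol W" .
 show ?thesis unfolding hh_def g_eq e by (simp add: right_diff_distrib)
qed

lemma hh_le: "\<bar>hh x\<bar> <= 3 * lam * kappa / vol W"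
proof -
 have "\<bar>\<integral>z. indicator A z * (indicator W (x + z) * u z - k z / vol W) \<partial>leb_on A\<bar>
   <= (LINT z|leb_on A. 3 * k z / vol W)"
 proof (rule order_trans[OF integral_abs_bound], rule integral_mono')
  show "integrable (leb_on A) (%z. 3 * k z / vol W)" using integrable_k by simp
 qed (use w_bound' k_nonneg volW in auto)
 also have "... = 3 * kappa / vol W" by (simp add: kappa_leb)
 finally have b: "\<bar>\<integral>z. indicator A z * (indicator W (x + z) * u z - k z / vol W) \<partial>leb_on A\<bar> <= 3 * kappa / vol W" .
 have "\<bar>hh x\<bar> <= lam * \<bar>\<integral>z. indicator A z * (indicator W (x + z) * u z - k z / vol W) \<partial>leb_on A\<bar>"
  unfolding hh_eq abs_mult using intensity_pos by (simp add: indicator_def)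
 also have "... <= lam * (3 * kappa / vol W)" using b intensity_pos by (intro mult_left_mono) auto
 finally show ?thesis by (simp add: mult_ac)
qed

lemma hh_out: "x \<notin> W ==> hh x = 0" by (simp add: hh_def g_out)

text \<open>For a fixed lag z put c = k z / |W|. The deviation is u - c on the overlap of W with its
  translate and c on the rest of W. Since overlap times u is k z, these add up to 2 k z (1 - overlap
  / |W|), at most 2 dl k z.\<close>

lemma integral_hh_le: "(LINT x|lborel. indicator W x * \<bar>hh x\<bar>) <= 2 * lam * dl * kappa"
proof -
 define F where "F p = \<bar>indicator A (snd p) * (indicator W (fst p + snd p) * u (snd p) - k (snd p) / vol W)\<bar>" for p
 have Fm: "F \<in> borel_measurable borel" unfolding F_def[abs_def] by measurable
 have Fb: "\<bar>F p\<bar> <= 3 * Ck / vol W" for p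
 proof -
  have "\<bar>F p\<bar> <= 3 * k (snd p) / vol W" unfolding F_def abs_abs by (rule w_bound')
  also have "... <= 3 * Ck / vol W" using k_le volW by (intro divide_right_mono) auto
  finally show ?thesis .
 qed
 note fub = integral_pair_borel[OF fmW fmA sets_leb_on sets_leb_on Fm Fb]
 have zint: "(LINT x|leb_on W. F (x, z)) <= 2 * dl * k z" for z
 proof (cases "z \<in> A")
  case False then show ?thesis using k_nonneg dl by (simp add: F_def)
 next
  case True
  note ov = overlap_pos[OF True] overlap_le[OF W, of z] overlap_ge[OF True]
  define c where "c = k z / vol W"
  have cu: "c <= u z" "0 <= c"
   unfolding c_def u_def using ov k_nonneg volW by (auto intro!: divide_left_mono)
  \<comment> \<open>Because c lies between 0 and u, the absolute value is u - c inside the overlap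
    and c outside, which is affine in the indicator.\<close>
  have eq: "F (x, z) = indicator W (x + z) * (u z - c - c) + c" for x
   using True cu by (simp add: F_def indicator_def c_def[symmetric])
  have i: "integrable (leb_on W) (%x. indicator W (x + z) :: real)"
  proof (rule integrable_leb_W[where C=1])
   show "(%x. indicator W (x + z) :: real) \<in> borel_measurable borel" by measurable
  qed (simp add: indicator_def)
  have ic: "integrable (leb_on W) (%x. c)" by (rule integrable_leb_W[where C="\<bar>c\<bar>"]) auto
  have "(LINT x|leb_on W. F (x, z))
    = overlap W z * (u z - c - c) + c * vol W"
   unfolding eq using i ic by (simp add: overlap_integral[OF W, symmetric] measure_leb_W)
  also have "... = overlap W z * u z - 2 * overlap W z * c + c * vol W" by (simp add: algebra_simps)
  also have "... = 2 * k z * (1 - overlap W z / vol W)" unfolding overlap_u c_def using volW by (simp add: field_simps)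
  also have "... <= 2 * k z * dl"
   using ov(3) volW k_nonneg by (intro mult_left_mono) (auto simp: field_simps)
  finally show ?thesis by (simp add: mult_ac)
 qed
 have hb: "\<bar>hh x\<bar> <= lam * (LINT z|leb_on A. F (x, z))" for x
 proof -
  have "\<bar>hh x\<bar> <= lam * \<bar>\<integral>z. indicator A z * (indicator W (x + z) * u z - k z / vol W) \<partial>leb_on A\<bar>"
   unfolding hh_eq abs_mult using intensity_pos by (simp add: indicator_def)
  also have "... <= lam * (LINT z|leb_on A. F (x, z))"
   using intensity_pos by (intro mult_left_mono order_trans[OF integral_abs_bound]) (simp_all add: F_def)
  finally show ?thesis .
 qed
 have Fxm: "(%x. \<integral>z. F (x, z) \<partial>leb_on A) \<in> borel_measurable borel"
 proof -
  interpret finite_measure "leb_on A" by (rule fmA)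
  have "(%(x, z). F (x, z)) \<in> borel_measurable (borel \<Otimes>\<^sub>M leb_on A)"
   using measurable_pair_borel[OF refl sets_leb_on Fm] by simp
  then show ?thesis by (rule borel_measurable_lebesgue_integral)
 qed
 have iF: "integrable (leb_on W) (%x. \<integral>z. F (x, z) \<partial>leb_on A)"
 proof (rule integrable_leb_W[OF Fxm])
  fix x
  have "\<bar>\<integral>z. F (x, z) \<partial>leb_on A\<bar> <= (LINT z|leb_on A. 3 * Ck / vol W)"
  proof (rule order_trans[OF integral_abs_bound], rule integral_mono')
   show "integrable (leb_on A) (%z. 3 * Ck / vol W)" by (rule integrable_leb_A[where C="\<bar>3 * Ck / vol W\<bar>"]) auto
  qed (use Fb Ck_nonneg volW in auto)
  then show "\<bar>\<integral>z. F (x, z) \<partial>leb_on A\<bar> <= \<bar>\<integral>z. 3 * Ck / vol W \<partial>leb_on A\<bar>"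
   by (rule order_trans[OF _ abs_ge_self])
 qed
 have "(LINT x|lborel. indicator W x * \<bar>hh x\<bar>) = (LINT x|leb_on W. \<bar>hh x\<bar>)"
  by (rule integral_leb_on[symmetric, OF W(1)]) measurable
 also have "... <= (LINT x|leb_on W. lam * (LINT z|leb_on A. F (x, z)))"
 proof (rule integral_mono)
  show "integrable (leb_on W) (%x. \<bar>hh x\<bar>)"
   by (rule integrable_leb_W[where C="3 * lam * kappa / vol W"]) (measurable, simp add: hh_le)
 qed (use iF hb in auto)
 also have "... = lam * (LINT z|leb_on A. (LINT x|leb_on W. F (x, z)))"
  using fub by simp
 also have "... <= lam * (LINT z|leb_on A. 2 * dl * k z)"
  using intensity_pos integrable_k dl k_nonneg zint by (intro mult_left_mono integral_mono') auto
 also have "... = 2 * lam * dl * kappa" by (simp add: kappa_leb)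
 finally show ?thesis .
qed

definition "resid om = edge_corrected_sum W (N om) k - expectation (%om. edge_corrected_sum W (N om) k)
 - 2 * lam * kappa * (lambda_hat W (N om) - lam)"

lemma expectation_card: "expectation (%om. real (card (N om Int W))) = lam * vol W"
proof -
 have "integral\<^sup>L (mom1 W) (%_. 1 :: real) = expectation (%om. \<Sum>p\<in>N om Int W. 1)"
  by (rule integral_mom(1)[OF W, where C=1]) simp_all
 then show ?thesis using measure_mom1[OF W] by simp
qed

text \<open>Replacing the linear sum by a multiple of the point count leaves the degenerate part of
  the pair sum plus twice the centred sum of the boundary deviations.\<close>

lemma resid_decomp:
 "resid om = (pair_sum om - 2 * lin_sum om - (e - 2 * m)) + 2 * ((\<Sum>x\<in>N om Int W. hh x) - expectation (%om. \<Sum>x\<in>N om Int W. hh x))"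
proof -
 have s: "(\<Sum>x\<in>N om Int W. hh x) = lin_sum om - lam * kappa / vol W * real (card (N om Int W))" for om
  by (simp add: hh_def lin_sum_def sum_subtractf)
 have E: "expectation (%om. \<Sum>x\<in>N om Int W. hh x) = m - lam * kappa / vol W * (lam * vol W)"
  unfolding s using variance_identity(4,6) integrable_card(1)[OF W] expectation_card
  by (subst Bochner_Integration.integral_diff) auto
 show ?thesis
  unfolding resid_def edge_sum_eq variance_identity(3) E unfolding s lambda_hat_def using volW
  by (simp add: field_simps)
qed

lemma resid_moment:
 "integrable M (%om. (resid om)\<^sup>2)"
 "expectation (%om. (resid om)\<^sup>2) <= (8 * Ck^2 * lag_measure A + 48 * lam ^ 3 * (1 + gamma_total) * dl * kappa\<^sup>2) / vol W"
proof -
 define X where "X om = pair_sum om - 2 * lin_sum om" for om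
 define Y where "Y om = (\<Sum>x\<in>N om Int W. hh x)" for om
 have iX: "integrable M X" "integrable M (%om. (X om)\<^sup>2)" "expectation X = e - 2 * m"
  unfolding X_def[abs_def] using variance_identity by simp_all
 note vp = variance_points_le[OF W hh_borel hh_le hh_out]
 have iY: "integrable M Y" "integrable M (%om. (Y om)\<^sup>2)"
  unfolding Y_def[abs_def]
  using integrable_sum_random_finite[OF random_finite_pts[OF W] integrable_card(1)[OF W] hh_borel hh_le] vp(1) by simp_all
 let ?X = "%om. X om - expectation X" and ?Y = "%om. Y om - expectation Y"
 have r: "resid om = ?X om + 2 * ?Y om" for om
  unfolding resid_decomp iX(3) unfolding X_def Y_def[abs_def] ..
 have sqx: "(?X om)\<^sup>2 = (X om)\<^sup>2 - 2 * expectation X * X om + (expectation X)\<^sup>2" for om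
  by (simp add: power2_eq_square algebra_simps)
 have sqy: "(?Y om)\<^sup>2 = (Y om)\<^sup>2 - 2 * expectation Y * Y om + (expectation Y)\<^sup>2" for om
  by (simp add: power2_eq_square algebra_simps)
 have jX: "integrable M (%om. (?X om)\<^sup>2)" unfolding sqx using iX by simp
 have jY: "integrable M (%om. (?Y om)\<^sup>2)" unfolding sqy using iY by simp
 \<comment> \<open>From (x + 2y)^2 <= 2 x^2 + 8 y^2. With the kernel bound 2 Ck / |W| and the bounds
   3 and 2 for \<open>hh\<close> this gives the constants 8 = 2 * 2^2 and 48 = 8 * 3 * 2.\<close>
 have le: "(resid om)\<^sup>2 <= 2 * (?X om)\<^sup>2 + 8 * (?Y om)\<^sup>2" for om
 proof -
  have "0 <= (?X om - 2 * ?Y om)\<^sup>2" by simp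
  then show ?thesis unfolding r power2_eq_square by (simp add: algebra_simps)
 qed
 have mr: "resid \<in> borel_measurable M" unfolding r[abs_def] using iX iY by simp
 have j: "integrable M (%om. 2 * (?X om)\<^sup>2 + 8 * (?Y om)\<^sup>2)" using jX jY by simp
 show ir: "integrable M (%om. (resid om)\<^sup>2)"
  by (rule bochner_integrable_bound[OF j]) (use mr le in auto)
 have "expectation (%om. (resid om)\<^sup>2) <= expectation (%om. 2 * (?X om)\<^sup>2 + 8 * (?Y om)\<^sup>2)"
  by (rule integral_mono[OF ir j le])
 also have "... = 2 * variance X + 8 * variance Y" using jX jY by simp
 also have "... <= 2 * ((2 * Ck / vol W)\<^sup>2 * vol W * lag_measure A)
   + 8 * (lam * (1 + gamma_total) * (3 * lam * kappa / vol W) * (2 * lam * dl * kappa))"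
 proof (intro add_mono mult_left_mono)
  show "variance X <= (2 * Ck / vol W)\<^sup>2 * vol W * lag_measure A" unfolding X_def[abs_def] by (rule variance_le)
  have "variance Y <= lam * (1 + gamma_total) * (3 * lam * kappa / vol W) * (LINT x|lborel. indicator W x * \<bar>hh x\<bar>)"
   unfolding Y_def[abs_def] by (rule vp(2))
  also have "... <= lam * (1 + gamma_total) * (3 * lam * kappa / vol W) * (2 * lam * dl * kappa)"
   using integral_hh_le intensity_pos gamma_total_nonneg kappa_nonneg volW by (intro mult_left_mono) auto
  finally show "variance Y <= lam * (1 + gamma_total) * (3 * lam * kappa / vol W) * (2 * lam * dl * kappa)" .
 qed auto
 also have "... = (8 * Ck^2 * lag_measure A + 48 * lam ^ 3 * (1 + gamma_total) * dl * kappa\<^sup>2) / vol W"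
  using volW by (simp add: field_simps power2_eq_square power3_eq_cube)
 finally show "expectation (%om. (resid om)\<^sup>2) <= (8 * Ck^2 * lag_measure A + 48 * lam ^ 3 * (1 + gamma_total) * dl * kappa\<^sup>2) / vol W" .
qed

text \<open>Unbiasedness of the edge correction: the base points for which both points fall into W
  have volume equal to the overlap, which cancels the denominator.\<close>

lemma integral_f_unreduce:
 assumes rh: "finite_measure rh" "sets rh = sets (red_borel 2)"
 shows "integral\<^sup>L (unreduce W tau2 rh) (%p. f (fst p) (snd p)) = (LINT h|rh. k (h 1))"
proof -
 interpret r: finite_measure rh by fact
 interpret b: finite_measure "leb_on W" by (rule fmW)
 interpret p: pair_sigma_finite rh "leb_on W" ..
 interpret ab: finite_measure "rh \<Otimes>\<^sub>M leb_on W" by (rule finite_pair_borel) unfold_locales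
 have tam: "tau2 \<in> borel_measurable (rh \<Otimes>\<^sub>M leb_on W)"
  using tau_measurable(1)[OF rh(2)] measurable_cong_sets[OF sets_pair_measure_cong[OF refl sets_leb_on] refl] by blast
 have i: "integrable (rh \<Otimes>\<^sub>M leb_on W) (%q. f (fst (tau2 q)) (snd (tau2 q)))"
  by (rule ab.integrable_const_bound[where B="2 * Ck / vol W"])
   (use f_le_D measurable_compose[OF tam f_borel] in auto)
 have "integral\<^sup>L (unreduce W tau2 rh) (%p. f (fst p) (snd p)) = (LINT q|(rh \<Otimes>\<^sub>M leb_on W). f (fst (tau2 q)) (snd (tau2 q)))"
  unfolding unreduce_def by (rule integral_distr[OF tam f_borel])
 also have "... = (LINT h|rh. (LINT x|leb_on W. f (h 1 + x) x))"
  using p.integral_fst'[OF i] by (simp add: tau2_def)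
 also have "... = (LINT h|rh. k (h 1))"
 proof (rule bochner_integral_cong[OF refl])
  fix h :: "nat => 'a"
  have "(LINT x|leb_on W. f (h 1 + x) x) = (LINT x|lborel. indicator W x * f (h 1 + x) x)"
   by (rule integral_leb_on[OF W(1)]) measurable
  also have "... = (LINT x|lborel. indicator W x * (indicator W (x + h 1) * u (h 1)))"
   using k_sym[of "h 1"] overlap_minus[OF W(1), of "h 1"]
   by (intro bochner_integral_cong) (auto simp: f_def u_def indicator_def add.commute)
  also have "... = (LINT x|leb_on W. indicator W (x + h 1) * u (h 1))"
   by (rule integral_leb_on[symmetric, OF W(1)]) measurable
  also have "... = overlap W (h 1) * u (h 1)"
   by (simp add: overlap_integral[OF W, symmetric])
  also have "... = k (h 1)" by (rule overlap_u)
  finally show "(LINT x|leb_on W. f (h 1 + x) x) = k (h 1)" .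
 qed
 finally show ?thesis .
qed

lemma mom1_f: "(LINT x|mom1 W. (LINT y|mom1 W. f x y)) = lam\<^sup>2 * kappa"
proof -
 define F where "F p = indicator W (fst p + snd p) * u (snd p)" for p
 have Fm: "F \<in> borel_measurable borel" unfolding F_def[abs_def] by measurable
 have Fb: "\<bar>F p\<bar> <= 2 * Ck / vol W" for p
 proof -
  have "\<bar>F p\<bar> <= u (snd p)" using u_nonneg[of "snd p"] by (simp add: F_def indicator_def)
  also have "... <= 2 * Ck / vol W" by (rule u_le)
  finally show ?thesis .
 qed
 note fub = integral_pair_borel[OF fmW fmA sets_leb_on sets_leb_on Fm Fb]
 have "(LINT x|mom1 W. (LINT y|mom1 W. f x y)) = (LINT x|mom1 W. g x)" by (simp add: g_def)
 also have "... = lam * (LINT x|lborel. indicator W x * g x)" by (rule integral_mom1[OF W g_borel])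
 also have "(LINT x|lborel. indicator W x * g x) = (LINT x|leb_on W. g x)"
  by (rule integral_leb_on[symmetric, OF W(1) g_borel])
 also have "... = (LINT x|leb_on W. lam * (LINT z|leb_on A. F (x, z)))"
 proof -
  have Fxm: "(%x. \<integral>z. F (x, z) \<partial>leb_on A) \<in> borel_measurable borel"
  proof -
   interpret finite_measure "leb_on A" by (rule fmA)
   have "(%(x, z). F (x, z)) \<in> borel_measurable (borel \<Otimes>\<^sub>M leb_on A)"
    using measurable_pair_borel[OF refl sets_leb_on Fm] by simp
   then show ?thesis by (rule borel_measurable_lebesgue_integral)
  qed
  then have Fl: "(%x. lam * (LINT z|leb_on A. F (x, z))) \<in> borel_measurable borel" by simp
  show ?thesis unfolding integral_leb_on[OF W(1) g_borel] integral_leb_on[OF W(1) Fl]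
   by (rule bochner_integral_cong) (auto simp: g_eq F_def indicator_def)
 qed
 also have "... = lam * (LINT z|leb_on A. (LINT x|leb_on W. F (x, z)))" using fub by simp
 also have "(LINT z|leb_on A. (LINT x|leb_on W. F (x, z))) = (LINT z|leb_on A. overlap W z * u z)"
  by (simp add: F_def overlap_integral[OF W, symmetric])
 also have "... = (LINT z|leb_on A. k z)" unfolding overlap_u ..
 finally show ?thesis by (simp add: kappa_leb power2_eq_square)
qed

text \<open>The mean through cumulants, for arbitrary kernels. The product part depends only on the
  integral of k, and the rest is an integral against the reduced cumulant that does not involve the
  window.\<close>

lemma expectation_edge_sum:
 "expectation (%om. edge_corrected_sum W (N om) k)
  = lam\<^sup>2 * kappa + lam * ((LINT h|gp 2. k (h 1)) - (LINT h|gm 2. k (h 1)))"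
 and integrable_edge_sum: "integrable M (%om. edge_corrected_sum W (N om) k)"
proof -
 have o: "f (fst p) (snd p) = 0" if "p \<notin> W \<times> W" for p using that by (cases p) (auto simp: f_out f_out2)
 have "expectation pair_sum = (LINT x|mom1 W. (LINT y|mom1 W. f x y)) + cum2 W (%p. f (fst p) (snd p))"
  unfolding variance_identity(3) e_def using integral_mom2[OF W f_borel f_le_D o] by simp
 then show "expectation (%om. edge_corrected_sum W (N om) k)
  = lam\<^sup>2 * kappa + lam * ((LINT h|gp 2. k (h 1)) - (LINT h|gm 2. k (h 1)))"
  unfolding edge_sum_eq mom1_f cum2_def
  by (simp add: integral_f_unreduce[OF finite_gp sets_gp] integral_f_unreduce[OF finite_gm sets_gm])
 show "integrable M (%om. edge_corrected_sum W (N om) k)" unfolding edge_sum_eq using variance_identity(5) by simp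
qed

end

section \<open>Windows and dilations\<close>

lemma measure_lborel_affine_image:
 fixes W :: "'a::euclidean_space set" and t :: 'a
 assumes W: "W \<in> sets borel" and c: "0 <= c" and im: "(%x. t + c *\<^sub>R x) ` W \<in> sets borel"
 shows "vol ((%x. t + c *\<^sub>R x) ` W) = c ^ DIM('a) * vol W"
proof -
 have "measure lebesgue ((%x. t + c *\<^sub>R x) ` W) = \<bar>c\<bar> ^ DIM('a) * measure lebesgue W"
  using measure_lebesgue_affine[of c t W] by (simp only: add.commute)
 then show ?thesis using W im c by (simp add: measure_completion)
qed

text \<open>The copy of W contracted towards x0 by the factor 1 - theta lies in W, and so does its
  translate by z: the shift is absorbed into the ball around x0, as z / theta has norm at most r.
  The volume factor (1 - theta)^d is estimated by Bernoulli's inequality.\<close>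

lemma convex_overlap_ge:
 fixes W :: "'a::euclidean_space set"
 assumes W: "convex W" "compact W" and ball: "cball x0 r \<subseteq> W" "0 < r"
  and \<theta>: "0 <= \<theta>" "\<theta> <= 1" and z: "norm z <= \<theta> * r"
 shows "(1 - real DIM('a) * \<theta>) * vol W <= overlap W z"
proof -
 have Wb: "W \<in> sets borel" using W(2) by (simp add: compact_imp_closed)
 define S where "S = (%w. \<theta> *\<^sub>R x0 + (1 - \<theta>) *\<^sub>R w) ` W"
 have "compact S" unfolding S_def by (intro compact_continuous_image continuous_intros W)
 then have Sb: "S \<in> sets borel" by (simp add: compact_imp_closed)
 have x0: "x0 \<in> W" using ball by auto
 have sub: "S \<subseteq> W Int {u. u + z \<in> W}"
 proof
  fix u assume "u \<in> S"
  then obtain w where w: "w \<in> W" "u = \<theta> *\<^sub>R x0 + (1 - \<theta>) *\<^sub>R w" by (auto simp: S_def)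
  have "u \<in> W" unfolding w(2) using convexD[OF W(1) x0 w(1), of \<theta> "1 - \<theta>"] \<theta> by simp
  moreover have "u + z \<in> W"
  proof (cases "\<theta> = 0")
   case True then show ?thesis using \<open>u \<in> W\<close> z by simp
  next
   case False
   with \<theta> have t: "0 < \<theta>" by simp
   define y where "y = x0 + (1 / \<theta>) *\<^sub>R z"
   have "norm ((1 / \<theta>) *\<^sub>R z) <= r" using z t by (simp add: field_simps)
   then have "y \<in> cball x0 r" by (simp add: y_def dist_norm)
   then have "y \<in> W" using ball by auto
   then have "\<theta> *\<^sub>R y + (1 - \<theta>) *\<^sub>R w \<in> W" using convexD[OF W(1) _ w(1), of y \<theta> "1 - \<theta>"] \<theta> by simp
   moreover have "\<theta> *\<^sub>R y + (1 - \<theta>) *\<^sub>R w = u + z" using t by (simp add: y_def w(2) algebra_simps)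
   ultimately show ?thesis by simp
  qed
  ultimately show "u \<in> W Int {u. u + z \<in> W}" by simp
 qed
 have "1 + real DIM('a) * (- \<theta>) <= (1 + (- \<theta>)) ^ DIM('a)"
  by (rule Bernoulli_inequality) (use \<theta> in simp)
 then have "(1 - real DIM('a) * \<theta>) * vol W <= (1 - \<theta>) ^ DIM('a) * vol W"
  by (intro mult_right_mono) auto
 also have "... = vol S"
  unfolding S_def by (rule measure_lborel_affine_image[symmetric, OF Wb]) (use \<theta> Sb in \<open>auto simp: S_def\<close>)
 also have "... <= overlap W z"
  unfolding overlap_def
 proof (rule measure_mono_fmeasurable[OF sub])
  have "bounded (W Int {u. u + z \<in> W})" using compact_imp_bounded[OF W(2)] by (rule bounded_subset) auto
  then show "W Int {u. u + z \<in> W} \<in> fmeasurable lborel"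
   using emeasure_bounded_finite overlap_set_borel[OF Wb] by (simp add: fmeasurable_def less_top)
 qed (use Sb in simp)
 finally show ?thesis .
qed

text \<open>For a set without inner balls \<open>inradius\<close> is the unspecified value
  \<open>Sup {}\<close>; the hypothesis excludes this case. Half the inradius is used because the
  supremum need not be attained.\<close>

lemma inradius_ball:
 fixes W :: "'a::euclidean_space set"
 assumes "max 0 (Sup {}) < inradius W"
 obtains x where "cball x (inradius W / 2) \<subseteq> W"
proof -
 let ?S = "{r. 0 < r & (\<exists>x\<in>W. cball x r \<subseteq> W)}"
 have ne: "?S ~= {}" using assms unfolding inradius_def by (metis max_less_iff_conj less_irrefl)
 have "inradius W / 2 < Sup ?S" using assms unfolding inradius_def[symmetric] by simp
 then obtain r where r: "r \<in> ?S" "inradius W / 2 < r" using less_cSupD[OF ne] by blast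
 then obtain x where "cball x r \<subseteq> W" by blast
 moreover have "cball x (inradius W / 2) \<subseteq> cball x r" using r(2) by (intro subset_cball) simp
 ultimately show ?thesis using that by blast
qed

lemma convex_averaging_eventually:
 fixes W :: "nat => 'a::euclidean_space set"
 assumes "convex_averaging W"
 shows "eventually (%n. 0 < inradius (W n) \<and>
   (\<forall>s z. norm z <= s \<longrightarrow> 2 * s <= inradius (W n) \<longrightarrow>
    (1 - 2 * real DIM('a) * s / inradius (W n)) * vol (W n) <= overlap (W n) z)) sequentially"
  and "filterlim (%n. vol (W n)) at_top sequentially"
proof -
 have W: "!!n. convex (W n)" "!!n. compact (W n)" and inr: "filterlim (%n. inradius (W n)) at_top sequentially"
  using assms by (auto simp: convex_averaging_def)
 have ev: "eventually (%n. max 0 (Sup {}) < inradius (W n)) sequentially"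
  using inr unfolding filterlim_at_top_dense by blast
 then show "eventually (%n. 0 < inradius (W n) \<and>
   (\<forall>s z. norm z <= s \<longrightarrow> 2 * s <= inradius (W n) \<longrightarrow>
    (1 - 2 * real DIM('a) * s / inradius (W n)) * vol (W n) <= overlap (W n) z)) sequentially"
 proof eventually_elim
  case (elim n)
  then have pos: "0 < inradius (W n)" by simp
  obtain x where x: "cball x (inradius (W n) / 2) \<subseteq> W n" using inradius_ball[OF elim] .
  have "(1 - 2 * real DIM('a) * s / inradius (W n)) * vol (W n) <= overlap (W n) z"
   if "norm z <= s" "2 * s <= inradius (W n)" for s z
  proof -
   have "0 <= s" using that(1) norm_ge_zero order_trans by blast
   \<comment> \<open>The available ball has radius \<open>inradius (W n) / 2\<close>, hence theta =
     2 s / inradius.\<close>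
   then have "(1 - real DIM('a) * (2 * s / inradius (W n))) * vol (W n) <= overlap (W n) z"
    using that pos by (intro convex_overlap_ge[OF W x]) auto
   then show ?thesis by (simp add: mult_ac)
  qed
  with pos show ?case by blast
 qed
 define c where "c = unit_ball_vol (real DIM('a)) / 2"
 have c: "0 < c" by (simp add: c_def)
 have ev2: "eventually (%n. 2 <= inradius (W n)) sequentially" using inr by (simp add: filterlim_at_top)
 have "eventually (%n. c * inradius (W n) <= vol (W n)) sequentially"
  using ev ev2
 proof eventually_elim
  case (elim n)
  obtain x where x: "cball x (inradius (W n) / 2) \<subseteq> W n" using inradius_ball[OF elim(1)] .
  define r where "r = inradius (W n) / 2"
  have r: "1 <= r" using elim by (simp add: r_def)
  \<comment> \<open>Linear growth in the inradius is enough for divergence of the volume.\<close>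
  have "r ^ 1 <= r ^ DIM('a)" using r by (intro power_increasing) (auto simp: Suc_le_eq)
  then have "unit_ball_vol (real DIM('a)) * r <= unit_ball_vol (real DIM('a)) * r ^ DIM('a)" by (intro mult_left_mono) auto
  also have "... = vol (cball x r)" using r by (simp add: content_cball)
  also have "... <= vol (W n)"
  proof (rule measure_mono_fmeasurable)
   show "cball x r \<subseteq> W n" using x by (simp add: r_def)
   show "W n \<in> fmeasurable lborel" using W(2)[of n] by (intro fmeasurable_compact)
  qed simp
  finally show ?case by (simp add: c_def r_def)
 qed
 moreover have "filterlim (%n. c * inradius (W n)) at_top sequentially"
  by (rule filterlim_tendsto_pos_mult_at_top[OF tendsto_const c inr])
 ultimately show "filterlim (%n. vol (W n)) at_top sequentially"
  by (rule filterlim_at_top_mono[rotated])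
qed

lemma win_scale_pow:
 fixes W :: "'a::euclidean_space set"
 assumes "0 < vol W" shows "(win_scale W powr a) ^ DIM('a) = vol W powr a"
proof -
 have "(win_scale W powr a) ^ DIM('a) = (vol W powr (1 / real DIM('a) * a)) powr real DIM('a)"
  using assms by (subst powr_realpow) (auto simp: win_scale_def powr_powr)
 then show ?thesis by (simp add: powr_powr)
qed

section \<open>Dilations of the body B and dyadic radii\<close>

locale gauge_body =
 fixes B :: "'a::euclidean_space set"
 assumes compactB: "compact B" and convexB: "convex B" and symB: "x \<in> B ==> - x \<in> B" and zeroB: "0 \<in> B"
begin

lemma compact_scaled: "compact (scaled t B)"
 by (intro compact_continuous_image continuous_intros compactB)

lemma scaled_borel [measurable]: "scaled t B \<in> sets borel"
 using compact_imp_closed[OF compact_scaled] by simp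

lemma bounded_scaled: "bounded (scaled t B)" using compact_imp_bounded[OF compact_scaled] .

lemma scaled_sym: "- z \<in> scaled t B \<longleftrightarrow> z \<in> scaled t B"
proof -
 have "- y \<in> scaled t B" if "y \<in> scaled t B" for y
  using that symB by (auto intro!: image_eqI[of _ _ "- _"])
 from this[of z] this[of "- z"] show ?thesis by auto
qed

lemma scaled_mono: "0 <= s ==> s <= t ==> scaled s B \<subseteq> scaled t B"
proof (cases "t = 0")
 case False
 assume st: "0 <= s" "s <= t"
 with False have t: "0 < t" by simp
 show ?thesis
 proof
  fix z assume "z \<in> scaled s B"
  then obtain y where y: "y \<in> B" "z = s *\<^sub>R y" by auto
  have "(s / t) *\<^sub>R y + (1 - s / t) *\<^sub>R 0 \<in> B"
   using convexD[OF convexB y(1) zeroB, of "s / t" "1 - s / t"] st t by simp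
  then have "(s / t) *\<^sub>R y \<in> B" by simp
  moreover have "z = t *\<^sub>R ((s / t) *\<^sub>R y)" using t y by simp
  ultimately show "z \<in> scaled t B" by blast
 qed
qed auto

lemma scaled_0: "scaled 0 B = {0}" using zeroB by auto

lemma vol_scaled: "0 <= t ==> vol (scaled t B) = t ^ DIM('a) * vol B"
 using measure_lborel_affine_image[of B t 0] compact_imp_closed[OF compactB] scaled_borel[of t] by simp

lemma fmeasurable_scaled: "scaled t B \<in> fmeasurable lborel"
 by (rule fmeasurable_compact[OF compact_scaled])

lemma vol_annulus:
 assumes "0 <= s" "s <= t"
 shows "vol (scaled t B - scaled s B) = (t ^ DIM('a) - s ^ DIM('a)) * vol B"
proof -
 have "vol (scaled t B - scaled s B) = vol (scaled t B) - vol (scaled s B)"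
  by (rule measure_Diff) (use scaled_mono[OF assms] fmeasurableD2[OF fmeasurable_scaled] in simp_all)
 then show ?thesis using assms by (simp add: vol_scaled left_diff_distrib)
qed

end

text \<open>A dyadic point of level K is a point of level K - 1 or one increment to the right of
  one. The largest increment of a level is replaced by the l2 norm of all of them, because second
  moments of increments can be summed.\<close>

lemma dyadic_chain:
 fixes Z :: "real => real"
 assumes Z0: "Z 0 = 0"
 shows "j <= 2 ^ K ==> \<bar>Z (R * real j / 2 ^ K)\<bar>
  <= (\<Sum>k\<le>K. sqrt (\<Sum>i<2 ^ k. (Z (R * real (i + 1) / 2 ^ k) - Z (R * real i / 2 ^ k))\<^sup>2))"
proof (induction K arbitrary: j)
 case 0
 then have "j = 0 \<or> j = 1" by auto
 then show ?case using Z0 by auto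
next
 case (Suc K)
 define m where "m k = sqrt (\<Sum>i<2 ^ k. (Z (R * real (i + 1) / 2 ^ k) - Z (R * real i / 2 ^ k))\<^sup>2)" for k
 have mn: "0 <= m k" for k by (simp add: m_def sum_nonneg)
 have inc: "\<bar>Z (R * real (i + 1) / 2 ^ k) - Z (R * real i / 2 ^ k)\<bar> <= m k" if "i < 2 ^ k" for i k
 proof -
  have "(Z (R * real (i + 1) / 2 ^ k) - Z (R * real i / 2 ^ k))\<^sup>2
    <= (\<Sum>i<2 ^ k. (Z (R * real (i + 1) / 2 ^ k) - Z (R * real i / 2 ^ k))\<^sup>2)"
   by (rule member_le_sum) (use that in auto)
  then show ?thesis using real_sqrt_le_mono by (fastforce simp: m_def)
 qed
 have IH: "\<bar>Z (R * real j / 2 ^ K)\<bar> <= (\<Sum>k\<le>K. m k)" if "j <= 2 ^ K" for j using Suc.IH[OF that] by (simp add: m_def)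
 have half: "R * real (2 * i) / 2 ^ Suc K = R * real i / 2 ^ K" for i by simp
 have "\<bar>Z (R * real j / 2 ^ Suc K)\<bar> <= (\<Sum>k\<le>K. m k) + m (Suc K)"
 proof (cases "even j")
  case True
  then obtain i where i: "j = 2 * i" by (elim evenE)
  with Suc.prems have "i <= 2 ^ K" by simp
  from IH[OF this] mn[of "Suc K"] show ?thesis unfolding i half by linarith
 next
  case False
  then obtain i where i: "j = 2 * i + 1" by (elim oddE)
  with Suc.prems have ii: "i <= 2 ^ K" "2 * i < 2 ^ Suc K" by auto
  have "\<bar>Z (R * real (2 * i + 1) / 2 ^ Suc K) - Z (R * real (2 * i) / 2 ^ Suc K)\<bar> <= m (Suc K)"
   by (rule inc[OF ii(2)])
  then show ?thesis using IH[OF ii(1)] unfolding i half by linarith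
 qed
 then show ?case by (simp add: m_def)
qed

section \<open>Mean pair counts through the reduced second moment measure\<close>

context B4_process
begin

text \<open>Infinite mass on bounded lags would be seen from every base point of the unit ball, and
  the second factorial moment of a bounded region would be infinite.\<close>

lemma alpha_lag_finite:
 "emeasure (alpha_red M N 2) {h \<in> space (alpha_red M N 2). h 1 \<in> cball 0 r} < \<infinity>"
proof -
 let ?mu = "alpha_red M N 2"
 note rm = alpha_red_is_reduced_moment
 have s: "sets ?mu = sets (red_borel 2)" using rm by (simp add: is_reduced_moment_def)
 \<comment> \<open>Moving the base point by at most 1 carries lags of norm at most r into the ball
   of radius r + 1.\<close>
 define A where "A l = (if l = 1 then cball 0 (r + 1) else cball 0 1 :: 'a set)" for l :: nat
 have Ab: "A l \<in> sets borel & bounded (A l)" for l by (simp add: A_def)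
 let ?S = "{h \<in> space ?mu. h 1 \<in> cball 0 r}"
 have sub: "?S \<subseteq> rect_minus 2 A x" if "x \<in> A 2" for x
 proof
  fix h assume h: "h \<in> ?S"
  then have hs: "h \<in> (\<Pi>\<^sub>E i\<in>{1..<2}. UNIV)" using space_red[OF s] by simp
  have "norm (h 1 + x) <= norm (h 1) + norm x" by (rule norm_triangle_ineq)
  also have "... <= r + 1" using h that by (intro add_mono) (auto simp: A_def)
  finally have "h 1 + x \<in> A 1" by (simp add: A_def)
  then show "h \<in> rect_minus 2 A x" unfolding mem_rect_minus[OF hs] ball_red .
 qed
 have rs: "rect_minus 2 A x \<in> sets ?mu" for x unfolding s by (rule rect_minus_sets) (use Ab in simp)
 have fm: "fact_moment M N {1..2} A = ennreal lam * (\<integral>\<^sup>+x\<in>A 2. emeasure ?mu (rect_minus 2 A x) \<partial>lborel)"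
  using rm Ab unfolding is_reduced_moment_def by blast
 have fin: "fact_moment M N {1..2} A < \<infinity>"
 proof -
  let ?W = "cball 0 (max (r + 1) 1) :: 'a set"
  have s12: "{1..2} = {1, 2::nat}" by auto
  have "fact_moment M N {1..2} A = emeasure (mom2 ?W) (A 1 \<times> A 2)"
   unfolding s12 mom2_def by (rule fact_moment_2) (auto simp: A_def)
  also have "... < \<infinity>"
   using finite_measure.emeasure_eq_measure[OF finite_measure_mom(2)[of ?W]] by simp
  finally show ?thesis .
 qed
 have pos: "emeasure lborel (A 2) > 0"
 proof -
  have "emeasure lborel (ball 0 1 :: 'a set) ~= 0"
   using unit_ball_vol_pos[of "real DIM('a)"] by (simp add: emeasure_ball del: unit_ball_vol_pos)
  moreover have "emeasure lborel (ball 0 1 :: 'a set) <= emeasure lborel (A 2)"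
   by (intro emeasure_mono) (auto simp: A_def)
  ultimately show ?thesis by (metis not_gr_zero le_zero_eq)
 qed
 show ?thesis
 proof (rule ccontr)
  assume "\<not> emeasure ?mu ?S < \<infinity>"
  then have inf: "emeasure ?mu ?S = \<infinity>" unfolding infinity_ennreal_def less_top[symmetric] not_not .
  have "emeasure ?mu (rect_minus 2 A x) * indicator (A 2) x = \<infinity> * indicator (A 2) x" for x
  proof (cases "x \<in> A 2")
   case True
   then have "\<infinity> <= emeasure ?mu (rect_minus 2 A x)" using emeasure_mono[OF sub[OF True] rs] inf by simp
   then show ?thesis using True by (simp add: top_unique)
  qed simp
  then have "(\<integral>\<^sup>+x\<in>A 2. emeasure ?mu (rect_minus 2 A x) \<partial>lborel) = \<infinity> * emeasure lborel (A 2)"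
   using Ab by (simp add: nn_integral_cmult_indicator)
  then have "fact_moment M N {1..2} A = \<infinity>"
   using fm pos intensity_pos by (simp add: ennreal_mult_eq_top_iff ennreal_top_mult)
  with fin show False by simp
 qed
qed

text \<open>The measure \<open>alpha_red\<close> is locally finite only; since points of W differ by
  at most 2 r, cutting it off at s changes nothing for pairs in W and makes \<open>unreduce\<close>
  applicable.\<close>

lemma mom2_alpha:
 assumes W: "W \<in> sets borel" "bounded W" and r: "W \<subseteq> cball 0 r"
  and F: "F \<in> borel_measurable borel" "!!p. \<bar>F p\<bar> <= C" and F_out: "\<forall>p. p \<notin> W \<times> W \<longrightarrow> F p = 0"
  and s: "2 * r <= s"
  and rh_def: "rh = density (alpha_red M N 2) (indicator {h \<in> space (alpha_red M N 2). h 1 \<in> cball 0 s})"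
 shows "integral\<^sup>L (mom2 W) F = lam * integral\<^sup>L (unreduce W tau2 rh) F"
  and "finite_measure rh" and "sets rh = sets (red_borel 2)"
  and "!!S. S \<in> sets borel ==> S \<subseteq> cball 0 s ==> measure rh {h \<in> space rh. h 1 \<in> S} = alpha2_red M N S"
proof -
 let ?mu = "alpha_red M N 2"
 let ?S = "{h \<in> space ?mu. h 1 \<in> cball 0 s}"
 note rm = alpha_red_is_reduced_moment
 have s2: "sets ?mu = sets (red_borel 2)" using rm by (simp add: is_reduced_moment_def)
 show srh: "sets rh = sets (red_borel 2)" by (simp add: rh_def s2)
 have sp: "space rh = space ?mu" by (simp add: rh_def)
 have cm: "{h \<in> space ?mu. h 1 \<in> T} \<in> sets ?mu" if "T \<in> sets borel" for T
 proof -
  have "(%f. f 1) \<in> measurable ?mu borel"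
   unfolding measurable_cong_sets[OF s2 refl] by (rule measurable_component_singleton) simp
  from measurable_sets[OF this that] show ?thesis by (simp add: vimage_def Int_def conj_commute)
 qed
 have Sm: "?S \<in> sets ?mu" by (rule cm) simp
 have erh: "emeasure rh T = emeasure ?mu (?S Int T)" if "T \<in> sets ?mu" for T
 proof -
  have "emeasure rh T = (\<integral>\<^sup>+h. indicator ?S h * indicator T h \<partial>?mu)"
   unfolding rh_def using Sm that by (subst emeasure_density) auto
  also have "... = (\<integral>\<^sup>+h. indicator (?S Int T) h \<partial>?mu)" by (intro nn_integral_cong) (auto simp: indicator_def)
  finally show ?thesis using Sm that by simp
 qed
 show fmrh: "finite_measure rh"
 proof
  have "emeasure rh (space rh) = emeasure ?mu (?S Int space ?mu)" unfolding sp by (rule erh) simp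
  also have "?S Int space ?mu = ?S" by auto
  finally show "emeasure rh (space rh) ~= \<infinity>" using alpha_lag_finite[of s] by simp
 qed
 show "measure rh {h \<in> space rh. h 1 \<in> S} = alpha2_red M N S" if S: "S \<in> sets borel" "S \<subseteq> cball 0 s" for S
 proof -
  have "?S Int {h \<in> space ?mu. h 1 \<in> S} = {h \<in> space ?mu. h 1 \<in> S}" using S by auto
  moreover have "rect 2 (%_. S) = {h \<in> space ?mu. h 1 \<in> S}"
  proof -
   have "h \<in> rect 2 (%_. S) \<longleftrightarrow> h \<in> (\<Pi>\<^sub>E i\<in>{1..<2}. UNIV) & (\<forall>l\<in>{1..<2}. h l \<in> S)" for h :: "nat => 'a"
    by (auto simp: PiE_iff)
   then show ?thesis unfolding space_red[OF s2] ball_red by auto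
  qed
  ultimately show ?thesis unfolding alpha2_red_def measure_def sp using erh[OF cm[OF S(1)]] by simp
 qed
 let ?L = "[(1, mom2 W), (- lam, unreduce W tau2 rh)]"
 have "lin_comb ?L (%mu. integral\<^sup>L mu F) = 0"
 proof (rule lin_comb_vanishes[OF rects2 _ _ _ F F_out[rule_format]])
  show "finite_measure (snd p) & sets (snd p) = sets borel" if "p \<in> set ?L" for p
   using that finite_measure_mom(2)[OF W] finite_measure_unreduce[OF fmrh W tau_measurable(1)[OF srh]] by auto
  show "W \<times> W \<in> sets borel" by (intro borel_Times W)
  fix S :: "('a \<times> 'a) set" assume "S \<in> rects2"
  then obtain a b where ab: "S = a \<times> b" "a \<in> sets borel" "b \<in> sets borel" unfolding rects2_def by blast
  define A where "A l = W Int (if l = 1 then a else b)" for l :: nat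
  have A: "!!l. A l \<in> sets borel" "!!l. A l \<subseteq> W" using ab W by (auto simp: A_def)
  have bA: "bounded (A l)" for l using bounded_subset[OF W(2) A(2)] .
  have e: "(W \<times> W) Int S = A 1 \<times> A 2" unfolding ab(1) A_def by auto
  have sub: "rect_minus 2 A x \<subseteq> (\<Pi>\<^sub>E i\<in>{1..<2}. UNIV)" for x by (intro PiE_mono) auto
  have "emeasure (unreduce W tau2 rh) (A 1 \<times> A 2) = (\<integral>\<^sup>+x\<in>A 2. emeasure rh (rect_minus 2 A x) \<partial>lborel)"
  proof (rule nn_unreduce_rect[OF fmrh W tau_measurable(1)[OF srh] A(1,2)])
   show "A 1 \<times> A 2 \<in> sets borel" by (intro borel_Times A)
   show "tau2 (f, x) \<in> A 1 \<times> A 2 \<longleftrightarrow> x \<in> A 2 & f \<in> rect_minus 2 A x" if "f \<in> space rh" for f x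
   proof -
    have "f \<in> (\<Pi>\<^sub>E i\<in>{1..<2}. UNIV)" using that by (simp only: space_red[OF srh])
    from mem_rect_minus[OF this, of x A] show ?thesis unfolding ball_red tau2_def by auto
   qed
   show "rect_minus 2 A x \<subseteq> space rh" for x using sub by (simp only: space_red[OF srh])
  qed
  also have "... = (\<integral>\<^sup>+x\<in>A 2. emeasure ?mu (rect_minus 2 A x) \<partial>lborel)"
  proof (rule nn_integral_cong)
   fix x
   show "emeasure rh (rect_minus 2 A x) * indicator (A 2) x = emeasure ?mu (rect_minus 2 A x) * indicator (A 2) x"
   proof (cases "x \<in> A 2")
    case True
    have "rect_minus 2 A x \<subseteq> ?S"
    proof
     fix h assume h: "h \<in> rect_minus 2 A x"
     then have hs: "h \<in> (\<Pi>\<^sub>E i\<in>{1..<2}. UNIV)" using sub by blast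
     have "h 1 + x \<in> A 1" using h unfolding mem_rect_minus[OF hs] ball_red .
     then have "norm (h 1 + x) <= r" "norm x <= r" using A(2) True r by (auto simp: subset_iff)
     then have "norm (h 1) <= r + r" using norm_triangle_ineq4[of "h 1 + x" x] by simp
     then show "h \<in> ?S" using hs s by (simp add: space_red[OF s2])
    qed
    then have "?S Int rect_minus 2 A x = rect_minus 2 A x" by auto
    moreover have "rect_minus 2 A x \<in> sets ?mu" unfolding s2 by (rule rect_minus_sets) (rule A)
    ultimately show ?thesis using erh[of "rect_minus 2 A x"] by simp
   qed simp
  qed
  finally have eu: "emeasure (unreduce W tau2 rh) (A 1 \<times> A 2) = (\<integral>\<^sup>+x\<in>A 2. emeasure ?mu (rect_minus 2 A x) \<partial>lborel)" .
  have s12: "{1..2} = {1, 2::nat}" by auto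
  have "emeasure (mom2 W) (A 1 \<times> A 2) = fact_moment M N {1..2} A"
   unfolding s12 mom2_def by (rule fact_moment_2[symmetric]) (use A W in auto)
  also have "... = ennreal lam * emeasure (unreduce W tau2 rh) (A 1 \<times> A 2)"
   unfolding eu using rm A(1) bA unfolding is_reduced_moment_def by blast
  finally have "measure (mom2 W) (A 1 \<times> A 2) = lam * measure (unreduce W tau2 rh) (A 1 \<times> A 2)"
   using intensity_pos by (simp add: measure_def enn2real_mult)
  then show "lin_comb ?L (%mu. measure mu ((W \<times> W) Int S)) = 0" unfolding e by simp
 qed
 then show "integral\<^sup>L (mom2 W) F = lam * integral\<^sup>L (unreduce W tau2 rh) F" by simp
qed

end

context window_kernel
begin

text \<open>The same mean expressed through the reduced moment measure, which is how the K-function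
  is defined. This identifies the centring in \<open>Delta\<close> as the exact expectation.\<close>

lemma expectation_edge_sum_indicator:
 assumes k: "k = indicator A"
 shows "expectation (%om. edge_corrected_sum W (N om) k) = lam * alpha2_red M N A"
proof -
 obtain r where r: "W \<subseteq> cball 0 r" using bounded_subset_ballD[OF W(2), of 0] by (meson ball_subset_cball order_trans)
 obtain r' where r': "A \<subseteq> cball 0 r'" using bounded_subset_ballD[OF A(2), of 0] by (meson ball_subset_cball order_trans)
 define s where "s = max (2 * r) r'"
 have As: "A \<subseteq> cball 0 s" using r' by (auto simp: s_def)
 define rh where "rh = density (alpha_red M N 2) (indicator {h \<in> space (alpha_red M N 2). h 1 \<in> cball 0 s})"
 have o: "\<forall>p. p \<notin> W \<times> W \<longrightarrow> f (fst p) (snd p) = 0" by (auto simp: f_out f_out2)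
 have s: "2 * r <= s" by (simp add: s_def)
 note m = mom2_alpha[OF W r f_borel f_le_D o s rh_def]
 interpret finite_measure rh by (rule m(2))
 have "integral\<^sup>L (mom2 W) (%p. f (fst p) (snd p)) = lam * (LINT h|rh. k (h 1))"
  using m(1) integral_f_unreduce[OF m(2) m(3)] by simp
 also have "(LINT h|rh. k (h 1)) = (LINT h|rh. indicator {h \<in> space rh. h 1 \<in> A} h)"
  by (rule bochner_integral_cong) (auto simp: k indicator_def)
 also have "... = measure rh ({h \<in> space rh. h 1 \<in> A} Int space rh)" by simp
 also have "{h \<in> space rh. h 1 \<in> A} Int space rh = {h \<in> space rh. h 1 \<in> A}" by auto
 also have "measure rh {h \<in> space rh. h 1 \<in> A} = alpha2_red M N A" by (rule m(4)[OF A(1) As])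
 finally show ?thesis unfolding edge_sum_eq variance_identity(3) e_def .
qed

end

section \<open>Chaining\<close>

lemma power_diff_le:
 fixes x y :: real
 assumes "0 <= y" "y <= x" "x <= 1"
 shows "x ^ d - y ^ d <= real d * (x - y)"
proof (induction d)
 case (Suc d)
 have "x ^ Suc d - y ^ Suc d = x * (x ^ d - y ^ d) + y ^ d * (x - y)" by (simp add: algebra_simps)
 also have "... <= 1 * (real d * (x - y)) + 1 * (x - y)"
  using assms Suc.IH power_mono[of y x d] power_le_one[of y d] by (intro add_mono mult_mono) auto
 finally show ?case by (simp add: algebra_simps)
qed simp

lemma dyadic_point:
 fixes t :: real
 assumes "0 <= t" "t <= rh"
 shows "\<exists>j<2 ^ K. rh * real j / 2 ^ K <= t & t <= rh * real (j + 1) / 2 ^ K"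
proof (induction K)
 case 0
 show ?case using assms by (intro exI[of _ 0]) auto
next
 case (Suc K)
 then obtain j where j: "j < 2 ^ K" "rh * real j / 2 ^ K <= t" "t <= rh * real (j + 1) / 2 ^ K" by blast
 show ?case
 proof (cases "t <= rh * real (2 * j + 1) / 2 ^ Suc K")
  case True
  with j show ?thesis by (intro exI[of _ "2 * j"]) auto
 next
  case False
  have "2 * j + 1 + 1 = 2 * (j + 1)" by simp
  then have "t <= rh * real (2 * j + 1 + 1) / 2 ^ Suc K" using j(3) by (simp only: power_Suc of_nat_mult)
  with False j(1) show ?thesis by (intro exI[of _ "2 * j + 1"]) auto
 qed
qed

text \<open>The ratio 1/2 under the root is replaced by the larger (3/4)^2 = 9/16 to obtain a
  rational geometric series with sum at most 4. The constant part of the bound grows only with the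
  number of levels.\<close>

lemma sum_sqrt_geometric_le:
 assumes "0 <= a" "0 <= b"
 shows "(\<Sum>k\<le>K. sqrt (a + b / 2 ^ k)) <= real (K + 1) * sqrt a + 4 * sqrt b"
proof -
 have "sqrt (a + b / 2 ^ k) <= sqrt a + sqrt b * (3 / 4) ^ k" for k
 proof -
  have "sqrt (a + b / 2 ^ k) <= sqrt a + sqrt (b / 2 ^ k)" using assms by (intro sqrt_add_le_add_sqrt) auto
  also have "sqrt (b / 2 ^ k) <= sqrt (b * ((3 / 4) ^ k)\<^sup>2)"
  proof -
   have "1 / 2 ^ k = (1 / 2 :: real) ^ k" by (simp add: power_one_over)
   also have "... <= (9 / 16) ^ k" by (intro power_mono) auto
   also have "... = ((3 / 4) ^ k)\<^sup>2" by (simp add: power2_eq_square flip: power_mult_distrib)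
   finally show ?thesis using assms(2) mult_left_mono[of "1 / 2 ^ k" "((3 / 4) ^ k)\<^sup>2" b] by (intro real_sqrt_le_mono) simp
  qed
  also have "... = sqrt b * (3 / 4) ^ k" by (simp add: real_sqrt_mult)
  finally show ?thesis by simp
 qed
 then have "(\<Sum>k\<le>K. sqrt (a + b / 2 ^ k)) <= (\<Sum>k\<le>K. sqrt a + sqrt b * (3 / 4) ^ k)" by (rule sum_mono)
 also have "... = real (K + 1) * sqrt a + sqrt b * (\<Sum>k\<le>K. (3 / 4) ^ k)" by (simp add: sum.distrib sum_distrib_left)
 finally have 1: "(\<Sum>k\<le>K. sqrt (a + b / 2 ^ k)) <= real (K + 1) * sqrt a + sqrt b * (\<Sum>k\<le>K. (3 / 4) ^ k)" .
 have "(\<Sum>k\<le>K. (3 / 4 :: real) ^ k) <= 4"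
 proof -
  have "(\<Sum>k\<le>K. (3 / 4 :: real) ^ k) = 4 * (1 - (3 / 4) ^ Suc K)" by (simp add: sum_gp0)
  also have "... <= 4 * 1" by (intro mult_left_mono) auto
  finally show ?thesis by simp
 qed
 then have "sqrt b * (\<Sum>k\<le>K. (3 / 4) ^ k) <= sqrt b * 4" by (rule mult_left_mono) (use assms(2) in simp)
 with 1 show ?thesis by linarith
qed

context B4_process
begin

lemma edge_sum_measurable:
 assumes W: "W \<in> sets borel" "bounded W" and [measurable]: "k \<in> borel_measurable borel"
 shows "(%om. edge_corrected_sum W (N om) k) \<in> borel_measurable M"
proof -
 have [measurable]: "overlap W \<in> borel_measurable borel" by (rule overlap_borel[OF W])
 have "(%p. k (snd p - fst p) / overlap W (snd p - fst p) :: real) \<in> borel_measurable (borel \<Otimes>\<^sub>M borel)" by measurable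
 then have m: "(%p. k (snd p - fst p) / overlap W (snd p - fst p) :: real) \<in> borel_measurable borel"
  by (simp add: borel_prod)
 show ?thesis unfolding edge_corrected_sum_eq[OF W(1)]
  by (rule random_finite_sum[OF random_finite_tuples2[OF W] m])
qed

definition "total_mass k = measure (gp k) (space (gp k)) + measure (gm k) (space (gm k))"

lemma total_mass_nonneg: "0 <= total_mass k" by (simp add: total_mass_def)

text \<open>Disjoint sets of lags have disjoint preimages under a coordinate, so their masses add up
  to no more than the total variation, however many sets there are.\<close>

lemma sum_lag_mass_le:
 assumes k: "k \<in> {2, 3, 4}" and i: "i \<in> {1..<k}" and J: "finite J" "disjoint_family_on A J"
  and A: "!!j. A j \<in> sets borel"
 shows "(\<Sum>j\<in>J. lag_mass k i (A j)) <= total_mass k"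
proof -
 have b: "(\<Sum>j\<in>J. measure rh (lag_set rh i (A j))) <= measure rh (space rh)"
  if r: "finite_measure rh" "sets rh = sets (red_borel k)" for rh :: "(nat => 'a) measure"
 proof -
  interpret finite_measure rh by fact
  have s: "lag_set rh i (A j) \<in> sets rh" for j by (rule lag_set_sets[OF r(2) i A])
  have "disjoint_family_on (%j. lag_set rh i (A j)) J"
   using J(2) by (fastforce simp: disjoint_family_on_def lag_set_def)
  then have "(\<Sum>j\<in>J. measure rh (lag_set rh i (A j))) = measure rh (\<Union>j\<in>J. lag_set rh i (A j))"
   using s J(1) by (intro finite_measure_finite_Union[symmetric]) auto
  also have "... <= measure rh (space rh)" by (rule bounded_measure)
  finally show ?thesis .
 qed
 show ?thesis unfolding lag_mass_def total_mass_def sum.distrib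
  by (intro add_mono b finite_gp sets_gp finite_gm sets_gm k)
qed

definition "lag_total = lam * (total_mass 4 + 4 * total_mass 3 + 2 * total_mass 2)"

lemma lag_total_nonneg: "0 <= lag_total"
 using intensity_pos total_mass_nonneg by (simp add: lag_total_def)

lemma sum_lag_measure_le:
 assumes J: "finite J" "disjoint_family_on A J" and A: "!!j. A j \<in> sets borel"
 shows "(\<Sum>j\<in>J. lag_measure (A j)) <= lag_total + 2 * lam^2 * (1 + gamma_total)^2 * (\<Sum>j\<in>J. vol (A j))"
proof -
 have "(\<Sum>j\<in>J. lag_measure (A j)) = lam * ((\<Sum>j\<in>J. lag_mass 4 3 (A j)) + 4 * (\<Sum>j\<in>J. lag_mass 3 1 (A j))
   + 2 * (\<Sum>j\<in>J. lag_mass 2 1 (A j))) + 2 * lam^2 * (1 + gamma_total)^2 * (\<Sum>j\<in>J. vol (A j))"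
  by (simp add: lag_measure_def sum.distrib flip: sum_distrib_left)
 also have "... <= lam * (total_mass 4 + 4 * total_mass 3 + 2 * total_mass 2) + 2 * lam^2 * (1 + gamma_total)^2 * (\<Sum>j\<in>J. vol (A j))"
  using intensity_pos by (intro add_right_mono mult_left_mono add_mono sum_lag_mass_le J A) auto
 finally show ?thesis by (simp add: lag_total_def)
qed

end

section \<open>A bound uniform over the dilations within one window\<close>

locale K_window = B4_process M N + gauge_body B
 for M :: "'o measure" and N :: "'o => 'a::euclidean_space set" and B :: "'a set" +
 fixes W :: "'a set" and rh dl :: real
 assumes W: "W \<in> sets borel" "bounded W" and volW: "0 < vol W" and rh: "0 <= rh"
  and dl: "0 <= dl" "dl <= 1 / 2" and overlap_ge: "z \<in> scaled rh B ==> (1 - dl) * vol W <= overlap W z"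
begin

lemma window_kernel_indicator:
 assumes S: "S \<in> sets borel" "S \<subseteq> scaled rh B" and sym: "!!z. - z \<in> S \<longleftrightarrow> z \<in> S"
 shows "window_kernel M N W S (indicator S) 1 dl"
proof
 show "bounded S" using bounded_subset[OF bounded_scaled S(2)] .
 show "indicator S (- z) = (indicator S z :: real)" for z using sym by (simp add: indicator_def)
 show "(1 - dl) * vol W <= overlap W z" if "z \<in> S" for z using overlap_ge S(2) that by blast
qed (use S W volW dl in \<open>auto simp: indicator_def\<close>)

definition "T om t = edge_corrected_sum W (N om) (indicator (scaled t B))"

lemma T_measurable: "(%om. T om t) \<in> borel_measurable M"
 unfolding T_def by (rule edge_sum_measurable[OF W]) (use scaled_borel[of t] in simp)

lemma T_increment:
 assumes "0 <= s" "s <= t"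
 shows "edge_corrected_sum W (N om) (indicator (scaled t B - scaled s B)) = T om t - T om s"
proof -
 have i: "indicator (scaled t B - scaled s B) z = (indicator (scaled t B) z - indicator (scaled s B) z :: real)" for z
  using scaled_mono[OF assms] by (auto simp: indicator_def)
 show ?thesis unfolding T_def edge_corrected_sum_eq[OF W(1)] i diff_divide_distrib sum_subtractf ..
qed

lemma T_mono: "0 <= s ==> s <= t ==> T om s <= T om t"
proof -
 assume st: "0 <= s" "s <= t"
 have "0 <= edge_corrected_sum W (N om) (indicator (scaled t B - scaled s B))"
  unfolding edge_corrected_sum_eq[OF W(1)] by (intro sum_nonneg divide_nonneg_nonneg) (auto simp: overlap_def)
 then show ?thesis unfolding T_increment[OF st] by simp
qed

lemma T_0: "T om 0 = 0"
 unfolding T_def edge_corrected_sum_eq[OF W(1)] scaled_0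
 by (rule sum.neutral) (auto simp: tuples2_def indicator_def)

abbreviation "alpha t \<equiv> alpha2_red M N (scaled t B)"

lemma expectation_T:
 assumes "0 <= t" "t <= rh"
 shows "integrable M (%om. T om t)" "expectation (%om. T om t) = lam * alpha t"
proof -
 interpret k: window_kernel M N W "scaled t B" "indicator (scaled t B)" 1 dl
  by (rule window_kernel_indicator[OF scaled_borel scaled_mono[OF assms] scaled_sym])
 show "integrable M (%om. T om t)" "expectation (%om. T om t) = lam * alpha t"
  unfolding T_def by (rule k.integrable_edge_sum, rule k.expectation_edge_sum_indicator[OF refl])
qed

text \<open>The pair count after removal of its mean and its linear part. Its increments are the
  residuals of the kernels that are indicators of annuli, which links the chaining to
  \<open>resid_moment\<close>.\<close>

definition "X om t = T om t - lam * alpha t - 2 * lam * (t ^ DIM('a) * vol B) * (lambda_hat W (N om) - lam)"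

lemma X_increment:
 assumes st: "0 <= s" "s <= t" "t <= rh"
 shows "integrable M (%om. (X om t - X om s)\<^sup>2)"
  and "expectation (%om. (X om t - X om s)\<^sup>2) <= (8 * lag_measure (scaled t B - scaled s B)
    + 48 * lam ^ 3 * (1 + gamma_total) * dl * ((t ^ DIM('a) - s ^ DIM('a)) * vol B)\<^sup>2) / vol W"
  and "alpha t - alpha s = alpha2_red M N (scaled t B - scaled s B)"
proof -
 let ?S = "scaled t B - scaled s B"
 have t: "0 <= t" "s <= rh" using st by auto
 have Sb: "?S \<in> sets borel" using scaled_borel by (rule sets.Diff[OF _ scaled_borel])
 interpret k: window_kernel M N W ?S "indicator ?S" 1 dl
  by (rule window_kernel_indicator[OF Sb]) (use scaled_mono[OF t(1) st(3)] scaled_sym in auto)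
 have kap: "k.kappa = (t ^ DIM('a) - s ^ DIM('a)) * vol B"
  unfolding vol_annulus[OF st(1,2), symmetric] k.kappa_def using Sb by simp
 have E: "expectation (%om. T om t - T om s) = lam * alpha2_red M N ?S"
  unfolding T_increment[OF st(1,2), symmetric] by (rule k.expectation_edge_sum_indicator[OF refl])
 have "lam * alpha t - lam * alpha s = lam * alpha2_red M N ?S"
  unfolding E[symmetric] expectation_T(2)[OF t(1) st(3), symmetric] expectation_T(2)[OF st(1) t(2), symmetric]
  by (rule Bochner_Integration.integral_diff[symmetric, OF expectation_T(1)[OF t(1) st(3)] expectation_T(1)[OF st(1) t(2)]])
 then have "lam * (alpha t - alpha s) = lam * alpha2_red M N ?S" by (simp only: right_diff_distrib)
 then show al: "alpha t - alpha s = alpha2_red M N ?S" using intensity_pos by (simp only: mult_cancel_left) simp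
 have "k.resid om = X om t - X om s" for om
  unfolding k.resid_def T_increment[OF st(1,2)] E kap al[symmetric] X_def
  by (simp add: algebra_simps)
 with k.resid_moment show "integrable M (%om. (X om t - X om s)\<^sup>2)"
  "expectation (%om. (X om t - X om s)\<^sup>2) <= (8 * lag_measure ?S
    + 48 * lam ^ 3 * (1 + gamma_total) * dl * ((t ^ DIM('a) - s ^ DIM('a)) * vol B)\<^sup>2) / vol W"
  unfolding kap by simp_all
qed

definition "D = rh ^ DIM('a) * vol B"

lemma D_nonneg: "0 <= D" using rh by (simp add: D_def)

lemma dyadic_vol:
 assumes i: "i < 2 ^ k"
 shows "((rh * real (i + 1) / 2 ^ k) ^ DIM('a) - (rh * real i / 2 ^ k) ^ DIM('a)) * vol B <= real DIM('a) * D / 2 ^ k"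
proof -
 have "real (i + 1) <= 2 ^ k" using i by (metis Suc_eq_plus1 Suc_leI of_nat_le_iff of_nat_numeral of_nat_power)
 then have "(real (i + 1) / 2 ^ k) ^ DIM('a) - (real i / 2 ^ k) ^ DIM('a) <= real DIM('a) * (real (i + 1) / 2 ^ k - real i / 2 ^ k)"
  by (intro power_diff_le) (auto simp: divide_right_mono)
 also have "... = real DIM('a) / 2 ^ k" by (simp flip: diff_divide_distrib)
 finally have "D * ((real (i + 1) / 2 ^ k) ^ DIM('a) - (real i / 2 ^ k) ^ DIM('a)) <= D * (real DIM('a) / 2 ^ k)"
  by (rule mult_left_mono[OF _ D_nonneg])
 moreover have "(rh * real (i + 1) / 2 ^ k) ^ DIM('a) = rh ^ DIM('a) * (real (i + 1) / 2 ^ k) ^ DIM('a)"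
   "(rh * real i / 2 ^ k) ^ DIM('a) = rh ^ DIM('a) * (real i / 2 ^ k) ^ DIM('a)"
  by (simp_all add: power_mult_distrib[symmetric])
 ultimately show ?thesis by (simp only: D_def) (simp add: algebra_simps)
qed

definition "step k i om = X om (rh * real (i + 1) / 2 ^ k) - X om (rh * real i / 2 ^ k)"

text \<open>The two parts of the summed second moments of one level: \<open>chain_a\<close> comes
  from lag masses and does not depend on the level, while \<open>chain_b\<close> comes from squared
  annulus volumes and is halved at each level.\<close>

definition "chain_a = 8 * (lag_total + 2 * lam^2 * (1 + gamma_total)^2 * D) / vol W"
definition "chain_b = 48 * lam ^ 3 * (1 + gamma_total) * dl * (real DIM('a) * D\<^sup>2) / vol W"

lemma chain_nonneg: "0 <= chain_a" "0 <= chain_b"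
 using lag_total_nonneg intensity_pos gamma_total_nonneg volW D_nonneg dl by (simp_all add: chain_a_def chain_b_def)

text \<open>The annuli of one level are disjoint with total volume D, so the lag masses are bounded
  by \<open>lag_total\<close> and the volume term by D, uniformly in the level.\<close>

lemma step_moment:
 "i < 2 ^ k ==> integrable M (%om. (step k i om)\<^sup>2)"
 "(\<Sum>i<2 ^ k. expectation (%om. (step k i om)\<^sup>2)) <= chain_a + chain_b / 2 ^ k"
proof -
 define t where "t i = rh * real i / 2 ^ k" for i
 have t: "0 <= t i" "t i <= t (i + 1)" for i using rh by (simp_all add: t_def divide_right_mono mult_left_mono)
 have trh: "t (i + 1) <= rh" if "i < 2 ^ k" for i
 proof -
  have "real (i + 1) <= 2 ^ k" using that by (metis Suc_eq_plus1 Suc_leI of_nat_le_iff of_nat_numeral of_nat_power)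
  then have "rh * real (i + 1) <= rh * 2 ^ k" by (rule mult_left_mono[OF _ rh])
  then show ?thesis by (simp add: t_def divide_le_eq)
 qed
 have st: "step k i om = X om (t (i + 1)) - X om (t i)" for i om by (simp add: step_def t_def)
 show "integrable M (%om. (step k i om)\<^sup>2)" if "i < 2 ^ k"
  unfolding st by (rule X_increment(1)[OF t trh[OF that]])
 define A where "A i = scaled (t (i + 1)) B - scaled (t i) B" for i
 define q where "q i = ((t (i + 1)) ^ DIM('a) - (t i) ^ DIM('a)) * vol B" for i
 have vA: "vol (A i) = q i" for i unfolding A_def q_def by (rule vol_annulus[OF t])
 have q0: "0 <= q i" for i unfolding vA[symmetric] by simp
 have Ab: "A i \<in> sets borel" for i unfolding A_def using scaled_borel by (rule sets.Diff[OF _ scaled_borel])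
 have tm: "t i <= t j" if "i <= j" for i j using rh that by (simp add: t_def divide_right_mono mult_left_mono)
 have dj: "disjoint_family_on A {..<2 ^ k}"
 proof -
  have "A i Int A j = {}" if "i < j" for i j
  proof -
   have "scaled (t (i + 1)) B \<subseteq> scaled (t j) B" by (rule scaled_mono[OF t(1) tm]) (use that in simp)
   then show ?thesis unfolding A_def by blast
  qed
  then have "A i Int A j = {}" if "i ~= j" for i j using that by (metis Int_commute linorder_neqE_nat)
  then show ?thesis by (simp add: disjoint_family_on_def)
 qed
 have sq: "(\<Sum>i<2 ^ k. q i) = D"
 proof -
  have "(\<Sum>i<2 ^ k. q i) = (\<Sum>i<2 ^ k. (t (Suc i)) ^ DIM('a) - (t i) ^ DIM('a)) * vol B"
   by (simp add: q_def sum_distrib_right)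
  also have "... = ((t (2 ^ k)) ^ DIM('a) - (t 0) ^ DIM('a)) * vol B" by (simp only: sum_lessThan_telescope[of "%i. t i ^ DIM('a)"])
  finally show ?thesis by (simp add: t_def D_def)
 qed
 \<comment> \<open>A sum of squares is at most the largest term times the sum; the largest volume is
   d D / 2^k and the sum telescopes to D.\<close>
 have sq2: "(\<Sum>i<2 ^ k. (q i)\<^sup>2) <= real DIM('a) * D^2 / 2 ^ k"
 proof -
  have "(\<Sum>i<2 ^ k. (q i)\<^sup>2) <= (\<Sum>i<2 ^ k. real DIM('a) * D / 2 ^ k * q i)"
   unfolding power2_eq_square
   by (intro sum_mono mult_right_mono q0) (use dyadic_vol[of _ k] in \<open>auto simp: q_def t_def\<close>)
  also have "... = real DIM('a) * D / 2 ^ k * D" unfolding sum_distrib_left[symmetric] sq ..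
  finally show ?thesis by (simp add: power2_eq_square)
 qed
 have "(\<Sum>i<2 ^ k. expectation (%om. (step k i om)\<^sup>2))
   <= (\<Sum>i<2 ^ k. (8 * lag_measure (A i) + 48 * lam ^ 3 * (1 + gamma_total) * dl * (q i)\<^sup>2) / vol W)"
  unfolding st A_def q_def by (intro sum_mono X_increment(2) t) (use trh in auto)
 also have "... = (8 * (\<Sum>i<2 ^ k. lag_measure (A i)) + 48 * lam ^ 3 * (1 + gamma_total) * dl * (\<Sum>i<2 ^ k. (q i)\<^sup>2)) / vol W"
  by (simp only: sum.distrib sum_distrib_left sum_divide_distrib[symmetric])
 also have "... <= (8 * (lag_total + 2 * lam^2 * (1 + gamma_total)^2 * D)
   + 48 * lam ^ 3 * (1 + gamma_total) * dl * (real DIM('a) * D^2 / 2 ^ k)) / vol W"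
 proof (intro divide_right_mono add_mono mult_left_mono sq2)
  show "(\<Sum>i<2 ^ k. lag_measure (A i)) <= lag_total + 2 * lam^2 * (1 + gamma_total)^2 * D"
   using sum_lag_measure_le[OF _ dj Ab] unfolding vA sq by simp
 qed (use intensity_pos gamma_total_nonneg dl volW in auto)
 also have "... = chain_a + chain_b / 2 ^ k" by (simp add: chain_a_def chain_b_def add_divide_distrib mult_ac)
 finally show "(\<Sum>i<2 ^ k. expectation (%om. (step k i om)\<^sup>2)) <= chain_a + chain_b / 2 ^ k" .
qed

definition "chain K om = (\<Sum>k\<le>K. sqrt (\<Sum>i<2 ^ k. (step k i om)\<^sup>2))"

lemma lambda_hat_measurable: "(%om. lambda_hat W (N om)) \<in> borel_measurable M"
 unfolding lambda_hat_def using random_finiteD(3)[OF random_finite_pts[OF W]] by simp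

lemma X_measurable [measurable]: "(%om. X om t) \<in> borel_measurable M"
 unfolding X_def using T_measurable lambda_hat_measurable by simp

lemma chain_moment:
 "integrable M (chain K)"
 "expectation (chain K) <= real (K + 1) * sqrt chain_a + 4 * sqrt chain_b"
proof -
 define m where "m k om = sqrt (\<Sum>i<2 ^ k. (step k i om)\<^sup>2)" for k om
 have [measurable]: "step k i \<in> borel_measurable M" for k i unfolding step_def[abs_def] by measurable
 have mm: "m k \<in> borel_measurable M" for k unfolding m_def[abs_def] by measurable
 have m2: "(m k om)\<^sup>2 = (\<Sum>i<2 ^ k. (step k i om)\<^sup>2)" for k om by (simp add: m_def sum_nonneg)
 have i2: "integrable M (%om. (m k om)\<^sup>2)" for k
  unfolding m2 by (rule Bochner_Integration.integrable_sum) (simp add: step_moment(1))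
 have im: "integrable M (m k)" for k by (rule square_integrable_imp_integrable[OF mm i2])
 have em: "expectation (m k) <= sqrt (chain_a + chain_b / 2 ^ k)" for k
 proof -
  have a: "\<bar>m k om\<bar> = m k om" for om by (simp add: m_def sum_nonneg)
  have "expectation (m k) <= sqrt (expectation (%om. (m k om)\<^sup>2))"
   using abs_expectation_le_sqrt[OF mm[of k] i2[of k]] unfolding a .
  also have "expectation (%om. (m k om)\<^sup>2) = (\<Sum>i<2 ^ k. expectation (%om. (step k i om)\<^sup>2))"
   unfolding m2 by (rule Bochner_Integration.integral_sum) (simp add: step_moment(1))
  also have "sqrt ... <= sqrt (chain_a + chain_b / 2 ^ k)" by (intro real_sqrt_le_mono step_moment(2))
  finally show ?thesis .
 qed
 have c: "chain K = (%om. \<Sum>k\<le>K. m k om)" by (simp add: chain_def[abs_def] m_def)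
 show "integrable M (chain K)" unfolding c using im by simp
 have "expectation (chain K) = (\<Sum>k\<le>K. expectation (m k))" unfolding c using im by simp
 also have "... <= (\<Sum>k\<le>K. sqrt (chain_a + chain_b / 2 ^ k))" by (intro sum_mono em)
 also have "... <= real (K + 1) * sqrt chain_a + 4 * sqrt chain_b" by (rule sum_sqrt_geometric_le[OF chain_nonneg])
 finally show "expectation (chain K) <= real (K + 1) * sqrt chain_a + 4 * sqrt chain_b" .
qed

text \<open>Between neighbouring dyadic radii T is monotone, so X can exceed its dyadic values only
  by what its two compensators change on that mesh. The bound on \<open>alpha2_red\<close> and
  \<open>dyadic_vol\<close> control both.\<close>

lemma X_sup_le:
 assumes a0: "!!A. A \<in> sets borel ==> bounded A ==> alpha2_red M N A <= a0 * vol A" "0 <= a0"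
  and t: "0 <= t" "t <= rh"
 shows "\<bar>X om t\<bar> <= chain K om + real DIM('a) * D / 2 ^ K * (lam * a0 + 2 * lam * \<bar>lambda_hat W (N om) - lam\<bar>)"
proof -
 obtain j where j: "j < 2 ^ K" "rh * real j / 2 ^ K <= t" "t <= rh * real (j + 1) / 2 ^ K"
  using dyadic_point[OF t] by blast
 define s where "s = rh * real j / 2 ^ K"
 define u where "u = rh * real (j + 1) / 2 ^ K"
 have su: "0 <= s" "s <= t" "t <= u" using j rh by (simp_all add: s_def u_def)
 have j1: "j <= 2 ^ K" "j + 1 <= 2 ^ K" using j by simp_all
 have urh: "u <= rh"
 proof -
  have "real (j + 1) <= 2 ^ K" using j1(2) by (metis of_nat_le_iff of_nat_numeral of_nat_power)
  then have "rh * real (j + 1) <= rh * 2 ^ K" by (rule mult_left_mono[OF _ rh])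
  then show ?thesis by (simp add: u_def divide_le_eq)
 qed
 \<comment> \<open>The dilation by 0 is a single point of volume 0, so the bound on
   \<open>alpha2_red\<close> leaves it no mass and the chain starts at the value 0.\<close>
 have al0: "alpha 0 = 0"
 proof -
  have "alpha 0 <= a0 * vol (scaled 0 B)" by (rule a0(1)[OF scaled_borel bounded_scaled])
  then have "alpha 0 <= 0" by (simp only: scaled_0) simp
  then show ?thesis by (simp add: alpha2_red_def measure_le_0_iff)
 qed
 have X0: "X om 0 = 0" unfolding X_def T_0 al0 by simp
 have ch: "\<bar>X om (rh * real i / 2 ^ K)\<bar> <= chain K om" if "i <= 2 ^ K" for i
  using dyadic_chain[of "X om", OF X0 that, of rh] by (simp only: chain_def step_def)
 have Xs: "\<bar>X om s\<bar> <= chain K om" unfolding s_def by (rule ch[OF j1(1)])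
 have Xu: "\<bar>X om u\<bar> <= chain K om" unfolding u_def by (rule ch[OF j1(2)])
 define q where "q = real DIM('a) * D / 2 ^ K"
 define h where "h = lambda_hat W (N om) - lam"
 have dv: "(u ^ DIM('a) - s ^ DIM('a)) * vol B <= q" unfolding s_def u_def q_def by (rule dyadic_vol[OF j(1)])
 have mono: "0 <= (u ^ DIM('a) - t ^ DIM('a)) * vol B" "0 <= (t ^ DIM('a) - s ^ DIM('a)) * vol B"
  using su by (auto intro!: mult_nonneg_nonneg power_mono)
 have al: "alpha u - alpha s <= a0 * q"
 proof -
  have s_u: "s <= u" using su by simp
  have "alpha u - alpha s = alpha2_red M N (scaled u B - scaled s B)" by (rule X_increment(3)[OF su(1) s_u urh])
  also have "... <= a0 * vol (scaled u B - scaled s B)"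
   using scaled_borel bounded_subset[OF bounded_scaled Diff_subset] by (intro a0(1) sets.Diff) auto
  also have "... <= a0 * q" unfolding vol_annulus[OF su(1) s_u] by (rule mult_left_mono[OF dv a0(2)])
  finally show ?thesis .
 qed
 have al_mono: "alpha s <= alpha t" "alpha t <= alpha u"
 proof -
  have p: "0 <= alpha2_red M N S" for S by (simp add: alpha2_red_def)
  show "alpha s <= alpha t" using X_increment(3)[of s t] p[of "scaled t B - scaled s B"] su urh by simp
  show "alpha t <= alpha u" using X_increment(3)[of t u] p[of "scaled u B - scaled t B"] su urh by simp
 qed
 have lal: "lam * alpha u <= lam * alpha s + lam * (a0 * q)" "lam * alpha s <= lam * alpha t" "lam * alpha t <= lam * alpha u"
  using al al_mono intensity_pos by (simp_all flip: distrib_left)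
 have hb: "\<bar>2 * lam * p * h\<bar> <= 2 * lam * q * \<bar>h\<bar>" if "0 <= p" "p <= q" for p
  using that intensity_pos by (simp add: abs_mult mult_right_mono)
 let ?p = "(u ^ DIM('a) - t ^ DIM('a)) * vol B" and ?p' = "(t ^ DIM('a) - s ^ DIM('a)) * vol B"
 have sump: "?p + ?p' <= q" using dv by (simp add: algebra_simps)
 have h1: "\<bar>2 * lam * ?p * h\<bar> <= 2 * lam * q * \<bar>h\<bar>" by (rule hb) (use mono sump in linarith)+
 have h2: "\<bar>2 * lam * ?p' * h\<bar> <= 2 * lam * q * \<bar>h\<bar>" by (rule hb) (use mono sump in linarith)+
 have Tm: "T om s <= T om t" "T om t <= T om u" using T_mono su by auto
 \<comment> \<open>The upper bound compares with the right neighbour u and the lower bound with the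
   left neighbour s, in both cases dropping the increment of T by its sign.\<close>
 have "X om t = X om u + (T om t - T om u) + (lam * alpha u - lam * alpha t) + 2 * lam * ?p * h"
  by (simp add: X_def h_def algebra_simps)
 then have up: "X om t <= \<bar>X om u\<bar> + lam * (a0 * q) + 2 * lam * q * \<bar>h\<bar>" using Tm lal h1 by linarith
 have "X om t = X om s + (T om t - T om s) + (lam * alpha s - lam * alpha t) - 2 * lam * ?p' * h"
  by (simp add: X_def h_def algebra_simps)
 then have lo: "- X om t <= \<bar>X om s\<bar> + lam * (a0 * q) + 2 * lam * q * \<bar>h\<bar>" using Tm lal h2 by linarith
 have "\<bar>X om t\<bar> <= chain K om + (lam * (a0 * q) + 2 * lam * q * \<bar>h\<bar>)" using up lo Xs Xu by linarith
 also have "lam * (a0 * q) + 2 * lam * q * \<bar>h\<bar> = q * (lam * a0 + 2 * lam * \<bar>h\<bar>)" by (simp add: algebra_simps)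
 finally show ?thesis unfolding q_def h_def .
qed

lemma sqrt_vol_error_moment:
 "integrable M (%om. (sqrt (vol W) * (lambda_hat W (N om) - lam))\<^sup>2)"
 "expectation (%om. (sqrt (vol W) * (lambda_hat W (N om) - lam))\<^sup>2) <= lam * (1 + gamma_total)"
proof -
 have sc: "{0} \<subseteq> scaled rh B" using zeroB by force
 \<comment> \<open>Any lag set would do; the interpretation is made for its formula for the mean
   number of points in W.\<close>
 interpret k: window_kernel M N W "{0}" "indicator {0}" 1 dl by (rule window_kernel_indicator) (use sc in auto)
 define C where "C om = (\<Sum>x\<in>N om Int W. indicator W x :: real)" for om
 have C: "C om = real (card (N om Int W))" for om
 proof -
  have "C om = (\<Sum>x\<in>N om Int W. 1)" unfolding C_def by (rule sum.cong) auto
  then show ?thesis by simp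
 qed
 have iW: "(indicator W :: 'a => real) \<in> borel_measurable borel" using W(1) by simp
 note vp = variance_points_le[OF W iW, where H=1, folded C_def]
 have EC: "expectation C = lam * vol W" unfolding C[abs_def] by (rule k.expectation_card)
 have eq: "(sqrt (vol W) * (lambda_hat W (N om) - lam))\<^sup>2 = (C om - expectation C)\<^sup>2 / vol W" for om
 proof -
  have 1: "lambda_hat W (N om) - lam = (C om - lam * vol W) / vol W" using volW by (simp add: lambda_hat_def C diff_divide_distrib)
  have 2: "(sqrt (vol W) * y)\<^sup>2 = vol W * y\<^sup>2" for y by (simp add: power_mult_distrib)
  show ?thesis unfolding EC 1 2 using volW by (simp add: power_divide) (simp add: power2_eq_square)
 qed
 have iC: "integrable M C" unfolding C[abs_def] by (rule integrable_card(1)[OF W])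
 have iC2: "integrable M (%om. (C om)\<^sup>2)" by (rule vp(1)) (auto simp: indicator_def)
 have ex: "(C om - expectation C)\<^sup>2 = (C om)\<^sup>2 - 2 * expectation C * C om + (expectation C)\<^sup>2" for om
  by (simp add: power2_eq_square algebra_simps)
 show "integrable M (%om. (sqrt (vol W) * (lambda_hat W (N om) - lam))\<^sup>2)"
  unfolding eq ex using iC iC2 by simp
 have v: "variance C <= lam * (1 + gamma_total) * 1 * (LINT x|lborel. indicator W x * \<bar>indicator W x\<bar>)"
  by (rule vp(2)) (auto simp: indicator_def)
 have "(LINT x|lborel. indicator W x * \<bar>indicator W x\<bar>) = (\<integral>x. indicator W x \<partial>lborel :: real)"
  by (rule bochner_integral_cong) (auto simp: indicator_def)
 also have "... = vol W" using W by simp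
 finally show "expectation (%om. (sqrt (vol W) * (lambda_hat W (N om) - lam))\<^sup>2) <= lam * (1 + gamma_total)"
  unfolding eq using v volW by (simp add: divide_le_eq)
qed

end

lemma integral_lborel_scale:
 fixes w :: "'a::euclidean_space => real"
 assumes h: "0 < h" and [measurable]: "w \<in> borel_measurable borel"
 shows "(LINT z|lborel. w (z /\<^sub>R h)) = h ^ DIM('a) * (LINT x|lborel. w x)"
proof -
 have "(LINT z|lborel. w (z /\<^sub>R h)) = (\<integral>z. w (z /\<^sub>R h) \<partial>density (distr lborel borel (%x. 0 + h *\<^sub>R x)) (%_. ennreal (\<bar>h\<bar> ^ DIM('a))))"
  using lborel_affine[of h "0 :: 'a"] h by simp
 also have "... = (LINT x|lborel. h ^ DIM('a) * w x)"
  using h by (simp add: integral_density integral_distr)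
 finally show ?thesis by simp
qed

text \<open>The logarithm is at most a constant times x^(alpha/4), half of the decay x^(-alpha/2)
  that the root provides.\<close>

lemma log_times_sqrt_powr_tendsto_0:
 fixes E \<alpha> :: real
 assumes E: "0 <= E" and \<alpha>: "0 < \<alpha>"
 shows "((%x. (2 + log 2 x) * sqrt (E * x powr - \<alpha>)) \<longlongrightarrow> 0) at_top"
proof -
 define C where "C = (2 + 4 / (\<alpha> * ln 2)) * sqrt E"
 have "((%x. C * x powr - (\<alpha> / 4)) \<longlongrightarrow> C * 0) at_top"
  using \<alpha> by (intro tendsto_mult tendsto_const tendsto_neg_powr filterlim_ident) auto
 then have lim: "((%x. C * x powr - (\<alpha> / 4)) \<longlongrightarrow> 0) at_top" by simp
 show ?thesis
 proof (rule Lim_null_comparison[OF _ lim])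
  show "eventually (%x. norm ((2 + log 2 x) * sqrt (E * x powr - \<alpha>)) <= C * x powr - (\<alpha> / 4)) at_top"
   using eventually_ge_at_top[of 1]
  proof eventually_elim
   case (elim x)
   have "ln x <= x powr (\<alpha> / 4) / (\<alpha> / 4)" using elim \<alpha> by (intro ln_powr_bound) auto
   then have "log 2 x <= 4 / (\<alpha> * ln 2) * x powr (\<alpha> / 4)" using \<alpha> by (simp add: log_def field_simps)
   moreover have "1 <= x powr (\<alpha> / 4)" using elim \<alpha> by (simp add: ge_one_powr_ge_zero)
   ultimately have 1: "2 + log 2 x <= (2 + 4 / (\<alpha> * ln 2)) * x powr (\<alpha> / 4)" by (simp add: distrib_right)
   have "sqrt (x powr - \<alpha>) = x powr - (\<alpha> / 2)" using elim by (simp add: powr_half_sqrt[symmetric] powr_powr)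
   then have "sqrt (E * x powr - \<alpha>) = sqrt E * x powr - (\<alpha> / 2)" by (simp add: real_sqrt_mult)
   then have "(2 + log 2 x) * sqrt (E * x powr - \<alpha>) <= (2 + 4 / (\<alpha> * ln 2)) * x powr (\<alpha> / 4) * (sqrt E * x powr - (\<alpha> / 2))"
    using mult_right_mono[OF 1, of "sqrt E * x powr - (\<alpha> / 2)"] E by simp
   also have "... = C * (x powr (\<alpha> / 4) * x powr - (\<alpha> / 2))" by (simp add: C_def)
   also have "x powr (\<alpha> / 4) * x powr - (\<alpha> / 2) = x powr - (\<alpha> / 4)" by (simp flip: powr_add)
   finally show ?case using elim E by simp
  qed
 qed
qed

context B4_process
begin

lemma lag_measure_le:
 "A \<in> sets borel ==> lag_measure A <= lag_total + 2 * lam^2 * (1 + gamma_total)^2 * vol A"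
 using sum_lag_measure_le[of "{0::nat}" "%_. A"] by (simp add: disjoint_family_on_def)

end

section \<open>Intensity estimators along an averaging sequence\<close>

locale averaging_process = B4_process M N
 for M :: "'o measure" and N :: "'o => 'a::euclidean_space set" +
 fixes W :: "nat => 'a set"
 assumes averaging: "convex_averaging W"
begin

lemma window: "W n \<in> sets borel" "bounded (W n)"
 using averaging by (auto simp: convex_averaging_def compact_imp_closed compact_imp_bounded)

lemmas overlap_ev = convex_averaging_eventually(1)[OF averaging]
lemmas vol_at_top = convex_averaging_eventually(2)[OF averaging]

lemma vol_ev: "eventually (%n. c < vol (W n)) sequentially"
 using vol_at_top unfolding filterlim_at_top_dense by blast

lemma intensity_estimate_measurable [measurable]: "(%om. lambda_hat (W n) (N om)) \<in> borel_measurable M"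
 unfolding lambda_hat_def using random_finiteD(3)[OF random_finite_pts[OF window]] by simp

definition "Y n om = sqrt (vol (W n)) * (lambda_hat (W n) (N om) - lam)"

lemma Y_measurable [measurable]: "Y n \<in> borel_measurable M" unfolding Y_def[abs_def] by measurable

lemma Y_moment: "0 < vol (W n) ==> integrable M (%om. (Y n om)\<^sup>2) & expectation (%om. (Y n om)\<^sup>2) <= lam * (1 + gamma_total)"
proof -
 assume v: "0 < vol (W n)"
 \<comment> \<open>The degenerate body {0} with radius 0 and no boundary loss gives access to the
   moment bound for the count, which does not involve the body.\<close>
 interpret k: K_window M N "{0}" "W n" 0 0
  by unfold_locales (use v window[of n] in \<open>auto simp: overlap_def\<close>)
 show ?thesis using k.sqrt_vol_error_moment by (simp add: Y_def)
qed

lemma Y_bounded: "bounded_in_prob M Y"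
 by (rule bounded_in_prob_moment2[OF Y_measurable, where C="lam * (1 + gamma_total)"])
  (use vol_ev[of 0] Y_moment in \<open>auto elim!: eventually_mono\<close>)

lemma lambda_hat_limit: "tends_in_prob M (%n om. lambda_hat (W n) (N om)) lam"
proof (rule tends_in_prob_sup_le)
 have "((%x. x powr - (1 / 2 :: real)) \<longlongrightarrow> 0) at_top"
  by (rule tendsto_neg_powr[OF _ filterlim_ident]) simp
 then have "(%n. vol (W n) powr - (1 / 2)) \<longlonglongrightarrow> 0" by (rule filterlim_compose[OF _ vol_at_top])
 from tends_in_prob_mult_bounded[OF tends_in_prob_of_real_seq[OF this] Y_bounded]
 show "tends_in_prob M (%n om. \<bar>vol (W n) powr - (1 / 2) * Y n om\<bar>) 0" by (rule tends_in_prob_abs)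
 show "eventually (%n. \<forall>om\<in>space M. \<bar>lambda_hat (W n) (N om) - lam\<bar> <= \<bar>vol (W n) powr - (1 / 2) * Y n om\<bar>) sequentially"
  using vol_ev[of 0]
  by eventually_elim (simp add: Y_def powr_minus powr_half_sqrt mult.assoc[symmetric])
qed measurable

lemma lambda2_hat_eq: "lambda2_hat A ph = (lambda_hat A ph)\<^sup>2 - lambda_hat A ph / vol A"
 by (simp add: lambda2_hat_def lambda_hat_def power2_eq_square left_diff_distrib diff_divide_distrib)

lemma lambda2_hat_limit: "tends_in_prob M (%n om. lambda2_hat (W n) (N om)) (lam\<^sup>2)"
proof -
 have "(%n. inverse (vol (W n))) \<longlonglongrightarrow> 0"
  by (rule filterlim_compose[OF tendsto_inverse_0_at_top[OF filterlim_ident] vol_at_top])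
 then have "tends_in_prob M (%n om. lambda_hat (W n) (N om) * lambda_hat (W n) (N om) - lambda_hat (W n) (N om) * inverse (vol (W n))) (lam * lam - lam * 0)"
  by (intro tends_in_prob_diff tends_in_prob_mult lambda_hat_limit tends_in_prob_of_real_seq)
 then show ?thesis by (simp add: lambda2_hat_eq power2_eq_square divide_inverse)
qed

end

section \<open>Uniform linear approximation of the empirical K-process\<close>

locale K_sequence = averaging_process M N W + gauge_body B
 for M :: "'o measure" and N :: "'o => 'a::euclidean_space set" and W :: "nat => 'a set" and B :: "'a set" +
 fixes R \<alpha> a0 :: real
 assumes R: "0 <= R" and \<alpha>: "0 < \<alpha>"
  and scale_limit: "(%n. win_scale (W n) powr \<alpha> / inradius (W n)) \<longlonglongrightarrow> 0"
  and a0: "0 <= a0" "A \<in> sets borel ==> bounded A ==> alpha2_red M N A <= a0 * vol A"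
begin

definition "Z n om r = Delta M N B \<alpha> (W n) om r - 2 * lam * vol B * r ^ DIM('a) * Y n om"

text \<open>The constants of the chaining bound freed of the window: the dilation reached in window
  n has volume |W|^alpha Q.\<close>

definition "Q = R ^ DIM('a) * vol B"
definition "E1 = 8 * (lag_total + 2 * lam^2 * (1 + gamma_total)^2 * Q)"
definition "E2 = 48 * lam ^ 3 * (1 + gamma_total) * real DIM('a) * Q\<^sup>2"
definition "E3 = lam * a0 + 2 * lam * sqrt (lam * (1 + gamma_total))"

lemma constants_nonneg: "0 <= Q" "0 <= E1" "0 <= E2" "0 <= E3"
 using R lag_total_nonneg gamma_total_nonneg intensity_pos a0(1) by (simp_all add: Q_def E1_def E2_def E3_def)

lemma sup_Z_bound:
 assumes v: "1 <= vol (W n)" and kw: "K_window M N B (W n) (win_scale (W n) powr \<alpha> * R) dl"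
 shows "\<exists>U. integrable M U & expectation (%om. \<bar>U om\<bar>) \<le>
   (2 + log 2 (vol (W n))) * sqrt (E1 * vol (W n) powr - \<alpha>) + 4 * sqrt (E2 * dl)
   + real DIM('a) * Q * E3 * vol (W n) powr - (1 / 2)
  & (\<forall>om. \<forall>r\<in>{0..R}. \<bar>Z n om r\<bar> <= U om)"
proof -
 define x where "x = vol (W n)"
 have x: "1 <= x" "0 < x" using v by (simp_all add: x_def)
 define c where "c = win_scale (W n) powr \<alpha>"
 have c: "0 <= c" by (simp add: c_def)
 interpret k: K_window M N B "W n" "c * R" dl using kw by (simp add: c_def)
 have cd: "c ^ DIM('a) = x powr \<alpha>" unfolding c_def x_def using x(2) by (intro win_scale_pow) (simp add: x_def)
 have D: "k.D = x powr \<alpha> * Q" unfolding k.D_def Q_def power_mult_distrib cd by simp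
 define P where "P = x powr (1 / 2 - \<alpha>)"
 have P: "0 < P" using x by (simp add: P_def)
 have P2: "P\<^sup>2 = x powr (1 - 2 * \<alpha>)"
  unfolding P_def power2_eq_square using x by (simp flip: powr_add)
 have Pc: "P * x powr \<alpha> = sqrt x" using x by (simp add: P_def powr_half_sqrt flip: powr_add)
 \<comment> \<open>With 2^K >= |W| the mesh term, of order |W|^alpha / 2^K, becomes O(|W|^(-1/2))
   after multiplication by P, while the number of levels is at most 2 + log |W| to base 2.\<close>
 define K where "K = nat \<lceil>log 2 x\<rceil>"
 have K: "x <= 2 ^ K" "real (K + 1) <= 2 + log 2 x"
 proof -
  have l: "0 <= log 2 x" using x by simp
  have rK: "real K = of_int \<lceil>log 2 x\<rceil>" unfolding K_def using l by (simp add: order_trans[OF _ le_of_int_ceiling])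
  have "log 2 x <= real K" unfolding rK by (rule le_of_int_ceiling)
  then have "2 powr (log 2 x) <= 2 powr real K" by simp
  then show "x <= 2 ^ K" using x by (simp add: powr_realpow)
  show "real (K + 1) <= 2 + log 2 x" unfolding of_nat_add rK using of_int_ceiling_le_add_one[of "log 2 x"] by linarith
 qed
 define h where "h om = \<bar>lambda_hat (W n) (N om) - lam\<bar>" for om
 define q where "q = real DIM('a) * k.D / 2 ^ K"
 define U where "U om = P * (k.chain K om + q * (lam * a0 + 2 * lam * h om))" for om
 have q: "0 <= q" using k.D_nonneg by (simp add: q_def)
 have "P * q <= real DIM('a) * Q * x powr - (1 / 2)"
 proof -
  have "P * q = real DIM('a) * (P * x powr \<alpha>) * Q / 2 ^ K" by (simp add: q_def D)
  also have "... <= real DIM('a) * sqrt x * Q / x"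
   unfolding Pc using K(1) x constants_nonneg by (intro divide_left_mono mult_nonneg_nonneg) auto
  also have "... = real DIM('a) * Q * (sqrt x / x)" by simp
  also have "sqrt x / x = x powr - (1 / 2)"
   using x by (simp add: powr_minus powr_half_sqrt divide_eq_eq field_simps)
  finally show ?thesis by simp
 qed
 note Pq = this
 have Y2: "integrable M (%om. (Y n om)\<^sup>2)" "expectation (%om. (Y n om)\<^sup>2) <= lam * (1 + gamma_total)"
  using Y_moment[of n] x(2) by (auto simp: x_def)
 have iY: "integrable M (Y n)" by (rule square_integrable_imp_integrable[OF Y_measurable Y2(1)])
 have hY: "h om <= \<bar>Y n om\<bar>" for om
 proof -
  have "1 * h om <= sqrt x * h om" using x by (intro mult_right_mono) (auto simp: h_def)
  then show ?thesis by (simp add: h_def Y_def abs_mult x_def)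
 qed
 have ih: "integrable M h"
  by (rule bochner_integrable_bound[OF integrable_abs[OF iY]])
   (use hY in \<open>auto simp: h_def[abs_def]\<close>)
 have Eh: "expectation h <= sqrt (lam * (1 + gamma_total))"
 proof -
  have "expectation h <= expectation (%om. \<bar>Y n om\<bar>)" by (rule integral_mono[OF ih integrable_abs[OF iY] hY])
  also have "... <= sqrt (expectation (%om. (Y n om)\<^sup>2))" by (rule abs_expectation_le_sqrt[OF Y_measurable Y2(1)])
  also have "... <= sqrt (lam * (1 + gamma_total))" by (rule real_sqrt_le_mono[OF Y2(2)])
  finally show ?thesis .
 qed
 have ic: "integrable M (k.chain K)" by (rule k.chain_moment(1))
 have iU: "integrable M U" unfolding U_def[abs_def] using ic ih by simp
 have Un: "0 <= U om" for om
 proof -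
  have "0 <= k.chain K om" unfolding k.chain_def by (intro sum_nonneg real_sqrt_ge_zero) auto
  then show ?thesis unfolding U_def using P q intensity_pos a0(1) by (simp add: h_def)
 qed
 \<comment> \<open>Here P^2 = |W|^(1 - 2 alpha) meets \<open>chain_a\<close> of order |W|^(alpha -
   1), which leaves |W|^(-alpha).\<close>
 have Pa: "P * sqrt k.chain_a <= sqrt (E1 * x powr - \<alpha>)"
 proof -
  have "x powr 0 <= x powr \<alpha>" using x \<alpha> by (intro powr_mono) auto
  then have "lag_total * 1 <= lag_total * x powr \<alpha>" using x lag_total_nonneg by (intro mult_left_mono) auto
  then have "8 * (lag_total + 2 * lam^2 * (1 + gamma_total)^2 * (x powr \<alpha> * Q)) <= E1 * x powr \<alpha>"
   by (simp add: E1_def algebra_simps)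
  then have "k.chain_a <= E1 * x powr \<alpha> / x" unfolding k.chain_a_def D x_def[symmetric] by (rule divide_right_mono) (use x in simp)
  then have "P\<^sup>2 * k.chain_a <= P\<^sup>2 * (E1 * x powr \<alpha> / x)" by (rule mult_left_mono) simp
  also have "... = E1 * (x powr (1 - 2 * \<alpha>) * x powr \<alpha> * x powr - 1)" using x by (simp add: P2 powr_minus divide_inverse)
  also have "... = E1 * x powr - \<alpha>" unfolding powr_add[symmetric] by simp
  finally have "sqrt (P\<^sup>2 * k.chain_a) <= sqrt (E1 * x powr - \<alpha>)" by (rule real_sqrt_le_mono)
  then show ?thesis using P by (simp add: real_sqrt_mult)
 qed
 \<comment> \<open>All powers of |W| cancel in the boundary part; it tends to zero only because dl
   does.\<close>
 have Pb: "P * sqrt k.chain_b = sqrt (E2 * dl)"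
 proof -
  have "P\<^sup>2 * k.chain_b = E2 * dl * (x powr (1 - 2 * \<alpha>) * x powr \<alpha> * x powr \<alpha> * x powr - 1)"
   unfolding k.chain_b_def D E2_def P2 x_def[symmetric] using x by (simp add: powr_minus divide_inverse power2_eq_square)
  also have "... = E2 * dl" using x by (simp flip: powr_add)
  finally have "sqrt (P\<^sup>2 * k.chain_b) = sqrt (E2 * dl)" by simp
  then show ?thesis using P by (simp add: real_sqrt_mult)
 qed
 have "expectation (%om. \<bar>U om\<bar>) = expectation U" using Un by simp
 also have "... = P * expectation (k.chain K) + P * q * (lam * a0 + 2 * lam * expectation h)"
  unfolding U_def[abs_def] using ic ih by (simp add: algebra_simps prob_space)
 also have "... <= P * (real (K + 1) * sqrt k.chain_a + 4 * sqrt k.chain_b) + real DIM('a) * Q * x powr - (1 / 2) * E3"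
 proof (rule add_mono)
  have "0 <= expectation h" by (rule integral_nonneg_AE) (simp add: h_def)
  then have "0 <= lam * a0 + 2 * lam * expectation h" using intensity_pos a0(1) by simp
  moreover have "lam * a0 + 2 * lam * expectation h <= E3"
   unfolding E3_def using Eh intensity_pos by (intro add_left_mono mult_left_mono) auto
  ultimately show "P * q * (lam * a0 + 2 * lam * expectation h) <= real DIM('a) * Q * x powr - (1 / 2) * E3"
   using constants_nonneg(1) by (intro mult_mono[OF Pq]) auto
  show "P * expectation (k.chain K) <= P * (real (K + 1) * sqrt k.chain_a + 4 * sqrt k.chain_b)"
   using P by (intro mult_left_mono k.chain_moment(2)) auto
 qed
 also have "P * (real (K + 1) * sqrt k.chain_a + 4 * sqrt k.chain_b) = real (K + 1) * (P * sqrt k.chain_a) + 4 * sqrt (E2 * dl)"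
  unfolding Pb[symmetric] by (simp add: algebra_simps)
 also have "real (K + 1) * (P * sqrt k.chain_a) <= (2 + log 2 x) * sqrt (E1 * x powr - \<alpha>)"
  by (intro mult_mono K(2) Pa) (use K(2) P k.chain_nonneg in auto)
 finally have EU: "expectation (%om. \<bar>U om\<bar>) <= (2 + log 2 x) * sqrt (E1 * x powr - \<alpha>) + 4 * sqrt (E2 * dl)
   + real DIM('a) * Q * E3 * x powr - (1 / 2)" by (simp add: mult_ac)
 have "\<bar>Z n om r\<bar> <= U om" if r: "r \<in> {0..R}" for om r
 proof -
  have PX: "Z n om r = P * k.X om (c * r)"
  proof -
   have K2: "lam\<^sup>2 * K_fun M N B (c * r) = lam * k.alpha (c * r)"
    using intensity_pos by (simp add: K_fun_def power2_eq_square)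
   have "P * (2 * lam * ((c * r) ^ DIM('a) * vol B) * (lambda_hat (W n) (N om) - lam))
     = 2 * lam * vol B * r ^ DIM('a) * (P * x powr \<alpha> * (lambda_hat (W n) (N om) - lam))"
    by (simp add: power_mult_distrib cd)
   also have "... = 2 * lam * vol B * r ^ DIM('a) * Y n om" unfolding Pc by (simp add: Y_def x_def)
   finally show ?thesis
    unfolding Z_def Delta_def c_def[symmetric] x_def[symmetric] P_def[symmetric] K2 lambda2K_hat_def k.X_def k.T_def
    by (simp add: right_diff_distrib)
  qed
  have "0 <= c * r" "c * r <= c * R" using c r by (auto intro: mult_left_mono)
  then have "\<bar>k.X om (c * r)\<bar> <= k.chain K om + q * (lam * a0 + 2 * lam * h om)"
   unfolding q_def h_def by (intro k.X_sup_le a0)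
  then have "P * \<bar>k.X om (c * r)\<bar> <= U om" unfolding U_def by (rule mult_left_mono) (use P in simp)
  then show ?thesis unfolding PX abs_mult using P by simp
 qed
 with iU EU show ?thesis unfolding x_def by blast
qed

lemma sup_Z_limit:
 "\<exists>U. tends_in_prob M U 0 & (\<forall>n om. 0 <= U n om) \<and>
   eventually (%n. \<forall>om. \<forall>r\<in>{0..R}. \<bar>Z n om r\<bar> <= U n om) sequentially"
proof -
 obtain b0 where b0: "B \<subseteq> cball 0 b0" "0 <= b0"
  using bounded_subset_ballD[OF compact_imp_bounded[OF compactB], of 0] ball_subset_cball by (metis less_imp_le order_trans)
 define c where "c n = win_scale (W n) powr \<alpha>" for n
 \<comment> \<open>Lags in the largest dilation have norm at most c n R b0; this is the overlap loss
   for such lags in \<open>overlap_ev\<close>.\<close>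
 define dl where "dl n = 2 * real DIM('a) * (c n * R * b0) / inradius (W n)" for n
 have "(%n. 2 * real DIM('a) * R * b0 * (c n / inradius (W n))) \<longlonglongrightarrow> 2 * real DIM('a) * R * b0 * 0"
  using scale_limit by (intro tendsto_intros) (simp add: c_def)
 then have dl0: "dl \<longlonglongrightarrow> 0" by (simp add: dl_def[abs_def] mult_ac)
 have "eventually (%n. dl n < 1 / 2) sequentially" by (rule order_tendstoD(2)[OF dl0]) simp
 then have ev: "eventually (%n. 1 <= vol (W n) & K_window M N B (W n) (c n * R) (dl n)) sequentially"
  using overlap_ev vol_ev[of 1]
 proof eventually_elim
  case (elim n)
  define s where "s = c n * R * b0"
  have s0: "0 <= s" using R b0 by (simp add: s_def c_def)
  have inr: "0 < inradius (W n)" using elim by blast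
  have "K_window M N B (W n) (c n * R) (dl n)"
  proof
   show "0 <= dl n" using s0 inr by (simp add: dl_def s_def)
   show "dl n <= 1 / 2" using elim by simp
   show "0 <= c n * R" using R by (simp add: c_def)
   show "0 < vol (W n)" using elim by simp
   show "(1 - dl n) * vol (W n) <= overlap (W n) z" if z: "z \<in> scaled (c n * R) B" for z
   proof -
    from z obtain y where y: "y \<in> B" "z = (c n * R) *\<^sub>R y" by auto
    have "norm y <= b0" using b0 y by auto
    then have "norm z <= s" using R by (simp add: y(2) s_def c_def mult_left_mono abs_mult)
    moreover have "2 * s <= inradius (W n)"
    proof -
     have "1 * (2 * s) <= real DIM('a) * (2 * s)" using s0 by (intro mult_right_mono) (auto simp: Suc_le_eq)
     also have "... = dl n * inradius (W n)" using inr by (simp add: dl_def s_def)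
     also have "... <= 1 * inradius (W n)" using elim inr by (intro mult_right_mono) auto
     finally show ?thesis by simp
    qed
    ultimately show ?thesis using elim unfolding dl_def s_def[symmetric] by blast
   qed
  qed (use window in auto)
  with elim show ?case by simp
 qed
 define e where "e n = (2 + log 2 (vol (W n))) * sqrt (E1 * vol (W n) powr - \<alpha>) + 4 * sqrt (E2 * dl n)
   + real DIM('a) * Q * E3 * vol (W n) powr - (1 / 2)" for n
 have "e \<longlonglongrightarrow> 0 + 4 * sqrt (E2 * 0) + real DIM('a) * Q * E3 * 0"
  unfolding e_def[abs_def]
 proof (intro tendsto_add tendsto_mult tendsto_const tendsto_real_sqrt dl0)
  show "(%n. (2 + log 2 (vol (W n))) * sqrt (E1 * vol (W n) powr - \<alpha>)) \<longlonglongrightarrow> 0"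
   by (rule filterlim_compose[OF log_times_sqrt_powr_tendsto_0[OF constants_nonneg(2) \<alpha>] vol_at_top])
  show "(%n. vol (W n) powr - (1 / 2)) \<longlonglongrightarrow> 0"
   by (rule filterlim_compose[OF _ vol_at_top], rule tendsto_neg_powr[OF _ filterlim_ident]) simp
 qed
 then have e0: "e \<longlonglongrightarrow> 0" by simp
 \<comment> \<open>A measurable majorant is chosen for each n for which the moment bound provides
   one; 0 serves as the default for the other indices, and measurability holds for all of
   them.\<close>
 define good where "good n U \<longleftrightarrow> integrable M U & expectation (%om. \<bar>U om\<bar>) <= e n & (\<forall>om. \<forall>r\<in>{0..R}. \<bar>Z n om r\<bar> <= U om)"
  for n and U :: "'o => real"
 define U where "U n = (if \<exists>u. good n u then SOME u. good n u else (%_. 0))" for n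
 have gU: "good n (U n)" if "\<exists>u. good n u" for n using someI_ex[OF that] that by (simp add: U_def)
 have Um: "U n \<in> borel_measurable M" for n
 proof (cases "\<exists>u. good n u")
  case True then show ?thesis using gU[of n] by (auto simp: good_def)
 qed (simp add: U_def)
 have Un: "0 <= U n om" for n om
 proof (cases "\<exists>u. good n u")
  case True
  then have "\<bar>Z n om 0\<bar> <= U n om" using gU[of n] R unfolding good_def by auto
  then show ?thesis by linarith
 qed (simp add: U_def)
 from ev have gev: "eventually (%n. good n (U n)) sequentially"
 proof eventually_elim
  case (elim n)
  then have "\<exists>u. good n u" unfolding good_def e_def using sup_Z_bound[of n "dl n"] by (simp add: c_def)
  then show ?case by (rule gU)
 qed
 have "tends_in_prob M U 0"
  by (rule tends_in_prob_moment1[OF Um _ e0]) (use gev in \<open>auto simp: good_def elim!: eventually_mono\<close>)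
 moreover have "eventually (%n. \<forall>om. \<forall>r\<in>{0..R}. \<bar>Z n om r\<bar> <= U n om) sequentially"
  using gev by eventually_elim (simp add: good_def)
 ultimately show ?thesis using Un by blast
qed

end

section \<open>The variance estimator\<close>

locale sigma_sequence = averaging_process M N W
 for M :: "'o measure" and N :: "'o => 'a::euclidean_space set" and W :: "nat => 'a set" +
 fixes w :: "'a => real" and b :: "nat => real"
 assumes kernel: "smoothing_kernel w"
  and b_pos: "0 < b n" and b_limit: "b \<longlonglongrightarrow> 0"
  and range_limit: "filterlim (%n. win_scale (W n) * b n) at_top sequentially"
  and b2_limit: "(%n. win_scale (W n) * (b n)\<^sup>2) \<longlonglongrightarrow> 0"
  and edge_limit: "(%n. win_scale (W n) * b n / inradius (W n)) \<longlonglongrightarrow> 0"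
begin

lemma w_borel [measurable]: "w \<in> borel_measurable borel" and w_nonneg: "0 <= w x" and w_sym: "w (- x) = w x"
 using kernel by (simp_all add: smoothing_kernel_def)

definition "h n = b n * win_scale (W n)"
definition "k n z = w (z /\<^sub>R h n)"
definition "I = (LINT x|lborel. w x)"

lemma k_borel [measurable]: "k n \<in> borel_measurable borel" unfolding k_def[abs_def] by measurable

lemma h_limit: "filterlim h at_top sequentially"
 using range_limit by (simp add: h_def[abs_def] mult.commute)

lemma k_limit: "(%n. k n z) \<longlonglongrightarrow> 1"
proof -
 have "(w \<longlongrightarrow> w 0) (at 0)" using kernel by (simp add: smoothing_kernel_def)
 then have c: "isCont w 0" by (simp add: isCont_def)
 have "(%n. inverse (h n)) \<longlonglongrightarrow> 0"
  by (rule filterlim_compose[OF tendsto_inverse_0_at_top[OF filterlim_ident] h_limit])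
 then have "(%n. z /\<^sub>R h n) \<longlonglongrightarrow> 0 *\<^sub>R z" by (intro tendsto_scaleR tendsto_const)
 then have "(%n. w (z /\<^sub>R h n)) \<longlonglongrightarrow> w 0" using isCont_tendsto_compose[OF c] by simp
 then show ?thesis using kernel by (simp add: k_def smoothing_kernel_def)
qed

lemma w_bounds:
 obtains Ck r0 where "!!x. w x <= Ck" "!!x. r0 < norm x ==> w x = 0" "0 <= r0"
proof -
 obtain Ck where Ck: "!!x. norm (w x) <= Ck" using kernel unfolding smoothing_kernel_def bounded_iff by blast
 obtain r0 where r0: "!!x. w x ~= 0 ==> norm x <= r0" using kernel unfolding smoothing_kernel_def bounded_iff by blast
 have "w x <= Ck" for x using Ck[of x] by simp
 moreover have "w x = 0" if "max r0 0 < norm x" for x using r0[of x] that by force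
 ultimately show thesis using that[of Ck "max r0 0"] by simp
qed

text \<open>The bandwidth in absolute units tends to infinity, so the kernels tend to 1 at every
  fixed lag. Dominated convergence under a finite measure yields the total mass, which is how the
  estimator finds the integral of the second cumulant.\<close>

lemma kernel_moment_limit:
 assumes rh: "finite_measure rh" "sets rh = sets (red_borel 2 :: (nat => 'a) measure)"
 shows "(%n. \<integral>f. k n (f 1) \<partial>rh) \<longlonglongrightarrow> measure rh (space rh)"
proof -
 interpret finite_measure rh by fact
 obtain Ck r0 where Ck: "!!x. w x <= Ck" "!!x. r0 < norm x ==> w x = 0" "0 <= r0" using w_bounds by blast
 have f1: "(%f. f 1) \<in> measurable rh borel"
  unfolding measurable_cong_sets[OF rh(2) refl] by (rule measurable_component_singleton) simp
 have "(%n. \<integral>f. k n (f 1) \<partial>rh) \<longlonglongrightarrow> (LINT f|rh. 1)"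
 proof (rule integral_dominated_convergence[where w="%_. Ck"])
  show "(%f. k n (f 1)) \<in> borel_measurable rh" for n by (rule measurable_compose[OF f1 k_borel])
  show "AE f in rh. norm (k n (f 1)) <= Ck" for n using Ck(1) w_nonneg by (simp add: k_def)
 qed (use k_limit in auto)
 then show ?thesis by simp
qed

definition "S n om = edge_corrected_sum (W n) (N om) (k n)"
definition "G n = (LINT f|gp 2. k n (f 1)) - (LINT f|gm 2. k n (f 1))"
definition "res n om = S n om - (lam\<^sup>2 * (h n ^ DIM('a) * I) + lam * G n)
 - 2 * lam * (h n ^ DIM('a) * I) * (lambda_hat (W n) (N om) - lam)"

lemma S_measurable [measurable]: "S n \<in> borel_measurable M"
 unfolding S_def[abs_def] by (rule edge_sum_measurable[OF window k_borel])

lemma res_measurable [measurable]: "res n \<in> borel_measurable M"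
 unfolding res_def[abs_def] by measurable

lemma h_pow: "0 < vol (W n) ==> h n ^ DIM('a) = b n ^ DIM('a) * vol (W n)"
 using win_scale_pow[of "W n" 1] by (simp add: h_def power_mult_distrib win_scale_def)

text \<open>The kernel sees lags in a ball of volume proportional to b^d |W|, so the lag term
  divided by |W| is of order 1 / |W| + b^d. The boundary term contains (h^d)^2 / |W| = (c b^2)^d,
  where c is the window scale, and the vanishing factor dl. The conditions on the bandwidth make
  both tend to 0.\<close>

lemma res_limit: "tends_in_prob M res 0"
proof -
 obtain Ck r0 where Ck: "!!x. w x <= Ck" "!!x. r0 < norm x ==> w x = 0" "0 <= r0" using w_bounds by blast
 define dl where "dl n = 2 * real DIM('a) * (h n * r0) / inradius (W n)" for n
 have "(%n. 2 * real DIM('a) * r0 * (win_scale (W n) * b n / inradius (W n))) \<longlonglongrightarrow> 2 * real DIM('a) * r0 * 0"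
  by (intro tendsto_intros edge_limit)
 then have dl0: "dl \<longlonglongrightarrow> 0" by (simp add: dl_def[abs_def] h_def mult_ac)
 have "eventually (%n. dl n < 1 / 2) sequentially" by (rule order_tendstoD(2)[OF dl0]) simp
 moreover have "eventually (%n. 0 < h n) sequentially" using h_limit unfolding filterlim_at_top_dense by blast
 ultimately have ev: "eventually (%n. 0 < vol (W n) & 0 < h n & dl n < 1 / 2 & 0 <= dl n \<and>
   window_kernel M N (W n) (cball 0 (h n * r0)) (k n) Ck (dl n)) sequentially"
  using overlap_ev vol_ev[of 0]
 proof eventually_elim
  case (elim n)
  define s where "s = h n * r0"
  have s0: "0 <= s" using elim Ck(3) by (simp add: s_def)
  have inr: "0 < inradius (W n)" using elim by blast
  have dln: "0 <= dl n" using s0 inr by (simp add: dl_def s_def)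
  have s2: "2 * s <= inradius (W n)"
  proof -
   have "1 * (2 * s) <= real DIM('a) * (2 * s)" using s0 by (intro mult_right_mono) (auto simp: Suc_le_eq)
   also have "... = dl n * inradius (W n)" using inr by (simp add: dl_def s_def)
   also have "... <= 1 * inradius (W n)" using elim inr by (intro mult_right_mono) auto
   finally show ?thesis by simp
  qed
  have "window_kernel M N (W n) (cball 0 (h n * r0)) (k n) Ck (dl n)"
  proof
   show "k n z = 0" if "z \<notin> cball 0 (h n * r0)" for z
   proof -
    have "h n * r0 < norm z" using that by simp
    then have "r0 < norm (z /\<^sub>R h n)" using elim by (simp add: field_simps)
    then show ?thesis unfolding k_def by (rule Ck(2))
   qed
   show "(1 - dl n) * vol (W n) <= overlap (W n) z" if "z \<in> cball 0 (h n * r0)" for z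
    using that elim s2 unfolding dl_def s_def[symmetric] by simp
   show "k n (- z) = k n z" for z using w_sym[of "z /\<^sub>R h n"] by (simp add: k_def)
  qed (use elim window dln Ck(1) w_nonneg in \<open>auto simp: k_def\<close>)
  with elim dln show ?case by simp
 qed
 define c1 where "c1 = unit_ball_vol (real DIM('a)) * r0 ^ DIM('a)"
 define c2 where "c2 = 2 * lam^2 * (1 + gamma_total)\<^sup>2"
 define c3 where "c3 = 48 * lam ^ 3 * (1 + gamma_total)"
 define e where "e n = 8 * Ck^2 * (lag_total * inverse (vol (W n)) + c2 * c1 * b n ^ DIM('a))
   + c3 * (dl n * (win_scale (W n) * (b n)\<^sup>2) ^ DIM('a) * I\<^sup>2)" for n
 have "e \<longlonglongrightarrow> 8 * Ck^2 * (lag_total * 0 + c2 * c1 * 0 ^ DIM('a)) + c3 * (0 * 0 ^ DIM('a) * I\<^sup>2)"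
  unfolding e_def[abs_def]
  by (intro tendsto_intros dl0 b_limit b2_limit
    filterlim_compose[OF tendsto_inverse_0_at_top[OF filterlim_ident] vol_at_top])
 then have e0: "e \<longlonglongrightarrow> 0" by (simp add: zero_power)
 show ?thesis
 proof (rule tends_in_prob_moment2[OF res_measurable _ e0])
  show "eventually (%n. integrable M (%om. (res n om)\<^sup>2) & expectation (%om. (res n om)\<^sup>2) <= e n) sequentially"
   using ev
  proof eventually_elim
   case (elim n)
   then interpret wk: window_kernel M N "W n" "cball 0 (h n * r0)" "k n" Ck "dl n" by blast
   have v: "0 < vol (W n)" and hn: "0 < h n" using elim by auto
   have kap: "wk.kappa = h n ^ DIM('a) * I"
    unfolding wk.kappa_def I_def k_def by (rule integral_lborel_scale[OF hn w_borel])
   have r: "wk.resid om = res n om" for om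
    unfolding wk.resid_def res_def wk.expectation_edge_sum kap S_def G_def by simp
   have "lag_measure (cball 0 (h n * r0)) <= lag_total + c2 * vol (cball (0 :: 'a) (h n * r0))"
    unfolding c2_def by (rule lag_measure_le) simp
   also have "vol (cball (0 :: 'a) (h n * r0)) = c1 * b n ^ DIM('a) * vol (W n)"
    using hn Ck(3) by (simp add: content_cball c1_def power_mult_distrib h_pow[OF v])
   finally have lg: "lag_measure (cball 0 (h n * r0)) / vol (W n) <= lag_total * inverse (vol (W n)) + c2 * c1 * b n ^ DIM('a)"
    using v by (simp add: pos_divide_le_eq distrib_right mult.assoc)
   have cp: "(win_scale (W n)) ^ DIM('a) = vol (W n)" using win_scale_pow[of "W n" 1] v by (simp add: win_scale_def)
   have kp: "(h n ^ DIM('a) * I)\<^sup>2 / vol (W n) = (win_scale (W n) * (b n)\<^sup>2) ^ DIM('a) * I\<^sup>2"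
   proof -
    have "(h n ^ DIM('a) * I)\<^sup>2 / vol (W n) = (b n ^ DIM('a))\<^sup>2 * (vol (W n) * vol (W n) / vol (W n)) * I\<^sup>2"
     unfolding h_pow[OF v] by (simp add: power2_eq_square)
    also have "... = (win_scale (W n) * (b n)\<^sup>2) ^ DIM('a) * I\<^sup>2"
     using v by (simp add: power_mult_distrib cp power2_eq_square)
    finally show ?thesis .
   qed
   have "expectation (%om. (res n om)\<^sup>2) <= (8 * Ck^2 * lag_measure (cball 0 (h n * r0))
     + c3 * dl n * (h n ^ DIM('a) * I)\<^sup>2) / vol (W n)"
    using wk.resid_moment(2) unfolding r kap c3_def .
   also have "... = 8 * Ck^2 * (lag_measure (cball 0 (h n * r0)) / vol (W n))
     + c3 * dl n * ((h n ^ DIM('a) * I)\<^sup>2 / vol (W n))" by (simp add: add_divide_distrib)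
   also have "... <= e n" unfolding e_def kp using mult_left_mono[OF lg, of "8 * Ck\<^sup>2"] by simp
   finally show ?case using wk.resid_moment(1) unfolding r by blast
  qed
 qed
qed

lemma sigma2_hat_eq:
 "sigma2_hat w (b n) (W n) (N om) = lambda_hat (W n) (N om) + S n om
   - lambda2_hat (W n) (N om) * h n ^ DIM('a) * I"
 by (simp add: sigma2_hat_def S_def k_def[abs_def] h_def I_def)

lemma sigma2_hat_measurable [measurable]: "(%om. sigma2_hat w (b n) (W n) (N om)) \<in> borel_measurable M"
 unfolding sigma2_hat_eq lambda2_hat_eq by measurable

text \<open>Write J = b^d I. The three terms of S and of the correction that grow like J |W| combine
  to -J |W| times the squared intensity error, that is, -J times the tight sequence of squares of Y.
  As J tends to 0, only lam plus lam times the integral of the second cumulant remains.\<close>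

lemma sigma2_hat_limit: "tends_in_prob M (%n om. sigma2_hat w (b n) (W n) (N om)) (sigma2 M N)"
proof -
 have sp: "rect 2 (%_. UNIV) = space (gp 2)" "rect 2 (%_. UNIV) = space (gm 2)"
  using space_red[OF sets_gp[of 2]] space_red[OF sets_gm[of 2]] by simp_all
 have sg: "sigma2 M N = lam * (1 + (measure (gp 2) (space (gp 2)) - measure (gm 2) (space (gm 2))))"
  unfolding sigma2_def signed_val_def gp_def[symmetric] gm_def[symmetric] using sp by simp
 have G: "G \<longlonglongrightarrow> measure (gp 2) (space (gp 2)) - measure (gm 2) (space (gm 2))"
  unfolding G_def[abs_def] by (intro tendsto_diff kernel_moment_limit finite_gp finite_gm sets_gp sets_gm) auto
 have b0: "(%n. b n ^ DIM('a) * I) \<longlonglongrightarrow> 0"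
 proof -
  have "(%n. b n ^ DIM('a) * I) \<longlonglongrightarrow> 0 ^ DIM('a) * I" by (intro tendsto_intros b_limit)
  then show ?thesis by (simp add: zero_power)
 qed
 let ?l = "%n om. lambda_hat (W n) (N om)"
 \<comment> \<open>An exact rearrangement of the estimator for windows of positive volume in which
   every term has an evident limit.\<close>
 define A where "A n om = (?l n om + ?l n om * (b n ^ DIM('a) * I) + lam * G n + res n om) - b n ^ DIM('a) * I * (Y n om)\<^sup>2" for n om
 have "tends_in_prob M A ((lam + lam * 0 + lam * (measure (gp 2) (space (gp 2)) - measure (gm 2) (space (gm 2))) + 0) - 0)"
  unfolding A_def[abs_def]
  by (intro tends_in_prob_diff tends_in_prob_add tends_in_prob_mult lambda_hat_limit res_limit tends_in_prob_of_real_seq[OF b0]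
    tends_in_prob_of_real_seq[OF tendsto_mult[OF tendsto_const G]]
    tends_in_prob_mult_bounded[OF tends_in_prob_of_real_seq[OF b0] bounded_in_prob_square[OF Y_bounded]])
 then have A: "tends_in_prob M A (sigma2 M N)" by (simp add: sg algebra_simps)
 from tends_in_prob_diff[OF A tends_in_prob_const[of "sigma2 M N"]]
 have A0: "tends_in_prob M (%n om. \<bar>A n om - sigma2 M N\<bar>) 0" using tends_in_prob_abs by simp
 show ?thesis
 proof (rule tends_in_prob_sup_le[OF sigma2_hat_measurable A0])
  show "eventually (%n. \<forall>om\<in>space M. \<bar>sigma2_hat w (b n) (W n) (N om) - sigma2 M N\<bar> <= \<bar>A n om - sigma2 M N\<bar>) sequentially"
   using vol_ev[of 0]
  proof eventually_elim
   case (elim n)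
   have "sigma2_hat w (b n) (W n) (N om) = A n om" for om
   proof -
    define l where "l = lambda_hat (W n) (N om)"
    define v where "v = vol (W n)"
    define J where "J = b n ^ DIM('a) * I"
    have v: "v ~= 0" using elim by (simp add: v_def)
    have hI: "h n ^ DIM('a) * I = J * v" using h_pow[OF elim] by (simp add: J_def v_def)
    have Sn: "S n om = res n om + (lam\<^sup>2 * (J * v) + lam * G n) + 2 * lam * (J * v) * (l - lam)"
     unfolding res_def hI l_def by simp
    have Y2: "(Y n om)\<^sup>2 = v * (l - lam)\<^sup>2" unfolding Y_def l_def v_def by (simp add: power_mult_distrib)
    have "lambda2_hat (W n) (N om) * h n ^ DIM('a) * I = (l\<^sup>2 - l / v) * (J * v)"
     unfolding lambda2_hat_eq l_def[symmetric] v_def[symmetric] hI[symmetric] by simp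
    also have "... = l\<^sup>2 * J * v - l * J" using v by (simp add: left_diff_distrib)
    finally have e: "lambda2_hat (W n) (N om) * h n ^ DIM('a) * I = l\<^sup>2 * J * v - l * J" .
    show ?thesis unfolding sigma2_hat_eq e Sn A_def Y2 l_def[symmetric] J_def[symmetric]
     by (simp add: power2_eq_square algebra_simps)
   qed
   then show ?case by simp
  qed
 qed
qed

end

section \<open>Limit distributions\<close>

text \<open>Around each point v is bounded by its two one-sided limits and its value there;
  bisection spreads the local bounds over the compact interval.\<close>

lemma cadlag_bounded:
 assumes v: "cadlag_on R v" and R: "0 <= R"
 obtains C where "0 <= C" "!!r. r \<in> {0..R} ==> \<bar>v r\<bar> <= C"
proof -
 have ev_bound: "eventually (%y. \<bar>v y\<bar> < \<bar>l\<bar> + 1) F" if "(v \<longlongrightarrow> l) F" for l and F :: "real filter"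
  by (rule order_tendstoD(2)[OF tendsto_rabs[OF that]]) simp
 define P where "P a c \<longleftrightarrow> (\<exists>C. \<forall>r. a <= r \<longrightarrow> r <= c \<longrightarrow> \<bar>v r\<bar> <= C)" for a c
 have loc: "\<exists>d>0. \<forall>a c. 0 <= a & a <= x & x <= c & c <= R & c - a < d \<longrightarrow> P a c" if x: "0 <= x" "x <= R" for x
 proof -
  have "\<exists>d1>0. \<exists>C1. \<forall>y. x < y \<longrightarrow> y < x + d1 \<longrightarrow> y <= R \<longrightarrow> \<bar>v y\<bar> <= C1"
  proof (cases "x < R")
   case True
   then have "(v \<longlongrightarrow> v x) (at_right x)" using v x by (simp add: cadlag_on_def)
   from ev_bound[OF this] obtain e where "x < e" "!!y. x < y ==> y < e ==> \<bar>v y\<bar> < \<bar>v x\<bar> + 1"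
    unfolding eventually_at_right_field by blast
   then show ?thesis by (intro exI[of _ "e - x"] conjI exI[of _ "\<bar>v x\<bar> + 1"]) (auto intro: less_imp_le)
  next
   case False
   then show ?thesis using x by (intro exI[of _ 1]) auto
  qed
  then obtain d1 C1 where 1: "0 < d1" "!!y. x < y ==> y < x + d1 ==> y <= R ==> \<bar>v y\<bar> <= C1" by blast
  have "\<exists>d2>0. \<exists>C2. \<forall>y. x - d2 < y \<longrightarrow> y < x \<longrightarrow> 0 <= y \<longrightarrow> \<bar>v y\<bar> <= C2"
  proof (cases "0 < x")
   case True
   then have "\<exists>l. (v \<longlongrightarrow> l) (at_left x)" using v x by (simp add: cadlag_on_def)
   then obtain l where "(v \<longlongrightarrow> l) (at_left x)" by blast
   from ev_bound[OF this] obtain e where "e < x" "!!y. e < y ==> y < x ==> \<bar>v y\<bar> < \<bar>l\<bar> + 1"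
    unfolding eventually_at_left_field by blast
   then show ?thesis by (intro exI[of _ "x - e"] conjI exI[of _ "\<bar>l\<bar> + 1"]) (auto intro: less_imp_le)
  next
   case False
   then show ?thesis using x by (intro exI[of _ 1]) auto
  qed
  then obtain d2 C2 where 2: "0 < d2" "!!y. x - d2 < y ==> y < x ==> 0 <= y ==> \<bar>v y\<bar> <= C2" by blast
  have "P a c" if ac: "0 <= a" "a <= x" "x <= c" "c <= R" "c - a < min d1 d2" for a c
   unfolding P_def
  proof (intro exI[of _ "max \<bar>v x\<bar> (max C1 C2)"] allI impI)
   fix r assume r: "a <= r" "r <= c"
   consider "r = x" | "x < r" | "r < x" by linarith
   then show "\<bar>v r\<bar> <= max \<bar>v x\<bar> (max C1 C2)"
   proof cases
    case 2
    then show ?thesis using 1(2)[of r] r ac by simp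
   next
    case 3
    then show ?thesis using 2(2)[of r] r ac by simp
   qed simp
  qed
  then show ?thesis using 1(1) 2(1) by (intro exI[of _ "min d1 d2"]) auto
 qed
 have "0 <= (0 :: real) & R <= R \<longrightarrow> P 0 R"
 proof (rule Bolzano[where P="%a c. 0 <= a & c <= R \<longrightarrow> P a c", OF R])
  fix a b' c assume h: "0 <= a & b' <= R \<longrightarrow> P a b'" "0 <= b' & c <= R \<longrightarrow> P b' c" "a <= b'" "b' <= c"
  show "0 <= a & c <= R \<longrightarrow> P a c"
  proof
   assume "0 <= a & c <= R"
   with h obtain C C' where "!!r. a <= r ==> r <= b' ==> \<bar>v r\<bar> <= C" "!!r. b' <= r ==> r <= c ==> \<bar>v r\<bar> <= C'"
    unfolding P_def by (metis order_trans)
   then have "\<bar>v r\<bar> <= max C C'" if "a <= r" "r <= c" for r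
    using that by (cases "r <= b'") (auto simp: le_max_iff_disj)
   then show "P a c" unfolding P_def by blast
  qed
 next
  fix x assume "0 <= x" "x <= R"
  from loc[OF this] show "\<exists>d>0. \<forall>a c. a <= x & x <= c & c - a < d \<longrightarrow> (0 <= a & c <= R \<longrightarrow> P a c)" by meson
 qed
 then obtain C where C: "!!r. 0 <= r ==> r <= R ==> \<bar>v r\<bar> <= C" unfolding P_def by auto
 show thesis
 proof (rule that[of "max C 0"])
  show "\<bar>v r\<bar> <= max C 0" if "r \<in> {0..R}" for r using C[of r] that by simp
 qed simp
qed

lemma normal_distr_scale:
 assumes \<sigma>: "0 < \<sigma>" and [measurable]: "g \<in> borel_measurable borel"
 shows "distr (density lborel (normal_density 0 \<sigma>)) borel (%y. g (y / \<sigma>)) = distr std_normal_distribution borel g"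
proof -
 let ?N = "density lborel (normal_density 0 \<sigma>)"
 interpret prob_space ?N by (rule prob_space_normal_density[OF \<sigma>])
 have "distr ?N lborel (%x. x) = distr ?N ?N (%x. x)" by (rule distr_cong) auto
 then have "distributed ?N lborel (%x. x) (normal_density 0 \<sigma>)" by (simp add: distributed_def)
 then have "distributed ?N lborel (%x. (x - 0) / \<sigma>) std_normal_density"
  unfolding normal_standard_normal_convert[OF \<sigma>] .
 then have e: "distr ?N lborel (%x. x / \<sigma>) = std_normal_distribution" by (simp add: distributed_def)
 have "distr (distr ?N lborel (%x. x / \<sigma>)) borel g = distr ?N borel (g \<circ> (%x. x / \<sigma>))"
  by (rule distr_distr) simp_all
 then show ?thesis unfolding e by (simp add: comp_def)
qed

text \<open>The constant extension of V is monotone and right-continuous on the whole line, also at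
  R, where V is known only from the left.\<close>

lemma stieltjes_facts:
 assumes V: "mono_on {0..R} V" "\<forall>r\<in>{0..<R}. (V \<longlongrightarrow> V r) (at_right r)" and R: "0 < R"
 shows "sigma_finite_measure (stieltjes R V)" "sets (stieltjes R V) = sets borel"
  "emeasure (stieltjes R V) {0..R} < \<infinity>"
proof -
 define F where "F r = V (max 0 (min R r))" for r
 have mono: "F x <= F y" if "x <= y" for x y
  unfolding F_def by (rule mono_onD[OF V(1)]) (use that R in auto)
 have rc: "continuous (at_right a) F" for a
  unfolding continuous_within
 proof (cases "a < 0")
  case True
  have "eventually (%x. x < 0) (at_right a)" using True by (intro eventually_at_right_less[THEN eventually_mono] eventually_at_rightI[of a 0]) auto
  then have "eventually (%x. F x = F a) (at_right a)"
   by eventually_elim (use True in \<open>auto simp: F_def max_def min_def\<close>)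
  then show "(F \<longlongrightarrow> F a) (at_right a)" by (rule tendsto_eventually)
 next
  case False
  show "(F \<longlongrightarrow> F a) (at_right a)"
  proof (cases "a < R")
   case True
   have "(V \<longlongrightarrow> V a) (at_right a)" using V(2) True False by simp
   moreover have "eventually (%x. V x = F x) (at_right a)"
    using True False by (intro eventually_at_rightI[of a R]) (auto simp: F_def)
   ultimately have "(F \<longlongrightarrow> V a) (at_right a)" by (rule Lim_transform_eventually)
   moreover have "F a = V a" using True False by (simp add: F_def)
   ultimately show ?thesis by simp
  next
   case False
   have "eventually (%x. F x = F a) (at_right a)"
    using False R by (intro eventually_at_rightI[of a "a + 1"]) (auto simp: F_def)
   then show ?thesis by (rule tendsto_eventually)
  qed
 qed
 have st: "stieltjes R V = interval_measure F" by (simp add: stieltjes_def F_def[abs_def])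
 show "sigma_finite_measure (stieltjes R V)" unfolding st by (rule sigma_finite_interval_measure[OF mono rc])
 show s: "sets (stieltjes R V) = sets borel" unfolding st by simp
 \<comment> \<open>The interval measure is computed on half-open intervals, so the left end is moved
   below 0 to include 0.\<close>
 have "emeasure (stieltjes R V) {0..R} <= emeasure (stieltjes R V) {-1<..R}" by (rule emeasure_mono) (auto simp: s)
 also have "... = ennreal (F R - F (- 1))" unfolding st by (rule emeasure_interval_measure_Ioc[OF _ mono rc]) (use R in simp)
 finally show "emeasure (stieltjes R V) {0..R} < \<infinity>" by (simp add: le_less_trans)
qed

context prob_space
begin

text \<open>The common form of both statistics, with g the square or the absolute value: if the
  K-part J is asymptotically q g(Y), then random coefficients with constant limits may be replaced
  by these limits, since g(Y) is tight.\<close>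

lemma statistic_limit:
 assumes Z: "converges_in_distribution M Y L" "real_distribution L" and g: "!!x. isCont g x"
  and gY: "bounded_in_prob M (%n om. g (Y n om))"
  and A: "tends_in_prob M A a" and B: "tends_in_prob M B b"
  and J: "tends_in_prob M (%n om. J n om - q * g (Y n om)) 0" "!!n. J n \<in> borel_measurable M"
 shows "converges_in_distribution M (%n om. A n om * J n om + B n om * g (Y n om)) (distr L borel (%y. (a * q + b) * g y))"
proof (rule converges_in_distribution_slutsky)
 have c: "isCont (%y. (a * q + b) * g y) x" for x by (intro continuous_intros g)
 show "converges_in_distribution M (%n om. (a * q + b) * g (Y n om)) (distr L borel (%y. (a * q + b) * g y))"
  by (rule converges_in_distribution_continuous[OF Z c])
 interpret L: real_distribution L by fact
 have "(%y. (a * q + b) * g y) \<in> borel_measurable borel"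
  by (rule borel_measurable_continuous_onI) (use c in \<open>simp add: continuous_at_imp_continuous_on\<close>)
 then have m: "(%y. (a * q + b) * g y) \<in> borel_measurable L"
  using measurable_cong_sets[OF L.events_eq_borel refl] by blast
 show "real_distribution (distr L borel (%y. (a * q + b) * g y))"
  by (rule L.real_distribution_distr[OF m])
 have [measurable]: "!!n. A n \<in> borel_measurable M" "!!n. B n \<in> borel_measurable M"
   "!!n. (%om. g (Y n om)) \<in> borel_measurable M" "!!n. J n \<in> borel_measurable M"
  using A B gY J(2) by (auto simp: tends_in_prob_def bounded_in_prob_def)
 show "(%om. A n om * J n om + B n om * g (Y n om)) \<in> borel_measurable M" for n by measurable
 have "tends_in_prob M (%n om. A n om - a) (a - a)" "tends_in_prob M (%n om. B n om - b) (b - b)"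
  by (intro tends_in_prob_diff A B tends_in_prob_const)+
 then have AB: "tends_in_prob M (%n om. A n om - a) 0" "tends_in_prob M (%n om. B n om - b) 0" by simp_all
 have "tends_in_prob M (%n om. A n om * (J n om - q * g (Y n om)) + q * ((A n om - a) * g (Y n om)) + (B n om - b) * g (Y n om)) (a * 0 + q * 0 + 0)"
  by (intro tends_in_prob_add tends_in_prob_mult A J(1) tends_in_prob_const tends_in_prob_mult_bounded AB gY)
 then show "tends_in_prob M (%n om. A n om * J n om + B n om * g (Y n om) - (a * q + b) * g (Y n om)) 0"
  by (simp add: algebra_simps)
qed

end

section \<open>Dependence on the radius: right continuity and joint measurability\<close>

context gauge_body
begin

text \<open>All pairs of a point and a radius whose dilation contains it, as a continuous image of a
  compact set. Its closedness gives both right continuity in the radius and joint Borel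
  measurability.\<close>

definition gauge_cone :: "real => ('a \<times> real) set" where
 "gauge_cone rh = (%(y, t). (t *\<^sub>R y, t)) ` (B \<times> {0..rh})"

lemma gauge_cone_iff: "(z, t) \<in> gauge_cone rh \<longleftrightarrow> t \<in> {0..rh} & z \<in> scaled t B"
 by (auto simp: gauge_cone_def)

lemma closed_gauge_cone: "closed (gauge_cone rh)"
proof -
 have "compact (gauge_cone rh)" unfolding gauge_cone_def split_def
  by (intro compact_continuous_image continuous_intros compact_Times compactB compact_Icc)
 then show ?thesis by (rule compact_imp_closed)
qed

text \<open>A point of the dilation stays in all larger ones; a point outside stays outside for
  slightly larger radii because the cone is closed. The bound t + 1 merely leaves room to the right
  of t.\<close>

lemma indicator_scaled_right_limit:
 assumes t: "0 <= t"
 shows "((%s. indicator (scaled s B) z :: real) \<longlongrightarrow> indicator (scaled t B) z) (at_right t)"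
proof (rule tendsto_eventually)
 show "eventually (%s. indicator (scaled s B) z = (indicator (scaled t B) z :: real)) (at_right t)"
 proof (cases "z \<in> scaled t B")
  case True
  have "z \<in> scaled s B" if "t < s" for s using scaled_mono[of t s] t that True by auto
  then show ?thesis using True by (intro eventually_at_rightI[of t "t + 1"]) (auto simp: indicator_def)
 next
  case False
  have "open ((%s. (z, s)) -` (- gauge_cone (t + 1)))"
   by (intro open_vimage continuous_intros) (simp add: closed_gauge_cone open_Compl)
  moreover have "t \<in> (%s. (z, s)) -` (- gauge_cone (t + 1))" using False by (simp add: gauge_cone_iff)
  ultimately have "eventually (%s. s \<in> (%s. (z, s)) -` (- gauge_cone (t + 1))) (at_right t)"
   by (rule topological_tendstoD[OF tendsto_ident_at])
  moreover have "eventually (%s. s \<in> {t<..<t + 1}) (at_right t)" by (rule eventually_at_right_real) simp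
  ultimately show ?thesis
   by eventually_elim (use t False in \<open>auto simp: gauge_cone_iff indicator_def\<close>)
 qed
qed

end

context B4_process
begin

lemma alpha2_red_Diff:
 assumes A: "A \<in> sets borel" "A \<subseteq> A'" "A' \<in> sets borel" "bounded A'"
 shows "alpha2_red M N (A' - A) = alpha2_red M N A' - alpha2_red M N A"
proof -
 let ?mu = "alpha_red M N 2"
 have s2: "sets ?mu = sets (red_borel 2)" using alpha_red_is_reduced_moment by (simp add: is_reduced_moment_def)
 have rs: "rect 2 (%_. S) \<in> sets ?mu" if "S \<in> sets borel" for S unfolding s2 by (rule sets_PiM_I_finite) (use that in auto)
 obtain r where r: "A' \<subseteq> cball 0 r" using bounded_subset_ballD[OF A(4), of 0] by (meson ball_subset_cball order_trans)
 have in_rect: "h \<in> rect 2 (%_. S) \<longleftrightarrow> h \<in> space ?mu & h 1 \<in> S" for h :: "nat => 'a" and S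
  unfolding space_red[OF s2] PiE_iff ball_red by blast
 have sub: "rect 2 (%_. A') \<subseteq> {h \<in> space ?mu. h 1 \<in> cball 0 r}"
  unfolding subset_iff in_rect using r by blast
 have cb: "{h \<in> space ?mu. h 1 \<in> cball 0 r} \<in> sets ?mu"
 proof -
  have "{h \<in> space ?mu. h 1 \<in> cball 0 r} = rect 2 (%_. cball 0 r)"
   unfolding set_eq_iff in_rect by simp
  then show ?thesis using rs[of "cball 0 r"] by simp
 qed
 have fin: "emeasure ?mu (rect 2 (%_. A')) ~= \<infinity>"
  using emeasure_mono[OF sub cb] alpha_lag_finite[of r] by (auto simp: top_unique)
 have eq: "rect 2 (%_. A' - A) = rect 2 (%_. A') - rect 2 (%_. A)"
  unfolding set_eq_iff Diff_iff in_rect by blast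
 have "rect 2 (%_. A) \<subseteq> rect 2 (%_. A')" using A(2) by (intro PiE_mono)
 from measure_Diff[OF fin rs[OF A(3)] rs[OF A(1)] this] show ?thesis unfolding alpha2_red_def eq .
qed

end

context K_sequence
begin

abbreviation "al t \<equiv> alpha2_red M N (scaled t B)"

lemma alpha_increment:
 assumes st: "0 <= s" "s <= t"
 shows "al s <= al t" "al t - al s <= a0 * vol B * (t ^ DIM('a) - s ^ DIM('a))"
proof -
 have d: "al t - al s = alpha2_red M N (scaled t B - scaled s B)"
  by (rule alpha2_red_Diff[symmetric, OF scaled_borel scaled_mono[OF st] scaled_borel bounded_scaled])
 have "0 <= alpha2_red M N (scaled t B - scaled s B)" by (simp add: alpha2_red_def)
 then show "al s <= al t" using d by linarith
 have "alpha2_red M N (scaled t B - scaled s B) <= a0 * vol (scaled t B - scaled s B)"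
  using scaled_borel bounded_subset[OF bounded_scaled Diff_subset] by (intro a0(2) sets.Diff) auto
 then show "al t - al s <= a0 * vol B * (t ^ DIM('a) - s ^ DIM('a))"
  unfolding d vol_annulus[OF st] by (simp add: mult_ac)
qed

text \<open>The bound on \<open>alpha2_red\<close> controls increments by those of t^d. Clipping at
  0 extends the function to the whole line, where continuity yields Borel measurability.\<close>

lemma alpha_continuous: "isCont (%t. al (max 0 t)) t"
proof -
 have le: "\<bar>al (max 0 s) - al (max 0 t)\<bar> <= a0 * vol B * \<bar>max 0 s ^ DIM('a) - max 0 t ^ DIM('a)\<bar>" for s t
 proof -
  have 1: "\<bar>al s - al t\<bar> <= a0 * vol B * \<bar>s ^ DIM('a) - t ^ DIM('a)\<bar>" if "0 <= t" "t <= s" for s t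
   using alpha_increment[OF that] power_mono[OF that(2,1), of "DIM('a)"] by simp
  show ?thesis
  proof (cases "max 0 t <= max 0 s")
   case True
   from 1[OF max.cobounded1 this] show ?thesis .
  next
   case False
   then have "max 0 s <= max 0 t" by linarith
   from 1[OF max.cobounded1 this] show ?thesis
    unfolding abs_minus_commute[of "al (max 0 t)"] abs_minus_commute[of "max 0 t ^ DIM('a)"] .
  qed
 qed
 have "((%s. a0 * vol B * \<bar>max 0 s ^ DIM('a) - max 0 t ^ DIM('a)\<bar>) \<longlongrightarrow> a0 * vol B * \<bar>max 0 t ^ DIM('a) - max 0 t ^ DIM('a)\<bar>) (at t)"
  by (intro tendsto_intros)
 then have lim: "((%s. a0 * vol B * \<bar>max 0 s ^ DIM('a) - max 0 t ^ DIM('a)\<bar>) \<longlongrightarrow> 0) (at t)" by simp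
 have "((%s. al (max 0 s) - al (max 0 t)) \<longlongrightarrow> 0) (at t)"
  by (rule Lim_null_comparison[OF _ lim], rule always_eventually, rule allI, unfold real_norm_def, rule le)
 then show ?thesis unfolding isCont_def by (rule LIM_zero_cancel)
qed

abbreviation "c n \<equiv> win_scale (W n) powr \<alpha>"

definition "T n om t = edge_corrected_sum (W n) (N om) (indicator (scaled t B))"

lemma Delta_eq: "0 <= r ==> Delta M N B \<alpha> (W n) om r = vol (W n) powr (1 / 2 - \<alpha>) * (T n om (c n * r) - lam * al (max 0 (c n * r)))"
proof -
 assume r: "0 <= r"
 have "lam\<^sup>2 * K_fun M N B (c n * r) = lam * al (c n * r)" using intensity_pos by (simp add: K_fun_def power2_eq_square)
 moreover have "max 0 (c n * r) = c n * r" using r by simp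
 ultimately show ?thesis unfolding Delta_def lambda2K_hat_def T_def by (simp only:)
qed

lemma Delta_measurable: "0 <= r ==> (%om. Delta M N B \<alpha> (W n) om r) \<in> borel_measurable M"
proof -
 have "(indicator (scaled t B) :: 'a => real) \<in> borel_measurable borel" for t using scaled_borel[of t] by simp
 from edge_sum_measurable[OF window this] show "0 <= r ==> ?thesis" unfolding Delta_eq T_def by simp
qed

text \<open>Needed to replace the supremum over an interval by one over a countable set.\<close>

lemma Delta_right_limit:
 assumes r: "0 <= r" shows "((%s. Delta M N B \<alpha> (W n) om s) \<longlongrightarrow> Delta M N B \<alpha> (W n) om r) (at_right r)"
proof (cases "c n = 0")
 \<comment> \<open>A window of volume 0 has scale 0, so \<open>Delta\<close> does not depend on the
   radius at all.\<close>
 case True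
 then have e: "Delta M N B \<alpha> (W n) om s = Delta M N B \<alpha> (W n) om r" for s by (simp add: Delta_def)
 show ?thesis by (rule tendsto_eventually, rule always_eventually, rule allI, rule e)
next
 case False
 then have c0: "0 < c n" by (simp add: less_le)
 have fl: "filterlim (%s. c n * s) (at_right (c n * r)) (at_right r)"
 proof (rule tendsto_imp_filterlim_at_right)
  show "((%s. c n * s) \<longlongrightarrow> c n * r) (at_right r)" by (intro tendsto_intros)
  have "eventually (%s. r < s) (at_right r)" by (rule eventually_at_right_less)
  then show "eventually (%s. c n * r < c n * s) (at_right r)"
   by eventually_elim (use c0 in auto)
 qed
 have "((%t. T n om t) \<longlongrightarrow> T n om (c n * r)) (at_right (c n * r))"
  unfolding T_def edge_corrected_sum_eq[OF window(1)] divide_inverse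
  by (intro tendsto_sum tendsto_mult indicator_scaled_right_limit tendsto_const) (use r in simp)
 then have T: "((%s. T n om (c n * s)) \<longlongrightarrow> T n om (c n * r)) (at_right r)" by (rule filterlim_compose[OF _ fl])
 have "((%s. c n * s) \<longlongrightarrow> c n * r) (at_right r)" by (intro tendsto_intros)
 from isCont_tendsto_compose[OF alpha_continuous this]
 have a: "((%s. al (max 0 (c n * s))) \<longlongrightarrow> al (max 0 (c n * r))) (at_right r)" .
 have "((%s. vol (W n) powr (1 / 2 - \<alpha>) * (T n om (c n * s) - lam * al (max 0 (c n * s))))
   \<longlongrightarrow> Delta M N B \<alpha> (W n) om r) (at_right r)"
  unfolding Delta_eq[OF r] by (intro tendsto_intros T a)
 moreover have "eventually (%s. r < s) (at_right r)" by (rule eventually_at_right_less)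
 then have "eventually (%s. vol (W n) powr (1 / 2 - \<alpha>) * (T n om (c n * s) - lam * al (max 0 (c n * s))) = Delta M N B \<alpha> (W n) om s) (at_right r)"
  by eventually_elim (use r in \<open>simp add: Delta_eq\<close>)
 ultimately show ?thesis by (rule Lim_transform_eventually)
qed

text \<open>The indicator of the dilation is rewritten as an indicator of the cone in the lag and
  the radius together, so the pair count becomes a parametrised sum over a random finite
  set.\<close>

lemma Delta_joint_measurable:
 "(%(om, r). indicator {0..R} r * Delta M N B \<alpha> (W n) om r) \<in> borel_measurable (M \<Otimes>\<^sub>M borel)"
proof -
 define E where "E = gauge_cone (c n * R)"
 define F where "F p r = (indicator E (snd p - fst p, c n * r) / overlap (W n) (snd p - fst p) :: real)" for p r
 have E: "E \<in> sets borel" using closed_gauge_cone by (simp add: E_def)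
 have d: "(%q :: ('a \<times> 'a) \<times> real. (snd (fst q) - fst (fst q), c n * snd q)) \<in> borel_measurable borel"
  by (intro borel_cont)
 have o: "(%q :: ('a \<times> 'a) \<times> real. snd (fst q) - fst (fst q)) \<in> borel_measurable borel"
  by (intro borel_cont)
 have "(indicator E :: _ => real) \<in> borel_measurable borel" using E by simp
 from borel_measurable_divide[OF measurable_compose[OF d this] measurable_compose[OF o overlap_borel[OF window]]]
 have Fm: "(%(p, r). F p r) \<in> borel_measurable borel" by (simp add: F_def split_def)
 have S: "(%(om, r). \<Sum>p\<in>tuples2 (N om Int W n). F p r) \<in> borel_measurable (M \<Otimes>\<^sub>M borel)"
  by (rule random_finite_sum_param[OF random_finite_tuples2[OF window] Fm])
 have am: "(%t. al (max 0 t)) \<in> borel_measurable borel"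
  by (rule borel_measurable_continuous_onI) (simp add: continuous_at_imp_continuous_on alpha_continuous)
 have e: "indicator {0..R} r * Delta M N B \<alpha> (W n) om r = indicator {0..R} r *
   (vol (W n) powr (1 / 2 - \<alpha>) * ((\<Sum>p\<in>tuples2 (N om Int W n). F p r) - lam * al (max 0 (c n * r))))" for om r
 proof (cases "r \<in> {0..R}")
  case True
  then have r: "0 <= r" "r <= R" by auto
  have "c n * r \<in> {0..c n * R}" using r by (auto intro: mult_left_mono)
  then have "indicator E (z, c n * r) = (indicator (scaled (c n * r) B) z :: real)" for z
   by (simp add: E_def gauge_cone_iff indicator_def)
  then show ?thesis unfolding Delta_eq[OF r(1)] T_def edge_corrected_sum_eq[OF window(1)] F_def by simp
 qed simp
 have S': "(%x. \<Sum>p\<in>tuples2 (N (fst x) Int W n). F p (snd x)) \<in> borel_measurable (M \<Otimes>\<^sub>M borel)"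
  using S by (simp add: split_def)
 have "(%r. al (max 0 (c n * r))) \<in> borel_measurable borel" by (rule measurable_compose[OF _ am]) simp
 then have a: "(%x. al (max 0 (c n * snd x))) \<in> borel_measurable (M \<Otimes>\<^sub>M borel)"
  by (rule measurable_compose[OF measurable_snd])
 have i: "(%x. indicator {0..R} (snd x) :: real) \<in> borel_measurable (M \<Otimes>\<^sub>M borel)" by measurable
 show ?thesis unfolding e split_def
  by (intro borel_measurable_times borel_measurable_diff S' a i borel_measurable_const)
qed

section \<open>The integral statistic and the supremum statistic\<close>

definition "L2 V n om = (LINT r:{0..R}|stieltjes R V. (Delta M N B \<alpha> (W n) om r)\<^sup>2)"
definition "Sup_stat v n om = (SUP r\<in>{0..R}. \<bar>Delta M N B \<alpha> (W n) om r * v r\<bar>)"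

lemma L2_eq: "L2 V n om = (LINT r|stieltjes R V. (indicator {0..R} r * Delta M N B \<alpha> (W n) om r)\<^sup>2)"
 unfolding L2_def set_lebesgue_integral_def
 by (rule bochner_integral_cong) (auto simp: indicator_def)

lemma L2_measurable:
 assumes V: "mono_on {0..R} V" "\<forall>r\<in>{0..<R}. (V \<longlongrightarrow> V r) (at_right r)" and R0: "0 < R"
 shows "L2 V n \<in> borel_measurable M"
proof -
 note st = stieltjes_facts[OF V R0]
 interpret sigma_finite_measure "stieltjes R V" by (rule st(1))
 have "(%(om, r). (indicator {0..R} r * Delta M N B \<alpha> (W n) om r)\<^sup>2) \<in> borel_measurable (M \<Otimes>\<^sub>M borel)"
  using borel_measurable_power[OF Delta_joint_measurable] by (simp add: split_def)
 then have "(%(om, r). (indicator {0..R} r * Delta M N B \<alpha> (W n) om r)\<^sup>2) \<in> borel_measurable (M \<Otimes>\<^sub>M stieltjes R V)"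
  using measurable_cong_sets[OF sets_pair_measure_cong[OF refl st(2)] refl] by blast
 then show ?thesis unfolding L2_eq[abs_def] by (rule borel_measurable_lebesgue_integral)
qed

lemma Delta_bounded: "\<exists>C. \<forall>r\<in>{0..R}. \<bar>Delta M N B \<alpha> (W n) om r\<bar> <= C"
proof -
 define P where "P = vol (W n) powr (1 / 2 - \<alpha>)"
 have "\<bar>Delta M N B \<alpha> (W n) om r\<bar> <= P * (T n om (c n * R) + lam * al (c n * R))" if r: "r \<in> {0..R}" for r
 proof -
  have cr: "0 <= c n * r" "c n * r <= c n * R" using r by (auto intro: mult_left_mono)
  have pos: "0 <= T n om t" for t
   unfolding T_def edge_corrected_sum_eq[OF window(1)] by (intro sum_nonneg divide_nonneg_nonneg) (auto simp: overlap_def)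
  have Tm: "T n om (c n * r) <= T n om (c n * R)"
   unfolding T_def edge_corrected_sum_eq[OF window(1)] using scaled_mono[OF cr]
   by (intro sum_mono divide_right_mono) (auto simp: overlap_def indicator_def)
  have am: "lam * al (c n * r) <= lam * al (c n * R)" "0 <= lam * al (c n * r)"
   using alpha_increment(1)[OF cr] intensity_pos by (simp_all add: alpha2_red_def)
  have "\<bar>T n om (c n * r) - lam * al (c n * r)\<bar> <= T n om (c n * R) + lam * al (c n * R)"
   using pos[of "c n * r"] Tm am by linarith
  then have "P * \<bar>T n om (c n * r) - lam * al (c n * r)\<bar> <= P * (T n om (c n * R) + lam * al (c n * R))"
   by (rule mult_left_mono) (simp add: P_def)
  moreover have "max 0 (c n * r) = c n * r" using cr(1) by simp
  ultimately show ?thesis using r unfolding P_def by (simp add: Delta_eq abs_mult)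
 qed
 then show ?thesis by blast
qed

text \<open>With Delta = z + e, where z is the uniform error and e the linear part, the squares
  differ by z^2 + 2 z e; integrating the uniform bound of this costs the Stieltjes mass of
  [0, R].\<close>

lemma L2_approx:
 assumes V: "mono_on {0..R} V" "\<forall>r\<in>{0..<R}. (V \<longlongrightarrow> V r) (at_right r)" and R0: "0 < R"
  and U: "!!r. r \<in> {0..R} ==> \<bar>Z n om r\<bar> <= U" and om: "om \<in> space M"
 shows "\<bar>L2 V n om - (2 * lam * vol B)^2 * (LINT r:{0..R}|stieltjes R V. r ^ (2 * DIM('a))) * (Y n om)\<^sup>2\<bar>
   <= measure (stieltjes R V) {0..R} * (U\<^sup>2 + 2 * (2 * lam * vol B * R ^ DIM('a)) * (U * \<bar>Y n om\<bar>))"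
proof -
 note st = stieltjes_facts[OF V R0]
 let ?\<nu> = "stieltjes R V"
 define p where "p = 2 * lam * vol B"
 have p: "0 <= p" using intensity_pos by (simp add: p_def)
 define y where "y = Y n om"
 let ?D = "%r. Delta M N B \<alpha> (W n) om r"
 define f where "f r = (indicator {0..R} r * ?D r)\<^sup>2" for r
 define g where "g r = (indicator {0..R} r * (p * r ^ DIM('a) * y))\<^sup>2" for r :: real
 have U0: "0 <= U" using U[of 0] R0 by force
 have iI: "integrable ?\<nu> (%r. c * indicator {0..R} r :: real)" for c
  using st(2,3) by (intro integrable_mult_right) (simp add: integrable_indicator_iff)
 have fm: "f \<in> borel_measurable ?\<nu>"
 proof -
  have "(%r. indicator {0..R} r * ?D r) \<in> borel_measurable borel"
   using measurable_Pair2[OF Delta_joint_measurable om] by simp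
  then show ?thesis unfolding f_def[abs_def] measurable_cong_sets[OF st(2) refl] by simp
 qed
 have gm: "g \<in> borel_measurable ?\<nu>" unfolding g_def[abs_def] measurable_cong_sets[OF st(2) refl] by measurable
 obtain C where C: "!!r. r \<in> {0..R} ==> \<bar>?D r\<bar> <= C" using Delta_bounded by blast
 have fi: "integrable ?\<nu> f"
 proof (rule bochner_integrable_bound[OF iI[of "C\<^sup>2"] fm], rule AE_I2)
  show "norm (f r) <= norm (C\<^sup>2 * indicator {0..R} r)" for r
  proof (cases "r \<in> {0..R}")
   case True
   have "(?D r)\<^sup>2 <= C\<^sup>2" using C[OF True] by (rule power2_le_iff_abs_le[THEN iffD2, rotated]) (use C[OF True] in linarith)
   then show ?thesis using True by (simp add: f_def)
  qed (simp add: f_def)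
 qed
 have gb: "\<bar>p * r ^ DIM('a) * y\<bar> <= p * R ^ DIM('a) * \<bar>y\<bar>" if "r \<in> {0..R}" for r
  using that p by (simp add: abs_mult mult_right_mono mult_left_mono power_mono)
 have gi: "integrable ?\<nu> g"
 proof (rule bochner_integrable_bound[OF iI[of "(p * R ^ DIM('a) * \<bar>y\<bar>)\<^sup>2"] gm], rule AE_I2)
  show "norm (g r) <= norm ((p * R ^ DIM('a) * \<bar>y\<bar>)\<^sup>2 * indicator {0..R} r)" for r
  proof (cases "r \<in> {0..R}")
   case True
   have "\<bar>p * r ^ DIM('a) * y\<bar>\<^sup>2 <= (p * R ^ DIM('a) * \<bar>y\<bar>)\<^sup>2" by (rule power_mono[OF gb[OF True]]) simp
   then show ?thesis using True by (simp only: power2_abs) (simp add: g_def)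
  qed (simp add: g_def)
 qed
 have ig: "integral\<^sup>L ?\<nu> g = p\<^sup>2 * (LINT r:{0..R}|?\<nu>. r ^ (2 * DIM('a))) * y\<^sup>2"
 proof -
  have "g = (%r. p\<^sup>2 * y^2 * (indicator {0..R} r *\<^sub>R r ^ (2 * DIM('a))))"
   by (rule ext) (simp add: g_def indicator_def power_mult_distrib mult.commute[of 2] power_mult)
  then show ?thesis unfolding set_lebesgue_integral_def by (simp only: integral_mult_right_zero mult_ac)
 qed
 define q where "q = U\<^sup>2 + 2 * (p * R ^ DIM('a)) * (U * \<bar>y\<bar>)"
 have diff: "\<bar>f r - g r\<bar> <= q * indicator {0..R} r" for r
 proof (cases "r \<in> {0..R}")
  case True
  define z where "z = Z n om r"
  define e where "e = p * r ^ DIM('a) * y"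
  have D: "?D r = z + e" by (simp add: z_def Z_def e_def p_def y_def)
  have z: "\<bar>z\<bar> <= U" unfolding z_def by (rule U[OF True])
  have e: "\<bar>e\<bar> <= p * R ^ DIM('a) * \<bar>y\<bar>" unfolding e_def by (rule gb[OF True])
  have "f r = (z + e)\<^sup>2" "g r = e\<^sup>2" using True by (simp_all add: f_def D) (simp_all add: g_def e_def)
  then have "\<bar>f r - g r\<bar> = \<bar>z * z + 2 * (z * e)\<bar>" by (simp add: power2_eq_square algebra_simps)
  also have "... <= \<bar>z * z\<bar> + \<bar>2 * (z * e)\<bar>" by (rule abs_triangle_ineq)
  also have "... <= U * U + 2 * (U * (p * R ^ DIM('a) * \<bar>y\<bar>))"
   unfolding abs_mult using z e U0 by (intro add_mono mult_mono) auto
  also have "... = q" by (simp add: q_def power2_eq_square)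
  finally show ?thesis using True by simp
 qed (simp add: f_def g_def)
 have "\<bar>integral\<^sup>L ?\<nu> f - integral\<^sup>L ?\<nu> g\<bar> = \<bar>\<integral>r. f r - g r \<partial>?\<nu>\<bar>" using fi gi by simp
 also have "... <= (\<integral>r. \<bar>f r - g r\<bar> \<partial>?\<nu>)" by (rule integral_abs_bound)
 also have "... <= (\<integral>r. q * indicator {0..R} r \<partial>?\<nu>)"
  by (rule integral_mono) (use fi gi iI diff in auto)
 also have "... = measure ?\<nu> {0..R} * q" using st(2) by (simp add: sets_eq_imp_space_eq[OF st(2)])
 finally show ?thesis unfolding ig f_def L2_eq[symmetric] q_def p_def y_def .
qed

lemma L2_limit:
 assumes V: "mono_on {0..R} V" "\<forall>r\<in>{0..<R}. (V \<longlongrightarrow> V r) (at_right r)" and R0: "0 < R"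
 shows "tends_in_prob M (%n om. L2 V n om - (2 * lam * vol B)^2 * (LINT r:{0..R}|stieltjes R V. r ^ (2 * DIM('a))) * (Y n om)\<^sup>2) 0"
proof -
 obtain U where U: "tends_in_prob M U 0" "!!n om. 0 <= U n om"
  "eventually (%n. \<forall>om. \<forall>r\<in>{0..R}. \<bar>Z n om r\<bar> <= U n om) sequentially"
  using sup_Z_limit by blast
 let ?m = "measure (stieltjes R V) {0..R}" and ?p = "2 * (2 * lam * vol B * R ^ DIM('a))"
 have "tends_in_prob M (%n om. ?m * (U n om * U n om + ?p * (U n om * \<bar>Y n om\<bar>))) (?m * (0 * 0 + ?p * 0))"
  by (intro tends_in_prob_cmult tends_in_prob_add tends_in_prob_mult U(1) tends_in_prob_mult_bounded bounded_in_prob_abs Y_bounded)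
 then have lim: "tends_in_prob M (%n om. ?m * ((U n om)\<^sup>2 + ?p * (U n om * \<bar>Y n om\<bar>))) 0" by (simp add: power2_eq_square)
 show ?thesis
 proof (rule tends_in_prob_sup_le[OF _ lim])
  show "(%om. L2 V n om - (2 * lam * vol B)^2 * (LINT r:{0..R}|stieltjes R V. r ^ (2 * DIM('a))) * (Y n om)\<^sup>2) \<in> borel_measurable M" for n
   using L2_measurable[OF V R0] by simp
  show "eventually (%n. \<forall>om\<in>space M. \<bar>L2 V n om - (2 * lam * vol B)^2 * (LINT r:{0..R}|stieltjes R V. r ^ (2 * DIM('a))) * (Y n om)^2 - 0\<bar>
    <= ?m * ((U n om)\<^sup>2 + ?p * (U n om * \<bar>Y n om\<bar>))) sequentially"
   using U(3)
  proof eventually_elim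
   case (elim n)
   show ?case unfolding diff_0_right by (intro ballI L2_approx[OF V R0]) (use elim in auto)
  qed
 qed
qed

context
 fixes v :: "real => real"
 assumes v: "cadlag_on R v"
begin

lemma weighted_bdd: "bdd_above ((%r. \<bar>Delta M N B \<alpha> (W n) om r * v r\<bar>) ` {0..R})"
proof -
 obtain C where C: "!!r. r \<in> {0..R} ==> \<bar>Delta M N B \<alpha> (W n) om r\<bar> <= C" using Delta_bounded by blast
 obtain D where D: "0 <= D" "!!r. r \<in> {0..R} ==> \<bar>v r\<bar> <= D" using cadlag_bounded[OF v R] by blast
 have "\<bar>Delta M N B \<alpha> (W n) om r * v r\<bar> <= C * D" if r: "r \<in> {0..R}" for r
  unfolding abs_mult using C[OF r] D(2)[OF r] by (intro mult_mono) auto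
 then show ?thesis by (intro bdd_aboveI2)
qed

text \<open>Right continuity of both \<open>Delta\<close> and v lets rational radii determine the
  supremum.\<close>

lemma Sup_stat_measurable: "Sup_stat v n \<in> borel_measurable M"
proof -
 \<comment> \<open>The endpoint R is added since it cannot be approached from the right within the
   interval.\<close>
 define D where "D = ({0..R} Int \<rat>) Un {R}"
 let ?F = "%r om. \<bar>Delta M N B \<alpha> (W n) om r * v r\<bar>"
 have D: "countable D" "D \<subseteq> {0..R}" "R \<in> D"
  using R countable_rat by (auto simp: D_def intro: countable_subset)
 have bD: "bdd_above ((%r. ?F r om) ` D)" for om using weighted_bdd D(2) by (rule bdd_above_mono[OF _ image_mono])
 have eq: "Sup_stat v n om = (SUP r\<in>D. ?F r om)" for om
 proof (rule antisym)
  show "(SUP r\<in>D. ?F r om) <= Sup_stat v n om"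
   unfolding Sup_stat_def by (rule cSUP_subset_mono[OF _ weighted_bdd D(2)]) (use D(3) in auto)
  show "Sup_stat v n om <= (SUP r\<in>D. ?F r om)"
   unfolding Sup_stat_def
  proof (rule cSUP_least)
   fix r assume r: "r \<in> {0..R}"
   show "?F r om <= (SUP r\<in>D. ?F r om)"
   proof (cases "r = R")
    case True
    then show ?thesis using cSUP_upper[OF D(3) bD] by simp
   next
    case False
    with r have r': "0 <= r" "r < R" by auto
    have "(v \<longlongrightarrow> v r) (at_right r)" using v r' by (simp add: cadlag_on_def)
    then have lim: "((%s. ?F s om) \<longlongrightarrow> ?F r om) (at_right r)"
     by (intro tendsto_intros Delta_right_limit r')
    show ?thesis
    proof (rule ccontr)
     assume "\<not> ?thesis"
     then have "eventually (%s. (SUP r\<in>D. ?F r om) < ?F s om) (at_right r)"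
      by (intro order_tendstoD(1)[OF lim]) simp
     then obtain e where e: "r < e" "!!s. r < s ==> s < e ==> (SUP r\<in>D. ?F r om) < ?F s om"
      unfolding eventually_at_right_field by blast
     obtain s where s: "s \<in> \<rat>" "r < s" "s < min e R" using Rats_dense_in_real[of r "min e R"] e(1) r' by auto
     then have "s \<in> D" using r' by (simp add: D_def)
     from cSUP_upper[OF this bD, of om] e(2)[of s] s show False by simp
    qed
   qed
  qed (use R in simp)
 qed
 have m: "(%om. ?F r om) \<in> borel_measurable M" if "r \<in> D" for r
  using Delta_measurable[of r n] that D(2) by auto
 show ?thesis unfolding eq[abs_def] by (rule borel_measurable_cSUP[OF D(1) m bD])
qed

text \<open>The two weighted functions differ by at most D U at every radius, hence so do their
  suprema; the factor p, constant in r, is pulled out of the second one.\<close>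

lemma Sup_stat_approx:
 assumes U: "!!r. r \<in> {0..R} ==> \<bar>Z n om r\<bar> <= U" and D: "0 <= D" "!!r. r \<in> {0..R} ==> \<bar>v r\<bar> <= D"
 shows "\<bar>Sup_stat v n om - 2 * lam * vol B * (SUP r\<in>{0..R}. \<bar>r ^ DIM('a) * v r\<bar>) * \<bar>Y n om\<bar>\<bar> <= D * U"
proof -
 define p where "p = 2 * lam * vol B * \<bar>Y n om\<bar>"
 have p: "0 <= p" using intensity_pos by (simp add: p_def)
 define s where "s = (SUP r\<in>{0..R}. \<bar>r ^ DIM('a) * v r\<bar>)"
 have ne: "{0..R} ~= {}" using R by simp
 have U0: "0 <= U" using U[of 0] R by force
 have bs: "bdd_above ((%r. \<bar>r ^ DIM('a) * v r\<bar>) ` {0..R})"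
 proof (rule bdd_aboveI2)
  show "\<bar>r ^ DIM('a) * v r\<bar> <= R ^ DIM('a) * D" if "r \<in> {0..R}" for r
   unfolding abs_mult using that D by (intro mult_mono) (auto simp: power_mono)
 qed
 have near: "\<bar>\<bar>Delta M N B \<alpha> (W n) om r * v r\<bar> - p * \<bar>r ^ DIM('a) * v r\<bar>\<bar> <= D * U" if r: "r \<in> {0..R}" for r
 proof -
  have "\<bar>2 * lam * vol B * r ^ DIM('a) * Y n om * v r\<bar> = p * \<bar>r ^ DIM('a) * v r\<bar>"
   using intensity_pos by (simp add: p_def abs_mult)
  moreover have "Delta M N B \<alpha> (W n) om r * v r - 2 * lam * vol B * r ^ DIM('a) * Y n om * v r = Z n om r * v r"
   by (simp add: Z_def algebra_simps)
  moreover have "\<bar>Z n om r * v r\<bar> <= U * D" unfolding abs_mult using U[OF r] D(2)[OF r] by (intro mult_mono) auto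
  ultimately show ?thesis
   using abs_triangle_ineq3[of "Delta M N B \<alpha> (W n) om r * v r" "2 * lam * vol B * r ^ DIM('a) * Y n om * v r"]
   by (simp add: mult.commute)
 qed
 have "Sup_stat v n om <= p * s + D * U"
  unfolding Sup_stat_def
 proof (rule cSUP_least[OF ne])
  fix r assume r: "r \<in> {0..R}"
  have "\<bar>r ^ DIM('a) * v r\<bar> <= s" unfolding s_def by (rule cSUP_upper[OF r bs])
  then have "p * \<bar>r ^ DIM('a) * v r\<bar> <= p * s" by (rule mult_left_mono[OF _ p])
  then show "\<bar>Delta M N B \<alpha> (W n) om r * v r\<bar> <= p * s + D * U" using near[OF r] by linarith
 qed
 moreover have "p * s <= Sup_stat v n om + D * U"
 \<comment> \<open>Pulling p out of the supremum divides by it, so p = 0 is settled by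
   nonnegativity.\<close>
 proof (cases "p = 0")
  case True
  have "\<bar>Delta M N B \<alpha> (W n) om R * v R\<bar> <= Sup_stat v n om"
   unfolding Sup_stat_def by (rule cSUP_upper[OF _ weighted_bdd]) (use R in simp)
  then have "0 <= Sup_stat v n om" by linarith
  moreover have "0 <= D * U" using D(1) U0 by simp
  ultimately show ?thesis using True by simp
 next
  case False
  with p have p: "0 < p" by simp
  have "s <= (Sup_stat v n om + D * U) / p"
   unfolding s_def
  proof (rule cSUP_least[OF ne])
   fix r assume r: "r \<in> {0..R}"
   have "\<bar>Delta M N B \<alpha> (W n) om r * v r\<bar> <= Sup_stat v n om"
    unfolding Sup_stat_def by (rule cSUP_upper[OF r weighted_bdd])
   then have "p * \<bar>r ^ DIM('a) * v r\<bar> <= Sup_stat v n om + D * U" using near[OF r] by linarith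
   then show "\<bar>r ^ DIM('a) * v r\<bar> <= (Sup_stat v n om + D * U) / p" using p by (simp add: le_divide_eq mult.commute)
  qed
  then show ?thesis using p by (simp add: le_divide_eq mult.commute)
 qed
 moreover have "2 * lam * vol B * (SUP r\<in>{0..R}. \<bar>r ^ DIM('a) * v r\<bar>) * \<bar>Y n om\<bar> = p * s"
  by (simp add: p_def s_def)
 ultimately show ?thesis by linarith
qed

lemma Sup_stat_limit:
 "tends_in_prob M (%n om. Sup_stat v n om - 2 * lam * vol B * (SUP r\<in>{0..R}. \<bar>r ^ DIM('a) * v r\<bar>) * \<bar>Y n om\<bar>) 0"
proof -
 obtain U where U: "tends_in_prob M U 0" "!!n om. 0 <= U n om"
  "eventually (%n. \<forall>om. \<forall>r\<in>{0..R}. \<bar>Z n om r\<bar> <= U n om) sequentially"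
  using sup_Z_limit by blast
 obtain D where D: "0 <= D" "!!r. r \<in> {0..R} ==> \<bar>v r\<bar> <= D" using cadlag_bounded[OF v R] by blast
 have lim: "tends_in_prob M (%n om. D * U n om) 0" using tends_in_prob_cmult[OF U(1), of D] by simp
 show ?thesis
 proof (rule tends_in_prob_sup_le[OF _ lim])
  show "(%om. Sup_stat v n om - 2 * lam * vol B * (SUP r\<in>{0..R}. \<bar>r ^ DIM('a) * v r\<bar>) * \<bar>Y n om\<bar>) \<in> borel_measurable M" for n
   using Sup_stat_measurable by simp
  show "eventually (%n. \<forall>om\<in>space M. \<bar>Sup_stat v n om - 2 * lam * vol B * (SUP r\<in>{0..R}. \<bar>r ^ DIM('a) * v r\<bar>) * \<bar>Y n om\<bar> - 0\<bar>
    <= D * U n om) sequentially"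
   using U(3)
  proof eventually_elim
   case (elim n)
   show ?case unfolding diff_0_right by (intro ballI Sup_stat_approx D) (use elim in auto)
  qed
 qed
qed

end

end

theorem theorem3:
  fixes M :: "'o measure"
    and N :: "'o \<Rightarrow> 'a::euclidean_space set"
    and W :: "nat \<Rightarrow> 'a set"
    and B :: "'a set"
    and w :: "'a \<Rightarrow> real"
    and b :: "nat \<Rightarrow> real"
    and V v :: "real \<Rightarrow> real"
    and R \<alpha> lam0 \<sigma>0 :: real
  assumes process: "simple_point_process M N" "B4_mixing M N"
    and intensity: "lam0 = intensity M N" "0 < lam0"
    and window: "convex_averaging W"
    and B: "compact B" "convex B" "\<forall>x\<in>B. - x \<in> B" "0 \<in> interior B"
    and w: "smoothing_kernel w"
    and R: "0 < R"
    and \<alpha>: "0 < \<alpha>" "\<alpha> \<le> 1/2"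
      "(\<lambda>n. win_scale (W n) powr \<alpha> / inradius (W n)) \<longlonglongrightarrow> 0"
    and \<sigma>0: "0 < \<sigma>0" "\<sigma>0\<^sup>2 = sigma2 M N"
    and a: "converges_in_distribution M
        (\<lambda>n \<omega>. (real (card (N \<omega> \<inter> W n)) - lam0 * vol (W n)) / sqrt (vol (W n)))
        (density lborel (normal_density 0 \<sigma>0))"
    and b: "\<exists>a0>0. \<forall>A\<in>sets borel. bounded A \<longrightarrow> alpha2_red M N A \<le> a0 * vol A"
    and c: "\<alpha> > 1/4 \<or>
      (\<exists>\<kappa>3 \<kappa>4 a01 a02.
         has_lebesgue_density 3 (gamma_red M N 3) (\<lambda>f. \<kappa>3 (f 1) (f 2)) \<and>
         has_lebesgue_density 4 (gamma_red M N 4) (\<lambda>f. \<kappa>4 (f 1) (f 2) (f 3)) \<and>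
         (\<forall>x y. \<bar>\<kappa>3 x y\<bar> \<le> a01) \<and>
         (\<integral>\<^sup>+x. (\<integral>\<^sup>+y. (\<integral>\<^sup>+z. ennreal \<bar>\<kappa>4 x (y + z) z\<bar> \<partial>lborel)\<^sup>2 \<partial>lborel) \<partial>lborel)
           \<le> ennreal a02)"
    and d: "\<forall>n. 0 < b n"
      "b \<longlonglongrightarrow> 0"
      "filterlim (\<lambda>n. win_scale (W n) * b n) at_top sequentially"
      "(\<lambda>n. win_scale (W n) * (b n)\<^sup>2) \<longlonglongrightarrow> 0"
      "(\<lambda>n. win_scale (W n) * b n / inradius (W n)) \<longlonglongrightarrow> 0"
    and V: "\<forall>r\<in>{0..R}. 0 \<le> V r" "mono_on {0..R} V"
      "\<forall>r\<in>{0..<R}. (V \<longlongrightarrow> V r) (at_right r)"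
    and v: "cadlag_on R v"
  shows "converges_in_distribution M
      (\<lambda>n \<omega>. (LINT r:{0..R}|stieltjes R V. (Delta M N B \<alpha> (W n) \<omega> r)\<^sup>2)
               / (lambda2_hat (W n) (N \<omega>) * sigma2_hat w (b n) (W n) (N \<omega>))
             + vol (W n) * (lambda_hat (W n) (N \<omega>) - lam0)\<^sup>2
               / sigma2_hat w (b n) (W n) (N \<omega>))
      (distr std_normal_distribution borel
         (\<lambda>z. (4 * (vol B)\<^sup>2 * (LINT r:{0..R}|stieltjes R V. r ^ (2 * DIM('a))) + 1) * z\<^sup>2))
    \<and> converges_in_distribution M
      (\<lambda>n \<omega>. (SUP r\<in>{0..R}. \<bar>Delta M N B \<alpha> (W n) \<omega> r * v r\<bar>)
               / (lambda_hat (W n) (N \<omega>) * sqrt (sigma2_hat w (b n) (W n) (N \<omega>)))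
             + sqrt (vol (W n)) * \<bar>lambda_hat (W n) (N \<omega>) - lam0\<bar>
               / sqrt (sigma2_hat w (b n) (W n) (N \<omega>)))
      (distr std_normal_distribution borel
         (\<lambda>z. (2 * vol B * (SUP r\<in>{0..R}. \<bar>r ^ DIM('a) * v r\<bar>) + 1) * \<bar>z\<bar>))"
proof -
 from b obtain a0 where a0: "0 < a0" "!!A. A \<in> sets borel ==> bounded A ==> alpha2_red M N A <= a0 * vol A"
  by blast
 have zero: "0 \<in> B" using B(4) interior_subset by blast
 interpret prob_space M using process(1) by (simp add: simple_point_process_def)
 interpret K: K_sequence M N W B R \<alpha> a0
 proof unfold_locales
  show "simple_point_process M N" "B4_mixing M N" by (rule process)+
  show "0 < intensity M N" using intensity by simp
  show "convex_averaging W" by (rule window)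
  show "compact B" "convex B" "0 \<in> B" by (rule B zero)+
  show "- x \<in> B" if "x \<in> B" for x using B(3) that by blast
  show "0 <= R" "0 < \<alpha>" "0 <= a0" using R \<alpha>(1) a0(1) by simp_all
  show "(%n. win_scale (W n) powr \<alpha> / inradius (W n)) \<longlonglongrightarrow> 0" by (rule \<alpha>(3))
  show "alpha2_red M N A <= a0 * vol A" if "A \<in> sets borel" "bounded A" for A using that by (rule a0(2))
 qed
 interpret S: sigma_sequence M N W w b
  by unfold_locales (rule w d(1)[rule_format] d(2-5))+
 have lam: "intensity M N = lam0" "0 < lam0" using intensity by simp_all
 let ?Y = K.Y and ?L = "density lborel (normal_density 0 \<sigma>0)"
 let ?l = "%n om. lambda_hat (W n) (N om)" and ?s = "%n om. sigma2_hat w (b n) (W n) (N om)"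
 \<comment> \<open>For a window of volume 0 both sides are 0, by the root on one side and division
   by zero on the other.\<close>
 have Y_eq: "?Y n om = (real (card (N om Int W n)) - lam0 * vol (W n)) / sqrt (vol (W n))" for n om
 proof (cases "vol (W n) = 0")
  case False
  define x where "x = sqrt (vol (W n))"
  have x: "vol (W n) = x * x" "x ~= 0" using False by (simp_all add: x_def)
  show ?thesis unfolding K.Y_def lam(1) lambda_hat_def x_def[symmetric] unfolding x(1) using x(2) by (simp add: field_simps)
 qed (simp add: K.Y_def)
 have Y_lim: "converges_in_distribution M ?Y ?L" using a by (simp add: Y_eq[abs_def])
 have L: "real_distribution ?L"
  by (intro real_distribution.intro prob_space_normal_density[OF \<sigma>0(1)] real_distribution_axioms.intro) simp_all
 have s_lim: "tends_in_prob M ?s (\<sigma>0\<^sup>2)" unfolding \<sigma>0(2) by (rule S.sigma2_hat_limit)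
 have inv: "tends_in_prob M (%n om. inverse (X n om)) (inverse x)" if "tends_in_prob M X x" "x ~= 0" for X and x :: real
  by (rule tends_in_prob_continuous[OF that(1)]) (use that(2) in \<open>auto intro: continuous_intros\<close>)
 have sq: "tends_in_prob M (%n om. sqrt (?s n om)) \<sigma>0"
  using tends_in_prob_continuous[OF s_lim, of sqrt] \<sigma>0(1) by (simp add: isCont_real_sqrt)
 let ?J = "LINT r:{0..R}|stieltjes R V. r ^ (2 * DIM('a))"
 let ?m = "SUP r\<in>{0..R}. \<bar>r ^ DIM('a) * v r\<bar>"
 \<comment> \<open>Here J is the integral of the squared process, asymptotically
   \<open>(2 * lam0 * vol B)\<^sup>2\<close> times the integral of \<open>r ^ (2 * DIM('a))\<close>
   times the square of Y.\<close>
 have 1: "converges_in_distribution M (%n om. inverse (lambda2_hat (W n) (N om) * ?s n om) * K.L2 V n om + inverse (?s n om) * (?Y n om)\<^sup>2)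
   (distr ?L borel (%y. (inverse (lam0\<^sup>2 * \<sigma>0\<^sup>2) * ((2 * lam0 * vol B)\<^sup>2 * ?J) + inverse (\<sigma>0\<^sup>2)) * y\<^sup>2))"
 proof (rule statistic_limit[OF Y_lim L])
  show "tends_in_prob M (%n om. inverse (lambda2_hat (W n) (N om) * ?s n om)) (inverse (lam0\<^sup>2 * \<sigma>0\<^sup>2))"
   using tends_in_prob_mult[OF K.lambda2_hat_limit s_lim] lam \<sigma>0(1) by (intro inv) auto
  show "tends_in_prob M (%n om. inverse (?s n om)) (inverse (\<sigma>0\<^sup>2))" by (rule inv[OF s_lim]) (use \<sigma>0(1) in simp)
  show "tends_in_prob M (%n om. K.L2 V n om - (2 * lam0 * vol B)^2 * ?J * (?Y n om)\<^sup>2) 0"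
   using K.L2_limit[OF V(2,3) R] unfolding lam(1) .
  show "K.L2 V n \<in> borel_measurable M" for n by (rule K.L2_measurable[OF V(2,3) R])
  show "bounded_in_prob M (%n om. (?Y n om)\<^sup>2)" by (rule bounded_in_prob_square[OF K.Y_bounded])
  show "isCont (%y :: real. y\<^sup>2) x" for x by (intro continuous_intros)
 qed
 have 2: "converges_in_distribution M (%n om. inverse (?l n om * sqrt (?s n om)) * K.Sup_stat v n om + inverse (sqrt (?s n om)) * \<bar>?Y n om\<bar>)
   (distr ?L borel (%y. (inverse (lam0 * \<sigma>0) * (2 * lam0 * vol B * ?m) + inverse \<sigma>0) * \<bar>y\<bar>))"
 proof (rule statistic_limit[OF Y_lim L])
  show "tends_in_prob M (%n om. inverse (?l n om * sqrt (?s n om))) (inverse (lam0 * \<sigma>0))"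
   using tends_in_prob_mult[OF K.lambda_hat_limit sq] lam \<sigma>0(1) by (intro inv) auto
  show "tends_in_prob M (%n om. inverse (sqrt (?s n om))) (inverse \<sigma>0)" by (rule inv[OF sq]) (use \<sigma>0(1) in simp)
  show "tends_in_prob M (%n om. K.Sup_stat v n om - 2 * lam0 * vol B * ?m * \<bar>?Y n om\<bar>) 0"
   using K.Sup_stat_limit[OF v] unfolding lam(1) .
  show "K.Sup_stat v n \<in> borel_measurable M" for n by (rule K.Sup_stat_measurable[OF v])
  show "bounded_in_prob M (%n om. \<bar>?Y n om\<bar>)" by (rule bounded_in_prob_abs[OF K.Y_bounded])
  show "isCont (%y :: real. \<bar>y\<bar>) x" for x by (intro continuous_intros)
 qed
 have Y2: "(?Y n om)\<^sup>2 = vol (W n) * (?l n om - lam0)\<^sup>2" "\<bar>?Y n om\<bar> = sqrt (vol (W n)) * \<bar>?l n om - lam0\<bar>" for n om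
  unfolding K.Y_def lam(1) by (simp_all add: power_mult_distrib abs_mult)
 \<comment> \<open>The estimated intensity cancels the factor lam0 from the linear part, and
   dividing by the standard deviation turns the normal limit into a standard one; only the geometry
   of B and the measure of V remain.\<close>
 have d1: "distr ?L borel (%y. (inverse (lam0\<^sup>2 * \<sigma>0\<^sup>2) * ((2 * lam0 * vol B)\<^sup>2 * ?J) + inverse (\<sigma>0\<^sup>2)) * y\<^sup>2)
   = distr std_normal_distribution borel (%z. (4 * (vol B)^2 * ?J + 1) * z\<^sup>2)"
 proof -
  have "(inverse (lam0\<^sup>2 * \<sigma>0\<^sup>2) * ((2 * lam0 * vol B)\<^sup>2 * ?J) + inverse (\<sigma>0\<^sup>2)) * y\<^sup>2
    = (4 * (vol B)^2 * ?J + 1) * (y / \<sigma>0)\<^sup>2" for y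
   using lam(2) \<sigma>0(1) by (simp add: power_mult_distrib power_divide field_simps)
  then show ?thesis using normal_distr_scale[OF \<sigma>0(1), of "%z. (4 * (vol B)^2 * ?J + 1) * z\<^sup>2"] by simp
 qed
 have d2: "distr ?L borel (%y. (inverse (lam0 * \<sigma>0) * (2 * lam0 * vol B * ?m) + inverse \<sigma>0) * \<bar>y\<bar>)
   = distr std_normal_distribution borel (%z. (2 * vol B * ?m + 1) * \<bar>z\<bar>)"
 proof -
  have "(inverse (lam0 * \<sigma>0) * (2 * lam0 * vol B * ?m) + inverse \<sigma>0) * \<bar>y\<bar> = (2 * vol B * ?m + 1) * \<bar>y / \<sigma>0\<bar>" for y
   using lam(2) \<sigma>0(1) by (simp add: field_simps)
  then show ?thesis using normal_distr_scale[OF \<sigma>0(1), of "%z. (2 * vol B * ?m + 1) * \<bar>z\<bar>"] by simp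
 qed
 have e1: "inverse (lambda2_hat (W n) (N om) * ?s n om) * K.L2 V n om + inverse (?s n om) * (?Y n om)\<^sup>2
   = (LINT r:{0..R}|stieltjes R V. (Delta M N B \<alpha> (W n) om r)\<^sup>2) / (lambda2_hat (W n) (N om) * ?s n om)
    + vol (W n) * (?l n om - lam0)\<^sup>2 / ?s n om" for n om
  unfolding Y2(1) K.L2_def by (simp only: divide_inverse mult.commute)
 have e2: "inverse (?l n om * sqrt (?s n om)) * K.Sup_stat v n om + inverse (sqrt (?s n om)) * \<bar>?Y n om\<bar>
   = (SUP r\<in>{0..R}. \<bar>Delta M N B \<alpha> (W n) om r * v r\<bar>) / (?l n om * sqrt (?s n om))
    + sqrt (vol (W n)) * \<bar>?l n om - lam0\<bar> / sqrt (?s n om)" for n om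
  unfolding Y2(2) K.Sup_stat_def by (simp only: divide_inverse mult.commute)
 from 1 2 show ?thesis unfolding d1 d2 e1 e2 ..
qed

end
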